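(* There is a $\tfrac32$-approximation algorithm for the splittable variant running in time $\mathcal{O}(n+c\log(c+m))$; i.e. for every instance it computes a feasible splittable schedule with makespan at most $\tfrac32\,\mathrm{OPT}_{\mathrm{split}}$ in that time.
   Context: An instance consists of $m\in\mathbb{N}$ identical parallel machines, a set $J$ of $n$ jobs, a partition $J=C_1\,\dot\cup\,\dots\,\dot\cup\, C_c$ into $c$ nonempty classes, processing times $t_j\in\mathbb{N}$ and setup times $s_i\in\mathbb{N}$ ($i\in[c]$). On each machine at most one item is processed at a time; a setup of class $i$ of length $s_i$ must be processed whenever the machine starts processing load of class $i$ and whenever it switches from another class to class $i$; setups are not preempted. In the splittable variant jobs may be split into arbitrarily many pieces processed on any machines at any times, also in parallel; a schedule may be given as machine configurations with multiplicities. $\mathrm{OPT}_{\mathrm{split}}$ is the minimum makespan. *)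

theory Defs
  imports Complex_Main
begin

section \<open>Instances\<close>

text \<open>Classes are \<open>0..<c\<close> with \<open>c = length setups\<close> and jobs are \<open>0..<n\<close> with
  \<open>n = length jobs\<close>; job \<open>j\<close> is given as a pair (class, processing time).\<close>

record inst =
  machines :: nat
  setups :: "nat list"
  jobs :: "(nat \<times> nat) list"

definition num_classes :: "inst \<Rightarrow> nat" where
  "num_classes I = length (setups I)"

definition num_jobs :: "inst \<Rightarrow> nat" where
  "num_jobs I = length (jobs I)"

definition setup_time :: "inst \<Rightarrow> nat \<Rightarrow> nat" where
  "setup_time I i = setups I ! i"

definition job_class :: "inst \<Rightarrow> nat \<Rightarrow> nat" where
  "job_class I j = fst (jobs I ! j)"

definition proc_time :: "inst \<Rightarrow> nat \<Rightarrow> nat" where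
  "proc_time I j = snd (jobs I ! j)"

text \<open>The last condition says that the class map is onto: every job has a class, and no class
  is empty. Setup and processing times may be 0.\<close>

definition valid_instance :: "inst \<Rightarrow> bool" where
  "valid_instance I \<longleftrightarrow> machines I \<ge> 1 \<and> num_jobs I \<ge> 1 \<and>
     job_class I ` {0..<num_jobs I} = {0..<num_classes I}"

section \<open>Splittable schedules\<close>

text \<open>\<open>Setup i b\<close> is a setup of class \<open>i\<close> starting at time \<open>b\<close>; \<open>Piece j b x\<close> is a piece of
  job \<open>j\<close> of length \<open>x\<close> starting at time \<open>b\<close>. The type of times is a parameter because
  algorithms write integral numerators (see \<open>represents\<close> below).\<close>

datatype 'a item = Setup nat 'a | Piece nat 'a 'a

type_synonym 'a config = "'a item list"

type_synonym 'a schedule = "('a config \<times> nat) list"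

fun item_start :: "'a item \<Rightarrow> 'a" where
  "item_start (Setup i b) = b"
| "item_start (Piece j b x) = b"

fun item_length :: "inst \<Rightarrow> real item \<Rightarrow> real" where
  "item_length I (Setup i b) = real (setup_time I i)"
| "item_length I (Piece j b x) = x"

definition item_end :: "inst \<Rightarrow> real item \<Rightarrow> real" where
  "item_end I it = item_start it + item_length I it"

fun item_class :: "inst \<Rightarrow> 'a item \<Rightarrow> nat" where
  "item_class I (Setup i b) = i"
| "item_class I (Piece j b x) = job_class I j"

fun is_piece :: "'a item \<Rightarrow> bool" where
  "is_piece (Setup i b) = False"
| "is_piece (Piece j b x) = True"

fun valid_item :: "inst \<Rightarrow> real item \<Rightarrow> bool" where
  "valid_item I (Setup i b) \<longleftrightarrow> i < num_classes I \<and> b \<ge> 0"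
| "valid_item I (Piece j b x) \<longleftrightarrow> j < num_jobs I \<and> b \<ge> 0 \<and> x \<ge> 0"

text \<open>A configuration lists the items of one machine in chronological order, possibly with idle
  time in between. A job piece must be directly preceded by an item of its own class (a setup
  or another piece); hence a setup occurs at the start of and between batches.\<close>

definition valid_config :: "inst \<Rightarrow> real config \<Rightarrow> bool" where
  "valid_config I cfg \<longleftrightarrow>
     (\<forall>it\<in>set cfg. valid_item I it) \<and>
     sorted_wrt (\<lambda>x y. item_end I x \<le> item_start y) cfg \<and>
     (\<forall>k<length cfg. is_piece (cfg ! k) \<longrightarrow>
        k > 0 \<and> item_class I (cfg ! (k - 1)) = item_class I (cfg ! k))"

fun piece_amount :: "nat \<Rightarrow> real item \<Rightarrow> real" where
  "piece_amount j (Setup i b) = 0"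
| "piece_amount j (Piece j' b x) = (if j' = j then x else 0)"

definition processed :: "real schedule \<Rightarrow> nat \<Rightarrow> real" where
  "processed S j =
     (\<Sum>(cfg, mult)\<leftarrow>S. real mult * (\<Sum>it\<leftarrow>cfg. piece_amount j it))"

text \<open>In a schedule, \<open>(cfg, mult)\<close> means that \<open>mult\<close> machines run \<open>cfg\<close>; machines not accounted
  for stay idle. Every job needs a piece, which only matters for jobs of processing time 0:
  they also have to be placed behind a setup of their class.\<close>

definition feasible :: "inst \<Rightarrow> real schedule \<Rightarrow> bool" where
  "feasible I S \<longleftrightarrow>
     (\<forall>(cfg, mult)\<in>set S. valid_config I cfg \<and> mult > 0) \<and>
     (\<Sum>(cfg, mult)\<leftarrow>S. mult) \<le> machines I \<and>
     (\<forall>j<num_jobs I. processed S j = real (proc_time I j) \<and>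
        (\<exists>(cfg, mult)\<in>set S. \<exists>b x. Piece j b x \<in> set cfg))"

definition makespan :: "inst \<Rightarrow> real schedule \<Rightarrow> real" where
  "makespan I S = Max (insert 0 (\<Union>(cfg, mult)\<in>set S. item_end I ` set cfg))"

definition OPT_split :: "inst \<Rightarrow> real" where
  "OPT_split I = (INF S\<in>{S. feasible I S}. makespan I S)"

section \<open>Machine model\<close>

text \<open>Algorithms are programs of a word RAM in structured form. The memory is split into arrays
  of natural numbers, addressed by a constant array name and a computed index; a program
  mentions only finitely many array names, so interleaving the arrays gives an ordinary RAM
  memory. All operations have unit cost; \<open>Sub\<close> is truncated and \<open>Div\<close> rounds down.\<close>

datatype expr =
    Const nat
  | Read nat expr
  | Add expr expr
  | Sub expr expr
  | Mul expr expr
  | Div expr expr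
  | Less expr expr

datatype com =
    Skip
  | Write nat expr expr
  | Seq com com
  | Cond expr com com
  | While expr com

type_synonym memory = "nat \<Rightarrow> nat \<Rightarrow> nat"

primrec eval :: "expr \<Rightarrow> memory \<Rightarrow> nat" where
  "eval (Const k) s = k"
| "eval (Read a e) s = s a (eval e s)"
| "eval (Add e f) s = eval e s + eval f s"
| "eval (Sub e f) s = eval e s - eval f s"
| "eval (Mul e f) s = eval e s * eval f s"
| "eval (Div e f) s = eval e s div eval f s"
| "eval (Less e f) s = (if eval e s < eval f s then 1 else 0)"

primrec cost :: "expr \<Rightarrow> nat" where
  "cost (Const k) = 1"
| "cost (Read a e) = 1 + cost e"
| "cost (Add e f) = 1 + cost e + cost f"
| "cost (Sub e f) = 1 + cost e + cost f"
| "cost (Mul e f) = 1 + cost e + cost f"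
| "cost (Div e f) = 1 + cost e + cost f"
| "cost (Less e f) = 1 + cost e + cost f"

text \<open>\<open>exec B p s t s'\<close>: started in memory \<open>s\<close>, program \<open>p\<close> halts after \<open>t\<close> steps in memory \<open>s'\<close>,
  and all stored values and the addresses they are stored at are below \<open>B\<close>. The bound rules
  out hiding superconstant work in arithmetic on huge numbers. Intermediate values inside an
  expression need no separate check: the expressions of a program are fixed, so these values
  are polynomial in \<open>B\<close>.\<close>

inductive exec :: "nat \<Rightarrow> com \<Rightarrow> memory \<Rightarrow> nat \<Rightarrow> memory \<Rightarrow> bool" for B :: nat where
  Skip: "exec B Skip s 1 s"
| Write: "eval e s < B \<Longrightarrow> eval f s < B \<Longrightarrow>
    exec B (Write a e f) s (1 + cost e + cost f) (s(a := (s a)(eval e s := eval f s)))"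
| Seq: "exec B p s t s' \<Longrightarrow> exec B q s' t' s'' \<Longrightarrow> exec B (Seq p q) s (t + t') s''"
| CondTrue: "eval e s \<noteq> 0 \<Longrightarrow> exec B p s t s' \<Longrightarrow> exec B (Cond e p q) s (1 + cost e + t) s'"
| CondFalse: "eval e s = 0 \<Longrightarrow> exec B q s t s' \<Longrightarrow> exec B (Cond e p q) s (1 + cost e + t) s'"
| WhileFalse: "eval e s = 0 \<Longrightarrow> exec B (While e p) s (1 + cost e) s"
| WhileTrue: "eval e s \<noteq> 0 \<Longrightarrow> exec B p s t s' \<Longrightarrow> exec B (While e p) s' t' s'' \<Longrightarrow>
    exec B (While e p) s (1 + cost e + t + t') s''"

text \<open>The input is in array 0, all other cells are initially 0, and the output is in array 1.\<close>

definition init_memory :: "nat list \<Rightarrow> memory" where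
  "init_memory xs = (\<lambda>a k. if a = 0 \<and> k < length xs then xs ! k else 0)"

definition holds_output :: "memory \<Rightarrow> nat list \<Rightarrow> bool" where
  "holds_output s ws \<longleftrightarrow> (\<forall>k<length ws. s 1 k = ws ! k)"

text \<open>Words consist of \<open>O(log N)\<close> bits, where \<open>N\<close> is the maximum of the input length and the
  input numbers: the values are bounded by a fixed power of the following number.\<close>

definition word_base :: "nat list \<Rightarrow> nat" where
  "word_base xs = 2 + length xs + Max (insert 0 (set xs))"

section \<open>Input and output encodings\<close>

definition encode_instance :: "inst \<Rightarrow> nat list" where
  "encode_instance I =
     [machines I, num_classes I, num_jobs I] @ setups I @ concat (map (\<lambda>(i, t). [i, t]) (jobs I))"

fun encode_item :: "nat item \<Rightarrow> nat list" where
  "encode_item (Setup i b) = [0, i, b]"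
| "encode_item (Piece j b x) = [1, j, b, x]"

definition encode_config :: "nat config \<times> nat \<Rightarrow> nat list" where
  "encode_config = (\<lambda>(cfg, mult). mult # length cfg # concat (map encode_item cfg))"

text \<open>The times of the output schedule are the rational numbers \<open>b / d\<close> with a common
  denominator \<open>d\<close>, which is written first. All lists are preceded by their lengths, so the words
  determine the schedule.\<close>

definition encode_schedule :: "nat \<Rightarrow> nat schedule \<Rightarrow> nat list" where
  "encode_schedule d R = d # length R # concat (map encode_config R)"

definition represents :: "memory \<Rightarrow> real schedule \<Rightarrow> bool" where
  "represents s S \<longleftrightarrow> (\<exists>d R. d > 0 \<and> holds_output s (encode_schedule d R) \<and>
     S = map (\<lambda>(cfg, mult). (map (map_item (\<lambda>b. real b / real d)) cfg, mult)) R)"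

end

theory Submission
  imports Defs
begin

text \<open>
  Call a class expensive at \<open>T\<close> if its setup time exceeds \<open>T/2\<close>. In a schedule of makespan at most
  \<open>T\<close> no machine serves two expensive classes, and an expensive class with load \<open>P\<close> occupies at least
  \<open>\<lceil>2 P / T\<rceil>\<close> machines. This gives two necessary conditions on \<open>T\<close>, one on the number of machines and
  one on the total load; \<open>T\<close> is acceptable if they hold. Conversely, if \<open>T\<close> is acceptable, then giving
  every expensive class machines with load \<open>T/2\<close> each, and wrapping the cheap classes around the
  remaining space below \<open>3/2 T\<close> with a new setup on every machine, yields a schedule.

  So it suffices to find the smallest acceptable \<open>T\<close>. It lies in \<open>[A/m, 2 A/m]\<close>, where \<open>A\<close> is the
  maximum of the total load and \<open>m\<close> times the largest setup time. Bisection with \<open>O(log m)\<close> tests of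
  cost \<open>O(c)\<close> shrinks this interval until each class has at most four jumps (values of \<open>T\<close> where its
  number of setups changes) in it. The remaining jumps are swept in increasing order with a tournament tree
  over the classes, in time \<open>O(c log c)\<close>; between two jumps the two conditions can be solved for
  \<open>T\<close> directly.\<close>


section \<open>Program logic\<close>

text \<open>Neither kind of search meets the time bound alone: the number of rounds of a pure
  bisection would depend on the size of the numbers, because the smallest acceptable
  \<open>T\<close> is a fraction, and a class may have of the order of \<open>m\<close> jumps, too
  many to sweep. At least \<open>m\<close> pieces are just enough, because \<open>2 * P / T\<close>
  then changes by at most 2 on a piece. A schedule of makespan \<open>T\<close> need not exist.
  Minimality of \<open>T\<close> is used only as a lower bound: every feasible makespan is
  acceptable, so \<open>T\<close> is at most the infimum \<open>OPT_split\<close>. Reals occur in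
  the analysis only. The program keeps \<open>T\<close> as a fraction \<open>tn / td\<close> and
  compares by cross multiplication. With \<open>d = 2 * td\<close> and \<open>H = tn\<close> all
  times become integers, \<open>H\<close> stands for \<open>T/2\<close>, and the schedule may reach
  \<open>3 * H\<close>. A single job may cover many machines. Its full machines are written as one
  configuration with a multiplicity, which keeps the output linear in \<open>n\<close>. The
  placement is a state machine on abstract states with two invariants, validity and a count of
  machines; the program is then shown to simulate it.\<close>

definition wp :: "nat \<Rightarrow> com \<Rightarrow> nat \<Rightarrow> (memory \<Rightarrow> bool) \<Rightarrow> memory \<Rightarrow> bool" where
  "wp B p t Q s \<longleftrightarrow> (\<exists>t' s'. exec B p s t' s' \<and> t' \<le> t \<and> Q s')"

text \<open>Symbolic execution of loop-free programs. \<open>While\<close> yields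
  \<open>False\<close>, so loops always go through \<open>wp_while\<close>.\<close>

primrec vc :: "nat \<Rightarrow> com \<Rightarrow> (memory \<Rightarrow> bool) \<Rightarrow> memory \<Rightarrow> bool" where
  "vc B Skip Q s = Q s"
| "vc B (Write a e f) Q s =
     (eval e s < B \<and> eval f s < B \<and> Q (s(a := (s a)(eval e s := eval f s))))"
| "vc B (Seq p q) Q s = vc B p (vc B q Q) s"
| "vc B (Cond e p q) Q s =
     ((eval e s \<noteq> 0 \<longrightarrow> vc B p Q s) \<and> (eval e s = 0 \<longrightarrow> vc B q Q s))"
| "vc B (While e p) Q s = False"

text \<open>Both branches of a conditional are added instead of compared, which only costs a
  constant factor. The 0 for \<open>While\<close> is a placeholder: for a program with loops the
  value leaves the loops out.\<close>

primrec max_cost :: "com \<Rightarrow> nat" where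
  "max_cost Skip = 1"
| "max_cost (Write a e f) = 1 + cost e + cost f"
| "max_cost (Seq p q) = max_cost p + max_cost q"
| "max_cost (Cond e p q) = 1 + cost e + max_cost p + max_cost q"
| "max_cost (While e p) = 0"

lemma wp_vc: "vc B p Q s \<Longrightarrow> wp B p (max_cost p) Q s"
proof (induction p arbitrary: Q s)
  case Skip
  then show ?case using exec.Skip[of B s] by (auto simp: wp_def intro!: exI conjI)
next
  case (Write a e f)
  then show ?case by (auto simp: wp_def intro!: exI exec.Write)
next
  case (Seq p q)
  from Seq.prems have "vc B p (vc B q Q) s" by simp
  from Seq.IH(1)[OF this] obtain t1 s1 where
    1: "exec B p s t1 s1" "t1 \<le> max_cost p" "vc B q Q s1" by (auto simp: wp_def)
  from Seq.IH(2)[OF 1(3)] obtain t2 s2 where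
    2: "exec B q s1 t2 s2" "t2 \<le> max_cost q" "Q s2" by (auto simp: wp_def)
  show ?case using exec.Seq[OF 1(1) 2(1)] 1 2 by (auto simp: wp_def intro!: exI conjI)
next
  case (Cond e p q)
  show ?case
  proof (cases "eval e s = 0")
    case True
    with Cond.prems Cond.IH(2) obtain t2 s2 where
      "exec B q s t2 s2" "t2 \<le> max_cost q" "Q s2" by (fastforce simp: wp_def)
    with exec.CondFalse[OF True this(1), of p] show ?thesis
      by (auto simp: wp_def intro!: exI conjI)
  next
    case False
    with Cond.prems Cond.IH(1) obtain t2 s2 where
      "exec B p s t2 s2" "t2 \<le> max_cost p" "Q s2" by (fastforce simp: wp_def)
    with exec.CondTrue[OF False this(1), of q] show ?thesis
      by (auto simp: wp_def intro!: exI conjI)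
  qed
qed simp

lemma wp_seq: "wp B p t1 (wp B q t2 Q) s \<Longrightarrow> wp B (Seq p q) (t1 + t2) Q s"
  unfolding wp_def by (meson exec.Seq add_mono)

lemma wp_mono: "wp B p t Q s \<Longrightarrow> t \<le> t' \<Longrightarrow> (\<And>s'. Q s' \<Longrightarrow> Q' s') \<Longrightarrow> wp B p t' Q' s"
  unfolding wp_def by (meson order_trans)

lemma wp_seqI:
  assumes "wp B p t1 R s" "\<And>s'. R s' \<Longrightarrow> wp B q t2 Q s'"
  shows "wp B (Seq p q) (t1 + t2) Q s"
  using assms by (intro wp_seq) (rule wp_mono[OF assms(1) le_refl])

text \<open>The ghost \<open>g\<close> carries an abstract state, and the measure is taken of it
  rather than of the memory. The last \<open>1 + cost e\<close> pays for the failing test.\<close>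

lemma wp_while:
  fixes I :: "'g \<Rightarrow> memory \<Rightarrow> bool" and \<mu> :: "'g \<Rightarrow> nat"
  assumes step: "\<And>g s. I g s \<Longrightarrow> eval e s \<noteq> 0 \<Longrightarrow> wp B p t (\<lambda>s'. \<exists>g'. I g' s' \<and> \<mu> g' < \<mu> g) s"
    and init: "I g s" "\<mu> g \<le> N"
    and fin: "\<And>g s. I g s \<Longrightarrow> eval e s = 0 \<Longrightarrow> Q s"
  shows "wp B (While e p) (N * (1 + cost e + t) + (1 + cost e)) Q s"
proof -
  have "wp B (While e p) (\<mu> g * (1 + cost e + t) + (1 + cost e)) Q s"
    using init(1)
  proof (induction "\<mu> g" arbitrary: g s rule: less_induct)
    case less
    show ?case
    proof (cases "eval e s = 0")
      case True
      have "Q s" by (rule fin[OF less.prems True])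
      with exec.WhileFalse[OF True, of B p] show ?thesis unfolding wp_def by (auto intro!: exI)
    next
      case False
      from step[OF less.prems False] obtain t1 s1 g1 where
        1: "exec B p s t1 s1" "t1 \<le> t" "I g1 s1" "\<mu> g1 < \<mu> g" unfolding wp_def by blast
      from less.hyps[OF 1(4) 1(3)] obtain t2 s2 where
        2: "exec B (While e p) s1 t2 s2" "t2 \<le> \<mu> g1 * (1 + cost e + t) + (1 + cost e)" "Q s2"
        unfolding wp_def by blast
      have "(\<mu> g1 + 1) * (1 + cost e + t) \<le> \<mu> g * (1 + cost e + t)"
        using 1(4) by (intro mult_le_mono1) simp
      then have "1 + cost e + t1 + t2 \<le> \<mu> g * (1 + cost e + t) + (1 + cost e)"
        using 1(2) 2(2) by (simp add: algebra_simps)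
      with exec.WhileTrue[OF False 1(1) 2(1)] 2(3) show ?thesis unfolding wp_def by blast
    qed
  qed
  then show ?thesis
    using mult_le_mono1[OF init(2), of "1 + cost e + t"] by (elim wp_mono) auto
qed

section \<open>A lower bound on the makespan\<close>

definition jobs_of :: "inst \<Rightarrow> nat \<Rightarrow> nat set" where
  "jobs_of I i = {j. j < num_jobs I \<and> job_class I j = i}"

definition class_load :: "inst \<Rightarrow> nat \<Rightarrow> nat" where
  "class_load I i = (\<Sum>j\<in>jobs_of I i. proc_time I j)"

text \<open>The \<open>max 1\<close> covers classes of load 0, whose jobs still need a piece behind
  a setup. For a cheap class only the one unavoidable setup is counted.\<close>

definition batches :: "nat \<Rightarrow> nat \<Rightarrow> real \<Rightarrow> nat" where
  "batches s P T = (if 2 * real s > T then max 1 (nat \<lceil>2 * real P / T\<rceil>) else 1)"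

definition exp_machines :: "nat \<Rightarrow> nat \<Rightarrow> real \<Rightarrow> nat" where
  "exp_machines s P T = (if 2 * real s > T then batches s P T else 0)"

definition acceptable :: "inst \<Rightarrow> real \<Rightarrow> bool" where
  "acceptable I T \<longleftrightarrow> (\<forall>i<num_classes I. real (setup_time I i) \<le> T) \<and>
     (\<Sum>i<num_classes I. exp_machines (setup_time I i) (class_load I i) T) \<le> machines I \<and>
     real (\<Sum>i<num_classes I. class_load I i + batches (setup_time I i) (class_load I i) T * setup_time I i)
       \<le> real (machines I) * T"

lemma finite_jobs_of [simp]: "finite (jobs_of I i)"
  by (simp add: jobs_of_def)

text \<open>\<open>real s \<le> T\<close> forces \<open>T > 0\<close> in the expensive case. At
  \<open>T = 0\<close> the quotient \<open>2 * P / T\<close> is 0 by convention, and monotonicity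
  would fail.\<close>

lemma batches_antimono:
  assumes "real s \<le> T" "T \<le> T'"
  shows "batches s P T' \<le> batches s P T"
proof (cases "2 * real s > T'")
  case True
  with assms have T: "T > 0" "2 * real s > T" by linarith+
  have "2 * real P / T' \<le> 2 * real P / T"
    using T assms by (intro divide_left_mono) auto
  then have "nat \<lceil>2 * real P / T'\<rceil> \<le> nat \<lceil>2 * real P / T\<rceil>"
    by (intro nat_mono ceiling_mono)
  with True T show ?thesis by (auto simp: batches_def)
qed (auto simp: batches_def)

lemma exp_machines_antimono:
  assumes "real s \<le> T" "T \<le> T'"
  shows "exp_machines s P T' \<le> exp_machines s P T"
  using batches_antimono[OF assms] assms by (auto simp: exp_machines_def)

text \<open>This makes bisection sound: a value that is not acceptable is a lower bound for all
  acceptable ones.\<close>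

lemma acceptable_mono:
  assumes acc: "acceptable I T" and le: "T \<le> T'"
  shows "acceptable I T'"
proof -
  have s: "real (setup_time I i) \<le> T" if "i < num_classes I" for i
    using acc that by (simp add: acceptable_def)
  have "(\<Sum>i<num_classes I. exp_machines (setup_time I i) (class_load I i) T')
      \<le> (\<Sum>i<num_classes I. exp_machines (setup_time I i) (class_load I i) T)"
    by (intro sum_mono exp_machines_antimono) (use s le in auto)
  moreover have "(\<Sum>i<num_classes I. class_load I i + batches (setup_time I i) (class_load I i) T' * setup_time I i)
      \<le> (\<Sum>i<num_classes I. class_load I i + batches (setup_time I i) (class_load I i) T * setup_time I i)"
    by (intro sum_mono add_mono mult_le_mono1 batches_antimono) (use s le in auto)
  moreover have "real (machines I) * T \<le> real (machines I) * T'"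
    using le by (intro mult_left_mono) auto
  ultimately show ?thesis
    using acc s le unfolding acceptable_def by (smt (verit) of_nat_le_iff order_trans)
qed

text \<open>The start bound \<open>a\<close> is arbitrary so that the induction can continue from
  the end of the first item.\<close>

lemma sum_item_length_le:
  assumes "sorted_wrt (\<lambda>x y. item_end I x \<le> item_start y) cfg"
    and "\<And>it. it \<in> set cfg \<Longrightarrow> valid_item I it"
    and "\<And>it. it \<in> set cfg \<Longrightarrow> a \<le> item_start it \<and> item_end I it \<le> T" and "a \<le> T"
  shows "(\<Sum>it\<leftarrow>cfg. item_length I it) \<le> T - a"
  using assms
proof (induction cfg arbitrary: a)
  case (Cons x xs)
  have "(\<Sum>it\<leftarrow>xs. item_length I it) \<le> T - item_end I x"
    by (rule Cons.IH) (use Cons.prems in auto)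
  moreover have "a \<le> item_start x" using Cons.prems by auto
  ultimately show ?case by (simp add: item_end_def)
qed auto

text \<open>Going back from a piece to its predecessors stays within the class, and it must meet a
  setup, because the first item of a configuration is not a piece.\<close>

lemma piece_has_setup:
  assumes "valid_config I cfg" "k < length cfg"
  shows "\<exists>b. Setup (item_class I (cfg ! k)) b \<in> set cfg"
  using assms(2)
proof (induction k rule: less_induct)
  case (less k)
  show ?case
  proof (cases "cfg ! k")
    case (Setup i b)
    then show ?thesis using less.prems nth_mem by force
  next
    case (Piece j b x)
    then have "is_piece (cfg ! k)" by simp
    with assms(1) less.prems have k: "k > 0" "item_class I (cfg ! (k - 1)) = item_class I (cfg ! k)"
      unfolding valid_config_def by blast+
    with less.IH[of "k - 1"] less.prems show ?thesis by simp
  qed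
qed

text \<open>Integration over the machines in use. All counting below is linear, so a bound for one
  machine carries over to the schedule through \<open>weigh_mono\<close> and
  \<open>weigh_sum\<close>.\<close>

definition weigh :: "'a schedule \<Rightarrow> ('a config \<Rightarrow> real) \<Rightarrow> real" where
  "weigh S f = (\<Sum>(cfg, mult)\<leftarrow>S. real mult * f cfg)"

lemma weigh_simps [simp]:
  "weigh [] f = 0" "weigh ((cfg, mult) # S) f = real mult * f cfg + weigh S f"
  by (auto simp: weigh_def)

lemma weigh_sum: "weigh S (\<lambda>cfg. \<Sum>i\<in>A. f i cfg) = (\<Sum>i\<in>A. weigh S (f i))"
  by (induction S) (auto simp: sum.distrib sum_distrib_left)

lemma weigh_add: "weigh S (\<lambda>cfg. f cfg + g cfg) = weigh S f + weigh S g"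
  by (induction S) (auto simp: algebra_simps)

lemma weigh_cmult: "weigh S (\<lambda>cfg. f cfg * a) = weigh S f * a"
  by (induction S) (auto simp: algebra_simps)

lemma weigh_mono:
  assumes "\<And>cfg mult. (cfg, mult) \<in> set S \<Longrightarrow> f cfg \<le> g cfg"
  shows "weigh S f \<le> weigh S g"
  using assms
proof (induction S)
  case (Cons x S)
  obtain cfg mult where x: "x = (cfg, mult)" by fastforce
  from Cons have "weigh S f \<le> weigh S g" by auto
  moreover have "real mult * f cfg \<le> real mult * g cfg"
    using Cons.prems x by (intro mult_left_mono) auto
  ultimately show ?case by (simp add: x)
qed auto

lemma weigh_one: "weigh S (\<lambda>_. 1) = real (\<Sum>(cfg, mult)\<leftarrow>S. mult)"
  by (induction S) auto

lemma weigh_ge_member: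
  assumes "(cfg, mult) \<in> set S" "\<And>cfg. f cfg \<ge> 0"
  shows "weigh S f \<ge> real mult * f cfg"
  using assms(1)
proof (induction S)
  case (Cons x S)
  obtain cfg' mult' where x: "x = (cfg', mult')" by fastforce
  have "weigh S f \<ge> 0" using assms(2) by (induction S) auto
  with Cons x assms(2)[of cfg'] show ?case by auto (smt (verit) mult_nonneg_nonneg of_nat_0_le_iff)
qed auto

lemma finite_item_ends: "finite (\<Union>(cfg, mult)\<in>set S. item_end I ` set cfg)"
  by auto

lemma item_end_le_makespan:
  assumes "(cfg, mult) \<in> set S" "it \<in> set cfg"
  shows "item_end I it \<le> makespan I S"
  unfolding makespan_def by (rule Max_ge) (use assms finite_item_ends in blast)+

lemma makespan_nonneg: "makespan I S \<ge> 0"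
  unfolding makespan_def by (rule Max_ge) (use finite_item_ends in auto)

lemma makespan_le:
  assumes "0 \<le> T" "\<And>cfg mult it. (cfg, mult) \<in> set S \<Longrightarrow> it \<in> set cfg \<Longrightarrow> item_end I it \<le> T"
  shows "makespan I S \<le> T"
  unfolding makespan_def by (rule Max.boundedI) (use assms finite_item_ends in auto)

definition present :: "inst \<Rightarrow> nat \<Rightarrow> real config \<Rightarrow> real" where
  "present I i cfg = (if \<exists>it\<in>set cfg. item_class I it = i then 1 else 0)"

definition config_load :: "inst \<Rightarrow> nat \<Rightarrow> real config \<Rightarrow> real" where
  "config_load I i cfg = (\<Sum>it\<leftarrow>cfg. if item_class I it = i then item_length I it else 0)"

definition config_amount :: "inst \<Rightarrow> nat \<Rightarrow> real config \<Rightarrow> real" where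
  "config_amount I i cfg = (\<Sum>j\<in>jobs_of I i. \<Sum>it\<leftarrow>cfg. piece_amount j it)"

lemma item_class_less:
  assumes "valid_instance I" "valid_item I it"
  shows "item_class I it < num_classes I"
proof (cases it)
  case (Piece j b x)
  with assms have "job_class I j \<in> {0..<num_classes I}"
    unfolding valid_instance_def by (metis atLeast0LessThan imageI lessThan_iff valid_item.simps(2))
  with Piece show ?thesis by simp
qed (use assms in auto)

lemma item_length_nonneg: "valid_item I it \<Longrightarrow> item_length I it \<ge> 0"
  by (cases it) auto

lemma sum_config_load:
  assumes "valid_instance I" "\<And>it. it \<in> set cfg \<Longrightarrow> valid_item I it"
  shows "(\<Sum>i<num_classes I. config_load I i cfg) = (\<Sum>it\<leftarrow>cfg. item_length I it)"
  using assms(2)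
proof (induction cfg)
  case (Cons it cfg)
  then have "item_class I it < num_classes I" using item_class_less assms(1) by auto
  with Cons show ?case by (simp add: config_load_def sum.distrib)
qed (auto simp: config_load_def)

text \<open>A machine that serves the class holds one of its setups by
  \<open>piece_has_setup\<close>. The indicator lets the bound cover all machines alike, so that it
  can be summed with \<open>weigh\<close>.\<close>

lemma config_load_ge:
  assumes "valid_config I cfg"
  shows "present I i cfg * real (setup_time I i) + config_amount I i cfg \<le> config_load I i cfg"
proof -
  \<comment> \<open>The share of setups in the load of class \<open>i\<close>; the rest of the load
    is the processed amount.\<close>
  define sl where "sl = (\<lambda>it. case it of Setup i' (b::real) \<Rightarrow> if i' = i then real (setup_time I i) else 0
    | Piece j b x \<Rightarrow> 0)"
  have sl_nonneg: "(\<Sum>it\<leftarrow>cfg'. sl it) \<ge> 0" for cfg'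
    by (rule sum_list_nonneg) (auto simp: sl_def split: item.splits)
  have valid: "\<And>it. it \<in> set cfg \<Longrightarrow> valid_item I it" using assms by (auto simp: valid_config_def)
  then have eq: "config_load I i cfg = (\<Sum>it\<leftarrow>cfg. sl it) + config_amount I i cfg"
  proof (induction cfg)
    case (Cons it cfg)
    have "(if item_class I it = i then item_length I it else 0) = sl it + (\<Sum>j\<in>jobs_of I i. piece_amount j it)"
    proof (cases it)
      case (Piece j b x)
      with Cons.prems[of it] have "j < num_jobs I" by simp
      then have "item_class I it = i \<longleftrightarrow> j \<in> jobs_of I i" using Piece by (auto simp: jobs_of_def)
      then show ?thesis using Piece by (simp add: sl_def)
    qed (auto simp: sl_def)
    with Cons show ?case by (simp add: config_load_def config_amount_def sum.distrib)
  qed (auto simp: config_load_def config_amount_def)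
  have "present I i cfg * real (setup_time I i) \<le> (\<Sum>it\<leftarrow>cfg. sl it)"
  proof (cases "\<exists>it\<in>set cfg. item_class I it = i")
    case True
    then obtain k where "k < length cfg" "item_class I (cfg ! k) = i" by (metis in_set_conv_nth)
    with piece_has_setup[OF assms] obtain b where "Setup i b \<in> set cfg" by metis
    then obtain xs ys where "cfg = xs @ Setup i b # ys" by (meson split_list)
    then show ?thesis using sl_nonneg[of xs] sl_nonneg[of ys] True by (simp add: present_def sl_def)
  next
    case False
    then show ?thesis using sl_nonneg by (simp add: present_def)
  qed
  with eq show ?thesis by simp
qed

lemma config_amount_nonneg:
  assumes "\<And>it. it \<in> set cfg \<Longrightarrow> valid_item I it"
  shows "config_amount I i cfg \<ge> 0"
proof -
  have "piece_amount j it \<ge> 0" if "valid_item I it" for j it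
    using that by (cases it) auto
  then show ?thesis unfolding config_amount_def using assms by (intro sum_nonneg sum_list_nonneg) auto
qed

text \<open>Let \<open>n i\<close> count the machines that serve class \<open>i\<close>. Each has at
  most \<open>T - s\<close> left for load, so \<open>P \<le> n i * (T - s)\<close>. For an expensive
  class this is at most \<open>n i * T / 2\<close>, hence \<open>n i\<close> is at least the number
  of batches. As no machine serves two expensive classes, these numbers add up to at most
  \<open>m\<close>; summing setups and loads over all machines gives the second condition.\<close>

lemma acceptable_makespan:
  assumes inst: "valid_instance I" and feas: "feasible I S"
  shows "acceptable I (makespan I S)"
proof -
  define T where "T = makespan I S"
  let ?c = "num_classes I" and ?s = "\<lambda>i. real (setup_time I i)"
  define n where "n = (\<lambda>i. weigh S (present I i))"
  have vc: "valid_config I cfg" "mult > 0" if "(cfg, mult) \<in> set S" for cfg mult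
    using feas that by (auto simp: feasible_def)
  have vi: "valid_item I it" if "(cfg, mult) \<in> set S" "it \<in> set cfg" for cfg mult it
    using vc(1)[OF that(1)] that(2) by (auto simp: valid_config_def)
  have total: "(\<Sum>i<?c. config_load I i cfg) \<le> T" if "(cfg, mult) \<in> set S" for cfg mult
  proof -
    have "(\<Sum>i<?c. config_load I i cfg) = (\<Sum>it\<leftarrow>cfg. item_length I it)"
      by (rule sum_config_load) (use inst vi[OF that] in auto)
    also have "\<dots> \<le> T - 0"
    proof (rule sum_item_length_le)
      show "sorted_wrt (\<lambda>x y. item_end I x \<le> item_start y) cfg"
        using vc[OF that] by (simp add: valid_config_def)
      show "0 \<le> item_start it \<and> item_end I it \<le> T" if "it \<in> set cfg" for it
        using vi[OF \<open>(cfg, mult) \<in> set S\<close> that] item_end_le_makespan[OF \<open>(cfg, mult) \<in> set S\<close> that]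
        by (cases it) (auto simp: T_def)
    qed (use vi[OF that] makespan_nonneg T_def in auto)
    finally show ?thesis by simp
  qed
  have load_nonneg: "config_load I i cfg \<ge> 0" if "(cfg, mult) \<in> set S" for cfg mult i
    unfolding config_load_def using item_length_nonneg vi[OF that] by (intro sum_list_nonneg) auto
  have load_le: "config_load I i cfg \<le> T" if "(cfg, mult) \<in> set S" "i < ?c" for cfg mult i
  proof -
    have "config_load I i cfg \<le> (\<Sum>i<?c. config_load I i cfg)"
      by (rule member_le_sum) (use load_nonneg[OF that(1)] that in auto)
    with total[OF that(1)] show ?thesis by linarith
  qed
  \<comment> \<open>Even a class of load 0 is present somewhere, because feasibility asks for a
    piece of every job.\<close>
  have pres: "\<exists>cfg mult. (cfg, mult) \<in> set S \<and> present I i cfg = 1" if i: "i < ?c" for i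
  proof -
    from inst i have "i \<in> job_class I ` {0..<num_jobs I}" by (simp add: valid_instance_def)
    then obtain j where "j < num_jobs I" "job_class I j = i" by auto
    moreover from this feas obtain cfg mult b x where "(cfg, mult) \<in> set S" "Piece j b x \<in> set cfg"
      by (force simp: feasible_def)
    ultimately have "(cfg, mult) \<in> set S \<and> present I i cfg = 1" by (force simp: present_def)
    then show ?thesis by blast
  qed
  have n_ge1: "n i \<ge> 1" if i: "i < ?c" for i
  proof -
    from pres[OF i] obtain cfg mult where *: "(cfg, mult) \<in> set S" "present I i cfg = 1" by blast
    have "n i \<ge> real mult * present I i cfg"
      unfolding n_def by (rule weigh_ge_member[OF *(1)]) (auto simp: present_def)
    with vc(2)[OF *(1)] *(2) show ?thesis by simp
  qed
  have s_le: "?s i \<le> T" if i: "i < ?c" for i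
  proof -
    from pres[OF i] obtain cfg mult where *: "(cfg, mult) \<in> set S" "present I i cfg = 1" by blast
    have "config_amount I i cfg \<ge> 0" using config_amount_nonneg vi[OF *(1)] by blast
    with config_load_ge[OF vc(1)[OF *(1)], of i] load_le[OF *(1) i] *(2) show ?thesis by simp
  qed
  have P_eq: "real (class_load I i) = weigh S (config_amount I i)" for i
  proof -
    have "real (class_load I i) = (\<Sum>j\<in>jobs_of I i. processed S j)"
      using feas by (simp add: class_load_def feasible_def jobs_of_def)
    also have "\<dots> = weigh S (config_amount I i)"
      unfolding config_amount_def weigh_sum by (simp add: weigh_def processed_def)
    finally show ?thesis .
  qed
  have P_le: "real (class_load I i) \<le> n i * (T - ?s i)" if i: "i < ?c" for i
  proof -
    have "weigh S (config_amount I i) \<le> weigh S (\<lambda>cfg. present I i cfg * (T - ?s i))"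
    proof (rule weigh_mono)
      fix cfg mult assume *: "(cfg, mult) \<in> set S"
      show "config_amount I i cfg \<le> present I i cfg * (T - ?s i)"
      proof (cases "present I i cfg = 1")
        case True
        with config_load_ge[OF vc(1)[OF *], of i] load_le[OF * i] show ?thesis by simp
      next
        case False
        then have "\<forall>it\<in>set cfg. item_class I it \<noteq> i" by (metis present_def)
        then have "config_load I i cfg = (\<Sum>it\<leftarrow>cfg. 0)"
          unfolding config_load_def by (intro arg_cong[where f = sum_list] map_cong) auto
        with config_load_ge[OF vc(1)[OF *], of i] False show ?thesis by (auto simp: present_def split: if_splits)
      qed
    qed
    with P_eq[of i] show ?thesis by (simp add: weigh_cmult n_def)
  qed
  \<comment> \<open>Integrality of \<open>n i\<close> lets the bound
    \<open>2 * P / T \<le> n i\<close> be rounded up.\<close>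
  have n_nat: "\<exists>k. n i = real k" for i
  proof -
    have "\<exists>k. weigh S' (present I i) = real k" for S'
    proof (induction S')
      case (Cons x S')
      obtain cfg mult where x: "x = (cfg, mult)" by fastforce
      from Cons obtain k where "weigh S' (present I i) = real k" by blast
      then have "weigh (x # S') (present I i) = real (k + (if present I i cfg = 1 then mult else 0))"
        by (auto simp: x present_def)
      then show ?case by blast
    qed (auto intro: exI[of _ 0])
    then show ?thesis by (simp add: n_def)
  qed
  have batches_le: "real (batches (setup_time I i) (class_load I i) T) \<le> n i" if i: "i < ?c" for i
  proof (cases "2 * ?s i > T")
    case True
    with s_le[OF i] have T: "T > 0" by linarith
    obtain k where k: "n i = real k" using n_nat by blast
    have "n i * (2 * (T - ?s i)) \<le> n i * T"
      using True n_ge1[OF i] by (intro mult_left_mono) auto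
    with P_le[OF i] have "2 * real (class_load I i) / T \<le> n i"
      using T by (simp add: divide_simps algebra_simps)
    then have "nat \<lceil>2 * real (class_load I i) / T\<rceil> \<le> k" by (simp add: k ceiling_le_iff nat_le_iff)
    moreover have "1 \<le> k" using n_ge1[OF i] k by simp
    ultimately have "batches (setup_time I i) (class_load I i) T \<le> k"
      using True by (simp only: batches_def max.bounded_iff simp_thms if_True)
    then show ?thesis using k by simp
  next
    case False
    with n_ge1[OF i] show ?thesis by (simp add: batches_def)
  qed
  have "real (\<Sum>i<?c. exp_machines (setup_time I i) (class_load I i) T) \<le> real (machines I)"
  proof -
    let ?X = "{i. i < ?c \<and> 2 * ?s i > T}"
    have "real (\<Sum>i<?c. exp_machines (setup_time I i) (class_load I i) T)
       = (\<Sum>i\<in>?X. real (batches (setup_time I i) (class_load I i) T))"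
      unfolding of_nat_sum by (rule sum.mono_neutral_cong_right) (auto simp: exp_machines_def)
    also have "\<dots> \<le> (\<Sum>i\<in>?X. n i)" by (rule sum_mono) (use batches_le in auto)
    also have "\<dots> = weigh S (\<lambda>cfg. \<Sum>i\<in>?X. present I i cfg)"
      by (simp add: n_def weigh_sum)
    also have "\<dots> \<le> weigh S (\<lambda>_. 1)"
    proof (rule weigh_mono)
      fix cfg mult assume *: "(cfg, mult) \<in> set S"
      show "(\<Sum>i\<in>?X. present I i cfg) \<le> 1"
      proof (cases "\<exists>i\<in>?X. present I i cfg \<noteq> 0")
        case True
        then obtain i where i: "i \<in> ?X" "present I i cfg \<noteq> 0" by blast
        then have pi: "present I i cfg = 1" by (auto simp: present_def split: if_splits)
        have other: "present I i' cfg = 0" if i': "i' \<in> ?X" "i' \<noteq> i" for i'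
        proof (rule ccontr)
          assume "present I i' cfg \<noteq> 0"
          then have pi': "present I i' cfg = 1" by (auto simp: present_def split: if_splits)
          have "(\<Sum>l\<in>{i, i'}. config_load I l cfg) \<le> (\<Sum>l<?c. config_load I l cfg)"
            by (rule sum_mono2) (use i i' load_nonneg[OF *] in auto)
          with total[OF *] i' have "config_load I i cfg + config_load I i' cfg \<le> T" by auto
          moreover have load_ge: "?s l \<le> config_load I l cfg" if "present I l cfg = 1" for l
            using config_load_ge[OF vc(1)[OF *], of l] config_amount_nonneg[of cfg I l] vi[OF *] that by auto
          moreover from load_ge[OF pi] load_ge[OF pi'] have "?s i + ?s i' \<le> config_load I i cfg + config_load I i' cfg"
            by (rule add_mono)
          ultimately show False using i(1) i'(1) by simp
        qed
        have "(\<Sum>i\<in>?X. present I i cfg) = present I i cfg + (\<Sum>i\<in>?X - {i}. present I i cfg)"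
          by (rule sum.remove) (use i in auto)
        also have "(\<Sum>i\<in>?X - {i}. present I i cfg) = 0"
          by (rule sum.neutral) (use other in auto)
        finally show ?thesis using pi by simp
      next
        case False
        then have "(\<Sum>i\<in>?X. present I i cfg) = 0" by (intro sum.neutral) auto
        then show ?thesis by simp
      qed
    qed
    also have "\<dots> \<le> real (machines I)" using feas by (simp add: weigh_one feasible_def)
    finally show ?thesis .
  qed
  moreover have "real (\<Sum>i<?c. class_load I i + batches (setup_time I i) (class_load I i) T * setup_time I i)
       \<le> real (machines I) * T"
  proof -
    have "real (\<Sum>i<?c. class_load I i + batches (setup_time I i) (class_load I i) T * setup_time I i)
      \<le> (\<Sum>i<?c. weigh S (\<lambda>cfg. present I i cfg * ?s i + config_amount I i cfg))"
      unfolding of_nat_sum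
    proof (rule sum_mono)
      fix i assume "i \<in> {..<?c}"
      with mult_right_mono[OF batches_le, of i "?s i"]
      show "real (class_load I i + batches (setup_time I i) (class_load I i) T * setup_time I i)
        \<le> weigh S (\<lambda>cfg. present I i cfg * ?s i + config_amount I i cfg)"
        by (simp add: weigh_add weigh_cmult P_eq n_def)
    qed
    also have "\<dots> = weigh S (\<lambda>cfg. \<Sum>i<?c. present I i cfg * ?s i + config_amount I i cfg)"
      by (simp add: weigh_sum)
    also have "\<dots> \<le> weigh S (\<lambda>_. T)"
    proof (rule weigh_mono)
      fix cfg mult assume *: "(cfg, mult) \<in> set S"
      have "(\<Sum>i<?c. present I i cfg * ?s i + config_amount I i cfg) \<le> (\<Sum>i<?c. config_load I i cfg)"
        by (rule sum_mono) (rule config_load_ge[OF vc(1)[OF *]])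
      with total[OF *] show "(\<Sum>i<?c. present I i cfg * ?s i + config_amount I i cfg) \<le> T" by linarith
    qed
    also have "\<dots> = real (\<Sum>(cfg, mult)\<leftarrow>S. mult) * T"
      using weigh_cmult[of S "\<lambda>_. 1" T] by (simp add: weigh_one)
    also have "\<dots> \<le> real (machines I) * T"
      using feas makespan_nonneg[of I S] by (intro mult_right_mono) (auto simp: feasible_def T_def)
    finally show ?thesis .
  qed
  ultimately show ?thesis using s_le unfolding acceptable_def T_def of_nat_le_iff by blast
qed

text \<open>\<open>OPT_split\<close> is an infimum, and nothing is said about it being attained. The
  given \<open>S\<close> shows that the infimum ranges over a nonempty set, as
  \<open>cINF_greatest\<close> requires.\<close>

lemma makespan_le_OPT_split:
  assumes "valid_instance I" "feasible I S" "makespan I S \<le> a * T" "a \<ge> 0"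
    and "\<And>T'. acceptable I T' \<Longrightarrow> T \<le> T'"
  shows "makespan I S \<le> a * OPT_split I"
proof -
  have "T \<le> OPT_split I"
    unfolding OPT_split_def
    by (rule cINF_greatest) (use assms acceptable_makespan in auto)
  with assms show ?thesis by (meson mult_left_mono order_trans)
qed

section \<open>Placing the load\<close>

text \<open>\<open>fill\<close> is the time up to which the machine in progress is occupied, and
  \<open>rem z\<close> is what remains of the job at position \<open>pos z\<close> of stream
  \<open>z\<close>. The state does not mention the memory, so the schedule can be verified before
  the program.\<close>

record placement_state =
  sched :: "nat schedule"
  fill :: nat
  mode :: nat
  str :: nat
  pos :: "nat \<Rightarrow> nat"
  rem :: "nat \<Rightarrow> nat"

definition append_item :: "'a schedule \<Rightarrow> 'a item \<Rightarrow> 'a schedule" where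
  "append_item R it = butlast R @ [(fst (last R) @ [it], snd (last R))]"

lemma append_item_snoc [simp]: "append_item (Q @ [(cfg, k)]) it = Q @ [(cfg @ [it], k)]"
  by (simp add: append_item_def)

fun amount_in :: "nat \<Rightarrow> nat item \<Rightarrow> nat" where
  "amount_in j (Setup i b) = 0"
| "amount_in j (Piece j' b x) = (if j' = j then x else 0)"

definition amount :: "nat \<Rightarrow> nat schedule \<Rightarrow> nat" where
  "amount j R = (\<Sum>(cfg, mult)\<leftarrow>R. mult * (\<Sum>it\<leftarrow>cfg. amount_in j it))"

lemma amount_simps [simp]:
  "amount j [] = 0"
  "amount j ((cfg, mult) # R) = mult * (\<Sum>it\<leftarrow>cfg. amount_in j it) + amount j R"
  "amount j (R @ R') = amount j R + amount j R'"
  by (auto simp: amount_def)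

definition num_used :: "nat schedule \<Rightarrow> nat" where
  "num_used R = (\<Sum>(cfg, mult)\<leftarrow>R. mult)"

lemma num_used_simps [simp]:
  "num_used [] = 0" "num_used ((cfg, mult) # R) = mult + num_used R"
  "num_used (R @ R') = num_used R + num_used R'"
  by (auto simp: num_used_def)

definition has_piece :: "'a schedule \<Rightarrow> nat \<Rightarrow> bool" where
  "has_piece R j \<longleftrightarrow> (\<exists>(cfg, mult)\<in>set R. \<exists>b x. Piece j b x \<in> set cfg)"

text \<open>Times are multiplied by \<open>d\<close>, and \<open>H\<close> is \<open>T/2\<close> in
  this unit, so no fractions occur. \<open>bt i\<close> stands for the number of batches, and
  \<open>machines\<close> and \<open>total\<close> are the two acceptance conditions.
  \<open>ord\<close> puts the \<open>e\<close> jobs of expensive classes first; in both parts every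
  class forms one run, so a class that has been left does not return.\<close>

locale placement =
  fixes I :: inst and d H e :: nat and ord :: "nat \<Rightarrow> nat" and bt :: "nat \<Rightarrow> nat"
  assumes inst: "valid_instance I" and d: "d > 0"
    and setup_le: "\<And>i. i < num_classes I \<Longrightarrow> setup_time I i * d \<le> 2 * H"
    and ord: "bij_betw ord {..<num_jobs I} {..<num_jobs I}"
    and e: "e \<le> num_jobs I"
    and expensive: "\<And>t. t < e \<Longrightarrow> H < setup_time I (job_class I (ord t)) * d"
    and cheap: "\<And>t. e \<le> t \<Longrightarrow> t < num_jobs I \<Longrightarrow> setup_time I (job_class I (ord t)) * d \<le> H"
    and sorted1: "\<And>t t'. t \<le> t' \<Longrightarrow> t' < e \<Longrightarrow> job_class I (ord t) \<le> job_class I (ord t')"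
    and sorted2: "\<And>t t'. e \<le> t \<Longrightarrow> t \<le> t' \<Longrightarrow> t' < num_jobs I \<Longrightarrow>
          job_class I (ord t) \<le> job_class I (ord t')"
    and bt_pos: "\<And>i. i < num_classes I \<Longrightarrow> bt i \<ge> 1"
    and bt: "\<And>i. i < num_classes I \<Longrightarrow> H < setup_time I i * d \<Longrightarrow> class_load I i * d \<le> bt i * H"
    and machines: "(\<Sum>i<num_classes I. if H < setup_time I i * d then bt i else 0) \<le> machines I"
    and total: "(\<Sum>i<num_classes I. class_load I i * d + bt i * (setup_time I i * d)) \<le> machines I * (2 * H)"
begin

abbreviation "n \<equiv> num_jobs I"
abbreviation "c \<equiv> num_classes I"
abbreviation "m \<equiv> machines I"

definition sg :: "nat \<Rightarrow> nat" where "sg i = setup_time I i * d"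
definition sz :: "nat \<Rightarrow> nat" where "sz t = proc_time I (ord t) * d"
definition cl :: "nat \<Rightarrow> nat" where "cl t = job_class I (ord t)"
text \<open>The load that a newly opened machine takes behind its setup: the share \<open>H\<close>
  on which \<open>bt\<close> is based for an expensive class, and all the space below
  \<open>3 * H\<close> for a cheap one.\<close>

definition wd :: "nat \<Rightarrow> nat" where "wd i = (if H < sg i then H else 3 * H - sg i)"
definition fin :: "nat \<Rightarrow> nat" where "fin z = (if z = 0 then e else n)"

text \<open>Positions below \<open>e\<close> form stream 0 (jobs of expensive classes), the others stream 1. Mode 0
  opens a new machine, mode 1 places the current job of stream \<open>str\<close>, mode 2 tries to open a
  batch of the current cheap class on the current machine.\<close>

definition step :: "placement_state \<Rightarrow> placement_state" where
  "step st = (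
    if mode st = 0 then
      let z = (if pos st 0 < e then 0 else 1); t = pos st z; i = cl t; r = rem st z;
          q = (if wd i < r then (r - 1) div wd i else 0)
      in st\<lparr>sched := sched st @ (if wd i < r then [([Setup i 0, Piece (ord t) (sg i) (wd i)], q)] else [])
                              @ [([Setup i 0], 1)],
            fill := sg i, mode := 1, str := z, rem := (rem st)(z := r - q * wd i)\<rparr>
    else if mode st = 1 then
      let z = str st; t = pos st z; i = cl t; r = rem st z; cap = sg i + wd i in
      if fill st + r \<le> cap then
        st\<lparr>sched := append_item (sched st) (Piece (ord t) (fill st) r), fill := fill st + r,
           pos := (pos st)(z := t + 1),
           mode := (if t + 1 < fin z \<and> cl (t + 1) = i then 1 else 2),
           rem := (if t + 1 < fin z then (rem st)(z := sz (t + 1)) else rem st)\<rparr>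
      else
        st\<lparr>sched := append_item (sched st) (Piece (ord t) (fill st) (cap - fill st)),
           rem := (rem st)(z := r - (cap - fill st)), mode := 0\<rparr>
    else
      let i = cl (pos st 1) in
      if pos st 1 < n \<and> fill st + sg i \<le> 3 * H then
        st\<lparr>sched := append_item (sched st) (Setup i (fill st)), fill := fill st + sg i,
           mode := 1, str := 1\<rparr>
      else st\<lparr>mode := 0, str := 1\<rparr>)"

definition finished :: "placement_state \<Rightarrow> bool" where
  "finished st \<longleftrightarrow> mode st = 0 \<and> \<not> pos st 0 < e \<and> \<not> pos st 1 < n"

text \<open>In mode 1 after opening a machine, the rest of the job fits, so that a job is completed
  after every at most four steps.\<close>

definition potential :: "placement_state \<Rightarrow> nat" where
  "potential st = 4 * ((e - pos st 0) + (n - pos st 1)) +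
     (if mode st = 0 then 1 else if mode st = 2 then 3 else
      let z = str st; i = cl (pos st z) in if fill st + rem st z \<le> sg i + wd i then 0 else 2)"

definition placed :: "placement_state \<Rightarrow> nat \<Rightarrow> nat" where
  "placed st t = (let z = (if t < e then 0 else 1) in
     if t < pos st z then sz t else if t = pos st z then sz t - rem st z else 0)"

fun nat_length :: "nat item \<Rightarrow> nat" where
  "nat_length (Setup i b) = sg i"
| "nat_length (Piece j b x) = x"

definition nat_end :: "nat item \<Rightarrow> nat" where
  "nat_end it = item_start it + nat_length it"

fun ok_item :: "nat item \<Rightarrow> bool" where
  "ok_item (Setup i b) \<longleftrightarrow> i < c"
| "ok_item (Piece j b x) \<longleftrightarrow> j < n"

definition ok_config :: "nat config \<Rightarrow> bool" where
  "ok_config cfg \<longleftrightarrow> (\<forall>it\<in>set cfg. ok_item it) \<and>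
     sorted_wrt (\<lambda>x y. nat_end x \<le> item_start y) cfg \<and>
     (\<forall>k<length cfg. is_piece (cfg ! k) \<longrightarrow>
        k > 0 \<and> item_class I (cfg ! (k - 1)) = item_class I (cfg ! k))"

definition ok_sched :: "nat schedule \<Rightarrow> bool" where
  "ok_sched R \<longleftrightarrow> (\<forall>(cfg, mult)\<in>set R. ok_config cfg \<and> mult > 0 \<and> (\<forall>it\<in>set cfg. nat_end it \<le> 3 * H))"

text \<open>Validity and amounts only; the number of machines is left to \<open>counts\<close>. In
  modes 1 and 2 the last configuration has multiplicity 1, so appending to it changes a single
  machine.\<close>

definition shape :: "placement_state \<Rightarrow> bool" where
  "shape st \<longleftrightarrow> mode st \<le> 2 \<and> str st \<le> 1 \<and> pos st 0 \<le> e \<and> e \<le> pos st 1 \<and> pos st 1 \<le> n \<and>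
     (pos st 0 < e \<longrightarrow> rem st 0 \<le> sz (pos st 0)) \<and> (pos st 1 < n \<longrightarrow> rem st 1 \<le> sz (pos st 1)) \<and>
     ok_sched (sched st) \<and>
     (\<forall>t<n. amount (ord t) (sched st) = placed st t \<and>
        (t < pos st (if t < e then 0 else 1) \<longrightarrow> has_piece (sched st) (ord t))) \<and>
     (mode st \<noteq> 0 \<longrightarrow> fill st \<le> 3 * H \<and> (\<exists>Q cfg. sched st = Q @ [(cfg, 1)] \<and>
        (\<forall>it\<in>set cfg. nat_end it \<le> fill st) \<and>
        (mode st = 1 \<longrightarrow> (let z = str st; i = cl (pos st z) in
           cfg \<noteq> [] \<and> item_class I (last cfg) = i \<and> pos st z < fin z \<and> fill st \<le> sg i + wd i))))"

section \<open>Validity of the schedule under each kind of step\<close>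

lemma cl_less: "t < n \<Longrightarrow> cl t < c"
proof -
  assume "t < n"
  then have "ord t < n" using ord by (auto simp: bij_betw_def)
  then have "job_class I (ord t) \<in> {0..<c}"
    using inst unfolding valid_instance_def by (metis atLeast0LessThan imageI lessThan_iff)
  then show ?thesis by (simp add: cl_def)
qed

lemma ord_less: "t < n \<Longrightarrow> ord t < n"
  using ord by (auto simp: bij_betw_def)

lemma ord_eq: "t < n \<Longrightarrow> t' < n \<Longrightarrow> ord t = ord t' \<longleftrightarrow> t = t'"
  using ord by (auto simp: bij_betw_def inj_on_def)

lemma ok_config_snoc:
  assumes "ok_config cfg" "\<forall>it\<in>set cfg. nat_end it \<le> item_start it'" "ok_item it'"
    and "is_piece it' \<Longrightarrow> cfg \<noteq> [] \<and> item_class I (last cfg) = item_class I it'"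
  shows "ok_config (cfg @ [it'])"
  using assms unfolding ok_config_def
  by (auto simp: sorted_wrt_append nth_append less_Suc_eq last_conv_nth)

lemma ok_config_full:
  assumes "i < c" "j < n" "job_class I j = i"
  shows "ok_config [Setup i 0, Piece j (sg i) x]" "ok_config [Setup i 0]"
  using assms by (auto simp: ok_config_def nat_end_def less_Suc_eq nth_Cons split: nat.splits)

lemma sg_le: "i < c \<Longrightarrow> sg i \<le> 2 * H"
  using setup_le by (simp add: sg_def)

lemma cap_le: "i < c \<Longrightarrow> sg i + wd i \<le> 3 * H"
  using sg_le[of i] by (auto simp: wd_def)

lemma cl_expensive: "t < e \<Longrightarrow> H < sg (cl t)" and cl_cheap: "e \<le> t \<Longrightarrow> t < n \<Longrightarrow> sg (cl t) \<le> H"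
  using expensive cheap by (auto simp: sg_def cl_def)

lemma has_piece_append: "has_piece (Q @ [(cfg, k)]) j \<Longrightarrow> has_piece (Q @ [(cfg @ [it], k)]) j"
  unfolding has_piece_def by fastforce

lemma stream_of:
  assumes "shape st" "z \<le> 1" "pos st z < fin z"
  shows "pos st z < n" "z = (if pos st z < e then 0 else 1)"
  using assms e by (cases "z = 0"; auto simp: shape_def fin_def le_Suc_eq)+

text \<open>The last hypothesis keeps the division meaningful: machines without room for load could
  never finish a job of which something remains. It is discharged by \<open>wd_eq_0\<close>.\<close>

lemma shape_open:
  assumes s: "shape st" and m0: "mode st = 0" and nf: "\<not> finished st"
    and pos: "\<And>z. z \<le> 1 \<Longrightarrow> pos st z < fin z \<Longrightarrow> wd (cl (pos st z)) = 0 \<Longrightarrow> rem st z = 0"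
  shows "shape (step st)" and "potential (step st) < potential st"
    and "\<forall>t<n. placed (step st) t = placed st t +
       (let z = (if pos st 0 < e then 0 else 1); i = cl (pos st z); r = rem st z in
        if t = pos st z \<and> wd i < r then (r - 1) div wd i * wd i else 0)"
proof -
  define z where "z = (if pos st 0 < e then 0 else 1::nat)"
  define t where "t = pos st z"
  define i where "i = cl t"
  define r where "r = rem st z"
  \<comment> \<open>The \<open>- 1\<close> leaves a positive rest of at most \<open>wd i\<close> for
    the machine opened last, so the job ends there, and its full machines share one configuration of
    multiplicity \<open>q\<close>.\<close>
  define q where "q = (if wd i < r then (r - 1) div wd i else 0)"
  have zz: "z \<le> 1" "t < fin z"
    using nf m0 by (auto simp: t_def z_def finished_def fin_def)
  then have tz: "t < fin z" "t < n" "z = (if t < e then 0 else 1)"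
    using stream_of[OF s zz(1)] by (simp_all add: t_def)
  have ti: "i < c" using cl_less[OF tz(2)] by (simp add: i_def)
  have r: "r \<le> sz t" using s zz by (auto simp: shape_def r_def t_def fin_def le_Suc_eq split: if_splits)
  have w0: "wd i = 0 \<Longrightarrow> r = 0" using pos[of z] zz by (simp add: r_def i_def t_def)
  have qw: "q * wd i \<le> r" "r - q * wd i \<le> wd i"
  proof -
    show "q * wd i \<le> r"
      unfolding q_def using div_times_less_eq_dividend[of "r - 1" "wd i"] by (auto simp del: div_times_less_eq_dividend intro: le_trans)
    show "r - q * wd i \<le> wd i"
    proof (cases "wd i < r")
      case True
      with w0 have "wd i > 0" by (cases "wd i = 0") auto
      then have "r - 1 < (q + 1) * wd i"
        using True dividend_less_div_times[of "wd i" "r - 1"] by (auto simp: q_def algebra_simps)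
      then show ?thesis by (simp add: algebra_simps)
    qed (auto simp: q_def)
  qed
  have qpos: "q > 0" if "wd i < r"
    using that w0 by (cases "wd i = 0") (auto simp: q_def div_greater_zero_iff)
  define st' where "st' = step st"
  have st': "sched st' = sched st @ (if wd i < r then [([Setup i 0, Piece (ord t) (sg i) (wd i)], q)] else [])
                              @ [([Setup i 0], 1)]"
    "fill st' = sg i" "mode st' = 1" "str st' = z" "pos st' = pos st" "rem st' = (rem st)(z := r - q * wd i)"
    using m0 by (simp_all add: st'_def step_def Let_def t_def i_def r_def q_def z_def)
  have pl: "placed st' t' = placed st t' + (if t' = t then q * wd i else 0)" for t'
  proof (cases "(if t' < e then 0 else 1) = z")
    case True
    show ?thesis unfolding placed_def True st' Let_def
      using r qw by (auto simp: t_def[symmetric] r_def[symmetric])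
  next
    case False
    then have "t' \<noteq> t" using tz by auto
    with False show ?thesis by (auto simp: placed_def st' Let_def)
  qed
  then show "\<forall>t<n. placed (step st) t = placed st t +
       (let z = (if pos st 0 < e then 0 else 1); i = cl (pos st z); r = rem st z in
        if t = pos st z \<and> wd i < r then (r - 1) div wd i * wd i else 0)"
    by (auto simp: st'_def[symmetric] q_def i_def r_def t_def z_def Let_def)
  have cj: "job_class I (ord t) = i" by (simp add: i_def cl_def)
  have "ok_sched (sched st')"
    using s ok_config_full[OF ti ord_less[OF tz(2)] cj] cap_le[OF ti] qpos sg_le[OF ti]
    by (auto simp: st' ok_sched_def shape_def nat_end_def)
  moreover have "amount (ord t') (sched st') = placed st' t' \<and>
        (t' < pos st' (if t' < e then 0 else 1) \<longrightarrow> has_piece (sched st') (ord t'))" if "t' < n" for t'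
  proof -
    have "amount (ord t') (sched st') = amount (ord t') (sched st) + (if t' = t then q * wd i else 0)"
      using ord_eq[OF that tz(2)] by (auto simp: st' q_def)
    moreover have "has_piece (sched st) j \<Longrightarrow> has_piece (sched st') j" for j
      by (auto simp: has_piece_def st')
    ultimately show ?thesis
      using s that pl[of t'] by (simp add: shape_def st'(5))
  qed
  moreover have "\<exists>Q cfg. sched st' = Q @ [(cfg, 1)] \<and> (\<forall>it\<in>set cfg. nat_end it \<le> fill st') \<and>
        (mode st' = 1 \<longrightarrow> (let z = str st'; i = cl (pos st' z) in
           cfg \<noteq> [] \<and> item_class I (last cfg) = i \<and> pos st' z < fin z \<and> fill st' \<le> sg i + wd i))"
  proof -
    obtain Q where "sched st' = Q @ [([Setup i 0], 1)]" by (simp add: st'(1))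
    then show ?thesis
      using zz by (intro exI[of _ Q] exI[of _ "[Setup i 0]"])
        (simp add: st'(2-) nat_end_def i_def[symmetric] t_def[symmetric] Let_def)
  qed
  moreover have "mode st' \<le> 2 \<and> str st' \<le> 1 \<and> pos st' 0 \<le> e \<and> e \<le> pos st' 1 \<and> pos st' 1 \<le> n \<and>
     (pos st' 0 < e \<longrightarrow> rem st' 0 \<le> sz (pos st' 0)) \<and> (pos st' 1 < n \<longrightarrow> rem st' 1 \<le> sz (pos st' 1))"
    using s zz r unfolding st' by (cases "z = 0") (auto simp: shape_def fin_def t_def le_Suc_eq)
  moreover have "fill st' \<le> 3 * H" using sg_le[OF ti] by (simp add: st'(2))
  ultimately have "shape st'" unfolding shape_def by blast
  then show "shape (step st)" by (simp add: st'_def)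
  show "potential (step st) < potential st"
    using qw m0 by (simp add: st'_def[symmetric] potential_def st' i_def t_def Let_def)
qed

lemma shape_place:
  assumes s: "shape st" and m1: "mode st = 1"
    and fits: "fill st + rem st (str st) \<le> sg (cl (pos st (str st))) + wd (cl (pos st (str st)))"
  shows "shape (step st)" and "potential (step st) < potential st"
    and "\<forall>t<n. placed (step st) t = placed st t + (if t = pos st (str st) then rem st (str st) else 0)"
proof -
  define z where "z = str st"
  define t where "t = pos st z"
  define i where "i = cl t"
  define r where "r = rem st z"
  from s m1 obtain Q cfg where R: "sched st = Q @ [(cfg, 1)]" "\<forall>it\<in>set cfg. nat_end it \<le> fill st"
    "cfg \<noteq> []" "item_class I (last cfg) = i" "t < fin z" "fill st \<le> sg i + wd i"
    by (auto simp: shape_def Let_def z_def t_def i_def)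
  have zz: "z \<le> 1" using s by (simp add: shape_def z_def)
  have tz: "t < n" "z = (if t < e then 0 else 1)"
    using stream_of[OF s zz] R(5) by (simp_all add: t_def)
  have ti: "i < c" using cl_less[OF tz(1)] by (simp add: i_def)
  have r: "r \<le> sz t" using s R(5) zz by (auto simp: shape_def r_def t_def fin_def le_Suc_eq split: if_splits)
  define st' where "st' = step st"
  have st': "sched st' = Q @ [(cfg @ [Piece (ord t) (fill st) r], 1)]"
    "fill st' = fill st + r" "mode st' = (if t + 1 < fin z \<and> cl (t + 1) = i then 1 else 2)"
    "str st' = z" "pos st' = (pos st)(z := t + 1)"
    "rem st' = (if t + 1 < fin z then (rem st)(z := sz (t + 1)) else rem st)"
    using m1 fits by (simp_all add: st'_def step_def Let_def t_def i_def r_def z_def R)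
  have pl: "placed st' t' = placed st t' + (if t' = t then r else 0)" if "t' < n" for t'
  proof (cases "(if t' < e then 0 else 1) = z")
    case True
    then have "t' < fin z" using that by (auto simp: fin_def split: if_splits)
    show ?thesis unfolding placed_def True st' Let_def
      using r \<open>t' < fin z\<close> by (auto simp: t_def[symmetric] r_def[symmetric])
  next
    case False
    then have "t' \<noteq> t" using tz by auto
    with False show ?thesis by (auto simp: placed_def st' Let_def)
  qed
  then show "\<forall>t<n. placed (step st) t = placed st t + (if t = pos st (str st) then rem st (str st) else 0)"
    by (auto simp: st'_def[symmetric] r_def t_def z_def)
  have cj: "job_class I (ord t) = i" by (simp add: i_def cl_def)
  have okc: "ok_config cfg" using s R(1) by (auto simp: shape_def ok_sched_def)
  have "ok_config (cfg @ [Piece (ord t) (fill st) r])"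
    by (rule ok_config_snoc[OF okc]) (use R cj ord_less[OF tz(1)] in auto)
  then have ok: "ok_sched (sched st')"
    using s R(1) fits cap_le[OF ti]
    by (auto simp: st' ok_sched_def shape_def nat_end_def z_def t_def i_def r_def)
  have am: "amount (ord t') (sched st') = placed st' t' \<and>
        (t' < pos st' (if t' < e then 0 else 1) \<longrightarrow> has_piece (sched st') (ord t'))" if "t' < n" for t'
  proof -
    have "amount (ord t') (sched st') = amount (ord t') (sched st) + (if t' = t then r else 0)"
      using ord_eq[OF that tz(1)] by (auto simp: st' R)
    moreover have "has_piece (sched st') (ord t')" if "t' < pos st' (if t' < e then 0 else 1)"
    proof (cases "t' = t")
      case True
      then show ?thesis by (auto simp: st' has_piece_def)
    next
      case False
      with that have "t' < pos st (if t' < e then 0 else 1)"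
        by (auto simp: st' t_def split: if_splits)
      with s \<open>t' < n\<close> R(1) have "has_piece (Q @ [(cfg, 1)]) (ord t')" by (simp add: shape_def)
      then show ?thesis unfolding st' by (rule has_piece_append)
    qed
    ultimately show ?thesis using s that pl[of t'] by (auto simp: shape_def)
  qed
  have ex: "\<exists>Q cfg. sched st' = Q @ [(cfg, 1)] \<and> (\<forall>it\<in>set cfg. nat_end it \<le> fill st') \<and>
        (mode st' = 1 \<longrightarrow> (let z = str st'; i = cl (pos st' z) in
           cfg \<noteq> [] \<and> item_class I (last cfg) = i \<and> pos st' z < fin z \<and> fill st' \<le> sg i + wd i))"
    by (rule exI[of _ Q], rule exI[of _ "cfg @ [Piece (ord t) (fill st) r]"])
       (use R(2) fits cj in \<open>auto simp: st' nat_end_def i_def t_def z_def r_def\<close>)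
  have basic: "mode st' \<le> 2 \<and> str st' \<le> 1 \<and> pos st' 0 \<le> e \<and> e \<le> pos st' 1 \<and> pos st' 1 \<le> n \<and>
     (pos st' 0 < e \<longrightarrow> rem st' 0 \<le> sz (pos st' 0)) \<and> (pos st' 1 < n \<longrightarrow> rem st' 1 \<le> sz (pos st' 1))"
    using s zz R(5) unfolding st' by (cases "z = 0") (auto simp: shape_def fin_def t_def le_Suc_eq)
  have "fill st' \<le> 3 * H"
    using fits cap_le[OF ti] by (simp add: st' z_def t_def i_def r_def)
  then have "shape st'"
    unfolding shape_def using basic ok am ex by blast
  then show "shape (step st)" by (simp add: st'_def)
  \<comment> \<open>Finishing a job lowers the first summand of the potential by 4, more than the
    mode term of at most 3 can gain.\<close>
  have "4 * ((e - pos st' 0) + (n - pos st' 1)) + 4 \<le> 4 * ((e - pos st 0) + (n - pos st 1))"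
    using s zz R(5) unfolding st' by (cases "z = 0") (auto simp: shape_def fin_def t_def le_Suc_eq)
  then show "potential (step st) < potential st"
    using m1 by (auto simp: st'_def[symmetric] potential_def Let_def)
qed

lemma shape_split:
  assumes s: "shape st" and m1: "mode st = 1"
    and fits: "\<not> fill st + rem st (str st) \<le> sg (cl (pos st (str st))) + wd (cl (pos st (str st)))"
  shows "shape (step st)" and "potential (step st) < potential st"
    and "\<forall>t<n. placed (step st) t = placed st t + (if t = pos st (str st) then
      sg (cl (pos st (str st))) + wd (cl (pos st (str st))) - fill st else 0)"
proof -
  define z where "z = str st"
  define t where "t = pos st z"
  define i where "i = cl t"
  define r where "r = rem st z"
  define a where "a = sg i + wd i - fill st"
  from s m1 obtain Q cfg where R: "sched st = Q @ [(cfg, 1)]" "\<forall>it\<in>set cfg. nat_end it \<le> fill st"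
    "cfg \<noteq> []" "item_class I (last cfg) = i" "t < fin z" "fill st \<le> sg i + wd i"
    by (auto simp: shape_def Let_def z_def t_def i_def)
  have zz: "z \<le> 1" using s by (simp add: shape_def z_def)
  have tz: "t < n" "z = (if t < e then 0 else 1)"
    using stream_of[OF s zz] R(5) by (simp_all add: t_def)
  have ti: "i < c" using cl_less[OF tz(1)] by (simp add: i_def)
  have r: "r \<le> sz t" using s R(5) zz by (auto simp: shape_def r_def t_def fin_def le_Suc_eq split: if_splits)
  have a: "a < r" using fits R(6) by (auto simp: a_def r_def i_def t_def z_def)
  define st' where "st' = step st"
  have st': "sched st' = Q @ [(cfg @ [Piece (ord t) (fill st) a], 1)]"
    "mode st' = 0" "str st' = z" "pos st' = pos st" "rem st' = (rem st)(z := r - a)"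
    using m1 fits by (simp_all add: st'_def step_def Let_def t_def i_def r_def z_def R a_def)
  have pl: "placed st' t' = placed st t' + (if t' = t then a else 0)" for t'
  proof (cases "(if t' < e then 0 else 1) = z")
    case True
    show ?thesis unfolding placed_def True st' Let_def
      using r a by (auto simp: t_def[symmetric] r_def[symmetric])
  next
    case False
    then have "t' \<noteq> t" using tz by auto
    with False show ?thesis by (auto simp: placed_def st' Let_def)
  qed
  then show "\<forall>t<n. placed (step st) t = placed st t + (if t = pos st (str st) then
      sg (cl (pos st (str st))) + wd (cl (pos st (str st))) - fill st else 0)"
    by (auto simp: st'_def[symmetric] a_def i_def t_def z_def)
  have cj: "job_class I (ord t) = i" by (simp add: i_def cl_def)
  have okc: "ok_config cfg" using s R(1) by (auto simp: shape_def ok_sched_def)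
  have "ok_config (cfg @ [Piece (ord t) (fill st) a])"
    by (rule ok_config_snoc[OF okc]) (use R cj ord_less[OF tz(1)] in auto)
  then have ok: "ok_sched (sched st')"
    using s R(1,6) cap_le[OF ti]
    by (auto simp: st' ok_sched_def shape_def nat_end_def a_def)
  have am: "amount (ord t') (sched st') = placed st' t' \<and>
        (t' < pos st' (if t' < e then 0 else 1) \<longrightarrow> has_piece (sched st') (ord t'))" if "t' < n" for t'
  proof -
    have "amount (ord t') (sched st') = amount (ord t') (sched st) + (if t' = t then a else 0)"
      using ord_eq[OF that tz(1)] by (auto simp: st' R)
    moreover have "has_piece (sched st') (ord t')" if "t' < pos st' (if t' < e then 0 else 1)"
    proof -
      have "has_piece (Q @ [(cfg, 1)]) (ord t')" using that s \<open>t' < n\<close> R(1) by (simp add: shape_def st')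
      then show ?thesis unfolding st' by (rule has_piece_append)
    qed
    ultimately show ?thesis using s that pl[of t'] by (auto simp: shape_def)
  qed
  have basic: "mode st' \<le> 2 \<and> str st' \<le> 1 \<and> pos st' 0 \<le> e \<and> e \<le> pos st' 1 \<and> pos st' 1 \<le> n \<and>
     (pos st' 0 < e \<longrightarrow> rem st' 0 \<le> sz (pos st' 0)) \<and> (pos st' 1 < n \<longrightarrow> rem st' 1 \<le> sz (pos st' 1))"
    using s zz r unfolding st' by (cases "z = 0") (auto simp: shape_def fin_def t_def le_Suc_eq)
  then have "shape st'"
    unfolding shape_def using ok am st'(2) by blast
  then show "shape (step st)" by (simp add: st'_def)
  show "potential (step st) < potential st"
    using m1 fits by (auto simp: st'_def[symmetric] potential_def Let_def st')
qed

lemma shape_setup: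
  assumes s: "shape st" and m2: "mode st = 2"
    and fits: "pos st 1 < n \<and> fill st + sg (cl (pos st 1)) \<le> 3 * H"
  shows "shape (step st)" and "potential (step st) < potential st"
    and "placed (step st) t = placed st t"
proof -
  define i where "i = cl (pos st 1)"
  from s m2 obtain Q cfg where R: "sched st = Q @ [(cfg, 1)]" "\<forall>it\<in>set cfg. nat_end it \<le> fill st"
    by (auto simp: shape_def Let_def)
  have ti: "i < c" using cl_less fits by (simp add: i_def)
  have i: "sg i \<le> H" using fits s cl_cheap by (auto simp: i_def shape_def)
  define st' where "st' = step st"
  have st': "sched st' = Q @ [(cfg @ [Setup i (fill st)], 1)]" "fill st' = fill st + sg i"
    "mode st' = 1" "str st' = 1" "pos st' = pos st" "rem st' = rem st"
    using m2 fits by (simp_all add: st'_def step_def Let_def i_def R)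
  show "placed (step st) t = placed st t" by (simp add: placed_def st'_def[symmetric] st')
  have okc: "ok_config cfg" using s R(1) by (auto simp: shape_def ok_sched_def)
  have "ok_config (cfg @ [Setup i (fill st)])"
    by (rule ok_config_snoc[OF okc]) (use R ti in auto)
  then have ok: "ok_sched (sched st')"
    using s R(1) fits by (auto simp: st' ok_sched_def shape_def nat_end_def i_def)
  have am: "amount (ord t') (sched st') = placed st' t' \<and>
        (t' < pos st' (if t' < e then 0 else 1) \<longrightarrow> has_piece (sched st') (ord t'))" if "t' < n" for t'
  proof -
    have "has_piece (sched st') (ord t')" if "t' < pos st' (if t' < e then 0 else 1)"
    proof -
      have "has_piece (Q @ [(cfg, 1)]) (ord t')" using that s \<open>t' < n\<close> R(1) by (simp add: shape_def st')
      then show ?thesis unfolding st' by (rule has_piece_append)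
    qed
    moreover have "amount (ord t') (sched st') = amount (ord t') (sched st)" by (simp add: st' R)
    moreover have "placed st' t' = placed st t'" by (simp add: placed_def st')
    ultimately show ?thesis using s that by (auto simp: shape_def)
  qed
  have ex: "\<exists>Q cfg. sched st' = Q @ [(cfg, 1)] \<and> (\<forall>it\<in>set cfg. nat_end it \<le> fill st') \<and>
        (mode st' = 1 \<longrightarrow> (let z = str st'; i = cl (pos st' z) in
           cfg \<noteq> [] \<and> item_class I (last cfg) = i \<and> pos st' z < fin z \<and> fill st' \<le> sg i + wd i))"
    by (rule exI[of _ Q], rule exI[of _ "cfg @ [Setup i (fill st)]"])
       (use R(2) fits i in \<open>auto simp: st' nat_end_def i_def fin_def wd_def\<close>)
  have basic: "mode st' \<le> 2 \<and> str st' \<le> 1 \<and> pos st' 0 \<le> e \<and> e \<le> pos st' 1 \<and> pos st' 1 \<le> n \<and>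
     (pos st' 0 < e \<longrightarrow> rem st' 0 \<le> sz (pos st' 0)) \<and> (pos st' 1 < n \<longrightarrow> rem st' 1 \<le> sz (pos st' 1))"
    using s by (auto simp: st' shape_def)
  have "fill st' \<le> 3 * H" using fits by (simp add: st' i_def)
  then have "shape st'" unfolding shape_def using basic ok am ex by blast
  then show "shape (step st)" by (simp add: st'_def)
  show "potential (step st) < potential st"
    using m2 by (auto simp: st'_def[symmetric] potential_def Let_def st')
qed

lemma shape_close:
  assumes s: "shape st" and m2: "mode st = 2"
    and fits: "\<not> (pos st 1 < n \<and> fill st + sg (cl (pos st 1)) \<le> 3 * H)"
  shows "shape (step st)" and "potential (step st) < potential st"
    and "placed (step st) t = placed st t"
proof -
  have st': "step st = st\<lparr>mode := 0, str := 1\<rparr>" using m2 fits by (auto simp: step_def Let_def)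
  show "shape (step st)" "potential (step st) < potential st" "placed (step st) t = placed st t"
    using s m2 by (auto simp: st' shape_def placed_def potential_def)
qed

section \<open>Counting the machines\<close>

definition class_placed :: "placement_state \<Rightarrow> nat \<Rightarrow> nat" where
  "class_placed st i = (\<Sum>t | t < e \<and> cl t = i. placed st t)"

definition charge :: "placement_state \<Rightarrow> (nat \<Rightarrow> nat) \<Rightarrow> nat set \<Rightarrow> nat" where
  "charge st x Y = (\<Sum>i<c. sg i * x i) + (\<Sum>i\<in>Y. sg i) + (\<Sum>t<n. placed st t)"

text \<open>The ghost \<open>x i\<close> counts the machines opened for the expensive class \<open>i\<close>, and \<open>Y\<close> is the set of
  cheap classes whose first setup has been charged to some machine (to the previous one, if it did
  not fit there). The setup \<open>u\<close> on the current machine merely continues a cheap batch and is not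
  charged. Hence every closed machine carries a charged load of at least \<open>2 * H\<close>, as long as there is
  cheap load left.\<close>

definition counts :: "placement_state \<Rightarrow> (nat \<Rightarrow> nat) \<Rightarrow> nat set \<Rightarrow> nat \<Rightarrow> bool" where
  "counts st x Y u \<longleftrightarrow>
    (\<forall>i<c. x i \<le> bt i) \<and> (\<forall>i. sg i \<le> H \<longrightarrow> x i = 0) \<and> Y \<subseteq> {i. i < c \<and> sg i \<le> H} \<and> u \<le> H \<and>
    num_used (sched st) \<le> m \<and>
    (pos st 0 < e \<longrightarrow> num_used (sched st) = (\<Sum>i<c. x i) \<and>
      (let i = cl (pos st 0) in
       if mode st = 1 \<and> str st = 0
       then 1 \<le> x i \<and> class_placed st i + sg i + H = x i * H + fill st
       else x i * H = class_placed st i \<and> (x i = 0 \<or> 0 < rem st 0)) \<and>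
      (\<forall>t. pos st 0 < t \<and> t < e \<and> cl t \<noteq> cl (pos st 0) \<longrightarrow> x (cl t) = 0)) \<and>
    (pos st 1 < n \<longrightarrow>
      (\<forall>t. pos st 1 < t \<and> t < n \<and> cl t \<noteq> cl (pos st 1) \<longrightarrow> cl t \<notin> Y) \<and>
      (if mode st = 0
       then num_used (sched st) * (2 * H) \<le> charge st x Y \<and>
         (num_used (sched st) = 0 \<or> num_used (sched st) * (2 * H) < charge st x Y + rem st 1)
       else 1 \<le> num_used (sched st) \<and>
         num_used (sched st) * (2 * H) + fill st \<le> charge st x Y + u + 2 * H) \<and>
      (mode st = 1 \<and> str st = 0 \<longrightarrow> u = 0) \<and>
      (mode st = 2 \<longrightarrow> u = 0 \<or> cl (pos st 1) \<notin> Y))"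

lemma class_load_eq: "class_load I i * d = (\<Sum>t | t < n \<and> cl t = i. sz t)"
proof -
  have "bij_betw ord {t. t < n \<and> cl t = i} (jobs_of I i)"
    using ord unfolding bij_betw_def jobs_of_def cl_def
    by (auto simp: inj_on_def image_iff)
  then have "(\<Sum>j\<in>jobs_of I i. proc_time I j) = (\<Sum>t | t < n \<and> cl t = i. proc_time I (ord t))"
    by (simp add: sum.reindex_bij_betw)
  then show ?thesis by (simp add: class_load_def sz_def sum_distrib_right)
qed

lemma total_load_eq: "(\<Sum>i<c. class_load I i * d) = (\<Sum>t<n. sz t)"
proof -
  have "(\<Sum>i<c. \<Sum>t | t \<in> {..<n} \<and> cl t = i. sz t) = (\<Sum>t<n. sz t)"
    by (rule sum.group) (use cl_less in auto)
  then show ?thesis by (simp add: class_load_eq)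
qed

text \<open>\<open>wd\<close> is at least \<open>H\<close>, so \<open>H = 0\<close>, and then
  \<open>total\<close> leaves no load at all.\<close>

lemma wd_eq_0:
  assumes "t < n" "wd (cl t) = 0"
  shows "sz t = 0"
proof -
  have "H = 0" using assms(2) by (auto simp: wd_def split: if_splits)
  then have "(\<Sum>i<c. class_load I i * d + bt i * (setup_time I i * d)) = 0" using total by simp
  then have "(\<Sum>i<c. class_load I i * d) = 0" by (simp add: sum.distrib)
  then show ?thesis using assms(1) total_load_eq by simp
qed

lemma placed_le: "t < n \<Longrightarrow> placed st t \<le> sz t"
  by (auto simp: placed_def Let_def)

lemma placed_pos:
  assumes "shape st" "z \<le> 1" "pos st z < fin z"
  shows "placed st (pos st z) + rem st z = sz (pos st z)"
  using stream_of[OF assms] assms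
  by (auto simp: placed_def shape_def fin_def le_Suc_eq Let_def split: if_splits)

lemma sum_le_machines:
  assumes "\<forall>i<c. x i \<le> bt i" "\<forall>i. sg i \<le> H \<longrightarrow> x i = 0"
  shows "(\<Sum>i<c. x i) \<le> m"
proof -
  have "(\<Sum>i<c. x i) \<le> (\<Sum>i<c. if H < setup_time I i * d then bt i else 0)"
    by (rule sum_mono) (use assms in \<open>auto simp: sg_def not_less\<close>)
  with machines show ?thesis by linarith
qed

text \<open>An expensive setup is charged at most \<open>bt i\<close> times and a cheap one at most
  once, and the rest of the current job is not among the placed load. So the left side is part of
  the sum bounded by \<open>total\<close>.\<close>

lemma charge_le:
  assumes x: "\<forall>i<c. x i \<le> bt i" "\<forall>i. sg i \<le> H \<longrightarrow> x i = 0" and Y: "Y \<subseteq> {i. i < c \<and> sg i \<le> H}"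
    and s: "shape st" "pos st 1 < n"
  shows "charge st x Y + rem st 1 \<le> m * (2 * H)"
proof -
  have "(\<Sum>i<c. sg i * x i) + (\<Sum>i\<in>Y. sg i) = (\<Sum>i<c. sg i * x i + (if i \<in> Y then sg i else 0))"
  proof -
    have "(\<Sum>i\<in>Y. sg i) = (\<Sum>i\<in>{..<c} \<inter> Y. sg i)" using Y by (intro arg_cong[where f = "sum sg"]) auto
    then show ?thesis by (simp add: sum.distrib sum.inter_restrict)
  qed
  also have "\<dots> \<le> (\<Sum>i<c. bt i * sg i)"
  proof (rule sum_mono)
    fix i assume i: "i \<in> {..<c}"
    show "sg i * x i + (if i \<in> Y then sg i else 0) \<le> bt i * sg i"
    proof (cases "sg i \<le> H")
      case True
      then show ?thesis using x(2) bt_pos[of i] i by auto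
    next
      case False
      then show ?thesis using x(1) Y i by auto
    qed
  qed
  finally have 1: "(\<Sum>i<c. sg i * x i) + (\<Sum>i\<in>Y. sg i) \<le> (\<Sum>i<c. bt i * sg i)" .
  have "(\<Sum>t<n. placed st t) + rem st 1 = (\<Sum>t\<in>{..<n} - {pos st 1}. placed st t) + sz (pos st 1)"
    using placed_pos[OF s(1), of 1] s(2) sum.remove[of "{..<n}" "pos st 1" "placed st"] by (simp add: fin_def)
  also have "\<dots> \<le> (\<Sum>t\<in>{..<n} - {pos st 1}. sz t) + sz (pos st 1)"
    by (intro add_right_mono sum_mono placed_le) auto
  also have "\<dots> = (\<Sum>t<n. sz t)" using s(2) sum.remove[of "{..<n}" "pos st 1" sz] by simp
  finally have "(\<Sum>t<n. placed st t) + rem st 1 \<le> (\<Sum>t<n. sz t)" .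
  with 1 total show ?thesis by (simp add: charge_def sum.distrib total_load_eq sg_def)
qed

lemma sum_placed_upd:
  assumes "\<forall>t<n. placed st' t = placed st t + (if t = t0 then a else 0)" "t0 < n"
  shows "(\<Sum>t<n. placed st' t) = (\<Sum>t<n. placed st t) + a"
    and "class_placed st' i = class_placed st i + (if t0 < e \<and> cl t0 = i then a else 0)"
proof -
  show "(\<Sum>t<n. placed st' t) = (\<Sum>t<n. placed st t) + a"
    using assms by (simp add: sum.distrib)
  have "class_placed st' i = (\<Sum>t | t < e \<and> cl t = i. placed st t + (if t = t0 then a else 0))"
    unfolding class_placed_def by (rule sum.cong) (use assms e in auto)
  then show "class_placed st' i = class_placed st i + (if t0 < e \<and> cl t0 = i then a else 0)"
    by (simp add: sum.distrib class_placed_def)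
qed

lemma charge_upd:
  assumes "\<forall>t<n. placed st' t = placed st t + (if t = t0 then a else 0)" "t0 < n"
  shows "charge st' x Y = charge st x Y + a"
  using sum_placed_upd(1)[OF assms] by (simp add: charge_def)

lemma sum_fun_upd_mult:
  assumes "i < c"
  shows "(\<Sum>l<c. f l * (x(i := x i + k)) l) = (\<Sum>l<c. f l * x l) + f i * (k::nat)"
proof -
  have "(\<Sum>l<c. f l * (x(i := x i + k)) l) = (\<Sum>l<c. f l * x l + (if l = i then f i * k else 0))"
    by (rule sum.cong) (auto simp: algebra_simps)
  with assms show ?thesis by (simp add: sum.distrib)
qed

lemma charge_x: "i < c \<Longrightarrow> charge st (x(i := x i + k)) Y = charge st x Y + sg i * k"
  using sum_fun_upd_mult[of i sg x k] by (simp add: charge_def)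

lemma sum_x: "i < c \<Longrightarrow> (\<Sum>l<c. (x(i := x i + k)) l) = (\<Sum>l<c. x l) + (k::nat)"
  using sum_fun_upd_mult[of i "\<lambda>_. 1" x k] by simp

lemma charge_Y: "Y \<subseteq> {i. i < c \<and> sg i \<le> H} \<Longrightarrow> i \<notin> Y \<Longrightarrow> charge st x (insert i Y) = charge st x Y + sg i"
  by (subgoal_tac "finite Y") (auto simp: charge_def intro: finite_subset)

lemma class_placed_le:
  assumes s: "shape st" and p: "pos st 0 < e"
  shows "class_placed st (cl (pos st 0)) + rem st 0 \<le> class_load I (cl (pos st 0)) * d"
proof -
  let ?T = "{t. t < e \<and> cl t = cl (pos st 0)}"
  have "class_placed st (cl (pos st 0)) + rem st 0 = (\<Sum>t\<in>?T - {pos st 0}. placed st t) + sz (pos st 0)"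
    using placed_pos[OF s, of 0] p sum.remove[of ?T "pos st 0" "placed st"]
    by (simp add: fin_def class_placed_def)
  also have "\<dots> \<le> (\<Sum>t\<in>?T - {pos st 0}. sz t) + sz (pos st 0)"
    by (intro add_right_mono sum_mono placed_le) (use e in auto)
  also have "\<dots> = (\<Sum>t\<in>?T. sz t)" using p sum.remove[of ?T "pos st 0" sz] by simp
  also have "\<dots> \<le> class_load I (cl (pos st 0)) * d"
    unfolding class_load_eq by (rule sum_mono2) (use e in auto)
  finally show ?thesis .
qed

lemma cl_mono: "t \<le> t' \<Longrightarrow> t' < e \<Longrightarrow> cl t \<le> cl t'" "e \<le> t \<Longrightarrow> t \<le> t' \<Longrightarrow> t' < n \<Longrightarrow> cl t \<le> cl t'"
  using sorted1 sorted2 by (auto simp: cl_def)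

lemma placed_open:
  assumes "shape st" "mode st = 0" "\<not> finished st"
  shows "shape (step st)" "potential (step st) < potential st"
    "\<forall>t<n. placed (step st) t = placed st t +
       (let z = (if pos st 0 < e then 0 else 1); i = cl (pos st z); r = rem st z in
        if t = pos st z \<and> wd i < r then (r - 1) div wd i * wd i else 0)"
proof -
  have "rem st z = 0" if z: "z \<le> 1" "pos st z < fin z" "wd (cl (pos st z)) = 0" for z
    using wd_eq_0[OF stream_of(1)[OF assms(1) z(1,2)] z(3)] placed_pos[OF assms(1) z(1,2)] by simp
  from shape_open[OF assms this]
  show "shape (step st)" "potential (step st) < potential st"
    "\<forall>t<n. placed (step st) t = placed st t +
       (let z = (if pos st 0 < e then 0 else 1); i = cl (pos st z); r = rem st z in
        if t = pos st z \<and> wd i < r then (r - 1) div wd i * wd i else 0)"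
    by blast+
qed

text \<open>The closed machines of the class carry exactly \<open>H\<close> each, and load remains
  unless none has been opened. So they number fewer than \<open>bt i\<close>, even together with the
  \<open>q\<close> new full machines, and one more may be opened.\<close>

lemma counts_open1:
  assumes s: "shape st" and cnt: "counts st x Y u" and m0: "mode st = 0" and p: "pos st 0 < e"
  shows "\<exists>x' Y' u'. counts (step st) x' Y' u'"
proof -
  define t where "t = pos st 0"
  define i where "i = cl t"
  define r where "r = rem st 0"
  define q where "q = (if H < r then (r - 1) div H else 0)"
  have tn: "t < n" using p e by (simp add: t_def)
  have ic: "i < c" using cl_less tn by (simp add: i_def)
  have si: "H < sg i" "wd i = H" using cl_expensive p by (simp_all add: i_def t_def wd_def)
  define st' where "st' = step st"
  have nf: "\<not> finished st" using p by (simp add: finished_def)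
  have pl: "\<forall>t'<n. placed st' t' = placed st t' + (if t' = t then q * H else 0)"
    using placed_open(3)[OF s m0 nf] p si by (auto simp: st'_def q_def r_def i_def t_def Let_def)
  have st': "num_used (sched st') = num_used (sched st) + q + 1"
    "fill st' = sg i" "mode st' = 1" "str st' = 0" "pos st' = pos st" "rem st' = (rem st)(0 := r - q * H)"
    using m0 p si by (auto simp: st'_def step_def Let_def t_def i_def r_def q_def)
  have K: "num_used (sched st) = (\<Sum>i<c. x i)" and xi: "x i * H = class_placed st i" "x i = 0 \<or> 0 < r"
    using cnt p m0 by (simp_all add: counts_def i_def t_def r_def Let_def)
  have x: "\<forall>i<c. x i \<le> bt i" "\<forall>i. sg i \<le> H \<longrightarrow> x i = 0" "Y \<subseteq> {i. i < c \<and> sg i \<le> H}"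
    using cnt by (simp_all add: counts_def)
  have qH: "q * H \<le> r - 1" using div_times_less_eq_dividend[of "r - 1" H] by (simp add: q_def)
  have xb: "x i + q + 1 \<le> bt i"
  proof (cases "x i + q = 0")
    case True
    then show ?thesis using bt_pos[OF ic] by simp
  next
    case False
    then have "r > 0" using xi(2) by (cases "q = 0") (auto simp: q_def split: if_splits)
    then have "(x i + q) * H < class_placed st i + r" using qH xi(1) by (simp add: algebra_simps)
    also have "\<dots> \<le> class_load I i * d"
      using class_placed_le[OF s p] by (simp add: i_def t_def r_def)
    also have "\<dots> \<le> bt i * H" using bt[OF ic] si by (simp add: sg_def)
    finally show ?thesis by simp
  qed
  define x' where "x' = x(i := x i + (q + 1))"
  have x': "\<forall>i<c. x' i \<le> bt i" "\<forall>i. sg i \<le> H \<longrightarrow> x' i = 0"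
    using x xb si by (auto simp: x'_def)
  have K': "num_used (sched st') = (\<Sum>i<c. x' i)"
    unfolding x'_def sum_x[OF ic] by (simp add: st' K)
  have Kle: "num_used (sched st') \<le> m" unfolding K' by (rule sum_le_machines[OF x'])
  have ch: "charge st' x' Y = charge st x Y + q * H + sg i * (q + 1)"
    unfolding x'_def charge_x[OF ic] charge_upd[OF pl tn] ..
  have ci: "class_placed st' i + sg i + H = x' i * H + fill st'"
    using sum_placed_upd(2)[OF pl tn, of i] p xi by (simp add: t_def i_def st' x'_def algebra_simps)
  \<comment> \<open>Each of the \<open>q\<close> full machines is charged load \<open>H\<close> and
    a setup longer than \<open>H\<close>. The setup on the last machine is its current
    \<open>fill\<close>.\<close>
  have L: "num_used (sched st') * (2 * H) + fill st' \<le> charge st' x' Y + 0 + 2 * H" if "pos st 1 < n"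
  proof -
    have "num_used (sched st) * (2 * H) \<le> charge st x Y" using cnt that m0 by (simp add: counts_def)
    moreover have "q * H \<le> q * sg i" using si by simp
    ultimately show ?thesis
      unfolding ch st' add_mult_distrib distrib_left using mult.commute[of "sg i" q] by linarith
  qed
  have "counts st' x' Y 0"
    unfolding counts_def
  proof (intro conjI impI)
    show "\<forall>t. pos st' 0 < t \<and> t < e \<and> cl t \<noteq> cl (pos st' 0) \<longrightarrow> x' (cl t) = 0"
      using cnt p by (auto simp: counts_def st' x'_def i_def t_def)
    show "\<forall>t. pos st' 1 < t \<and> t < n \<and> cl t \<noteq> cl (pos st' 1) \<longrightarrow> cl t \<notin> Y" if "pos st' 1 < n"
      using cnt that by (simp add: counts_def st')
    show "if mode st' = 0 then num_used (sched st') * (2 * H) \<le> charge st' x' Y \<and>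
         (num_used (sched st') = 0 \<or> num_used (sched st') * (2 * H) < charge st' x' Y + rem st' 1)
       else 1 \<le> num_used (sched st') \<and>
         num_used (sched st') * (2 * H) + fill st' \<le> charge st' x' Y + 0 + 2 * H" if "pos st' 1 < n"
      using L that by (simp add: st')
    show "let i = cl (pos st' 0) in if mode st' = 1 \<and> str st' = 0
       then 1 \<le> x' i \<and> class_placed st' i + sg i + H = x' i * H + fill st'
       else x' i * H = class_placed st' i \<and> (x' i = 0 \<or> 0 < rem st' 0)"
      using ci by (simp add: st'(3-6) i_def[symmetric] t_def[symmetric] x'_def Let_def)
  qed (use x' x Kle K' st' in auto)
  then show ?thesis unfolding st'_def by blast
qed

text \<open>By the strict inequality of the invariant, the machines in use account for less than
  \<open>m * (2 * H)\<close>, so another one is available. Its setup is not charged but recorded as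
  the new \<open>u\<close>.\<close>

lemma counts_open2:
  assumes s: "shape st" and cnt: "counts st x Y u" and m0: "mode st = 0"
    and p: "\<not> pos st 0 < e" "pos st 1 < n"
  shows "\<exists>x' Y' u'. counts (step st) x' Y' u'"
proof -
  define t where "t = pos st 1"
  define i where "i = cl t"
  define r where "r = rem st 1"
  define q where "q = (if wd i < r then (r - 1) div wd i else 0)"
  have tn: "t < n" "e \<le> t" using p s by (simp_all add: t_def shape_def)
  have ic: "i < c" using cl_less tn by (simp add: i_def)
  have si: "sg i \<le> H" "wd i = 3 * H - sg i" using cl_cheap[OF tn(2,1)] by (simp_all add: i_def wd_def)
  define st' where "st' = step st"
  have nf: "\<not> finished st" using p by (simp add: finished_def)
  have pl: "\<forall>t'<n. placed st' t' = placed st t' + (if t' = t then q * wd i else 0)"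
    using placed_open(3)[OF s m0 nf] p by (auto simp: st'_def q_def r_def i_def t_def Let_def)
  have st': "num_used (sched st') = num_used (sched st) + q + 1"
    "fill st' = sg i" "mode st' = 1" "str st' = 1" "pos st' = pos st" "rem st' = (rem st)(1 := r - q * wd i)"
    using m0 p by (auto simp: st'_def step_def Let_def t_def i_def r_def q_def)
  have L: "num_used (sched st) * (2 * H) \<le> charge st x Y"
     "num_used (sched st) = 0 \<or> num_used (sched st) * (2 * H) < charge st x Y + r"
    using cnt p m0 by (simp_all add: counts_def r_def)
  have x: "\<forall>i<c. x i \<le> bt i" "\<forall>i. sg i \<le> H \<longrightarrow> x i = 0" "Y \<subseteq> {i. i < c \<and> sg i \<le> H}"
    using cnt by (simp_all add: counts_def)
  have qw: "q * wd i \<le> r - 1" using div_times_less_eq_dividend[of "r - 1" "wd i"] by (simp add: q_def)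
  \<comment> \<open>A machine full of cheap load holds \<open>3 * H - sg i \<ge> 2 * H\<close> of
    it, so the setups of the \<open>q\<close> full machines need not be charged.\<close>
  have "q * (2 * H) \<le> q * wd i" using si by (intro mult_le_mono2) simp
  note qw2 = this
  have Kle: "num_used (sched st') \<le> m"
  proof (cases "num_used (sched st) + q = 0")
    case True
    then show ?thesis using inst by (simp add: st' valid_instance_def)
  next
    case False
    have "(num_used (sched st) + q) * (2 * H) < charge st x Y + r"
    proof (cases "q = 0")
      case False
      then have "r > 0" by (auto simp: q_def split: if_splits)
      then show ?thesis unfolding add_mult_distrib using L(1) qw qw2 by linarith
    qed (use L False in auto)
    also have "\<dots> \<le> m * (2 * H)" using charge_le[OF x s p(2)] by (simp add: r_def)
    finally show ?thesis by (simp add: st')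
  qed
  have ch: "charge st' x Y = charge st x Y + q * wd i"
    unfolding charge_upd[OF pl tn(1)] ..
  have "counts st' x Y (sg i)"
    unfolding counts_def
  proof (intro conjI impI)
    show "\<forall>t. pos st' 1 < t \<and> t < n \<and> cl t \<noteq> cl (pos st' 1) \<longrightarrow> cl t \<notin> Y" if "pos st' 1 < n"
      using cnt that by (simp add: counts_def st')
    show "if mode st' = 0 then num_used (sched st') * (2 * H) \<le> charge st' x Y \<and>
         (num_used (sched st') = 0 \<or> num_used (sched st') * (2 * H) < charge st' x Y + rem st' 1)
       else 1 \<le> num_used (sched st') \<and>
         num_used (sched st') * (2 * H) + fill st' \<le> charge st' x Y + sg i + 2 * H"
    proof -
      have "(num_used (sched st) + q + 1) * (2 * H) + sg i \<le> charge st x Y + q * wd i + sg i + 2 * H"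
        unfolding add_mult_distrib using L(1) qw2 by linarith
      then show ?thesis by (simp add: st' ch)
    qed
  qed (use x Kle si st' p in auto)
  then show ?thesis unfolding st'_def by blast
qed

lemma counts_place:
  assumes s: "shape st" and cnt: "counts st x Y u" and m1: "mode st = 1"
    and fits: "fill st + rem st (str st) \<le> sg (cl (pos st (str st))) + wd (cl (pos st (str st)))"
  shows "\<exists>x' Y' u'. counts (step st) x' Y' u'"
proof -
  define z where "z = str st"
  define t where "t = pos st z"
  define i where "i = cl t"
  define r where "r = rem st z"
  from s m1 obtain Q cfg where R: "sched st = Q @ [(cfg, 1)]" "t < fin z"
    by (auto simp: shape_def Let_def z_def t_def i_def)
  have zz: "z \<le> 1" using s by (simp add: shape_def z_def)
  have tz: "t < n" "z = (if t < e then 0 else 1)"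
    using stream_of[OF s zz] R(2) by (simp_all add: t_def)
  define st' where "st' = step st"
  have st': "num_used (sched st') = num_used (sched st)"
    "fill st' = fill st + r" "mode st' = (if t + 1 < fin z \<and> cl (t + 1) = i then 1 else 2)"
    "str st' = z" "pos st' = (pos st)(z := t + 1)"
    "rem st' = (if t + 1 < fin z then (rem st)(z := sz (t + 1)) else rem st)"
    using m1 fits by (simp_all add: st'_def step_def Let_def t_def i_def r_def z_def R)
  have pl: "\<forall>t'<n. placed st' t' = placed st t' + (if t' = t then r else 0)"
    using shape_place(3)[OF s m1 fits] by (simp add: st'_def t_def r_def z_def)
  have ch: "charge st' x Y = charge st x Y + r"
    unfolding charge_upd[OF pl tz(1)] ..
  have basic: "\<forall>i<c. x i \<le> bt i" "\<forall>i. sg i \<le> H \<longrightarrow> x i = 0" "Y \<subseteq> {i. i < c \<and> sg i \<le> H}"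
     "u \<le> H" "num_used (sched st') \<le> m"
    using cnt by (simp_all add: counts_def st')
  \<comment> \<open>Classes are runs of the order, so a class that is left does not occur again.
    This preserves the clauses about the classes still to come.\<close>
  have later: "cl t' \<noteq> i" if "t < t'" "t' < fin z" "cl (t + 1) \<noteq> i" for t'
  proof (cases "z = 0")
    case True
    then have "i \<le> cl (t + 1)" "cl (t + 1) \<le> cl t'"
      unfolding i_def using that by (intro cl_mono(1); simp add: fin_def)+
    with that show ?thesis by simp
  next
    case False
    then have "i \<le> cl (t + 1)" "cl (t + 1) \<le> cl t'"
      unfolding i_def using that tz by (intro cl_mono(2); simp add: fin_def split: if_splits)+
    with that show ?thesis by simp
  qed
  have "counts st' x Y u"
  proof (cases "z = 0")
    case True
    have p: "t < e" "pos st 0 = t" "str st = 0" "r = rem st 0"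
      using True R by (simp_all add: fin_def t_def z_def r_def)
    have old: "num_used (sched st) = (\<Sum>i<c. x i)" "1 \<le> x i" "class_placed st i + sg i + H = x i * H + fill st"
      "\<forall>t'. t < t' \<and> t' < e \<and> cl t' \<noteq> i \<longrightarrow> x (cl t') = 0"
      using cnt p m1 by (simp_all add: counts_def i_def Let_def)
    have pos': "pos st' 0 = t + 1" "pos st' 1 = pos st 1" using True by (simp_all add: st'(5))
    have E: "num_used (sched st') = (\<Sum>i<c. x i) \<and>
      (let i = cl (pos st' 0) in
       if mode st' = 1 \<and> str st' = 0
       then 1 \<le> x i \<and> class_placed st' i + sg i + H = x i * H + fill st'
       else x i * H = class_placed st' i \<and> (x i = 0 \<or> 0 < rem st' 0)) \<and>
      (\<forall>t. pos st' 0 < t \<and> t < e \<and> cl t \<noteq> cl (pos st' 0) \<longrightarrow> x (cl t) = 0)" if te: "pos st' 0 < e"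
    proof (cases "cl (t + 1) = i")
      case same: True
      have "class_placed st' i = class_placed st i + r"
        using sum_placed_upd(2)[OF pl tz(1), of i] p by (simp add: i_def)
      then show ?thesis
        using old same te True by (auto simp: pos' st'(1,2,3,4) fin_def Let_def)
    next
      case diff: False
      have x0: "x (cl (t + 1)) = 0" using old(4) te diff by (simp add: pos')
      \<comment> \<open>A new class starts here: all its jobs are at \<open>t + 1\<close> or later,
        and nothing of them is placed yet.\<close>
      have "class_placed st' (cl (t + 1)) = 0"
        unfolding class_placed_def
      proof (rule sum.neutral, rule ballI)
        fix t' assume t': "t' \<in> {t'. t' < e \<and> cl t' = cl (t + 1)}"
        have "t' \<ge> t + 1"
        proof (rule ccontr)
          assume "\<not> t' \<ge> t + 1"
          then have "cl t' \<le> i" "i \<le> cl (t + 1)"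
            unfolding i_def using te by (intro cl_mono(1); simp add: pos')+
          with t' diff show False by simp
        qed
        moreover have "rem st' 0 = sz (t + 1)" using True te by (simp add: st' pos' fin_def)
        ultimately show "placed st' t' = 0" using t' by (simp add: placed_def Let_def pos')
      qed
      moreover have "x (cl t') = 0" if "t + 1 < t'" "t' < e" for t'
        using old(4) later[of t'] that True diff by (simp add: fin_def)
      ultimately show ?thesis
        using old(1) x0 diff by (simp add: pos' st'(1,3) Let_def)
    qed
    have F: "num_used (sched st) * (2 * H) + fill st \<le> charge st x Y + u + 2 * H"
      "1 \<le> num_used (sched st)" "u = 0"
      "\<forall>t. pos st 1 < t \<and> t < n \<and> cl t \<noteq> cl (pos st 1) \<longrightarrow> cl t \<notin> Y" if "pos st 1 < n"
      using cnt that m1 p(3) by (simp_all add: counts_def)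
    show ?thesis
      unfolding counts_def
    proof (intro conjI impI)
      show "if mode st' = 0 then num_used (sched st') * (2 * H) \<le> charge st' x Y \<and>
         (num_used (sched st') = 0 \<or> num_used (sched st') * (2 * H) < charge st' x Y + rem st' 1)
       else 1 \<le> num_used (sched st') \<and>
         num_used (sched st') * (2 * H) + fill st' \<le> charge st' x Y + u + 2 * H" if "pos st' 1 < n"
        using F(1,2)[OF that[unfolded pos'(2)]] by (simp add: st'(1-3) ch)
    qed (use basic E F in \<open>simp_all add: pos' del: One_nat_def\<close>)
  next
    case False
    then have z1: "z = 1" using zz by simp
    have "e \<le> t" using tz(2) z1 by (cases "t < e") simp_all
    moreover have "pos st 1 = t" "str st = 1" "r = rem st 1" using z1 t_def z_def r_def by simp_all
    ultimately have p: "t < n" "pos st 1 = t" "str st = 1" "r = rem st 1" "e \<le> t"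
      using tz(1) by auto
    have pos': "pos st' 0 = pos st 0" "pos st' 1 = t + 1" using z1 by (simp_all add: st'(5))
    have cp: "class_placed st' l = class_placed st l" for l
      using sum_placed_upd(2)[OF pl tz(1), of l] p by simp
    have r0: "rem st' 0 = rem st 0" using z1 by (simp add: st'(6))
    have old: "\<forall>t'. t < t' \<and> t' < n \<and> cl t' \<noteq> i \<longrightarrow> cl t' \<notin> Y"
       "1 \<le> num_used (sched st)" "num_used (sched st) * (2 * H) + fill st \<le> charge st x Y + u + 2 * H"
      using cnt p m1 by (simp_all add: counts_def i_def)
    have Yl: "\<forall>t'. t + 1 < t' \<and> t' < n \<and> cl t' \<noteq> cl (t + 1) \<longrightarrow> cl t' \<notin> Y"
    proof (intro allI impI)
      fix t' assume t': "t + 1 < t' \<and> t' < n \<and> cl t' \<noteq> cl (t + 1)"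
      then have "cl t' \<noteq> i" using later[of t'] z1 by (cases "cl (t + 1) = i") (auto simp: fin_def)
      then show "cl t' \<notin> Y" using old(1) t' by simp
    qed
    have E: "num_used (sched st') = (\<Sum>i<c. x i) \<and>
      (let i = cl (pos st' 0) in
       if mode st' = 1 \<and> str st' = 0
       then 1 \<le> x i \<and> class_placed st' i + sg i + H = x i * H + fill st'
       else x i * H = class_placed st' i \<and> (x i = 0 \<or> 0 < rem st' 0)) \<and>
      (\<forall>t. pos st' 0 < t \<and> t < e \<and> cl t \<noteq> cl (pos st' 0) \<longrightarrow> x (cl t) = 0)" if "pos st' 0 < e"
      using cnt that p unfolding counts_def pos' cp r0 st'(1) st'(4) z1 by (simp add: Let_def)
    show ?thesis
      unfolding counts_def
    proof (intro conjI impI)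
      show "\<forall>t'. pos st' 1 < t' \<and> t' < n \<and> cl t' \<noteq> cl (pos st' 1) \<longrightarrow> cl t' \<notin> Y"
        using Yl unfolding pos' .
      show "u = 0 \<or> cl (pos st' 1) \<notin> Y" if "pos st' 1 < n" "mode st' = 2"
        using that old(1) by (simp add: pos' st'(3) z1 fin_def del: One_nat_def split: if_splits)
      show "if mode st' = 0 then num_used (sched st') * (2 * H) \<le> charge st' x Y \<and>
         (num_used (sched st') = 0 \<or> num_used (sched st') * (2 * H) < charge st' x Y + rem st' 1)
       else 1 \<le> num_used (sched st') \<and>
         num_used (sched st') * (2 * H) + fill st' \<le> charge st' x Y + u + 2 * H"
        using old(2,3) by (simp add: st'(1-3) ch)
    qed (use basic E st'(4) z1 in auto)
  qed
  then show ?thesis unfolding st'_def by blast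
qed

text \<open>A split job means that the machine is full. With an expensive class it ends at
  \<open>sg i + H > 2 * H\<close>, all of it charged. With a cheap class it ends at
  \<open>3 * H\<close>, of which at most \<open>u \<le> H\<close> is an uncharged setup.\<close>

lemma counts_split:
  assumes s: "shape st" and cnt: "counts st x Y u" and m1: "mode st = 1"
    and fits: "\<not> fill st + rem st (str st) \<le> sg (cl (pos st (str st))) + wd (cl (pos st (str st)))"
  shows "\<exists>x' Y' u'. counts (step st) x' Y' u'"
proof -
  define z where "z = str st"
  define t where "t = pos st z"
  define i where "i = cl t"
  define r where "r = rem st z"
  define a where "a = sg i + wd i - fill st"
  from s m1 obtain Q cfg where R: "sched st = Q @ [(cfg, 1)]" "t < fin z" "fill st \<le> sg i + wd i"
    by (auto simp: shape_def Let_def z_def t_def i_def)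
  have zz: "z \<le> 1" using s by (simp add: shape_def z_def)
  have tz: "t < n" "z = (if t < e then 0 else 1)"
    using stream_of[OF s zz] R(2) by (simp_all add: t_def)
  \<comment> \<open>The rest of the job stays positive; the strict inequality for cheap load and the
    clause on \<open>rem\<close> for expensive classes rely on this.\<close>
  have a: "a < r" using fits R(3) by (auto simp: a_def r_def i_def t_def z_def)
  define st' where "st' = step st"
  have st': "num_used (sched st') = num_used (sched st)"
    "mode st' = 0" "str st' = z" "pos st' = pos st" "rem st' = (rem st)(z := r - a)"
    using m1 fits by (simp_all add: st'_def step_def Let_def t_def i_def r_def z_def R a_def)
  have pl: "\<forall>t'<n. placed st' t' = placed st t' + (if t' = t then a else 0)"
    using shape_split(3)[OF s m1 fits] by (simp add: st'_def t_def a_def i_def z_def)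
  have ch: "charge st' x Y = charge st x Y + a"
    unfolding charge_upd[OF pl tz(1)] ..
  have basic: "\<forall>i<c. x i \<le> bt i" "\<forall>i. sg i \<le> H \<longrightarrow> x i = 0" "Y \<subseteq> {i. i < c \<and> sg i \<le> H}"
     "u \<le> H" "num_used (sched st') \<le> m"
    using cnt by (simp_all add: counts_def st')
  have "counts st' x Y u"
  proof (cases "z = 0")
    case True
    have p: "t < e" "pos st 0 = t" "str st = 0" "r = rem st 0"
      using True R by (simp_all add: fin_def t_def z_def r_def)
    have si: "H < sg i" "wd i = H" using cl_expensive p by (simp_all add: i_def t_def wd_def)
    have old: "num_used (sched st) = (\<Sum>i<c. x i)" "class_placed st i + sg i + H = x i * H + fill st"
      "\<forall>t'. t < t' \<and> t' < e \<and> cl t' \<noteq> i \<longrightarrow> x (cl t') = 0"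
      using cnt p m1 by (simp_all add: counts_def i_def Let_def)
    have "class_placed st' i = class_placed st i + a"
      using sum_placed_upd(2)[OF pl tz(1), of i] p by (simp add: i_def)
    then have cp: "x i * H = class_placed st' i"
      using old(2) si R(3) by (simp add: a_def)
    have "num_used (sched st) * (2 * H) < charge st x Y + a" if "pos st 1 < n"
    proof -
      have "num_used (sched st) * (2 * H) + fill st \<le> charge st x Y + u + 2 * H"
        using cnt that m1 by (simp add: counts_def)
      moreover have "u = 0" using cnt that m1 p(3) by (simp add: counts_def)
      ultimately show ?thesis using si R(3) unfolding a_def by linarith
    qed
    note L = this
    show ?thesis
      unfolding counts_def
    proof (intro conjI impI)
      show "let i = cl (pos st' 0) in if mode st' = 1 \<and> str st' = 0
         then 1 \<le> x i \<and> class_placed st' i + sg i + H = x i * H + fill st'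
         else x i * H = class_placed st' i \<and> (x i = 0 \<or> 0 < rem st' 0)"
        using cp a by (simp add: st' p True i_def[symmetric])
      show "\<forall>t'. pos st' 0 < t' \<and> t' < e \<and> cl t' \<noteq> cl (pos st' 0) \<longrightarrow> x (cl t') = 0"
        using old(3) by (simp add: st' p i_def)
      show "if mode st' = 0 then num_used (sched st') * (2 * H) \<le> charge st' x Y \<and>
         (num_used (sched st') = 0 \<or> num_used (sched st') * (2 * H) < charge st' x Y + rem st' 1)
       else 1 \<le> num_used (sched st') \<and>
         num_used (sched st') * (2 * H) + fill st' \<le> charge st' x Y + u + 2 * H" if "pos st' 1 < n"
        using L that by (simp add: st' ch)
    qed (use basic cnt old(1) in \<open>simp_all add: counts_def st'\<close>)
  next
    case False
    then have z1: "z = 1" using zz by simp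
    have "e \<le> t" using tz(2) z1 by (cases "t < e") simp_all
    moreover have "pos st 1 = t" "str st = 1" "r = rem st 1" using z1 t_def z_def r_def by simp_all
    ultimately have p: "t < n" "pos st 1 = t" "str st = 1" "r = rem st 1" "e \<le> t"
      using tz(1) by auto
    have si: "sg i \<le> H" "wd i = 3 * H - sg i" using cl_cheap[of t] p by (simp_all add: i_def wd_def)
    have cp: "class_placed st' l = class_placed st l" for l
      using sum_placed_upd(2)[OF pl tz(1), of l] p by simp
    have old: "num_used (sched st) * (2 * H) + fill st \<le> charge st x Y + u + 2 * H"
      using cnt p m1 by (simp add: counts_def)
    have "num_used (sched st) * (2 * H) \<le> charge st x Y + a"
      using old si R(3) basic(4) unfolding a_def by linarith
    then show ?thesis
      unfolding counts_def
      using basic cnt p a z1 by (auto simp: counts_def st' ch cp Let_def)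
  qed
  then show ?thesis unfolding st'_def by blast
qed

lemma charge_cong: "(\<And>t. placed st' t = placed st t) \<Longrightarrow> charge st' x Y = charge st x Y"
  by (simp add: charge_def)

lemma class_placed_cong: "(\<And>t. placed st' t = placed st t) \<Longrightarrow> class_placed st' i = class_placed st i"
  by (simp add: class_placed_def)

text \<open>If the class is in \<open>Y\<close>, its first setup has been paid for, and the new one
  becomes the uncharged \<open>u\<close>. The last clause of the invariant ensures
  \<open>u = 0\<close> before, so a machine never has two uncharged setups.\<close>

lemma counts_setup:
  assumes s: "shape st" and cnt: "counts st x Y u" and m2: "mode st = 2"
    and fits: "pos st 1 < n \<and> fill st + sg (cl (pos st 1)) \<le> 3 * H"
  shows "\<exists>x' Y' u'. counts (step st) x' Y' u'"
proof -
  define i where "i = cl (pos st 1)"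
  from s m2 obtain Q cfg where R: "sched st = Q @ [(cfg, 1)]"
    by (auto simp: shape_def Let_def)
  have i: "sg i \<le> H" "i < c" using fits s cl_cheap cl_less by (auto simp: i_def shape_def)
  define st' where "st' = step st"
  have st': "num_used (sched st') = num_used (sched st)" "fill st' = fill st + sg i"
    "mode st' = 1" "str st' = 1" "pos st' = pos st" "rem st' = rem st"
    using m2 fits by (simp_all add: st'_def step_def Let_def i_def R)
  have pl: "placed st' t = placed st t" for t using shape_setup(3)[OF s m2 fits] by (simp add: st'_def)
  note cp = class_placed_cong[OF pl] and ch = charge_cong[OF pl]
  have Ysub: "Y \<subseteq> {i. i < c \<and> sg i \<le> H}" using cnt by (simp add: counts_def)
  show ?thesis
  proof (cases "i \<in> Y")
    case True
    then have "u = 0" using cnt m2 fits by (simp add: counts_def i_def)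
    then have "counts st' x Y (sg i)"
      using cnt m2 fits i unfolding counts_def by (auto simp: st' ch cp Let_def)
    then show ?thesis unfolding st'_def by blast
  next
    case False
    then have "counts st' x (insert i Y) u"
      using cnt m2 fits i False unfolding counts_def
      by (auto simp: st' ch cp charge_Y[OF Ysub False] Let_def i_def[symmetric] simp del: One_nat_def)
    then show ?thesis unfolding st'_def by blast
  qed
qed

text \<open>A setup that does not fit is charged to the machine being closed, unless it was charged
  before. If it is charged now, \<open>fill + sg i > 3 * H\<close> outweighs the uncharged
  \<open>u \<le> H\<close>. Otherwise \<open>u = 0\<close> and \<open>fill > 2 * H\<close> by
  itself.\<close>

lemma counts_close:
  assumes s: "shape st" and cnt: "counts st x Y u" and m2: "mode st = 2"
    and fits: "\<not> (pos st 1 < n \<and> fill st + sg (cl (pos st 1)) \<le> 3 * H)"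
  shows "\<exists>x' Y' u'. counts (step st) x' Y' u'"
proof -
  define i where "i = cl (pos st 1)"
  have st': "step st = st\<lparr>mode := 0, str := 1\<rparr>" using m2 fits by (auto simp: step_def Let_def)
  have pl: "placed (st\<lparr>mode := 0, str := 1\<rparr>) t = placed st t" for t by (simp add: placed_def)
  note cp = class_placed_cong[OF pl] and ch = charge_cong[OF pl]
  have Ysub: "Y \<subseteq> {i. i < c \<and> sg i \<le> H}" using cnt by (simp add: counts_def)
  show ?thesis
  proof (cases "pos st 1 < n")
    case True
    then have i: "sg i \<le> H" "i < c" using s cl_cheap cl_less by (auto simp: i_def shape_def)
    have f: "fill st + sg i > 3 * H" using fits True by (simp add: i_def)
    have old: "num_used (sched st) * (2 * H) + fill st \<le> charge st x Y + u + 2 * H" "u \<le> H"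
      using cnt True m2 by (simp_all add: counts_def)
    show ?thesis
    proof (cases "i \<in> Y")
      case iY: True
      then have "u = 0" using cnt m2 True by (simp add: counts_def i_def)
      with old i f have "num_used (sched st) * (2 * H) < charge st x Y" by linarith
      then have "counts (step st) x Y u"
        using cnt m2 unfolding counts_def st' by (auto simp: ch cp Let_def simp del: One_nat_def)
      then show ?thesis by blast
    next
      case False
      have "num_used (sched st) * (2 * H) < charge st x Y + sg i" using old f by linarith
      then have "counts (step st) x (insert i Y) u"
        using cnt m2 i unfolding counts_def st'
        by (auto simp: ch cp charge_Y[OF Ysub False] Let_def i_def[symmetric] simp del: One_nat_def)
      then show ?thesis by blast
    qed
  next
    case False
    then have "counts (step st) x Y u"
      using cnt m2 unfolding counts_def st' by (auto simp: cp Let_def simp del: One_nat_def)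
    then show ?thesis by blast
  qed
qed

section \<open>Both invariants together\<close>

definition good :: "placement_state \<Rightarrow> bool" where
  "good st \<longleftrightarrow> shape st \<and> (\<exists>x Y u. counts st x Y u)"

lemma good_step:
  assumes "good st" "\<not> finished st"
  shows "good (step st)" "potential (step st) < potential st"
proof -
  from assms(1) obtain x Y u where s: "shape st" and cnt: "counts st x Y u" by (auto simp: good_def)
  consider "mode st = 0" "pos st 0 < e" | "mode st = 0" "\<not> pos st 0 < e" "pos st 1 < n"
    | "mode st = 1" | "mode st = 2"
    using assms s by (fastforce simp: finished_def shape_def)
  then have "good (step st) \<and> potential (step st) < potential st"
  proof cases
    case 1
    then show ?thesis using placed_open[OF s] counts_open1[OF s cnt] assms(2) by (simp add: good_def)
  next
    case 2
    then show ?thesis using placed_open[OF s] counts_open2[OF s cnt] assms(2) by (simp add: good_def)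
  next
    case 3
    then show ?thesis
      using shape_place[OF s] shape_split[OF s] counts_place[OF s cnt] counts_split[OF s cnt]
      unfolding good_def by blast
  next
    case 4
    then show ?thesis
      using shape_setup[OF s] shape_close[OF s] counts_setup[OF s cnt] counts_close[OF s cnt]
      unfolding good_def by blast
  qed
  then show "good (step st)" "potential (step st) < potential st" by auto
qed

lemma good_init:
  assumes "sched st = []" "mode st = 0" "str st \<le> 1" "pos st 0 = 0" "pos st 1 = e"
    "0 < e \<Longrightarrow> rem st 0 = sz 0" "e < n \<Longrightarrow> rem st 1 = sz e"
  shows "good st" "potential st \<le> 4 * n + 1"
proof -
  have pl: "placed st t = 0" if "t < n" for t using assms that by (auto simp: placed_def Let_def)
  then have "shape st" using assms e by (auto simp: shape_def ok_sched_def)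
  moreover have "class_placed st i = 0" for i
    unfolding class_placed_def using e by (intro sum.neutral) (auto simp: pl)
  then have "counts st (\<lambda>_. 0) {} 0" using assms by (simp add: counts_def)
  ultimately show "good st" unfolding good_def by blast
  show "potential st \<le> 4 * n + 1" using assms e by (simp add: potential_def)
qed

lemma good_bounds:
  assumes "good st"
  shows "num_used (sched st) \<le> m" "mode st \<noteq> 0 \<Longrightarrow> fill st \<le> 3 * H"
  using assms by (auto simp: good_def counts_def shape_def)

section \<open>From integral to real times\<close>

definition real_sched :: "nat schedule \<Rightarrow> real schedule" where
  "real_sched R = map (\<lambda>(cfg, mult). (map (map_item (\<lambda>b. real b / real d)) cfg, mult)) R"

lemma item_class_map_item [simp]: "item_class I (map_item f it) = item_class I it"
  by (cases it) auto

lemma is_piece_map_item [simp]: "is_piece (map_item f it) = is_piece it"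
  by (cases it) auto

lemma item_start_map_item [simp]: "item_start (map_item f it) = f (item_start it)"
  by (cases it) auto

lemma item_end_map_item: "item_end I (map_item (\<lambda>b. real b / real d) it) = real (nat_end it) / real d"
  using d by (cases it) (auto simp: item_end_def nat_end_def sg_def field_simps)

lemma valid_config_real:
  assumes "ok_config cfg"
  shows "valid_config I (map (map_item (\<lambda>b. real b / real d)) cfg)"
proof -
  let ?f = "map_item (\<lambda>b. real b / real d)"
  have "valid_item I (?f it)" if "ok_item it" for it
    using that by (cases it) auto
  moreover have "sorted_wrt (\<lambda>x y. item_end I (?f x) \<le> item_start (?f y)) cfg"
  proof (rule sorted_wrt_mono_rel)
    show "sorted_wrt (\<lambda>x y. nat_end x \<le> item_start y) cfg" using assms by (simp add: ok_config_def)
    show "item_end I (?f x) \<le> item_start (?f y)" if "nat_end x \<le> item_start y" for x y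
      using that by (simp add: item_end_map_item divide_right_mono)
  qed
  ultimately show ?thesis using assms by (auto simp: valid_config_def ok_config_def sorted_wrt_map)
qed

lemma processed_real: "processed (real_sched R) j = real (amount j R) / real d"
proof -
  have "(\<Sum>it\<leftarrow>cfg. piece_amount j (map_item (\<lambda>b. real b / real d) it)) = real (\<Sum>it\<leftarrow>cfg. amount_in j it) / real d"
    for cfg
  proof (induction cfg)
    case (Cons it cfg)
    then show ?case by (cases it) (auto simp: add_divide_distrib)
  qed auto
  then show ?thesis
    by (induction R) (auto simp: processed_def real_sched_def add_divide_distrib comp_def)
qed

lemma finished_feasible:
  assumes "good st" "finished st"
  shows "feasible I (real_sched (sched st))"
    and "makespan I (real_sched (sched st)) \<le> 3 * (real H / real d)"
proof -
  have s: "shape st" using assms(1) by (simp add: good_def)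
  have ok: "ok_sched (sched st)" using s by (simp add: shape_def)
  have fin: "pos st 0 = e" "pos st 1 = n" using s assms(2) by (auto simp: shape_def finished_def)
  have "(\<Sum>(cfg, mult)\<leftarrow>real_sched R. mult) = num_used R" for R
    by (induction R) (auto simp: real_sched_def num_used_def)
  then have used: "(\<Sum>(cfg, mult)\<leftarrow>real_sched (sched st). mult) \<le> m"
    using good_bounds(1)[OF assms(1)] by simp
  have jobs: "processed (real_sched (sched st)) j = real (proc_time I j) \<and>
        (\<exists>(cfg, mult)\<in>set (real_sched (sched st)). \<exists>b x. Piece j b x \<in> set cfg)" if "j < n" for j
  proof -
    have "j \<in> ord ` {..<n}" using that ord by (simp add: bij_betw_def)
    then obtain t where t: "t < n" "j = ord t" by auto
    have "amount j (sched st) = sz t" "has_piece (sched st) j"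
      using s t fin by (auto simp: shape_def placed_def)
    moreover from this obtain cfg mult b x where "(cfg, mult) \<in> set (sched st)" "Piece j b x \<in> set cfg"
      by (auto simp: has_piece_def)
    then have "(map (map_item (\<lambda>b. real b / real d)) cfg, mult) \<in> set (real_sched (sched st))"
      "Piece j (real b / real d) (real x / real d) \<in> set (map (map_item (\<lambda>b. real b / real d)) cfg)"
      by (force simp: real_sched_def)+
    then have "\<exists>(cfg, mult)\<in>set (real_sched (sched st)). \<exists>b x. Piece j b x \<in> set cfg" by blast
    moreover have "processed (real_sched (sched st)) j = real (proc_time I j)"
      using d t \<open>amount j (sched st) = sz t\<close> by (simp add: processed_real sz_def)
    ultimately show ?thesis by blast
  qed
  have "valid_config I cfg \<and> mult > 0" if "(cfg, mult) \<in> set (real_sched (sched st))" for cfg mult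
    using that ok valid_config_real by (fastforce simp: real_sched_def ok_sched_def)
  then show "feasible I (real_sched (sched st))"
    using used jobs by (auto simp: feasible_def)
  show "makespan I (real_sched (sched st)) \<le> 3 * (real H / real d)"
  proof (rule makespan_le)
    fix cfg mult it assume "(cfg, mult) \<in> set (real_sched (sched st))" "it \<in> set cfg"
    then obtain cfg' it' where *: "(cfg', mult) \<in> set (sched st)" "it' \<in> set cfg'"
      "it = map_item (\<lambda>b. real b / real d) it'" by (auto simp: real_sched_def)
    then have "nat_end it' \<le> 3 * H" using ok by (auto simp: ok_sched_def)
    then have "real (nat_end it') \<le> 3 * real H" by linarith
    then show "item_end I it \<le> 3 * (real H / real d)"
      using d by (simp add: * item_end_map_item divide_right_mono)
  qed simp
qed

end

section \<open>The smallest acceptable makespan\<close>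

definition total_load :: "inst \<Rightarrow> nat" where
  "total_load I = (\<Sum>i<num_classes I. setup_time I i + class_load I i)"

definition max_setup :: "inst \<Rightarrow> nat" where
  "max_setup I = Max (insert 0 (setup_time I ` {..<num_classes I}))"

text \<open>Divided by \<open>m\<close>, this is the larger of two simple lower bounds: the longest
  setup, and the average load with one setup per class.\<close>

definition base_load :: "inst \<Rightarrow> nat" where
  "base_load I = max (machines I * max_setup I) (total_load I)"

lemma setup_le_max: "i < num_classes I \<Longrightarrow> setup_time I i \<le> max_setup I"
  unfolding max_setup_def by (rule Max_ge) auto

lemma max_setup_le: "(\<And>i. i < num_classes I \<Longrightarrow> real (setup_time I i) \<le> T) \<Longrightarrow> 0 \<le> T \<Longrightarrow> real (max_setup I) \<le> T"
proof -
  assume *: "\<And>i. i < num_classes I \<Longrightarrow> real (setup_time I i) \<le> T" "0 \<le> T"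
  have "max_setup I \<in> insert 0 (setup_time I ` {..<num_classes I})"
    unfolding max_setup_def by (rule Max_in) auto
  with * show ?thesis by auto
qed

lemma batches_ge1: "batches s P T \<ge> 1"
  by (simp add: batches_def)

lemma num_classes_pos: "valid_instance I \<Longrightarrow> num_classes I > 0"
proof (rule ccontr)
  assume "valid_instance I" "\<not> num_classes I > 0"
  then have "job_class I ` {0..<num_jobs I} = {}" "num_jobs I \<ge> 1" by (auto simp: valid_instance_def)
  then show False by auto
qed

lemma machines_pos: "valid_instance I \<Longrightarrow> machines I > 0"
  by (simp add: valid_instance_def)

lemma setup_le_base:
  assumes "valid_instance I" "i < num_classes I"
  shows "real (setup_time I i) \<le> real (base_load I) / real (machines I)"
proof -
  have "machines I * setup_time I i \<le> base_load I"
    unfolding base_load_def by (intro max.coboundedI1 mult_le_mono2 setup_le_max assms)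
  then have "real (machines I * setup_time I i) \<le> real (base_load I)" by (rule of_nat_mono)
  then show ?thesis using machines_pos[OF assms(1)] by (simp add: field_simps)
qed

lemma class_load_le_base: "i < num_classes I \<Longrightarrow> class_load I i \<le> base_load I"
proof -
  assume i: "i < num_classes I"
  have "setup_time I i + class_load I i \<le> total_load I"
    unfolding total_load_def by (rule member_le_sum[of i _ "\<lambda>i. setup_time I i + class_load I i"]) (use i in auto)
  then show ?thesis by (simp add: base_load_def)
qed

lemma acceptable_lower:
  assumes "valid_instance I" "acceptable I T"
  shows "real (base_load I) / real (machines I) \<le> T"
proof -
  let ?m = "real (machines I)"
  have m: "?m > 0" using machines_pos[OF assms(1)] by simp
  have s: "real (setup_time I i) \<le> T" if "i < num_classes I" for i
    using assms(2) that by (simp add: acceptable_def)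
  from s[OF num_classes_pos[OF assms(1)]] have "0 \<le> T" by linarith
  then have 1: "?m * real (max_setup I) \<le> ?m * T"
    using max_setup_le[of I T] s m by (intro mult_left_mono) auto
  have "total_load I \<le> (\<Sum>i<num_classes I. class_load I i + batches (setup_time I i) (class_load I i) T * setup_time I i)"
    unfolding total_load_def
  proof (rule sum_mono)
    fix i
    show "setup_time I i + class_load I i \<le>
        class_load I i + batches (setup_time I i) (class_load I i) T * setup_time I i"
      using mult_le_mono1[OF batches_ge1, of "setup_time I i" "setup_time I i" "class_load I i" T] by simp
  qed
  then have "real (total_load I) \<le>
     real (\<Sum>i<num_classes I. class_load I i + batches (setup_time I i) (class_load I i) T * setup_time I i)"
    by (rule of_nat_mono)
  then have "real (total_load I) \<le> ?m * T" using assms(2) unfolding acceptable_def by linarith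
  with 1 have "real (base_load I) \<le> ?m * T" by (simp add: base_load_def max_def)
  then show ?thesis using m by (simp add: field_simps)
qed

text \<open>At twice the lower bound no setup exceeds half of it, so no class is expensive, and only
  the total load with one setup per class remains to be bounded.\<close>

lemma acceptable_upper:
  assumes "valid_instance I"
  shows "acceptable I (2 * real (base_load I) / real (machines I))"
proof -
  let ?T = "2 * real (base_load I) / real (machines I)"
  have m: "real (machines I) > 0" using machines_pos[OF assms(1)] by simp
  have s: "2 * real (setup_time I i) \<le> ?T" if "i < num_classes I" for i
    using setup_le_base[OF assms that] by simp
  have s': "real (setup_time I i) \<le> ?T" if "i < num_classes I" for i
    using s[OF that] of_nat_0_le_iff[of "setup_time I i", where ?'a = real] by linarith
  have "exp_machines (setup_time I i) (class_load I i) ?T = 0"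
    "batches (setup_time I i) (class_load I i) ?T = 1" if "i < num_classes I" for i
    using s[OF that] by (auto simp: exp_machines_def batches_def)
  then have 1: "(\<Sum>i<num_classes I. exp_machines (setup_time I i) (class_load I i) ?T) = 0"
    "(\<Sum>i<num_classes I. class_load I i + batches (setup_time I i) (class_load I i) ?T * setup_time I i) = total_load I"
    by (auto simp: total_load_def intro!: sum.cong)
  have "real (total_load I) \<le> 2 * real (base_load I)" by (simp add: base_load_def)
  then have "real (total_load I) \<le> real (machines I) * ?T" using m by simp
  then show ?thesis unfolding acceptable_def 1 using s' by simp
qed

section \<open>The number of batches and its jumps\<close>

lemma batches_rat:
  assumes "xd > 0"
  shows "batches s P (real xn / real xd) =
    (if xn < 2 * s * xd then max 1 ((2 * P * xd + xn - 1) div xn) else 1)"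
proof -
  have iff: "2 * real s > real xn / real xd \<longleftrightarrow> xn < 2 * s * xd"
  proof -
    have "2 * real s > real xn / real xd \<longleftrightarrow> real xn < real (2 * s * xd)"
      using assms by (simp add: field_simps)
    then show ?thesis by (simp only: of_nat_less_iff)
  qed
  \<comment> \<open>Rounding up is rounding down after adding \<open>xn - 1\<close>; this is the
    form that the program evaluates. For \<open>xn = 0\<close> both quotients are 0 by
    convention.\<close>
  have "nat \<lceil>2 * real P / (real xn / real xd)\<rceil> = (2 * P * xd + xn - 1) div xn"
  proof (cases "xn = 0")
    case False
    have "2 * real P / (real xn / real xd) = real_of_int (int (2 * P * xd)) / real_of_int (int xn)" by simp
    then have "nat \<lceil>2 * real P / (real xn / real xd)\<rceil> = nat (- (- int (2 * P * xd) div int xn))"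
      by (simp only: ceiling_divide_eq_div)
    also have "\<dots> = (2 * P * xd + xn - 1) div xn"
    proof -
      define q where "q = (2 * P * xd + xn - 1) div xn"
      have 1: "q * xn \<le> 2 * P * xd + xn - 1" by (simp add: q_def)
      have 2: "2 * P * xd + xn - 1 < (q + 1) * xn"
        unfolding q_def using False dividend_less_div_times[of xn "2 * P * xd + xn - 1"] by simp
      have "- int (2 * P * xd) div int xn = - int q"
      proof (rule int_div_pos_eq)
        define r where "r = int q * int xn - int (2 * P * xd)"
        show "- int (2 * P * xd) = int xn * - int q + r" by (simp add: r_def algebra_simps)
        have "int (q * xn) \<le> int (2 * P * xd) + int xn - 1" using 1 False by linarith
        then show "r < int xn" by (simp add: r_def)
        have "int (2 * P * xd) + int xn - 1 < int ((q + 1) * xn)" using 2 False by linarith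
        then show "0 \<le> r" by (simp add: r_def algebra_simps)
      qed
      then show ?thesis by (simp add: q_def)
    qed
    finally show ?thesis .
  qed auto
  with iff show ?thesis by (simp add: batches_def)
qed

lemma exp_machines_rat:
  assumes "xd > 0"
  shows "exp_machines s P (real xn / real xd) =
    (if xn < 2 * s * xd then max 1 ((2 * P * xd + xn - 1) div xn) else 0)"
proof -
  have "2 * real s > real xn / real xd \<longleftrightarrow> real xn < real (2 * s * xd)"
    using assms by (simp add: field_simps)
  then have "2 * real s > real xn / real xd \<longleftrightarrow> xn < 2 * s * xd" by (simp only: of_nat_less_iff)
  then show ?thesis using batches_rat[OF assms] by (simp add: exp_machines_def)
qed

text \<open>The batches drop to \<open>b - 1\<close> at \<open>2 * P / (b - 1)\<close>, and the
  class becomes cheap at \<open>2 * s\<close>. The test \<open>P < s * (b - 1)\<close> picks the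
  smaller of these two values without a division.\<close>

definition next_jump :: "nat \<Rightarrow> nat \<Rightarrow> real \<Rightarrow> real" where
  "next_jump s P T = (let b = batches s P T in
     if 1 < b \<and> P < s * (b - 1) then 2 * real P / real (b - 1) else 2 * real s)"

lemma batches_gt1:
  assumes "1 < batches s P T" "0 < T"
  shows "real (batches s P T - 1) < 2 * real P / T" "2 * real P / T \<le> real (batches s P T)"
proof -
  define k where "k = nat \<lceil>2 * real P / T\<rceil>"
  have "batches s P T = (if 2 * real s > T then max 1 k else 1)" by (simp add: batches_def k_def)
  with assms have k: "batches s P T = k" "1 < k" by (auto simp: max_def split: if_splits)
  then have "\<lceil>2 * real P / T\<rceil> > 1" unfolding k_def by linarith
  then have "real (batches s P T) = of_int \<lceil>2 * real P / T\<rceil>" by (simp add: k k_def)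
  then show "real (batches s P T - 1) < 2 * real P / T" "2 * real P / T \<le> real (batches s P T)"
    using assms(1) by linarith+
qed

text \<open>As long as \<open>T' * (b - 1) < 2 * P\<close>, the rounded quotient is at least
  \<open>b\<close>. If turning cheap is the next jump, then \<open>s * (b - 1) \<le> P\<close> and
  \<open>T' < 2 * s\<close> give the same inequality.\<close>

lemma batches_const:
  assumes T: "2 * real s > T" "0 < T" and T': "T \<le> T'" "T' < next_jump s P T"
  shows "batches s P T' = batches s P T" "2 * real s > T'"
proof -
  define b where "b = batches s P T"
  have b1: "b \<ge> 1" unfolding b_def by (rule batches_ge1)
  show s: "2 * real s > T'"
  proof (cases "1 < b \<and> P < s * (b - 1)")
    case True
    then have "real P < real (s * (b - 1))" by (simp only: of_nat_less_iff)
    then have "2 * real P / real (b - 1) \<le> 2 * real s" using True by (simp add: field_simps)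
    then show ?thesis using T' True by (simp add: next_jump_def b_def[symmetric])
  qed (use T' in \<open>auto simp: next_jump_def b_def[symmetric]\<close>)
  have le: "batches s P T' \<le> b"
  proof -
    have "nat \<lceil>2 * real P / T'\<rceil> \<le> nat \<lceil>2 * real P / T\<rceil>"
      using T T' by (intro nat_mono ceiling_mono divide_left_mono) auto
    then show ?thesis using s T by (auto simp: batches_def b_def)
  qed
  moreover have "b \<le> batches s P T'"
  proof (cases "1 < b")
    case True
    have "T' * real (b - 1) < 2 * real P"
    proof (cases "P < s * (b - 1)")
      case P: True
      with T' True have "T' < 2 * real P / real (b - 1)" by (simp add: next_jump_def b_def[symmetric])
      then show ?thesis using True by (simp add: field_simps)
    next
      case False
      then have "real (s * (b - 1)) \<le> real P" by (simp only: of_nat_le_iff not_less)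
      moreover have "T' * real (b - 1) < 2 * real s * real (b - 1)"
        using s True by (intro mult_strict_right_mono) auto
      ultimately show ?thesis unfolding of_nat_mult by linarith
    qed
    then have "real (b - 1) < 2 * real P / T'" using T T' by (simp add: field_simps)
    then have "int (b - 1) < \<lceil>2 * real P / T'\<rceil>" by (simp add: less_ceiling_iff)
    then show ?thesis using s by (auto simp: batches_def)
  qed (use b1 batches_ge1[of s P T'] in simp)
  ultimately show "batches s P T' = batches s P T" by (simp add: b_def)
qed

lemma next_jump_gt:
  assumes "2 * real s > T" "0 < T"
  shows "T < next_jump s P T"
proof (cases "1 < batches s P T")
  case True
  have "T < 2 * real P / real (batches s P T - 1)"
    using batches_gt1(1)[OF True assms(2)] assms(2) True by (simp add: field_simps)
  then show ?thesis using assms by (auto simp: next_jump_def Let_def)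
qed (use assms in \<open>auto simp: next_jump_def\<close>)

text \<open>At the jump the quotient is exactly \<open>b - 1\<close>, so every jump that does not
  make the class cheap lowers the count. The number of sweep steps is bounded by this.\<close>

lemma batches_next_jump:
  assumes T: "2 * real s > T" "0 < T" and s: "2 * real s > next_jump s P T"
  shows "batches s P (next_jump s P T) < batches s P T"
proof -
  define b where "b = batches s P T"
  from s have b: "1 < b" "P < s * (b - 1)" "next_jump s P T = 2 * real P / real (b - 1)"
    by (auto simp: next_jump_def b_def[symmetric] Let_def split: if_splits)
  have P: "P > 0"
  proof (rule ccontr)
    assume "\<not> P > 0"
    then have "batches s P T = 1" by (simp add: batches_def)
    with b show False by (simp add: b_def)
  qed
  have "2 * real P / next_jump s P T = real (b - 1)" using P b(1) by (simp add: b(3))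
  then have "nat \<lceil>2 * real P / next_jump s P T\<rceil> = b - 1" by simp
  then have "batches s P (next_jump s P T) = max 1 (b - 1)"
    unfolding batches_def using s by simp
  with b(1) show ?thesis by (simp add: b_def[symmetric])
qed

text \<open>\<open>P \<le> A\<close> and \<open>T \<ge> A / m\<close> give
  \<open>2 * P / T \<le> 2 * m\<close>. This keeps the sums of the program within the word
  size.\<close>

lemma batches_bound:
  assumes "valid_instance I" "i < num_classes I" "real (base_load I) / real (machines I) \<le> T"
  shows "batches (setup_time I i) (class_load I i) T \<le> 2 * machines I"
proof (cases "2 * real (setup_time I i) > T \<and> class_load I i > 0")
  case True
  let ?m = "real (machines I)"
  have m: "?m > 0" using machines_pos[OF assms(1)] by simp
  have P: "real (class_load I i) \<le> real (base_load I)" using class_load_le_base[OF assms(2)] by simp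
  with True have "0 < real (base_load I) / ?m" using m by simp
  then have T: "0 < T" using assms(3) by linarith
  have "2 * real (class_load I i) \<le> 2 * ?m * T"
    using P assms(3) m by (simp add: field_simps)
  then have "2 * real (class_load I i) / T \<le> real (2 * machines I)" using T by (simp add: field_simps)
  then have "nat \<lceil>2 * real (class_load I i) / T\<rceil> \<le> 2 * machines I"
    by (simp only: nat_le_iff ceiling_le_iff of_int_of_nat_eq)
  then show ?thesis using machines_pos[OF assms(1)] by (auto simp: batches_def)
qed (use machines_pos[OF assms(1)] in \<open>auto simp: batches_def\<close>)

text \<open>After the bisection the interval is so short that every class has at most four jumps left.\<close>

lemma batches_interval:
  assumes inst: "valid_instance I" "i < num_classes I" and G: "machines I \<le> G"
    and lo: "lo = real (base_load I) * (real G + l) / (real (machines I) * real G)"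
    and hi: "hi = real (base_load I) * (real G + l + 1) / (real (machines I) * real G)" and "0 \<le> l"
  shows "batches (setup_time I i) (class_load I i) lo \<le> max 1 (nat \<lceil>2 * real (class_load I i) / hi\<rceil>) + 3"
proof (cases "class_load I i > 0")
  case True
  let ?m = "real (machines I)" and ?A = "real (base_load I)" and ?P = "real (class_load I i)"
  have m: "?m > 0" using machines_pos[OF inst(1)] by simp
  have P: "?P \<le> ?A" using class_load_le_base[OF inst(2)] by simp
  with True have A: "?A > 0" by simp
  have Gp: "real G \<ge> ?m" using G by simp
  then have G0: "real G > 0" using m by linarith
  have lo0: "lo > 0" using A m G0 \<open>0 \<le> l\<close> unfolding lo by (intro divide_pos_pos mult_pos_pos) auto
  have hilo: "hi - lo = ?A / (?m * real G)"
    unfolding lo hi by (simp add: diff_divide_distrib[symmetric] algebra_simps)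
  then have "hi \<ge> lo" using A m G0 by (smt (verit) divide_nonneg_nonneg mult_nonneg_nonneg)
  have lo_ge: "lo \<ge> ?A / ?m"
  proof -
    have "?A / ?m = ?A * real G / (?m * real G)" using G0 by simp
    also have "\<dots> \<le> lo" unfolding lo using A m G0 \<open>0 \<le> l\<close> by (intro divide_right_mono) auto
    finally show ?thesis .
  qed
  have Am: "?A / ?m > 0" using A m by simp
  \<comment> \<open>Since \<open>P \<le> A\<close> and both ends are at least \<open>A / m\<close>,
    the difference is at most \<open>2 * A * (hi - lo) / ((A / m) * (A / m)) = 2 * m / G\<close>,
    which is at most 2.\<close>
  have "2 * ?P / lo - 2 * ?P / hi = 2 * ?P * (hi - lo) / (lo * hi)"
    using lo0 \<open>hi \<ge> lo\<close> by (simp add: field_simps)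
  also have "\<dots> \<le> 2 * ?A * (hi - lo) / ((?A / ?m) * (?A / ?m))"
    using P lo_ge Am \<open>hi \<ge> lo\<close> by (intro frac_le mult_mono mult_pos_pos) auto
  also have "\<dots> = 2 * ?m / real G" unfolding hilo using A m G0 by (simp add: field_simps)
  also have "\<dots> \<le> 2" using Gp G0 by (simp add: field_simps)
  finally have diff: "2 * ?P / lo \<le> 2 * ?P / hi + 2" by simp
  have "\<lceil>2 * ?P / lo\<rceil> \<le> \<lceil>2 * ?P / hi\<rceil> + 3" using diff by linarith
  moreover have "\<lceil>2 * ?P / hi\<rceil> \<ge> 0" using lo0 \<open>hi \<ge> lo\<close> by (simp add: order_less_le_trans[of "-1" 0])
  ultimately have "nat \<lceil>2 * ?P / lo\<rceil> \<le> nat \<lceil>2 * ?P / hi\<rceil> + 3" by linarith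
  then show ?thesis by (auto simp: batches_def)
qed (auto simp: batches_def)

section \<open>Solving the conditions between two jumps\<close>

definition exp_sum :: "inst \<Rightarrow> real \<Rightarrow> nat" where
  "exp_sum I T = (\<Sum>i<num_classes I. exp_machines (setup_time I i) (class_load I i) T)"

definition load_sum :: "inst \<Rightarrow> real \<Rightarrow> nat" where
  "load_sum I T = (\<Sum>i<num_classes I. class_load I i + batches (setup_time I i) (class_load I i) T * setup_time I i)"

text \<open>From \<open>A / m\<close> on the setups fit by themselves, so two numbers
  decide.\<close>

lemma acceptable_sums:
  assumes "valid_instance I" "real (base_load I) / real (machines I) \<le> T"
  shows "acceptable I T \<longleftrightarrow> exp_sum I T \<le> machines I \<and> real (load_sum I T) \<le> real (machines I) * T"
proof -
  have "real (setup_time I i) \<le> T" if "i < num_classes I" for i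
    using setup_le_base[OF assms(1) that] assms(2) by linarith
  then show ?thesis by (auto simp: acceptable_def exp_sum_def load_sum_def)
qed

text \<open>Both sums are constant from \<open>Y\<close> up to \<open>X\<close>, so acceptability
  there means \<open>M \<le> m\<close> and \<open>L / m \<le> T\<close>. The smallest solution is
  then explicit.\<close>

lemma sweep_found:
  assumes inst: "valid_instance I" and Y: "real (base_load I) / real (machines I) \<le> Y"
    and low: "\<And>T. acceptable I T \<Longrightarrow> Y \<le> T"
    and const: "\<And>T. Y \<le> T \<Longrightarrow> T < X \<Longrightarrow> exp_sum I T = M \<and> load_sum I T = L"
    and T: "T = max Y (real L / real (machines I))" and M: "M \<le> machines I" and X: "T < X"
  shows "acceptable I T" "acceptable I T' \<Longrightarrow> T \<le> T'"
proof -
  have m: "real (machines I) > 0" using machines_pos[OF inst] by simp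
  have YT: "Y \<le> T" using T by simp
  have "real L / real (machines I) \<le> T" using T by simp
  then have "real L \<le> real (machines I) * T" using m by (simp add: field_simps)
  then show "acceptable I T"
    using acceptable_sums[OF inst, of T] Y YT const[OF YT X] M by linarith
  assume acc: "acceptable I T'"
  show "T \<le> T'"
  proof (rule ccontr)
    assume less: "\<not> T \<le> T'"
    then have "load_sum I T' = L" using const[of T'] low[OF acc] X by simp
    then have "real L \<le> real (machines I) * T'"
      using acc acceptable_sums[OF inst acceptable_lower[OF inst acc]] by simp
    then have "real L / real (machines I) \<le> T'" using m by (simp add: field_simps)
    with low[OF acc] less T show False by simp
  qed
qed

text \<open>If the explicit solution does not exist below \<open>X\<close>, the search may continue
  from \<open>X\<close> without losing an acceptable value.\<close>

lemma sweep_not_found: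
  assumes inst: "valid_instance I"
    and low: "\<And>T. acceptable I T \<Longrightarrow> Y \<le> T"
    and const: "\<And>T. Y \<le> T \<Longrightarrow> T < X \<Longrightarrow> exp_sum I T = M \<and> load_sum I T = L"
    and not: "\<not> (M \<le> machines I \<and> max Y (real L / real (machines I)) < X)"
    and acc: "acceptable I T"
  shows "X \<le> T"
proof (rule ccontr)
  assume "\<not> X \<le> T"
  then have *: "exp_sum I T = M" "load_sum I T = L" using const[of T] low[OF acc] by auto
  have m: "real (machines I) > 0" using machines_pos[OF inst] by simp
  have "M \<le> machines I" "real L \<le> real (machines I) * T"
    using acc acceptable_sums[OF inst acceptable_lower[OF inst acc]] * by simp_all
  then have "max Y (real L / real (machines I)) \<le> T" using low[OF acc] m by (simp add: field_simps)
  with not \<open>M \<le> machines I\<close> \<open>\<not> X \<le> T\<close> show False by linarith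
qed

section \<open>The search program\<close>

abbreviation Var :: "nat \<Rightarrow> expr" where "Var x \<equiv> Read x (Const 0)"
abbreviation Set :: "nat \<Rightarrow> expr \<Rightarrow> com" (infix "::=" 62) where "x ::= e \<equiv> Write x (Const 0) e"
abbreviation Sequence :: "com \<Rightarrow> com \<Rightarrow> com" (infixr ";;" 60) where "p ;; q \<equiv> Seq p q"

text \<open>Arrays with names \<open>v_\<dots>\<close> hold a number in their cell 0.\<close>

abbreviation "v_m \<equiv> 10 :: nat"
abbreviation "v_c \<equiv> 11 :: nat"
abbreviation "v_n \<equiv> 12 :: nat"
abbreviation "v_i \<equiv> 13 :: nat"
abbreviation "v_j \<equiv> 14 :: nat"
abbreviation "v_N \<equiv> 15 :: nat"
abbreviation "v_smax \<equiv> 16 :: nat"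
abbreviation "v_A \<equiv> 17 :: nat"
abbreviation "a_P \<equiv> 20 :: nat"
abbreviation "a_head \<equiv> 21 :: nat"
abbreviation "a_next \<equiv> 22 :: nat"
abbreviation "v_xn \<equiv> 30 :: nat"
abbreviation "v_xd \<equiv> 31 :: nat"
abbreviation "v_M \<equiv> 32 :: nat"
abbreviation "v_L \<equiv> 33 :: nat"
abbreviation "v_b \<equiv> 34 :: nat"
abbreviation "a_cnt \<equiv> 40 :: nat"
abbreviation "a_mul \<equiv> 41 :: nat"
abbreviation "a_kn \<equiv> 42 :: nat"
abbreviation "a_kd \<equiv> 43 :: nat"

abbreviation "e_setup \<equiv> Read 0 (Add (Const 3) (Var v_i))"
abbreviation "e_load \<equiv> Read a_P (Var v_i)"

text \<open>Evaluates class \<open>v_i\<close> at \<open>v_xn / v_xd\<close> and adds it to the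
  sums. The key \<open>(3 * A + 1) / m\<close> of a cheap class is a sentinel: it exceeds the always
  acceptable \<open>2 * A / m\<close>, so the sweep stops before it. The \<open>+ 1\<close> matters
  for \<open>A = 0\<close>.\<close>

definition eval_class :: com where
  "eval_class =
    Cond (Less (Var v_xn) (Mul (Mul (Const 2) e_setup) (Var v_xd)))
      (v_b ::= Div (Sub (Add (Mul (Mul (Const 2) e_load) (Var v_xd)) (Var v_xn)) (Const 1)) (Var v_xn) ;;
       Cond (Var v_b) Skip (v_b ::= Const 1) ;;
       Write a_cnt (Var v_i) (Var v_b) ;;
       Write a_mul (Var v_i) (Var v_b) ;;
       Cond (Mul (Less (Const 1) (Var v_b)) (Less e_load (Mul e_setup (Sub (Var v_b) (Const 1)))))
         (Write a_kn (Var v_i) (Mul (Const 2) e_load) ;; Write a_kd (Var v_i) (Sub (Var v_b) (Const 1)))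
         (Write a_kn (Var v_i) (Mul (Const 2) e_setup) ;; Write a_kd (Var v_i) (Const 1)))
      (Write a_cnt (Var v_i) (Const 0) ;;
       Write a_mul (Var v_i) (Const 1) ;;
       Write a_kn (Var v_i) (Add (Mul (Const 3) (Var v_A)) (Const 1)) ;;
       Write a_kd (Var v_i) (Var v_m)) ;;
    v_M ::= Add (Var v_M) (Read a_cnt (Var v_i)) ;;
    v_L ::= Add (Var v_L) (Add e_load (Mul (Read a_mul (Var v_i)) e_setup))"

definition eval_all :: com where
  "eval_all =
    (v_i ::= Const 0 ;; v_M ::= Const 0 ;; v_L ::= Const 0) ;;
    While (Less (Var v_i) (Var v_c)) (eval_class ;; v_i ::= Add (Var v_i) (Const 1))"

lemma nth_concat_pairs: "j < length js \<Longrightarrow>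
    concat (map (\<lambda>(i, t). [i, t]) js) ! (2 * j) = fst (js ! j) \<and>
    concat (map (\<lambda>(i, t). [i, t]) js) ! (2 * j + 1) = snd (js ! j)"
proof (induction js arbitrary: j)
  case (Cons x js)
  then show ?case by (cases j; cases x) auto
qed auto

lemma length_concat_pairs: "length (concat (map (\<lambda>(i, t). [i, t]) js)) = 2 * length js"
  by (induction js) auto

text \<open>\<open>V\<close> bounds the dimensions and \<open>A\<close>, and sizes are tracked as
  powers of \<open>V\<close> up to the seventh, which lie below \<open>B\<close>. By
  \<open>8 \<le> V\<close>, one more factor \<open>V\<close> absorbs a small constant or a second
  summand.\<close>

locale ram =
  fixes I :: inst and V B :: nat
  assumes inst: "valid_instance I"
    and V: "machines I \<le> V" "num_jobs I \<le> V" "num_classes I \<le> V" "base_load I \<le> V" "8 \<le> V"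
    and B: "V ^ 8 \<le> B"
begin

abbreviation "n \<equiv> num_jobs I"
abbreviation "c \<equiv> num_classes I"
abbreviation "m \<equiv> machines I"
abbreviation "A \<equiv> base_load I"
abbreviation "s_of \<equiv> setup_time I"
abbreviation "P_of \<equiv> class_load I"

lemma less_B: "x \<le> V ^ 7 \<Longrightarrow> x < B"
proof -
  assume x: "x \<le> V ^ 7"
  have "V ^ 7 < V ^ 8" using V(5) by (intro power_strict_increasing) auto
  with x B show ?thesis by linarith
qed

lemma V_pow: "a \<le> b \<Longrightarrow> V ^ a \<le> V ^ b"
  using V(5) by (intro power_increasing) auto

lemma less_B_pow: "x \<le> V ^ a \<Longrightarrow> a \<le> 7 \<Longrightarrow> x < B"
  using V_pow[of a 7] less_B by (meson order_trans)

lemma mult_V: "x \<le> V ^ a \<Longrightarrow> y \<le> V ^ b \<Longrightarrow> k = a + b \<Longrightarrow> x * y \<le> V ^ k"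
  by (simp add: power_add mult_le_mono)

lemma add_V: "x \<le> V ^ a \<Longrightarrow> y \<le> V ^ a \<Longrightarrow> k = a + 1 \<Longrightarrow> x + y \<le> V ^ k"
proof -
  assume "k = a + 1" "x \<le> V ^ a" "y \<le> V ^ a"
  then have "x + y \<le> 2 * V ^ a" by linarith
  also have "\<dots> \<le> V * V ^ a" using V(5) by (intro mult_le_mono1) linarith
  finally show ?thesis using \<open>k = a + 1\<close> by simp
qed

lemma c_pos: "c > 0" and m_pos: "m > 0"
  using num_classes_pos[OF inst] machines_pos[OF inst] by auto

lemma setup_le_A: "i < c \<Longrightarrow> s_of i \<le> A"
proof -
  assume "i < c"
  from setup_le_max[OF this] have "s_of i \<le> m * max_setup I"
    using m_pos mult_le_mono[of 1 m "s_of i" "max_setup I"] by simp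
  then show ?thesis by (simp add: base_load_def)
qed

lemma setup_le_V: "i < c \<Longrightarrow> s_of i \<le> V" and load_le_V: "i < c \<Longrightarrow> P_of i \<le> V"
  using setup_le_A class_load_le_base V(4) by (meson order_trans)+

definition header :: "memory \<Rightarrow> bool" where
  "header s \<longleftrightarrow> s 0 = init_memory (encode_instance I) 0 \<and> s v_m 0 = m \<and> s v_c 0 = c \<and> s v_n 0 = n"

definition loads :: "memory \<Rightarrow> bool" where
  "loads s \<longleftrightarrow> header s \<and> (\<forall>i<c. s a_P i = P_of i) \<and> s v_A 0 = A"

lemma input_machines: "init_memory (encode_instance I) 0 0 = m"
  and input_classes: "init_memory (encode_instance I) 0 (Suc 0) = c"
  and input_jobs: "init_memory (encode_instance I) 0 2 = n"
  by (simp_all add: init_memory_def encode_instance_def)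

lemma input_setup: "i < c \<Longrightarrow> init_memory (encode_instance I) 0 (3 + i) = s_of i"
  by (auto simp: init_memory_def encode_instance_def num_classes_def setup_time_def nth_append numeral_3_eq_3)

lemma input_job:
  assumes "j < n"
  shows "init_memory (encode_instance I) 0 (3 + c + 2 * j) = job_class I j"
    "init_memory (encode_instance I) 0 (4 + c + 2 * j) = proc_time I j"
proof -
  have len: "length (encode_instance I) = 3 + c + 2 * n"
    by (simp add: encode_instance_def length_concat_pairs num_classes_def num_jobs_def)
  have nth: "encode_instance I ! (3 + c + k) = concat (map (\<lambda>(i, t). [i, t]) (jobs I)) ! k" for k
  proof -
    have "encode_instance I = (m # c # n # setups I) @ concat (map (\<lambda>(i, t). [i, t]) (jobs I))"
      by (simp add: encode_instance_def)
    then show ?thesis by (simp only: nth_append) (simp add: num_classes_def)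
  qed
  note p = nth_concat_pairs[of j "jobs I"]
  show "init_memory (encode_instance I) 0 (3 + c + 2 * j) = job_class I j"
    using assms p nth[of "2 * j"] by (simp add: init_memory_def len job_class_def num_jobs_def)
  have "4 + c + 2 * j = 3 + c + (2 * j + 1)" by simp
  then show "init_memory (encode_instance I) 0 (4 + c + 2 * j) = proc_time I j"
    using assms p nth[of "2 * j + 1"] by (simp add: init_memory_def len proc_time_def num_jobs_def add.assoc)
qed

definition class_key :: "nat \<Rightarrow> real \<Rightarrow> real" where
  "class_key i T = (if 2 * real (s_of i) > T then next_jump (s_of i) (P_of i) T else (3 * real A + 1) / real m)"

abbreviation "mul_of i T \<equiv> batches (s_of i) (P_of i) T"
abbreviation "cnt_of i T \<equiv> exp_machines (s_of i) (P_of i) T"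

lemma mul_le_V: "i < c \<Longrightarrow> real A / real m \<le> T \<Longrightarrow> mul_of i T \<le> V ^ 2"
proof -
  assume "i < c" "real A / real m \<le> T"
  from batches_bound[OF inst this] have "mul_of i T \<le> 2 * m" .
  also have "\<dots> \<le> V * V" using V(1,5) by (intro mult_le_mono) auto
  finally show ?thesis by (simp add: power2_eq_square)
qed

text \<open>The bounds on the key do not depend on the fraction used for \<open>T\<close>: a key is
  formed from load, setup and batches. So the fractions do not grow when keys become the next
  evaluation points in the sweep.\<close>

definition evaluated :: "memory \<Rightarrow> nat \<Rightarrow> real \<Rightarrow> bool" where
  "evaluated s i T \<longleftrightarrow> s a_cnt i = cnt_of i T \<and> s a_mul i = mul_of i T \<and> s a_kd i > 0 \<and>
     real (s a_kn i) / real (s a_kd i) = class_key i T \<and> s a_kn i \<le> V ^ 2 \<and> s a_kd i \<le> V ^ 2"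

lemma wp_eval_class:
  assumes ld: "loads s" and i: "s v_i 0 = i" "i < c" and x: "s v_xn 0 = xn" "s v_xd 0 = xd" "xd > 0"
    and T: "T = real xn / real xd" "real A / real m \<le> T"
    and sums: "s v_M 0 + cnt_of i T < B" "s v_L 0 + (P_of i + mul_of i T * s_of i) < B"
  shows "wp B eval_class (max_cost eval_class) (\<lambda>s'. evaluated s' i T \<and>
     (\<forall>l. l \<noteq> i \<longrightarrow> s' a_cnt l = s a_cnt l \<and> s' a_mul l = s a_mul l \<and> s' a_kn l = s a_kn l \<and> s' a_kd l = s a_kd l) \<and>
     (\<forall>a. a \<notin> {v_b, v_M, v_L, a_cnt, a_mul, a_kn, a_kd} \<longrightarrow> s' a = s a) \<and>
     s' v_M 0 = s v_M 0 + cnt_of i T \<and> s' v_L 0 = s v_L 0 + (P_of i + mul_of i T * s_of i)) s"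
proof (rule wp_vc)
  have s0: "s 0 = init_memory (encode_instance I) 0" and sm: "s v_m 0 = m" and sA: "s v_A 0 = A"
    and sP: "s a_P i = P_of i"
    using ld i by (auto simp: loads_def header_def)
  have si: "s 0 (3 + i) = s_of i" using input_setup[OF i(2)] s0 by simp
  have mul: "mul_of i T = (if xn < 2 * s_of i * xd then max 1 ((2 * P_of i * xd + xn - 1) div xn) else 1)"
    unfolding T by (rule batches_rat[OF x(3)])
  have cnt: "cnt_of i T = (if xn < 2 * s_of i * xd then max 1 ((2 * P_of i * xd + xn - 1) div xn) else 0)"
    unfolding T by (rule exp_machines_rat[OF x(3)])
  have ex: "2 * real (s_of i) > T \<longleftrightarrow> xn < 2 * s_of i * xd"
  proof -
    have "2 * real (s_of i) > T \<longleftrightarrow> real xn < real (2 * s_of i * xd)"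
      using x(3) by (simp add: T field_simps)
    then show ?thesis by (simp only: of_nat_less_iff)
  qed
  have VB: "V < B" "V ^ 2 < B" using less_B_pow[of V 1] less_B_pow[of "V ^ 2" 2] by auto
  have iB: "i < B" using i(2) V(3) VB by linarith
  have mB: "m < B" using V(1) VB by linarith
  have Vsq: "V ^ 2 = V * V" by (simp add: power2_eq_square)
  have VV: "8 * V \<le> V ^ 2" unfolding Vsq using V(5) by (intro mult_le_mono1) auto
  have k1: "3 * A + 1 \<le> V ^ 2" "2 * P_of i \<le> V ^ 2" "2 * s_of i \<le> V ^ 2" "m \<le> V ^ 2" "1 \<le> V ^ 2"
    using VV V setup_le_V[OF i(2)] load_le_V[OF i(2)] by linarith+
  have k1B: "3 * A + 1 < B" "2 * P_of i < B" "2 * s_of i < B" "1 < B"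
    using k1 VB V(5) by linarith+
  define b where "b = max 1 ((2 * P_of i * xd + xn - 1) div xn)"
  show "vc B eval_class (\<lambda>s'. evaluated s' i T \<and>
     (\<forall>l. l \<noteq> i \<longrightarrow> s' a_cnt l = s a_cnt l \<and> s' a_mul l = s a_mul l \<and> s' a_kn l = s a_kn l \<and> s' a_kd l = s a_kd l) \<and>
     (\<forall>a. a \<notin> {v_b, v_M, v_L, a_cnt, a_mul, a_kn, a_kd} \<longrightarrow> s' a = s a) \<and>
     s' v_M 0 = s v_M 0 + cnt_of i T \<and> s' v_L 0 = s v_L 0 + (P_of i + mul_of i T * s_of i)) s"
  proof (cases "xn < 2 * s_of i * xd")
    case True
    then have mb: "mul_of i T = b" "cnt_of i T = b" by (simp_all add: mul cnt b_def)
    have bV: "b \<le> V ^ 2" using mul_le_V[OF i(2) T(2)] mb by simp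
    then have bB: "b < B" "b - Suc 0 < B" "b - Suc 0 \<le> V ^ 2" using VB by linarith+
    have b0: "b \<ge> 1" by (simp add: b_def)
    have key: "class_key i T = (if 1 < b \<and> P_of i < s_of i * (b - 1) then 2 * real (P_of i) / real (b - 1)
        else 2 * real (s_of i))"
      using True ex by (simp add: class_key_def next_jump_def mb)
    have b: "(2 * P_of i * xd + xn - 1) div xn = (if (2 * P_of i * xd + xn - 1) div xn = 0 then 0 else b)"
      by (simp add: b_def)
    show ?thesis
    proof (cases "(2 * P_of i * xd + xn - 1) div xn = 0")
      case z: True
      then have b1: "b = 1" by (simp add: b_def)
      show ?thesis
        unfolding eval_class_def
        using True i x si sP sA sm sums mb key iB VB k1 k1B b1 z
        by (simp add: evaluated_def)
    next
      case nz: False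
      then have b': "(2 * P_of i * xd + xn - 1) div xn = b" using b by simp
      show ?thesis
        unfolding eval_class_def
        using True i x si sP sA sm sums mb key iB VB k1 k1B b' b0 bB bV
        by (simp add: evaluated_def)
    qed
  next
    case False
    then have mb: "mul_of i T = 1" "cnt_of i T = 0" by (simp_all add: mul cnt)
    have key: "class_key i T = (3 * real A + 1) / real m" using False ex by (simp add: class_key_def)
    show ?thesis
      unfolding eval_class_def
      using False i x si sP sA sm sums mb key iB mB VB k1 k1B m_pos
      by (simp add: evaluated_def)
  qed
qed

text \<open>Each class has its own point \<open>y i\<close>, because during the sweep the classes
  were last evaluated at different points.\<close>

lemma cnt_sum_le: "(\<And>i. i < c \<Longrightarrow> real A / real m \<le> y i) \<Longrightarrow> (\<Sum>i<c. cnt_of i (y i)) \<le> V ^ 3"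
proof -
  assume y: "\<And>i. i < c \<Longrightarrow> real A / real m \<le> y i"
  have "(\<Sum>i<c. cnt_of i (y i)) \<le> (\<Sum>i<c. V ^ 2)"
  proof (rule sum_mono)
    fix i assume "i \<in> {..<c}"
    then have "mul_of i (y i) \<le> V ^ 2" using mul_le_V y by simp
    then show "cnt_of i (y i) \<le> V ^ 2" by (simp add: exp_machines_def)
  qed
  also have "\<dots> = c * V ^ 2" by simp
  also have "\<dots> \<le> V ^ 3" by (rule mult_V[of _ 1 _ 2]) (use V in simp_all)
  finally show ?thesis .
qed

lemma mul_sum_le: "(\<And>i. i < c \<Longrightarrow> real A / real m \<le> y i) \<Longrightarrow>
    (\<Sum>i<c. P_of i + mul_of i (y i) * s_of i) \<le> V ^ 5"
proof -
  assume y: "\<And>i. i < c \<Longrightarrow> real A / real m \<le> y i"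
  have "(\<Sum>i<c. P_of i + mul_of i (y i) * s_of i) \<le> (\<Sum>i<c. V ^ 4)"
  proof (rule sum_mono)
    fix i assume i: "i \<in> {..<c}"
    then have "mul_of i (y i) * s_of i \<le> V ^ 3"
      by (intro mult_V[of _ 2 _ 1]) (use mul_le_V y setup_le_V in auto)
    moreover have "P_of i \<le> V ^ 3" using load_le_V[of i] i V_pow[of 1 3] by simp
    ultimately show "P_of i + mul_of i (y i) * s_of i \<le> V ^ 4"
      by (intro add_V) auto
  qed
  also have "\<dots> = c * V ^ 4" by simp
  also have "\<dots> \<le> V ^ 5" by (rule mult_V[of _ 1 _ 4]) (use V in simp_all)
  finally show ?thesis .
qed

lemma exp_sum_le: "real A / real m \<le> T \<Longrightarrow> exp_sum I T \<le> V ^ 3"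
  using cnt_sum_le[of "\<lambda>_. T"] by (simp add: exp_sum_def)

lemma load_sum_le: "real A / real m \<le> T \<Longrightarrow> load_sum I T \<le> V ^ 5"
  using mul_sum_le[of "\<lambda>_. T"] by (simp add: load_sum_def)

definition search_arrays :: "nat set" where
  "search_arrays = {v_i, v_b, v_M, v_L, a_cnt, a_mul, a_kn, a_kd}"

definition t_all :: nat where
  "t_all = max_cost (v_i ::= Const 0 ;; v_M ::= Const 0 ;; v_L ::= Const 0) +
     (1 + cost (Less (Var v_i) (Var v_c)) + max_cost (eval_class ;; v_i ::= Add (Var v_i) (Const 1)))"

lemma wp_eval_all:
  assumes ld: "loads s" and x: "s v_xn 0 = xn" "s v_xd 0 = xd" "xd > 0"
    and T: "T = real xn / real xd" "real A / real m \<le> T"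
  shows "wp B eval_all (t_all * (c + 1)) (\<lambda>s'. (\<forall>i<c. evaluated s' i T) \<and>
     (\<forall>a. a \<notin> search_arrays \<longrightarrow> s' a = s a) \<and>
     s' v_M 0 = exp_sum I T \<and> s' v_L 0 = load_sum I T) s"
proof -
  define P where "P = (\<lambda>k s'. s' v_i 0 = k \<and> k \<le> c \<and> (\<forall>i<k. evaluated s' i T) \<and>
     (\<forall>a. a \<notin> search_arrays \<longrightarrow> s' a = s a) \<and>
     s' v_M 0 = (\<Sum>i<k. cnt_of i T) \<and> s' v_L 0 = (\<Sum>i<k. P_of i + mul_of i T * s_of i))"
  have B1: "1 < B" "0 < B" "c < B" using less_B_pow[of 1 0] less_B_pow[of c 1] V by auto
  have step: "wp B (eval_class ;; v_i ::= Add (Var v_i) (Const 1))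
      (max_cost eval_class + max_cost (v_i ::= Add (Var v_i) (Const 1)))
      (\<lambda>s''. \<exists>k'. P k' s'' \<and> c - k' < c - k) s'"
    if P: "P k s'" and e: "eval (Less (Var v_i) (Var v_c)) s' \<noteq> 0" for k s'
  proof -
    have fr: "s' a = s a" if "a \<notin> search_arrays" for a using P that by (simp add: P_def)
    have ld': "loads s'"
      using ld fr by (simp add: loads_def header_def search_arrays_def)
    have k: "k < c" "s' v_i 0 = k" using e P ld' by (auto simp: P_def loads_def header_def split: if_splits)
    have x': "s' v_xn 0 = xn" "s' v_xd 0 = xd" using x fr by (simp_all add: search_arrays_def)
    have M: "s' v_M 0 + cnt_of k T \<le> exp_sum I T"
    proof -
      have "s' v_M 0 + cnt_of k T = (\<Sum>i<Suc k. cnt_of i T)" using P by (simp add: P_def)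
      also have "\<dots> \<le> exp_sum I T" unfolding exp_sum_def by (rule sum_mono2) (use k in auto)
      finally show ?thesis .
    qed
    have L: "s' v_L 0 + (P_of k + mul_of k T * s_of k) \<le> load_sum I T"
    proof -
      have "s' v_L 0 + (P_of k + mul_of k T * s_of k) = (\<Sum>i<Suc k. P_of i + mul_of i T * s_of i)"
        using P by (simp add: P_def)
      also have "\<dots> \<le> load_sum I T" unfolding load_sum_def by (rule sum_mono2) (use k in auto)
      finally show ?thesis .
    qed
    have MB: "s' v_M 0 + cnt_of k T < B" using M less_B_pow[OF exp_sum_le[OF T(2)]] by simp
    have LB: "s' v_L 0 + (P_of k + mul_of k T * s_of k) < B" using L less_B_pow[OF load_sum_le[OF T(2)]] by simp
    show ?thesis
    proof (rule wp_seqI[OF wp_eval_class[OF ld' k(2,1) x' x(3) T MB LB]], rule wp_vc)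
      fix s2 assume s2: "evaluated s2 k T \<and>
       (\<forall>l. l \<noteq> k \<longrightarrow> s2 a_cnt l = s' a_cnt l \<and> s2 a_mul l = s' a_mul l \<and> s2 a_kn l = s' a_kn l \<and> s2 a_kd l = s' a_kd l) \<and>
       (\<forall>a. a \<notin> {v_b, v_M, v_L, a_cnt, a_mul, a_kn, a_kd} \<longrightarrow> s2 a = s' a) \<and>
       s2 v_M 0 = s' v_M 0 + cnt_of k T \<and> s2 v_L 0 = s' v_L 0 + (P_of k + mul_of k T * s_of k)"
      have i2: "s2 v_i 0 = k" using s2 k by simp
      have ev: "evaluated s2 i T" if "i < k" for i
      proof -
        have "evaluated s' i T" using P that by (simp add: P_def)
        then show ?thesis using s2 that by (simp add: evaluated_def)
      qed
      have "P (k + 1) (s2(v_i := (s2 v_i)(0 := k + 1)))"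
        unfolding P_def
      proof (intro conjI allI impI)
        fix i assume "i < k + 1"
        then have "evaluated s2 i T" using ev s2 by (cases "i = k") auto
        then show "evaluated (s2(v_i := (s2 v_i)(0 := k + 1))) i T" by (simp add: evaluated_def)
      next
        fix a assume "a \<notin> search_arrays"
        then show "(s2(v_i := (s2 v_i)(0 := k + 1))) a = s a"
          using s2 fr by (simp add: search_arrays_def)
      qed (use s2 P k in \<open>simp_all add: P_def\<close>)
      then show "vc B (v_i ::= Add (Var v_i) (Const 1)) (\<lambda>s''. \<exists>k'. P k' s'' \<and> c - k' < c - k) s2"
        using B1 k i2 by (auto intro!: exI[of _ "k + 1"])
    qed
  qed
  have "wp B eval_all (max_cost (v_i ::= Const 0 ;; v_M ::= Const 0 ;; v_L ::= Const 0) +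
      (c * (1 + cost (Less (Var v_i) (Var v_c)) +
        (max_cost eval_class + max_cost (v_i ::= Add (Var v_i) (Const 1)))) + (1 + cost (Less (Var v_i) (Var v_c)))))
    (\<lambda>s'. (\<forall>i<c. evaluated s' i T) \<and> (\<forall>a. a \<notin> search_arrays \<longrightarrow> s' a = s a) \<and>
     s' v_M 0 = exp_sum I T \<and> s' v_L 0 = load_sum I T) s"
    unfolding eval_all_def
  proof (rule wp_seqI[where R = "P 0"])
    show "wp B (v_i ::= Const 0 ;; v_M ::= Const 0 ;; v_L ::= Const 0)
      (max_cost (v_i ::= Const 0 ;; v_M ::= Const 0 ;; v_L ::= Const 0)) (P 0) s"
      by (rule wp_vc) (use B1 in \<open>simp add: P_def search_arrays_def\<close>)
  next
    fix s1 assume "P 0 s1"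
    show "wp B (While (Less (Var v_i) (Var v_c)) (eval_class ;; v_i ::= Add (Var v_i) (Const 1)))
      (c * (1 + cost (Less (Var v_i) (Var v_c)) + (max_cost eval_class + max_cost (v_i ::= Add (Var v_i) (Const 1)))) +
       (1 + cost (Less (Var v_i) (Var v_c))))
      (\<lambda>s'. (\<forall>i<c. evaluated s' i T) \<and> (\<forall>a. a \<notin> search_arrays \<longrightarrow> s' a = s a) \<and>
         s' v_M 0 = exp_sum I T \<and> s' v_L 0 = load_sum I T) s1"
    proof (rule wp_while[where I = P and \<mu> = "\<lambda>k. c - k" and g = 0, OF step \<open>P 0 s1\<close>])
      fix k s' assume P: "P k s'" and "eval (Less (Var v_i) (Var v_c)) s' = 0"
      moreover have "s' v_c 0 = c"
        using P ld by (simp add: P_def loads_def header_def search_arrays_def)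
      ultimately have "k = c" by (simp add: P_def split: if_splits)
      with P show "(\<forall>i<c. evaluated s' i T) \<and> (\<forall>a. a \<notin> search_arrays \<longrightarrow> s' a = s a) \<and>
         s' v_M 0 = exp_sum I T \<and> s' v_L 0 = load_sum I T"
        by (simp add: P_def exp_sum_def load_sum_def)
    qed auto
  qed
  then show ?thesis
    by (rule wp_mono) (simp_all add: t_all_def algebra_simps)
qed

end

section \<open>Bisection\<close>

abbreviation "v_G \<equiv> 44 :: nat"
abbreviation "v_l \<equiv> 45 :: nat"

abbreviation "e_And x y \<equiv> Mul x y"
abbreviation "e_Not x \<equiv> Sub (Const 1) x"
abbreviation "e_Le x y \<equiv> e_Not (Less y x)"

text \<open>The left end \<open>A * (G + l) / (m * G)\<close> of interval number \<open>l\<close>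
  out of \<open>G\<close>: the whole range starts at \<open>A / m\<close> and also has length
  \<open>A / m\<close>.\<close>

definition to_lower :: com where
  "to_lower = v_xn ::= Mul (Var v_A) (Add (Var v_G) (Var v_l)) ;; v_xd ::= Mul (Var v_m) (Var v_G)"

text \<open>Once \<open>G\<close> and \<open>l\<close> are doubled, the middle of the old interval
  is the boundary between the new numbers \<open>l\<close> and \<open>l + 1\<close>.\<close>

definition to_middle :: com where
  "to_middle =
    v_l ::= Add (Var v_l) (Var v_l) ;; v_G ::= Add (Var v_G) (Var v_G) ;;
    v_xn ::= Mul (Var v_A) (Add (Add (Var v_G) (Var v_l)) (Const 1)) ;; v_xd ::= Mul (Var v_m) (Var v_G)"

definition test_middle :: com where
  "test_middle =
    Cond (e_And (e_Le (Var v_M) (Var v_m)) (e_Le (Mul (Var v_L) (Var v_xd)) (Mul (Var v_m) (Var v_xn))))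
      Skip (v_l ::= Add (Var v_l) (Const 1))"

definition bisect_step :: com where
  "bisect_step =
    to_middle ;;
    eval_all ;;
    test_middle"

definition bisect :: com where
  "bisect = (v_G ::= Const 1 ;; v_l ::= Const 0) ;;
    While (Less (Var v_G) (Var v_m)) bisect_step ;;
    to_lower ;;
    eval_all"

text \<open>The binary logarithm rounded down, and 0 for \<open>x \<le> 1\<close>.\<close>

fun halvings :: "nat \<Rightarrow> nat" where
  "halvings x = (if x \<le> 1 then 0 else Suc (halvings (x div 2)))"

declare halvings.simps [simp del]

lemma less_power_halvings: "x < 2 ^ Suc (halvings x)"
proof (induction x rule: halvings.induct)
  case (1 x)
  show ?case
  proof (cases "x \<le> 1")
    case False
    then have "x div 2 < 2 ^ Suc (halvings (x div 2))" using 1 by simp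
    then show ?thesis using False by (subst halvings.simps) simp
  qed (auto simp: halvings.simps)
qed

lemma halvings_le_log: "1 \<le> x \<Longrightarrow> real (halvings x) \<le> log 2 (real x)"
proof (induction x rule: halvings.induct)
  case (1 x)
  show ?case
  proof (cases "x \<le> 1")
    case False
    then have x2: "1 \<le> x div 2" by simp
    with 1 False have "real (halvings (x div 2)) \<le> log 2 (real (x div 2))" by simp
    also have "\<dots> \<le> log 2 (real x / 2)"
    proof -
      have "real (2 * (x div 2)) \<le> real x" by (rule of_nat_mono) simp
      then have "real (x div 2) \<le> real x / 2" by simp
      then show ?thesis using x2 by (subst log_le_cancel_iff) auto
    qed
    also have "\<dots> = log 2 (real x) - 1" using False by (simp add: log_divide)
    finally show ?thesis using False by (subst halvings.simps) simp
  qed (use 1 in \<open>auto simp: halvings.simps\<close>)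
qed

lemma halvings_mono: "x \<le> y \<Longrightarrow> halvings x \<le> halvings y"
proof (induction y arbitrary: x rule: halvings.induct)
  case (1 y)
  show ?case
  proof (cases "x \<le> 1")
    case False
    then have "halvings (x div 2) \<le> halvings (y div 2)" using 1 by (intro 1(1)) (auto intro: div_le_mono)
    then show ?thesis using False 1(2) by (subst (1 2) halvings.simps) simp
  qed (simp add: halvings.simps[of x])
qed

context ram
begin

definition t_bisect :: nat where
  "t_bisect = max_cost (v_G ::= Const 1 ;; v_l ::= Const 0) +
     2 * (1 + cost (Less (Var v_G) (Var v_m)) + max_cost bisect_step + t_all) +
     max_cost to_lower + t_all"

text \<open>\<open>[A / m, 2 * A / m]\<close> is divided into \<open>G\<close> intervals, and the smallest acceptable value lies in
  number \<open>l\<close>.\<close>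

definition bisected :: "nat \<Rightarrow> nat \<Rightarrow> bool" where
  "bisected G l \<longleftrightarrow> 1 \<le> G \<and> l + 1 \<le> G \<and>
     (\<forall>T. acceptable I T \<longrightarrow> real (A * (G + l)) / real (m * G) \<le> T) \<and>
     acceptable I (real (A * (G + l + 1)) / real (m * G))"

lemma bisected_init: "bisected 1 0"
  using acceptable_lower[OF inst] acceptable_upper[OF inst] by (simp add: bisected_def mult.commute)

lemma bisected_step:
  assumes "bisected G l"
  defines "T \<equiv> real (A * (2 * G + 2 * l + 1)) / real (m * (2 * G))"
  shows "acceptable I T \<Longrightarrow> bisected (2 * G) (2 * l)"
    and "\<not> acceptable I T \<Longrightarrow> bisected (2 * G) (2 * l + 1)"
    and "real A / real m \<le> T"
proof -
  have G: "G \<ge> 1" "l + 1 \<le> G" using assms by (auto simp: bisected_def)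
  have lo: "real (A * (2 * G + 2 * l)) / real (m * (2 * G)) = real (A * (G + l)) / real (m * G)"
    using G m_pos by (simp add: field_simps)
  have hi: "real (A * (2 * G + (2 * l + 1) + 1)) / real (m * (2 * G)) = real (A * (G + l + 1)) / real (m * G)"
    using G m_pos by (simp add: field_simps)
  show "acceptable I T \<Longrightarrow> bisected (2 * G) (2 * l)"
    using assms(1) G lo unfolding bisected_def T_def by auto
  show "bisected (2 * G) (2 * l + 1)" if "\<not> acceptable I T"
  proof -
    have "T \<le> T'" if "acceptable I T'" for T'
      using acceptable_mono[OF that, of T] \<open>\<not> acceptable I T\<close> by linarith
    then show ?thesis using assms(1) G hi unfolding bisected_def T_def by (auto simp: add.assoc)
  qed
  have "real A / real m = real (A * (2 * G)) / real (m * (2 * G))" using G m_pos by (simp add: field_simps)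
  also have "\<dots> \<le> T" unfolding T_def by (intro divide_right_mono of_nat_mono mult_le_mono2) auto
  finally show "real A / real m \<le> T" .
qed

lemma bisected_ge: "bisected G l \<Longrightarrow> real A / real m \<le> real (A * (G + l)) / real (m * G)"
proof -
  assume "bisected G l"
  then have G: "G \<ge> 1" by (simp add: bisected_def)
  have "real A / real m = real (A * G) / real (m * G)" using G m_pos by (simp add: field_simps)
  also have "\<dots> \<le> real (A * (G + l)) / real (m * G)" by (intro divide_right_mono of_nat_mono mult_le_mono2) auto
  finally show ?thesis .
qed

text \<open>Cross multiplication turns the real condition into the integer comparison made by
  \<open>test_middle\<close>.\<close>

lemma acceptable_rat:
  assumes "xd > 0" "real A / real m \<le> real xn / real xd"
  shows "acceptable I (real xn / real xd) \<longleftrightarrow>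
    exp_sum I (real xn / real xd) \<le> m \<and> load_sum I (real xn / real xd) * xd \<le> m * xn"
proof -
  have "real l \<le> real m * (real xn / real xd) \<longleftrightarrow> real (l * xd) \<le> real (m * xn)" for l
    using assms(1) by (simp add: field_simps)
  then show ?thesis using acceptable_sums[OF inst assms(2)] by (simp only: of_nat_le_iff)
qed

definition bisect_arrays :: "nat set" where
  "bisect_arrays = search_arrays \<union> {v_G, v_l, v_xn, v_xd}"

lemma loads_frame: "loads s \<Longrightarrow> \<forall>a. a \<notin> bisect_arrays \<longrightarrow> s' a = s a \<Longrightarrow> loads s'"
  by (simp add: loads_def header_def bisect_arrays_def search_arrays_def)

lemma wp_bisect_step:
  assumes ld: "loads s" and bis: "bisected G l" "G < m" and s: "s v_G 0 = G" "s v_l 0 = l"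
  shows "wp B bisect_step (max_cost bisect_step + t_all * (c + 1))
    (\<lambda>s'. (\<forall>a. a \<notin> bisect_arrays \<longrightarrow> s' a = s a) \<and> s' v_G 0 = 2 * G \<and> bisected (2 * G) (s' v_l 0)) s"
proof -
  define xn where "xn = A * (2 * G + 2 * l + 1)"
  define xd where "xd = m * (2 * G)"
  have G: "G \<ge> 1" "l + 1 \<le> G" using bis by (auto simp: bisected_def)
  have xd: "xd > 0" using G m_pos by (simp add: xd_def)
  have sm: "s v_m 0 = m" "s v_A 0 = A" using ld by (auto simp: loads_def header_def)
  have VV: "8 * V \<le> V ^ 2" unfolding power2_eq_square using V(5) by (intro mult_le_mono1) auto
  have "2 * G + 2 * l + 1 \<le> V ^ 2" "2 * G \<le> V ^ 2" "2 * l + 1 \<le> V ^ 2"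
    using bis(2) G V(1) VV by linarith+
  note G2 = this
  have "xn \<le> V ^ 3" unfolding xn_def by (rule mult_V[of _ 1 _ 2]) (use G2 V in auto)
  have "xd \<le> V ^ 3" unfolding xd_def by (rule mult_V[of _ 1 _ 2]) (use G2 V in auto)
  have bounds: "xn < B" "xd < B" "2 * G < B" "2 * l + 1 < B" "1 < B"
    using less_B_pow[OF \<open>xn \<le> V ^ 3\<close>] less_B_pow[OF \<open>xd \<le> V ^ 3\<close>] less_B_pow[OF G2(2)] less_B_pow[OF G2(3)]
      less_B_pow[of 1 0] by auto
  define T where "T = real xn / real xd"
  have T: "real A / real m \<le> T" using bisected_step(3)[OF bis(1)] by (simp add: T_def xn_def xd_def)
  define R where "R = (\<lambda>s1. s1 v_G 0 = 2 * G \<and> s1 v_l 0 = 2 * l \<and> s1 v_xn 0 = xn \<and> s1 v_xd 0 = xd \<and>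
    (\<forall>a. a \<notin> {v_G, v_l, v_xn, v_xd} \<longrightarrow> s1 a = s a))"
  have 1: "wp B to_middle (max_cost to_middle) R s"
    using bounds s sm by (intro wp_vc) (simp add: to_middle_def R_def xn_def xd_def mult_2)
  have 2: "wp B (eval_all ;; test_middle) (t_all * (c + 1) + max_cost test_middle)
     (\<lambda>s'. (\<forall>a. a \<notin> bisect_arrays \<longrightarrow> s' a = s a) \<and> s' v_G 0 = 2 * G \<and> bisected (2 * G) (s' v_l 0)) s1"
    if R: "R s1" for s1
  proof (rule wp_seqI)
    have "loads s1" using ld R by (simp add: loads_def header_def R_def)
    then show "wp B eval_all (t_all * (c + 1)) (\<lambda>s'. (\<forall>i<c. evaluated s' i T) \<and>
     (\<forall>a. a \<notin> search_arrays \<longrightarrow> s' a = s1 a) \<and>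
     s' v_M 0 = exp_sum I T \<and> s' v_L 0 = load_sum I T) s1"
      using R xd T by (intro wp_eval_all) (auto simp: R_def T_def)
  next
    fix s2 assume s2: "(\<forall>i<c. evaluated s2 i T) \<and>
     (\<forall>a. a \<notin> search_arrays \<longrightarrow> s2 a = s1 a) \<and>
     s2 v_M 0 = exp_sum I T \<and> s2 v_L 0 = load_sum I T"
    have v: "s2 v_m 0 = m" "s2 v_xn 0 = xn" "s2 v_xd 0 = xd" "s2 v_G 0 = 2 * G" "s2 v_l 0 = 2 * l"
      using s2 R sm by (simp_all add: search_arrays_def R_def)
    have fr: "s2 a = s a" if "a \<notin> bisect_arrays" for a
      using s2 R that by (simp add: search_arrays_def bisect_arrays_def R_def)
    have acc: "acceptable I T \<longleftrightarrow> exp_sum I T \<le> m \<and> load_sum I T * xd \<le> m * xn"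
      unfolding T_def by (rule acceptable_rat) (use xd T T_def in auto)
    have T2: "T = real (A * (2 * G + 2 * l + 1)) / real (m * (2 * G))" by (simp add: T_def xn_def xd_def)
    show "wp B test_middle (max_cost test_middle)
     (\<lambda>s'. (\<forall>a. a \<notin> bisect_arrays \<longrightarrow> s' a = s a) \<and> s' v_G 0 = 2 * G \<and> bisected (2 * G) (s' v_l 0)) s2"
    proof (rule wp_vc, cases "acceptable I T")
      case True
      then show "vc B test_middle
       (\<lambda>s'. (\<forall>a. a \<notin> bisect_arrays \<longrightarrow> s' a = s a) \<and> s' v_G 0 = 2 * G \<and> bisected (2 * G) (s' v_l 0)) s2"
        using acc v s2 fr bisected_step(1)[OF bis(1) True[unfolded T2]] by (simp add: test_middle_def)
    next
      case False
      then show "vc B test_middle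
       (\<lambda>s'. (\<forall>a. a \<notin> bisect_arrays \<longrightarrow> s' a = s a) \<and> s' v_G 0 = 2 * G \<and> bisected (2 * G) (s' v_l 0)) s2"
        using acc v s2 fr bounds bisected_step(2)[OF bis(1) False[unfolded T2]]
        by (auto simp: test_middle_def bisect_arrays_def)
    qed
  qed
  show ?thesis
    unfolding bisect_step_def by (rule wp_mono[OF wp_seqI[OF 1 2]]) (auto simp: eval_all_def)
qed

text \<open>\<open>G\<close> doubles until it reaches \<open>m\<close>, which takes at most
  \<open>halvings m + 1\<close> rounds, and \<open>G \<le> 2 * m\<close> keeps the fractions small.
  The last evaluation returns from the tested middle to the left end, where the sweep
  starts.\<close>

lemma wp_bisect:
  assumes ld: "loads s"
  shows "wp B bisect (t_bisect * ((c + 1) * (halvings m + 1)))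
    (\<lambda>s'. \<exists>G l. bisected G l \<and> m \<le> G \<and> G \<le> 2 * m \<and> s' v_xn 0 = A * (G + l) \<and> s' v_xd 0 = m * G \<and>
       (\<forall>i<c. evaluated s' i (real (A * (G + l)) / real (m * G))) \<and>
       s' v_M 0 = exp_sum I (real (A * (G + l)) / real (m * G)) \<and>
       s' v_L 0 = load_sum I (real (A * (G + l)) / real (m * G)) \<and>
       (\<forall>a. a \<notin> bisect_arrays \<longrightarrow> s' a = s a)) s"
proof -
  let ?Q = "\<lambda>s'. \<exists>G l. bisected G l \<and> m \<le> G \<and> G \<le> 2 * m \<and> s' v_xn 0 = A * (G + l) \<and> s' v_xd 0 = m * G \<and>
       (\<forall>i<c. evaluated s' i (real (A * (G + l)) / real (m * G))) \<and>
       s' v_M 0 = exp_sum I (real (A * (G + l)) / real (m * G)) \<and>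
       s' v_L 0 = load_sum I (real (A * (G + l)) / real (m * G)) \<and>
       (\<forall>a. a \<notin> bisect_arrays \<longrightarrow> s' a = s a)"
  have sm: "s v_m 0 = m" "s v_A 0 = A" using ld by (auto simp: loads_def header_def)
  have B01: "0 < B" "1 < B" using less_B_pow[of 1 0] by auto
  define P where "P = (\<lambda>e s'. s' v_G 0 = 2 ^ e \<and> 2 ^ e \<le> 2 * m \<and> bisected (2 ^ e) (s' v_l 0) \<and>
    (\<forall>a. a \<notin> bisect_arrays \<longrightarrow> s' a = s a))"
  define R where "R = (\<lambda>s'. \<exists>e. P e s' \<and> m \<le> 2 ^ e)"
  let ?tb = "max_cost bisect_step + t_all * (c + 1)"
  let ?e = "Less (Var v_G) (Var v_m)"
  have 1: "wp B (v_G ::= Const 1 ;; v_l ::= Const 0) (max_cost (v_G ::= Const 1 ;; v_l ::= Const 0)) (P 0) s"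
    using B01 m_pos bisected_init by (intro wp_vc) (simp add: P_def bisect_arrays_def)
  have 2: "wp B (While ?e bisect_step) (Suc (halvings m) * (1 + cost ?e + ?tb) + (1 + cost ?e)) R s1"
    if P0: "P 0 s1" for s1
  proof (rule wp_while[where I = P and \<mu> = "\<lambda>k. Suc (halvings m) - k" and g = 0])
    fix k s' assume P: "P k s'" and e: "eval ?e s' \<noteq> 0"
    have fr: "s' a = s a" if "a \<notin> bisect_arrays" for a using P that by (simp add: P_def)
    have ld': "loads s'" using loads_frame[OF ld] fr by blast
    have sm': "s' v_m 0 = m" using ld' by (simp add: loads_def header_def)
    have less: "2 ^ k < m" using e P sm' by (simp add: P_def split: if_splits)
    then have "(2::nat) ^ k < 2 ^ Suc (halvings m)" using less_power_halvings[of m] by linarith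
    then have k: "k < Suc (halvings m)" by (rule power_less_imp_less_exp[rotated]) simp
    show "wp B bisect_step ?tb (\<lambda>s''. \<exists>k'. P k' s'' \<and> Suc (halvings m) - k' < Suc (halvings m) - k) s'"
    proof (rule wp_mono[OF wp_bisect_step[OF ld', of "2 ^ k" "s' v_l 0"]])
      fix s2 assume s2: "(\<forall>a. a \<notin> bisect_arrays \<longrightarrow> s2 a = s' a) \<and> s2 v_G 0 = 2 * 2 ^ k \<and>
        bisected (2 * 2 ^ k) (s2 v_l 0)"
      then have "P (Suc k) s2" using fr less by (simp add: P_def)
      then show "\<exists>k'. P k' s2 \<and> Suc (halvings m) - k' < Suc (halvings m) - k"
        using k by (intro exI[of _ "Suc k"]) simp
    qed (use P less in \<open>simp_all add: P_def\<close>)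
  next
    fix k s' assume P: "P k s'" and e: "eval ?e s' = 0"
    have "s' v_m 0 = m" using P sm by (simp add: P_def bisect_arrays_def search_arrays_def)
    then show "R s'" using P e by (auto simp: R_def P_def split: if_splits)
  qed (use P0 in auto)
  have 3: "wp B (to_lower ;; eval_all)
     (max_cost to_lower + t_all * (c + 1))
     ?Q s2" if R: "R s2" for s2
  proof -
    obtain e where P: "P e s2" and me: "m \<le> 2 ^ e" using R by (auto simp: R_def)
    define G where "G = (2::nat) ^ e"
    define l where "l = s2 v_l 0"
    define T where "T = real (A * (G + l)) / real (m * G)"
    have G: "s2 v_G 0 = G" "G \<le> 2 * m" "m \<le> G" "bisected G l" "G \<ge> 1" "l + 1 \<le> G"
      using P me by (auto simp: P_def G_def l_def bisected_def)
    have fr: "s2 a = s a" if "a \<notin> bisect_arrays" for a using P that by (simp add: P_def)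
    have sm2: "s2 v_m 0 = m" "s2 v_A 0 = A" using sm fr by (simp_all add: bisect_arrays_def search_arrays_def)
    have VV: "8 * V \<le> V ^ 2" unfolding power2_eq_square using V(5) by (intro mult_le_mono1) auto
    have "A * (G + l) \<le> V ^ 3" by (rule mult_V[of _ 1 _ 2]) (use G V VV in auto)
    moreover have "m * G \<le> V ^ 3" by (rule mult_V[of _ 1 _ 2]) (use G V VV in auto)
    ultimately have bnd: "A * (G + l) < B" "m * G < B" using less_B_pow[of _ 3] by auto
    define R2 where "R2 = (\<lambda>s3. s3 v_xn 0 = A * (G + l) \<and> s3 v_xd 0 = m * G \<and> (\<forall>a. a \<notin> {v_xn, v_xd} \<longrightarrow> s3 a = s2 a))"
    show ?thesis
    proof (rule wp_seqI[where R = R2])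
      show "wp B to_lower
        (max_cost to_lower) R2 s2"
        using G sm2 bnd B01 by (intro wp_vc) (simp add: to_lower_def R2_def l_def)
    next
      fix s3 assume R2: "R2 s3"
      have fr3: "s3 a = s a" if "a \<notin> bisect_arrays" for a
        using fr R2 that by (simp add: R2_def bisect_arrays_def)
      have ld3: "loads s3" using loads_frame[OF ld] fr3 by blast
      have x3: "s3 v_xn 0 = A * (G + l)" "s3 v_xd 0 = m * G" using R2 by (simp_all add: R2_def)
      have pos: "m * G > 0" using m_pos G by simp
      show "wp B eval_all (t_all * (c + 1)) ?Q s3"
      proof (rule wp_mono[OF wp_eval_all[OF ld3 x3 pos T_def]])
        show "real A / real m \<le> T" unfolding T_def by (rule bisected_ge[OF G(4)])
        fix s4 assume s4: "(\<forall>i<c. evaluated s4 i T) \<and> (\<forall>a. a \<notin> search_arrays \<longrightarrow> s4 a = s3 a) \<and>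
          s4 v_M 0 = exp_sum I T \<and> s4 v_L 0 = load_sum I T"
        have "s4 v_xn 0 = A * (G + l)" "s4 v_xd 0 = m * G"
          using s4 x3 by (simp_all add: search_arrays_def)
        moreover have "s4 a = s a" if "a \<notin> bisect_arrays" for a
          using s4 fr3 that by (simp add: bisect_arrays_def)
        ultimately show "?Q s4"
          using s4 G(2-4) unfolding T_def by (intro exI[of _ G] exI[of _ l]) blast
      qed simp
    qed
  qed
  have "wp B bisect (max_cost (v_G ::= Const 1 ;; v_l ::= Const 0) +
      ((Suc (halvings m) * (1 + cost ?e + ?tb) + (1 + cost ?e)) +
       (max_cost to_lower + t_all * (c + 1)))) ?Q s"
    unfolding bisect_def
    by (rule wp_seqI[OF 1], rule wp_seqI[OF 2], assumption, rule 3)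
  then show ?thesis
  proof (rule wp_mono)
    define a where "a = max_cost (v_G ::= Const 1 ;; v_l ::= Const 0)"
    define b where "b = 1 + cost ?e"
    define x where "x = max_cost to_lower"
    define h where "h = halvings m"
    have "a + ((Suc h * (b + (max_cost bisect_step + t_all * (c + 1))) + b) + (x + t_all * (c + 1)))
      \<le> (a + 2 * (b + max_cost bisect_step + t_all) + x + t_all) * ((c + 1) * (h + 1))"
      by (simp add: algebra_simps)
    then show "a + ((Suc (halvings m) * (1 + cost ?e + ?tb) + (1 + cost ?e)) + (x + t_all * (c + 1)))
      \<le> t_bisect * ((c + 1) * (halvings m + 1))"
      unfolding t_bisect_def a_def b_def x_def h_def by simp
  qed
qed

end

section \<open>Tournament tree over the classes\<close>

abbreviation "a_tree \<equiv> 50 :: nat"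
abbreviation "v_v \<equiv> 51 :: nat"
abbreviation "v_x \<equiv> 55 :: nat"
abbreviation "v_y \<equiv> 56 :: nat"

text \<open>A tournament tree: node \<open>c + i\<close> is the leaf of class \<open>i\<close>, the children of \<open>v\<close> are \<open>2 * v\<close> and
  \<open>2 * v + 1\<close>, and every node holds the class with the smallest key below it.\<close>

definition pick :: com where
  "pick =
    v_x ::= Read a_tree (Mul (Const 2) (Var v_v)) ;;
    v_y ::= Read a_tree (Add (Mul (Const 2) (Var v_v)) (Const 1)) ;;
    Cond (Less (Mul (Read a_kn (Var v_y)) (Read a_kd (Var v_x))) (Mul (Read a_kn (Var v_x)) (Read a_kd (Var v_y))))
      (Write a_tree (Var v_v) (Var v_y)) (Write a_tree (Var v_v) (Var v_x))"

text \<open>The first loop ends with \<open>v_v = c\<close>, so the second one visits the inner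
  nodes from \<open>c - 1\<close> down to 1, children before parents. This numbering works for every
  \<open>c\<close>, not only for powers of two.\<close>

definition build_tree :: com where
  "build_tree =
    v_v ::= Const 0 ;;
    While (Less (Var v_v) (Var v_c)) (Write a_tree (Add (Var v_c) (Var v_v)) (Var v_v) ;; v_v ::= Add (Var v_v) (Const 1)) ;;
    While (Less (Const 1) (Var v_v)) (v_v ::= Sub (Var v_v) (Const 1) ;; pick)"

definition update_path :: com where
  "update_path = v_v ::= Add (Var v_c) (Var v_i) ;;
    While (Less (Const 1) (Var v_v)) (v_v ::= Div (Var v_v) (Const 2) ;; pick)"

definition key :: "memory \<Rightarrow> nat \<Rightarrow> real" where
  "key s i = real (s a_kn i) / real (s a_kd i)"

definition node_ok :: "memory \<Rightarrow> nat \<Rightarrow> bool" where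
  "node_ok s v \<longleftrightarrow> s a_tree v \<in> {s a_tree (2 * v), s a_tree (2 * v + 1)} \<and>
     key s (s a_tree v) \<le> key s (s a_tree (2 * v)) \<and> key s (s a_tree v) \<le> key s (s a_tree (2 * v + 1))"

definition tree_arrays :: "nat set" where
  "tree_arrays = {a_tree, v_v, v_x, v_y}"

text \<open>Halving leads to the parent, so for positive \<open>u\<close> this says that
  \<open>u\<close> lies on the path from \<open>v\<close> to the root, ends included.\<close>

definition anc :: "nat \<Rightarrow> nat \<Rightarrow> bool" where
  "anc u v \<longleftrightarrow> (\<exists>k. u = v div 2 ^ k)"

lemma anc_refl: "anc u u"
  unfolding anc_def by (rule exI[of _ 0]) simp

lemma anc_half: "anc u v \<Longrightarrow> anc (u div 2) v" and anc_cases: "anc u v \<Longrightarrow> u = v \<or> anc u (v div 2)"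
proof -
  assume "anc u v"
  then obtain k where k: "u = v div 2 ^ k" by (auto simp: anc_def)
  then have "u div 2 = v div 2 ^ Suc k" by (simp add: div_mult2_eq[symmetric] mult.commute)
  then show "anc (u div 2) v" unfolding anc_def by blast
  show "u = v \<or> anc u (v div 2)"
  proof (cases k)
    case (Suc k')
    then have "u = (v div 2) div 2 ^ k'" using k by (simp add: div_mult2_eq)
    then show ?thesis by (auto simp: anc_def)
  qed (use k in auto)
qed

lemma anc_half_proper: "anc u v \<Longrightarrow> anc (u div 2) (v div 2)"
proof -
  assume "anc u v"
  then obtain k where "u = v div 2 ^ k" by (auto simp: anc_def)
  then have "u div 2 = (v div 2) div 2 ^ k" by (simp add: div_mult2_eq[symmetric] mult.commute)
  then show ?thesis by (auto simp: anc_def)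
qed

context ram
begin

definition leaves_ok :: "memory \<Rightarrow> bool" where
  "leaves_ok s \<longleftrightarrow> (\<forall>l<c. s a_tree (c + l) = l)"

definition tree_ok :: "memory \<Rightarrow> bool" where
  "tree_ok s \<longleftrightarrow> leaves_ok s \<and> (\<forall>v. 1 \<le> v \<and> v < c \<longrightarrow> node_ok s v)"

definition keys_ok :: "memory \<Rightarrow> bool" where
  "keys_ok s \<longleftrightarrow> (\<forall>i<c. s a_kd i > 0)"

text \<open>A winner is inherited from a child, so it is a leaf below its node. Consequently, nodes
  off the path of a leaf never hold the class of that leaf.\<close>

lemma tree_node:
  assumes "tree_ok s" "1 \<le> u" "u < 2 * c"
  shows "s a_tree u < c \<and> anc u (c + s a_tree u)"
  using assms(2,3)
proof (induction "2 * c - u" arbitrary: u rule: less_induct)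
  case less
  show ?case
  proof (cases "u < c")
    case True
    with assms(1) less have ok: "node_ok s u" by (simp add: tree_ok_def)
    then obtain u' where u': "u' \<in> {2 * u, 2 * u + 1}" "s a_tree u = s a_tree u'"
      by (auto simp: node_ok_def)
    then have "s a_tree u' < c \<and> anc u' (c + s a_tree u')"
      using less.prems True by (intro less.hyps) auto
    moreover have "u' div 2 = u" using u' by auto
    ultimately show ?thesis using u' anc_half[of u' "c + s a_tree u'"] by auto
  next
    case False
    then have "s a_tree (c + (u - c)) = u - c"
      using assms(1) less.prems unfolding tree_ok_def leaves_ok_def by (metis add_diff_inverse_nat less_diff_conv2 mult_2 not_less)
    with False less.prems show ?thesis by (simp add: anc_refl)
  qed
qed

lemma tree_min:
  assumes "tree_ok s" "l < c"
  shows "s a_tree 1 < c" "key s (s a_tree 1) \<le> key s l"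
proof -
  show "s a_tree 1 < c" using tree_node[OF assms(1), of 1] c_pos by simp
  have "key s (s a_tree 1) \<le> key s (s a_tree v)" if "1 \<le> v" "v < 2 * c" for v
    using that
  proof (induction v rule: less_induct)
    case (less v)
    show ?case
    proof (cases "v = 1")
      case False
      then have "v div 2 < v" "1 \<le> v div 2" "v div 2 < c" using less.prems by auto
      then have 1: "key s (s a_tree 1) \<le> key s (s a_tree (v div 2))" "node_ok s (v div 2)"
        using less.IH[of "v div 2"] assms(1) by (auto simp: tree_ok_def)
      have "v = 2 * (v div 2) \<or> v = 2 * (v div 2) + 1" by auto
      then have "key s (s a_tree (v div 2)) \<le> key s (s a_tree v)"
        using 1(2) unfolding node_ok_def by metis
      with 1(1) show ?thesis by linarith
    qed simp
  qed
  from this[of "c + l"] show "key s (s a_tree 1) \<le> key s l"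
    using assms c_pos by (simp add: tree_ok_def leaves_ok_def)
qed

lemma wp_pick:
  assumes w: "s v_v 0 = w" "w < c" and xy: "s a_tree (2 * w) = x" "s a_tree (2 * w + 1) = y" "x < c" "y < c"
    and k: "keys_ok s"
  shows "wp B pick (max_cost pick) (\<lambda>s'. \<exists>z\<in>{x, y}. key s z \<le> key s x \<and> key s z \<le> key s y \<and>
    s' a_tree = (s a_tree)(w := z) \<and> (\<forall>a. a \<notin> {v_x, v_y, a_tree} \<longrightarrow> s' a = s a)) s"
proof (rule wp_vc)
  have cB: "c < B" using less_B_pow[of c 1] V by simp
  have kd: "s a_kd x > 0" "s a_kd y > 0" using k xy by (auto simp: keys_ok_def)
  have less: "key s y < key s x \<longleftrightarrow> s a_kn y * s a_kd x < s a_kn x * s a_kd y"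
  proof -
    have "key s y < key s x \<longleftrightarrow> real (s a_kn y * s a_kd x) < real (s a_kn x * s a_kd y)"
      using kd by (simp add: key_def field_simps)
    then show ?thesis by (simp only: of_nat_less_iff)
  qed
  show "vc B pick (\<lambda>s'. \<exists>z\<in>{x, y}. key s z \<le> key s x \<and> key s z \<le> key s y \<and>
    s' a_tree = (s a_tree)(w := z) \<and> (\<forall>a. a \<notin> {v_x, v_y, a_tree} \<longrightarrow> s' a = s a)) s"
    using w xy cB less unfolding pick_def by (auto simp: not_less)
qed

text \<open>Besides \<open>w\<close> itself, only the parent \<open>w div 2\<close> refers to the
  entry of \<open>w\<close>, so no other node can be spoiled.\<close>

lemma node_ok_pick:
  assumes z: "z \<in> {s a_tree (2 * w), s a_tree (2 * w + 1)}" "key s z \<le> key s (s a_tree (2 * w))"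
      "key s z \<le> key s (s a_tree (2 * w + 1))"
    and s': "s' a_tree = (s a_tree)(w := z)" "s' a_kn = s a_kn" "s' a_kd = s a_kd" and w: "1 \<le> w"
  shows "node_ok s' w" and "u \<noteq> w \<Longrightarrow> u \<noteq> w div 2 \<Longrightarrow> node_ok s u \<Longrightarrow> node_ok s' u"
proof -
  have k: "key s' = key s" using s' by (simp add: key_def fun_eq_iff)
  show "node_ok s' w" using z w by (auto simp: node_ok_def k s')
  assume u: "u \<noteq> w" "u \<noteq> w div 2" "node_ok s u"
  then have "2 * u \<noteq> w" "2 * u + 1 \<noteq> w" by auto
  with u show "node_ok s' u" by (simp add: node_ok_def k s')
qed

definition t_path :: nat where
  "t_path = max_cost (v_v ::= Add (Var v_c) (Var v_i)) +
     (1 + cost (Less (Const 1) (Var v_v)) + max_cost (v_v ::= Div (Var v_v) (Const 2) ;; pick)) +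
     (1 + cost (Less (Const 1) (Var v_v)))"

text \<open>\<open>s0\<close> has the same tree but the keys before the change, for which the tree
  was correct. Only nodes above the changed leaf can be wrong, and they are repaired from the leaf
  upwards.\<close>

lemma wp_update_path:
  assumes i: "s v_i 0 = i" "i < c" and sc: "s v_c 0 = c" and k: "keys_ok s"
    and ok: "tree_ok s0" and s0: "s0 a_tree = s a_tree" "\<And>l. l < c \<Longrightarrow> l \<noteq> i \<Longrightarrow> key s0 l = key s l"
  shows "wp B update_path (t_path * (halvings (2 * c) + 1))
    (\<lambda>s'. tree_ok s' \<and> (\<forall>a. a \<notin> tree_arrays \<longrightarrow> s' a = s a)) s"
proof -
  have B: "2 < B" "2 * c < B" "c < B" "0 < B" using V less_B_pow[of "2 * c" 2] less_B_pow[of 2 1] less_B_pow[of c 1]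
    mult_le_mono[of 2 V c V] by (auto simp: power2_eq_square)
  define P where "P = (\<lambda>v s'. s' v_v 0 = v \<and> 1 \<le> v \<and> v < 2 * c \<and> leaves_ok s' \<and>
    (\<forall>u. 1 \<le> u \<and> u < 2 * c \<longrightarrow> s' a_tree u < c) \<and>
    (\<forall>u. 1 \<le> u \<and> u < c \<and> \<not> anc u (v div 2) \<longrightarrow> node_ok s' u) \<and> (\<forall>a. a \<notin> tree_arrays \<longrightarrow> s' a = s a))"
  let ?e = "Less (Const 1) (Var v_v)"
  let ?b = "v_v ::= Div (Var v_v) (Const 2) ;; pick"
  \<comment> \<open>Neither such a node nor its children hold \<open>i\<close>, so a new key of
    \<open>i\<close> does not affect its condition.\<close>
  have off: "node_ok s u" if u: "1 \<le> u" "u < c" "\<not> anc u ((c + i) div 2)" for u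
  proof -
    have ne: "s a_tree u' \<noteq> i \<and> s a_tree u' < c" if u': "u' = u \<or> u' = 2 * u \<or> u' = 2 * u + 1" for u'
    proof -
      have lt: "1 \<le> u'" "u' < 2 * c" using u u' by auto
      have t: "s a_tree u' < c" "anc u' (c + s a_tree u')" using tree_node[OF ok lt] s0 by auto
      have "s a_tree u' \<noteq> i"
      proof
        assume "s a_tree u' = i"
        then have a: "anc u' (c + i)" using t by simp
        from u' show False
        proof (elim disjE)
          assume "u' = u"
          then show False using anc_cases[OF a] u by auto
        next
          assume "u' = 2 * u"
          then show False using anc_half_proper[OF a] u by simp
        next
          assume "u' = 2 * u + 1"
          then show False using anc_half_proper[OF a] u by simp
        qed
      qed
      with t show ?thesis by simp
    qed
    have "node_ok s0 u" using ok u by (simp add: tree_ok_def)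
    then show ?thesis
      using ne[of u] ne[of "2 * u"] ne[of "2 * u + 1"] s0(2) unfolding node_ok_def s0(1) by simp
  qed
  have 1: "wp B (v_v ::= Add (Var v_c) (Var v_i)) (max_cost (v_v ::= Add (Var v_c) (Var v_i))) (P (c + i)) s"
  proof (rule wp_vc)
    have "leaves_ok s" using ok s0 by (simp add: tree_ok_def leaves_ok_def)
    moreover have "s a_tree u < c" if "1 \<le> u" "u < 2 * c" for u
      using tree_node[OF ok that] s0 by simp
    ultimately have "P (c + i) (s(v_v := (s v_v)(0 := c + i)))"
      unfolding P_def using i off c_pos by (simp add: leaves_ok_def node_ok_def key_def tree_arrays_def)
    then show "vc B (v_v ::= Add (Var v_c) (Var v_i)) (P (c + i)) s"
      using i sc B by simp
  qed
  have step: "wp B ?b (max_cost ?b) (\<lambda>s''. \<exists>v'. P v' s'' \<and> halvings v' < halvings v) s'"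
    if P: "P v s'" and e: "eval ?e s' \<noteq> 0" for v s'
  proof -
    define w where "w = v div 2"
    have v: "s' v_v 0 = v" "1 < v" "v < 2 * c" using P e by (auto simp: P_def split: if_splits)
    then have w: "1 \<le> w" "w < c" by (auto simp: w_def)
    have fr: "s' a = s a" if "a \<notin> tree_arrays" for a using P that by (simp add: P_def)
    define s1 where "s1 = s'(v_v := (s' v_v)(0 := w))"
    have s1: "s1 v_v 0 = w" "s1 a_tree = s' a_tree" "s1 a_kn = s a_kn" "s1 a_kd = s a_kd"
      using fr by (simp_all add: s1_def tree_arrays_def)
    have k1: "keys_ok s1" using k s1 by (simp add: keys_ok_def)
    have xy: "s1 a_tree (2 * w) < c" "s1 a_tree (2 * w + 1) < c" using P w by (auto simp: P_def s1)
    have A: "wp B (v_v ::= Div (Var v_v) (Const 2)) (max_cost (v_v ::= Div (Var v_v) (Const 2))) (\<lambda>s2. s2 = s1) s'"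
      by (rule wp_vc) (use v w B in \<open>simp add: s1_def w_def\<close>)
    show ?thesis
      unfolding max_cost.simps(3)
    proof (rule wp_seqI[OF A])
      fix s2 assume "s2 = s1"
      have "wp B pick (max_cost pick) (\<lambda>s''. \<exists>v'. P v' s'' \<and> halvings v' < halvings v) s1"
      proof (rule wp_mono[OF wp_pick[OF s1(1) w(2) refl refl xy k1] order_refl])
        fix s3 assume "\<exists>z\<in>{s1 a_tree (2 * w), s1 a_tree (2 * w + 1)}.
            key s1 z \<le> key s1 (s1 a_tree (2 * w)) \<and> key s1 z \<le> key s1 (s1 a_tree (2 * w + 1)) \<and>
            s3 a_tree = (s1 a_tree)(w := z) \<and> (\<forall>a. a \<notin> {v_x, v_y, a_tree} \<longrightarrow> s3 a = s1 a)"
        then obtain z where z: "z \<in> {s1 a_tree (2 * w), s1 a_tree (2 * w + 1)}"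
          "key s1 z \<le> key s1 (s1 a_tree (2 * w))" "key s1 z \<le> key s1 (s1 a_tree (2 * w + 1))"
          "s3 a_tree = (s1 a_tree)(w := z)" "\<forall>a. a \<notin> {v_x, v_y, a_tree} \<longrightarrow> s3 a = s1 a" by blast
        have zc: "z < c" using z(1) xy by auto
        have s3k: "s3 a_kn = s1 a_kn" "s3 a_kd = s1 a_kd" using z(5) by simp_all
        note nok = node_ok_pick[OF z(1-4) s3k w(1)]
        have old: "node_ok s1 u" if "1 \<le> u" "u < c" "\<not> anc u w" for u
        proof -
          have "node_ok s' u" using P that by (simp add: P_def w_def)
          then show ?thesis by (simp add: node_ok_def key_def s1_def)
        qed
        have "P w s3"
          unfolding P_def
        proof (intro conjI allI impI)
          show "s3 v_v 0 = w" using z(5) s1 by simp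
          show "1 \<le> w" "w < 2 * c" using w by auto
          show "leaves_ok s3" using P w by (auto simp: P_def leaves_ok_def z(4) s1)
          show "s3 a_tree u < c" if "1 \<le> u \<and> u < 2 * c" for u
            using P that zc by (auto simp: P_def z(4) s1)
          show "node_ok s3 u" if u: "1 \<le> u \<and> u < c \<and> \<not> anc u (w div 2)" for u
          proof (cases "u = w")
            case False
            then have "\<not> anc u w" using anc_cases u by blast
            then have "node_ok s1 u" using old u by simp
            moreover have "u \<noteq> w div 2" using u anc_refl by auto
            ultimately show ?thesis using nok(2) False by simp
          qed (use nok(1) in simp)
          show "s3 a = s a" if "a \<notin> tree_arrays" for a
            using that z(5) fr[OF that] by (simp add: tree_arrays_def s1_def)
        qed
        moreover have "halvings w < halvings v"
          using v by (subst (2) halvings.simps) (simp add: w_def)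
        ultimately show "\<exists>v'. P v' s3 \<and> halvings v' < halvings v" by blast
      qed
      then show "wp B pick (max_cost pick) (\<lambda>s''. \<exists>v'. P v' s'' \<and> halvings v' < halvings v) s2"
        using \<open>s2 = s1\<close> by simp
    qed
  qed
  have 2: "wp B (While ?e ?b) (halvings (2 * c) * (1 + cost ?e + max_cost ?b) + (1 + cost ?e))
    (\<lambda>s'. tree_ok s' \<and> (\<forall>a. a \<notin> tree_arrays \<longrightarrow> s' a = s a)) s1" if P1: "P (c + i) s1" for s1
  proof (rule wp_while[where I = P and \<mu> = halvings and g = "c + i", OF step P1])
    show "halvings (c + i) \<le> halvings (2 * c)" by (rule halvings_mono) (use i in simp)
    fix v s' assume P: "P v s'" and e: "eval ?e s' = 0"
    then have "v = 1" by (auto simp: P_def split: if_splits)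
    \<comment> \<open>At the root the exempt nodes are the ancestors of \<open>1 div 2 = 0\<close>,
      and no positive number is one.\<close>
    moreover have "\<not> anc u 0" if "1 \<le> u" for u using that by (auto simp: anc_def)
    ultimately show "tree_ok s' \<and> (\<forall>a. a \<notin> tree_arrays \<longrightarrow> s' a = s a)"
      using P by (simp add: P_def tree_ok_def)
  qed
  have "wp B update_path (max_cost (v_v ::= Add (Var v_c) (Var v_i)) +
      (halvings (2 * c) * (1 + cost ?e + max_cost ?b) + (1 + cost ?e)))
    (\<lambda>s'. tree_ok s' \<and> (\<forall>a. a \<notin> tree_arrays \<longrightarrow> s' a = s a)) s"
    unfolding update_path_def by (rule wp_seqI[OF 1 2])
  then show ?thesis
  proof (rule wp_mono)
    define h where "h = halvings (2 * c)"
    define x where "x = max_cost (v_v ::= Add (Var v_c) (Var v_i))"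
    define y where "y = 1 + cost ?e"
    have "x + (h * (y + max_cost ?b) + y) \<le> (x + (y + max_cost ?b) + y) * (h + 1)"
      by (simp add: algebra_simps)
    then show "max_cost (v_v ::= Add (Var v_c) (Var v_i)) + (halvings (2 * c) * (1 + cost ?e + max_cost ?b) + (1 + cost ?e))
      \<le> t_path * (halvings (2 * c) + 1)"
      unfolding t_path_def h_def x_def y_def by simp
  qed
qed

definition t_build :: nat where
  "t_build = max_cost (v_v ::= Const 0) +
     (1 + cost (Less (Var v_v) (Var v_c)) +
       max_cost (Write a_tree (Add (Var v_c) (Var v_v)) (Var v_v) ;; v_v ::= Add (Var v_v) (Const 1))) +
     (1 + cost (Less (Var v_v) (Var v_c))) +
     (1 + cost (Less (Const 1) (Var v_v)) + max_cost (v_v ::= Sub (Var v_v) (Const 1) ;; pick)) +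
     (1 + cost (Less (Const 1) (Var v_v)))"

lemma wp_build_tree:
  assumes sc: "s v_c 0 = c" and k: "keys_ok s"
  shows "wp B build_tree (t_build * (c + 1)) (\<lambda>s'. tree_ok s' \<and> (\<forall>a. a \<notin> tree_arrays \<longrightarrow> s' a = s a)) s"
proof -
  have B: "2 < B" "2 * c < B" "c < B" "0 < B" using V less_B_pow[of "2 * c" 2] less_B_pow[of 2 1] less_B_pow[of c 1]
    mult_le_mono[of 2 V c V] by (auto simp: power2_eq_square)
  define P where "P = (\<lambda>v s'. s' v_v 0 = v \<and> v \<le> c \<and> (\<forall>l<v. s' a_tree (c + l) = l) \<and>
     (\<forall>a. a \<notin> tree_arrays \<longrightarrow> s' a = s a))"
  define P' where "P' = (\<lambda>v s'. s' v_v 0 = v \<and> 1 \<le> v \<and> v \<le> c \<and> leaves_ok s' \<and>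
     (\<forall>u. v \<le> u \<and> u < 2 * c \<longrightarrow> s' a_tree u < c) \<and>
     (\<forall>u. v \<le> u \<and> u < c \<longrightarrow> node_ok s' u) \<and> (\<forall>a. a \<notin> tree_arrays \<longrightarrow> s' a = s a))"
  let ?e = "Less (Var v_v) (Var v_c)"
  let ?b = "Write a_tree (Add (Var v_c) (Var v_v)) (Var v_v) ;; v_v ::= Add (Var v_v) (Const 1)"
  let ?e' = "Less (Const 1) (Var v_v)"
  let ?b' = "v_v ::= Sub (Var v_v) (Const 1) ;; pick"
  have 1: "wp B (v_v ::= Const 0) (max_cost (v_v ::= Const 0)) (P 0) s"
    by (rule wp_vc) (use B in \<open>simp add: P_def tree_arrays_def\<close>)
  have step: "wp B ?b (max_cost ?b) (\<lambda>s''. \<exists>v'. P v' s'' \<and> c - v' < c - v) s'"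
    if P: "P v s'" and e: "eval ?e s' \<noteq> 0" for v s'
  proof (rule wp_vc)
    have c: "s' v_c 0 = c" using P sc by (simp add: P_def tree_arrays_def)
    then have v: "s' v_v 0 = v" "v < c" using P e by (auto simp: P_def split: if_splits)
    define s2 where "s2 = (let s1 = s'(a_tree := (s' a_tree)(c + v := v)) in s1(v_v := (s1 v_v)(0 := v + 1)))"
    have "P (v + 1) s2" using P v by (auto simp: P_def s2_def Let_def tree_arrays_def less_Suc_eq)
    then have "\<exists>v'. P v' s2 \<and> c - v' < c - v" using v by (intro exI[of _ "v + 1"]) simp
    then show "vc B ?b (\<lambda>s''. \<exists>v'. P v' s'' \<and> c - v' < c - v) s'"
      using v c B by (simp add: s2_def)
  qed
  have 2: "wp B (While ?e ?b) (c * (1 + cost ?e + max_cost ?b) + (1 + cost ?e)) (P' c) s1"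
    if P1: "P 0 s1" for s1
  proof (rule wp_while[where I = P and \<mu> = "\<lambda>v. c - v" and g = 0, OF step P1])
    show "c - 0 \<le> c" by (rule diff_le_self)
    fix v s' assume P: "P v s'" and e: "eval ?e s' = 0"
    have "s' v_c 0 = c" using P sc by (simp add: P_def tree_arrays_def)
    then have v: "v = c" using P e by (auto simp: P_def split: if_splits)
    have "s' a_tree u < c" if "c \<le> u" "u < 2 * c" for u
    proof -
      have "\<forall>l<c. s' a_tree (c + l) = l" using P v by (simp add: P_def)
      then have "u - c < c \<longrightarrow> s' a_tree (c + (u - c)) = u - c" by blast
      then show ?thesis using that by simp
    qed
    moreover have "\<not> (c \<le> u \<and> u < c)" for u by simp
    moreover have "1 \<le> c" using c_pos by simp
    ultimately show "P' c s'" using P v unfolding P_def P'_def leaves_ok_def by auto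
  qed
  have step': "wp B ?b' (max_cost ?b') (\<lambda>s''. \<exists>v'. P' v' s'' \<and> v' < v) s'"
    if P: "P' v s'" and e: "eval ?e' s' \<noteq> 0" for v s'
  proof -
    define w where "w = v - 1"
    have v: "s' v_v 0 = v" "1 < v" "v \<le> c" using P e by (auto simp: P'_def split: if_splits)
    then have w: "1 \<le> w" "w < c" by (auto simp: w_def)
    have fr: "s' a = s a" if "a \<notin> tree_arrays" for a using P that by (simp add: P'_def)
    define s1 where "s1 = s'(v_v := (s' v_v)(0 := w))"
    have s1: "s1 v_v 0 = w" "s1 a_tree = s' a_tree" "s1 a_kn = s a_kn" "s1 a_kd = s a_kd"
      using fr by (simp_all add: s1_def tree_arrays_def)
    have k1: "keys_ok s1" using k s1 by (simp add: keys_ok_def)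
    have xy: "s1 a_tree (2 * w) < c" "s1 a_tree (2 * w + 1) < c"
      using P w by (auto simp: P'_def s1 w_def)
    have A: "wp B (v_v ::= Sub (Var v_v) (Const 1)) (max_cost (v_v ::= Sub (Var v_v) (Const 1))) (\<lambda>s2. s2 = s1) s'"
      by (rule wp_vc) (use v w B in \<open>simp add: s1_def w_def\<close>)
    show ?thesis
      unfolding max_cost.simps(3)
    proof (rule wp_seqI[OF A])
      fix s2 assume "s2 = s1"
      have "wp B pick (max_cost pick) (\<lambda>s''. \<exists>v'. P' v' s'' \<and> v' < v) s1"
      proof (rule wp_mono[OF wp_pick[OF s1(1) w(2) refl refl xy k1] order_refl])
        fix s3 assume "\<exists>z\<in>{s1 a_tree (2 * w), s1 a_tree (2 * w + 1)}.
            key s1 z \<le> key s1 (s1 a_tree (2 * w)) \<and> key s1 z \<le> key s1 (s1 a_tree (2 * w + 1)) \<and>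
            s3 a_tree = (s1 a_tree)(w := z) \<and> (\<forall>a. a \<notin> {v_x, v_y, a_tree} \<longrightarrow> s3 a = s1 a)"
        then obtain z where z: "z \<in> {s1 a_tree (2 * w), s1 a_tree (2 * w + 1)}"
          "key s1 z \<le> key s1 (s1 a_tree (2 * w))" "key s1 z \<le> key s1 (s1 a_tree (2 * w + 1))"
          "s3 a_tree = (s1 a_tree)(w := z)" "\<forall>a. a \<notin> {v_x, v_y, a_tree} \<longrightarrow> s3 a = s1 a" by blast
        have zc: "z < c" using z(1) xy by auto
        have s3k: "s3 a_kn = s1 a_kn" "s3 a_kd = s1 a_kd" using z(5) by simp_all
        note nok = node_ok_pick[OF z(1-4) s3k w(1)]
        have "P' w s3"
          unfolding P'_def
        proof (intro conjI allI impI)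
          show "s3 v_v 0 = w" using z(5) s1 by simp
          show "1 \<le> w" "w \<le> c" using w by auto
          show "leaves_ok s3" using P w by (auto simp: P'_def leaves_ok_def z(4) s1)
          show "s3 a_tree u < c" if "w \<le> u \<and> u < 2 * c" for u
          proof (cases "u = w")
            case False
            then have "v \<le> u" using that unfolding w_def by linarith
            then show ?thesis using P that False by (simp add: P'_def z(4) s1)
          qed (use zc in \<open>simp add: z(4)\<close>)
          show "node_ok s3 u" if u: "w \<le> u \<and> u < c" for u
          proof (cases "u = w")
            case False
            then have "v \<le> u" using u unfolding w_def by linarith
            then have "node_ok s' u" using P u by (simp add: P'_def)
            then have "node_ok s1 u" by (simp add: node_ok_def key_def s1_def)
            moreover have "u \<noteq> w div 2" using u w by auto
            ultimately show ?thesis using nok(2) False by simp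
          qed (use nok(1) in simp)
          show "s3 a = s a" if "a \<notin> tree_arrays" for a
            using that z(5) fr[OF that] by (simp add: tree_arrays_def s1_def)
        qed
        then show "\<exists>v'. P' v' s3 \<and> v' < v" using v by (intro exI[of _ w]) (simp add: w_def)
      qed
      then show "wp B pick (max_cost pick) (\<lambda>s''. \<exists>v'. P' v' s'' \<and> v' < v) s2"
        using \<open>s2 = s1\<close> by simp
    qed
  qed
  have 3: "wp B (While ?e' ?b') (c * (1 + cost ?e' + max_cost ?b') + (1 + cost ?e'))
    (\<lambda>s'. tree_ok s' \<and> (\<forall>a. a \<notin> tree_arrays \<longrightarrow> s' a = s a)) s1" if P1: "P' c s1" for s1
  proof (rule wp_while[where I = P' and \<mu> = id and g = c])
    show "wp B ?b' (max_cost ?b') (\<lambda>s''. \<exists>v'. P' v' s'' \<and> id v' < id v) s'"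
      if "P' v s'" "eval ?e' s' \<noteq> 0" for v s' using step'[OF that] by simp
    fix v s' assume P: "P' v s'" and e: "eval ?e' s' = 0"
    then have "v = 1" by (auto simp: P'_def split: if_splits)
    then show "tree_ok s' \<and> (\<forall>a. a \<notin> tree_arrays \<longrightarrow> s' a = s a)"
      using P by (simp add: P'_def tree_ok_def)
  qed (use P1 in simp_all)
  have "wp B build_tree (max_cost (v_v ::= Const 0) +
      ((c * (1 + cost ?e + max_cost ?b) + (1 + cost ?e)) + (c * (1 + cost ?e' + max_cost ?b') + (1 + cost ?e'))))
    (\<lambda>s'. tree_ok s' \<and> (\<forall>a. a \<notin> tree_arrays \<longrightarrow> s' a = s a)) s"
    unfolding build_tree_def by (rule wp_seqI[OF 1], rule wp_seqI[OF 2], assumption, rule 3)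
  then show ?thesis
  proof (rule wp_mono)
    define x where "x = max_cost (v_v ::= Const 0)"
    define y where "y = 1 + cost ?e"
    define y' where "y' = 1 + cost ?e'"
    have "x + ((c * (y + max_cost ?b) + y) + (c * (y' + max_cost ?b') + y'))
      \<le> (x + (y + max_cost ?b) + y + (y' + max_cost ?b') + y') * (c + 1)"
      by (simp add: algebra_simps)
    then show "max_cost (v_v ::= Const 0) +
      ((c * (1 + cost ?e + max_cost ?b) + (1 + cost ?e)) + (c * (1 + cost ?e' + max_cost ?b') + (1 + cost ?e')))
      \<le> t_build * (c + 1)"
      unfolding t_build_def x_def y_def y'_def by simp
  qed
qed

end

section \<open>Sweeping the remaining jumps\<close>

abbreviation "v_found \<equiv> 52 :: nat"
abbreviation "v_tn \<equiv> 53 :: nat"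
abbreviation "v_td \<equiv> 54 :: nat"

text \<open>With \<open>Y\<close> for the current point, the candidate \<open>v_tn / v_td\<close> is
  \<open>max Y (L / m)\<close>. It is the answer if \<open>M \<le> m\<close> and it lies strictly
  before the next jump.\<close>

definition check :: com where
  "check =
    v_i ::= Read a_tree (Const 1) ;;
    Cond (e_Le (Mul (Var v_L) (Var v_xd)) (Mul (Var v_m) (Var v_xn)))
      (v_tn ::= Var v_xn ;; v_td ::= Var v_xd) (v_tn ::= Var v_L ;; v_td ::= Var v_m) ;;
    v_found ::= e_And (e_Le (Var v_M) (Var v_m))
      (Less (Mul (Var v_tn) (Read a_kd (Var v_i))) (Mul (Read a_kn (Var v_i)) (Var v_td)))"

text \<open>Only the class with the smallest key changes there: its old contribution is taken out of
  the sums, \<open>eval_class\<close> adds the new one, and only its path in the tree is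
  repaired.\<close>

definition pop :: com where
  "pop =
    (v_xn ::= Read a_kn (Var v_i) ;; v_xd ::= Read a_kd (Var v_i) ;;
     v_M ::= Sub (Var v_M) (Read a_cnt (Var v_i)) ;;
     v_L ::= Sub (Var v_L) (Add e_load (Mul (Read a_mul (Var v_i)) e_setup))) ;;
    eval_class ;; update_path"

definition sweep :: com where
  "sweep = build_tree ;; check ;; While (e_Not (Var v_found)) (pop ;; check)"

context ram
begin

definition sweep_arrays :: "nat set" where
  "sweep_arrays = bisect_arrays \<union> tree_arrays \<union> {v_found, v_tn, v_td}"

definition optimal :: "real \<Rightarrow> bool" where
  "optimal T \<longleftrightarrow> acceptable I T \<and> (\<forall>T'. acceptable I T' \<longrightarrow> T \<le> T')"

text \<open>\<open>y i\<close> is the point at which class \<open>i\<close> was evaluated last, \<open>Y\<close> the current point; no class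
  jumps strictly between \<open>y i\<close> and its key.\<close>

definition sweeping :: "(nat \<Rightarrow> real) \<Rightarrow> memory \<Rightarrow> bool" where
  "sweeping y s \<longleftrightarrow> loads s \<and> tree_ok s \<and> s v_xd 0 > 0 \<and> s v_xn 0 \<le> V ^ 3 \<and> s v_xd 0 \<le> V ^ 3 \<and>
     s v_M 0 = (\<Sum>i<c. cnt_of i (y i)) \<and> s v_L 0 = (\<Sum>i<c. P_of i + mul_of i (y i) * s_of i) \<and>
     (let Y = real (s v_xn 0) / real (s v_xd 0) in
        real A / real m \<le> Y \<and> (\<forall>T. acceptable I T \<longrightarrow> Y \<le> T) \<and>
        (\<forall>i<c. real A / real m \<le> y i \<and> y i \<le> Y \<and> Y \<le> key s i \<and> evaluated s i (y i)))"

definition checked :: "(nat \<Rightarrow> real) \<Rightarrow> memory \<Rightarrow> bool" where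
  "checked y s \<longleftrightarrow> sweeping y s \<and> s v_i 0 < c \<and> (\<forall>l<c. key s (s v_i 0) \<le> key s l) \<and>
     s v_td 0 > 0 \<and> s v_tn 0 \<le> V ^ 5 \<and> s v_td 0 \<le> V ^ 3 \<and>
     (s v_found 0 \<noteq> 0 \<longrightarrow> optimal (real (s v_tn 0) / real (s v_td 0))) \<and>
     (s v_found 0 = 0 \<longrightarrow> (\<forall>T. acceptable I T \<longrightarrow> key s (s v_i 0) \<le> T))"

lemma exp_pos: "i < c \<Longrightarrow> real A / real m \<le> T \<Longrightarrow> 2 * real (s_of i) > T \<Longrightarrow> T > 0"
  using setup_le_base[OF inst, of i] by linarith

lemma class_const:
  assumes "i < c" "real A / real m \<le> y" "y \<le> T" "T < class_key i y"
  shows "cnt_of i T = cnt_of i y" "mul_of i T = mul_of i y"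
proof -
  have "cnt_of i T = cnt_of i y \<and> mul_of i T = mul_of i y"
  proof (cases "2 * real (s_of i) > y")
    case True
    then show ?thesis
      using batches_const[OF True exp_pos[OF assms(1,2) True] assms(3)] assms(4)
      by (simp add: class_key_def exp_machines_def)
  next
    case False
    then show ?thesis using assms(3) by (simp add: batches_def exp_machines_def)
  qed
  then show "cnt_of i T = cnt_of i y" "mul_of i T = mul_of i y" by auto
qed

text \<open>An expensive class has its next jump after \<open>y\<close>. For a cheap one the
  sentinel lies above \<open>2 * A / m\<close>, and \<open>y\<close> cannot exceed this acceptable
  value.\<close>

lemma class_key_ge:
  assumes "i < c" "real A / real m \<le> y" "\<And>T. acceptable I T \<Longrightarrow> y \<le> T"
  shows "y \<le> class_key i y"
proof (cases "2 * real (s_of i) > y")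
  case True
  then show ?thesis using next_jump_gt[OF True exp_pos[OF assms(1,2) True], of "P_of i"] by (simp add: class_key_def)
next
  case False
  have "y \<le> 2 * real A / real m" by (rule assms(3)[OF acceptable_upper[OF inst]])
  also have "\<dots> \<le> (3 * real A + 1) / real m" by (intro divide_right_mono) auto
  finally show ?thesis using False by (simp add: class_key_def)
qed

lemma key_class_key: "evaluated s i y \<Longrightarrow> key s i = class_key i y"
  by (simp add: evaluated_def key_def)

text \<open>Before the smallest key every class keeps the values of its last evaluation. Classes
  that jump at the same point are popped one after another; in between, the smallest key equals the
  current point, so the range in question is empty and outdated sums do no harm.\<close>

lemma sweeping_const:
  assumes sw: "sweeping y s" and T: "real (s v_xn 0) / real (s v_xd 0) \<le> T" "\<And>l. l < c \<Longrightarrow> T < key s l"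
  shows "exp_sum I T = s v_M 0 \<and> load_sum I T = s v_L 0"
proof -
  have "cnt_of i T = cnt_of i (y i) \<and> mul_of i T = mul_of i (y i)" if "i < c" for i
  proof -
    from sw that have a: "real A / real m \<le> y i" "y i \<le> real (s v_xn 0) / real (s v_xd 0)" "evaluated s i (y i)"
      by (simp_all add: sweeping_def Let_def)
    have "y i \<le> T" using a(2) T(1) by linarith
    moreover have "T < class_key i (y i)" using T(2)[OF that] key_class_key[OF a(3)] by simp
    ultimately show ?thesis using class_const[OF that a(1)] by blast
  qed
  then show ?thesis using sw by (simp add: sweeping_def exp_sum_def load_sum_def)
qed

lemma sweeping_cong:
  assumes eq: "\<And>a. a \<notin> {v_i, v_tn, v_td, v_found} \<Longrightarrow> s' a = s a" and sw: "sweeping y s"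
  shows "sweeping y s'"
proof -
  have k: "key s' = key s" by (simp add: key_def fun_eq_iff eq)
  have "loads s' = loads s" by (simp add: loads_def header_def eq)
  moreover have "tree_ok s' = tree_ok s" by (simp add: tree_ok_def leaves_ok_def node_ok_def k eq)
  moreover have "evaluated s' = evaluated s" by (simp add: evaluated_def fun_eq_iff eq)
  moreover have "s' v_xn = s v_xn" "s' v_xd = s v_xd" "s' v_M = s v_M" "s' v_L = s v_L" by (simp_all add: eq)
  ultimately show ?thesis using sw unfolding sweeping_def k by simp
qed

lemma wp_check:
  assumes sw: "sweeping y s"
  shows "wp B check (max_cost check) (\<lambda>s'. checked y s' \<and> (\<forall>a. a \<notin> {v_i, v_tn, v_td, v_found} \<longrightarrow> s' a = s a)) s"
proof (rule wp_vc)
  define Y where "Y = real (s v_xn 0) / real (s v_xd 0)"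
  define xn where "xn = s v_xn 0"
  define xd where "xd = s v_xd 0"
  define L where "L = s v_L 0"
  define i where "i = s a_tree 1"
  have tr: "tree_ok s" and ld: "loads s" and xd: "xd > 0" and xb: "xn \<le> V ^ 3" "xd \<le> V ^ 3"
    and Y: "real A / real m \<le> Y" "\<And>T. acceptable I T \<Longrightarrow> Y \<le> T"
    and y: "\<And>l. l < c \<Longrightarrow> real A / real m \<le> y l" "\<And>l. l < c \<Longrightarrow> evaluated s l (y l)"
    using sw by (auto simp: sweeping_def Let_def Y_def xn_def xd_def)
  have sm: "s v_m 0 = m" using ld by (simp add: loads_def header_def)
  have LV: "L \<le> V ^ 5" using sw mul_sum_le[of y] y by (simp add: sweeping_def L_def)
  have i: "i < c" "\<And>l. l < c \<Longrightarrow> key s i \<le> key s l"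
    using tree_min[OF tr] c_pos by (auto simp: i_def)
  have kd: "s a_kd i > 0" using y(2)[OF i(1)] by (simp add: evaluated_def)
  define tn where "tn = (if L * xd \<le> m * xn then xn else L)"
  define td where "td = (if L * xd \<le> m * xn then xd else m)"
  have tb: "tn \<le> V ^ 5" "td \<le> V ^ 3" "td > 0"
    using LV xb xd m_pos V_pow[of 3 5] V_pow[of 1 3] V(1) by (auto simp: tn_def td_def)
  have bnd: "tn < B" "td < B" "i < B" "1 < B" "0 < B"
    using less_B_pow[OF tb(1)] less_B_pow[OF tb(2)] less_B_pow[of c 1] less_B_pow[of 1 0] V i(1) by auto
  define T where "T = max Y (real L / real m)"
  have T: "T = real tn / real td"
  proof -
    have "real L / real m \<le> Y \<longleftrightarrow> real (L * xd) \<le> real (m * xn)"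
      using xd m_pos by (simp add: Y_def xn_def xd_def field_simps)
    then have "real L / real m \<le> Y \<longleftrightarrow> L * xd \<le> m * xn" by (simp only: of_nat_le_iff)
    then show ?thesis by (auto simp: T_def tn_def td_def Y_def xn_def xd_def max_def)
  qed
  define f where "f \<longleftrightarrow> s v_M 0 \<le> m \<and> tn * s a_kd i < s a_kn i * td"
  have f: "f \<longleftrightarrow> s v_M 0 \<le> m \<and> T < key s i"
  proof -
    have "T < key s i \<longleftrightarrow> real (tn * s a_kd i) < real (s a_kn i * td)"
      using tb(3) kd by (simp add: T key_def field_simps)
    then show ?thesis unfolding f_def by (simp only: of_nat_less_iff)
  qed
  have const: "exp_sum I T' = s v_M 0 \<and> load_sum I T' = L" if "Y \<le> T'" "T' < key s i" for T'
    using sweeping_const[OF sw, of T'] that i(2) unfolding Y_def L_def by fastforce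
  have opt: "optimal (real tn / real td)" if f
    using sweep_found[OF inst Y(1) Y(2) const T_def] that f unfolding optimal_def T[symmetric] by blast
  have low: "key s i \<le> T'" if "\<not> f" "acceptable I T'" for T'
    by (rule sweep_not_found[where Y = Y and X = "key s i" and M = "s v_M 0" and L = L, OF inst])
      (use Y(2) const that f in \<open>auto simp: T_def\<close>)
  define s' where "s' = s(v_i := (s v_i)(0 := i), v_tn := (s v_tn)(0 := tn), v_td := (s v_td)(0 := td),
     v_found := (s v_found)(0 := if f then 1 else 0))"
  have s'k: "key s' = key s" by (simp add: key_def fun_eq_iff s'_def)
  have "sweeping y s'"
    by (rule sweeping_cong[OF _ sw]) (simp add: s'_def)
  then have "checked y s'"
    unfolding checked_def s'k using i tb opt low by (simp add: s'_def)
  moreover have "\<forall>a. a \<notin> {v_i, v_tn, v_td, v_found} \<longrightarrow> s' a = s a" by (simp add: s'_def)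
  ultimately have Q: "checked y s' \<and> (\<forall>a. a \<notin> {v_i, v_tn, v_td, v_found} \<longrightarrow> s' a = s a)" by blast
  show "vc B check (\<lambda>s'. checked y s' \<and> (\<forall>a. a \<notin> {v_i, v_tn, v_td, v_found} \<longrightarrow> s' a = s a)) s"
  proof (cases "L * xd \<le> m * xn")
    case True
    then have "tn = xn" "td = xd" by (simp_all add: tn_def td_def)
    then have eq: "s' = s(v_i := (s v_i)(0 := i), v_tn := (s v_tn)(0 := xn), v_td := (s v_td)(0 := xd),
     v_found := (s v_found)(0 := if s v_M 0 \<le> m \<and> xn * s a_kd i < s a_kn i * xd then 1 else 0))"
      by (simp add: s'_def f_def)
    show ?thesis
      using Q bnd True sm \<open>tn = xn\<close> \<open>td = xd\<close> unfolding eq check_def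
      by (simp add: i_def xn_def xd_def L_def split del: if_split) (auto split: if_splits)
  next
    case False
    then have "tn = L" "td = m" by (simp_all add: tn_def td_def)
    then have eq: "s' = s(v_i := (s v_i)(0 := i), v_tn := (s v_tn)(0 := L), v_td := (s v_td)(0 := m),
     v_found := (s v_found)(0 := if s v_M 0 \<le> m \<and> L * s a_kd i < s a_kn i * m then 1 else 0))"
      by (simp add: s'_def f_def)
    show ?thesis
      using Q bnd False sm \<open>tn = L\<close> \<open>td = m\<close> unfolding eq check_def
      by (simp add: i_def xn_def xd_def L_def split del: if_split) (auto split: if_splits)
  qed
qed

text \<open>Bounds the jumps of class \<open>i\<close> from \<open>y\<close> up to
  \<open>hi\<close>: one for turning cheap, and the drops of its batches down to their value at
  \<open>hi\<close>. The sum over all classes is the measure of the sweep.\<close>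

definition jumps_left :: "real \<Rightarrow> nat \<Rightarrow> real \<Rightarrow> nat" where
  "jumps_left hi i y = (if 2 * real (s_of i) > y
     then 1 + (mul_of i y - max 1 (nat \<lceil>2 * real (P_of i) / hi\<rceil>)) else 0)"

definition t_pop :: nat where
  "t_pop = max_cost (v_xn ::= Read a_kn (Var v_i) ;; v_xd ::= Read a_kd (Var v_i) ;;
     v_M ::= Sub (Var v_M) (Read a_cnt (Var v_i)) ;;
     v_L ::= Sub (Var v_L) (Add e_load (Mul (Read a_mul (Var v_i)) e_setup))) +
     max_cost eval_class + t_path"

lemma wp_pop:
  assumes ck: "checked y s" and nf: "s v_found 0 = 0" and hi: "acceptable I hi"
  shows "wp B pop (t_pop * (halvings (2 * c) + 1)) (\<lambda>s'. \<exists>y'. sweeping y' s' \<and>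
     (\<Sum>i<c. jumps_left hi i (y' i)) < (\<Sum>i<c. jumps_left hi i (y i)) \<and>
     (\<forall>a. a \<notin> sweep_arrays \<longrightarrow> s' a = s a)) s"
proof -
  define i where "i = s v_i 0"
  define X where "X = key s i"
  define Y where "Y = real (s v_xn 0) / real (s v_xd 0)"
  define xn where "xn = s a_kn i"
  define xd where "xd = s a_kd i"
  have sw: "sweeping y s" and i: "i < c" and Xmin: "\<And>l. l < c \<Longrightarrow> X \<le> key s l"
    and low: "\<And>T. acceptable I T \<Longrightarrow> X \<le> T"
    using ck nf by (auto simp: checked_def i_def X_def)
  have tr: "tree_ok s" and ld: "loads s"
    and Y: "real A / real m \<le> Y"
    and y: "\<And>l. l < c \<Longrightarrow> real A / real m \<le> y l" "\<And>l. l < c \<Longrightarrow> y l \<le> Y" "\<And>l. l < c \<Longrightarrow> Y \<le> key s l"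
     "\<And>l. l < c \<Longrightarrow> evaluated s l (y l)"
    using sw by (auto simp: sweeping_def Let_def Y_def)
  have sc: "s v_c 0 = c" "s v_A 0 = A" "s v_m 0 = m" and s0: "s 0 = init_memory (encode_instance I) 0"
    and sP: "s a_P i = P_of i"
    using ld i by (auto simp: loads_def header_def)
  have si: "s 0 (3 + i) = s_of i" using input_setup[OF i] s0 by simp
  have YX: "Y \<le> X" using y(3)[OF i] by (simp add: X_def)
  have AX: "real A / real m \<le> X" using Y YX by linarith
  have ev: "s a_cnt i = cnt_of i (y i)" "s a_mul i = mul_of i (y i)" "xd > 0" "xn \<le> V ^ 2" "xd \<le> V ^ 2"
    "X = real xn / real xd" "X = class_key i (y i)"
    using y(4)[OF i] by (auto simp: evaluated_def xn_def xd_def X_def key_def)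
  define y' where "y' = y(i := X)"
  have y'A: "real A / real m \<le> y' l" if "l < c" for l using y(1)[OF that] AX by (simp add: y'_def)
  define M0 where "M0 = (\<Sum>l\<in>{..<c} - {i}. cnt_of l (y l))"
  define L0 where "L0 = (\<Sum>l\<in>{..<c} - {i}. P_of l + mul_of l (y l) * s_of l)"
  have M: "s v_M 0 = cnt_of i (y i) + M0" and L: "s v_L 0 = P_of i + mul_of i (y i) * s_of i + L0"
    using sw sum.remove[of "{..<c}" i "\<lambda>l. cnt_of l (y l)"] i
      sum.remove[of "{..<c}" i "\<lambda>l. P_of l + mul_of l (y l) * s_of l"]
    by (simp_all add: sweeping_def M0_def L0_def)
  have M': "(\<Sum>l<c. cnt_of l (y' l)) = M0 + cnt_of i X"
    and L': "(\<Sum>l<c. P_of l + mul_of l (y' l) * s_of l) = L0 + (P_of i + mul_of i X * s_of i)"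
    using sum.remove[of "{..<c}" i "\<lambda>l. cnt_of l (y' l)"] i
      sum.remove[of "{..<c}" i "\<lambda>l. P_of l + mul_of l (y' l) * s_of l"]
    by (simp_all add: M0_def L0_def y'_def)
  have MB: "M0 + cnt_of i X < B" and LB: "L0 + (P_of i + mul_of i X * s_of i) < B"
    using less_B_pow[OF cnt_sum_le[of y']] less_B_pow[OF mul_sum_le[of y']] y'A M' L' by auto
  have xB: "xn < B" "xd < B" "0 < B" using less_B_pow[OF ev(4)] less_B_pow[OF ev(5)] less_B_pow[of 1 0] by auto
  define s1 where "s1 = s(v_xn := (s v_xn)(0 := xn), v_xd := (s v_xd)(0 := xd), v_M := (s v_M)(0 := M0),
    v_L := (s v_L)(0 := L0))"
  let ?p = "v_xn ::= Read a_kn (Var v_i) ;; v_xd ::= Read a_kd (Var v_i) ;;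
     v_M ::= Sub (Var v_M) (Read a_cnt (Var v_i)) ;;
     v_L ::= Sub (Var v_L) (Add e_load (Mul (Read a_mul (Var v_i)) e_setup))"
  have ii: "s v_i 0 = i" by (simp add: i_def)
  have 1: "wp B ?p (max_cost ?p) (\<lambda>s2. s2 = s1) s"
    by (rule wp_vc)
      (use M L MB LB xB ii si sP ev(1,2) in \<open>simp add: s1_def xn_def[symmetric] xd_def[symmetric]\<close>)
  have ld1: "loads s1" using ld by (simp add: s1_def loads_def header_def)
  have s1v: "s1 v_i 0 = i" "s1 v_xn 0 = xn" "s1 v_xd 0 = xd" using ii by (simp_all add: s1_def)
  have MB1: "s1 v_M 0 + cnt_of i X < B" and LB1: "s1 v_L 0 + (P_of i + mul_of i X * s_of i) < B"
    using MB LB by (simp_all add: s1_def)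
  note ev_class = wp_eval_class[OF ld1 s1v(1) i s1v(2,3) ev(3,6) AX MB1 LB1]
  have main: "wp B update_path (t_path * (halvings (2 * c) + 1)) (\<lambda>s'. \<exists>y'. sweeping y' s' \<and>
     (\<Sum>i<c. jumps_left hi i (y' i)) < (\<Sum>i<c. jumps_left hi i (y i)) \<and>
     (\<forall>a. a \<notin> sweep_arrays \<longrightarrow> s' a = s a)) s3"
    if s3: "evaluated s3 i X \<and>
     (\<forall>l. l \<noteq> i \<longrightarrow> s3 a_cnt l = s1 a_cnt l \<and> s3 a_mul l = s1 a_mul l \<and> s3 a_kn l = s1 a_kn l \<and> s3 a_kd l = s1 a_kd l) \<and>
     (\<forall>a. a \<notin> {v_b, v_M, v_L, a_cnt, a_mul, a_kn, a_kd} \<longrightarrow> s3 a = s1 a) \<and>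
     s3 v_M 0 = s1 v_M 0 + cnt_of i X \<and> s3 v_L 0 = s1 v_L 0 + (P_of i + mul_of i X * s_of i)" for s3
  proof -
    have fr3: "s3 a = s a" if "a \<notin> sweep_arrays" for a
      using s3 that by (simp add: sweep_arrays_def bisect_arrays_def search_arrays_def s1_def)
    have ev3: "evaluated s3 l (y' l)" if "l < c" for l
    proof (cases "l = i")
      case False
      then have "evaluated s3 l (y l)" using y(4)[OF that] s3 by (simp add: evaluated_def s1_def)
      then show ?thesis using False by (simp add: y'_def)
    qed (use s3 in \<open>simp add: y'_def\<close>)
    have key3: "key s3 l = key s l" if "l < c" "l \<noteq> i" for l
      using s3 that by (simp add: key_def s1_def)
    have v3: "s3 v_i 0 = i" "s3 v_c 0 = c" "s3 v_xn 0 = xn" "s3 v_xd 0 = xd" "s3 a_tree = s a_tree"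
      using s3 ii sc by (simp_all add: s1_def)
    have k3: "keys_ok s3" using ev3 by (simp add: keys_ok_def evaluated_def)
    have key3s: "key s l = key s3 l" if "l < c" "l \<noteq> i" for l using key3[OF that] by simp
    have less: "(\<Sum>l<c. jumps_left hi l (y' l)) < (\<Sum>l<c. jumps_left hi l (y l))"
    proof (rule sum_strict_mono_ex1)
      have step: "jumps_left hi i X < jumps_left hi i (y i)"
      proof -
        \<comment> \<open>The popped class was expensive: otherwise its key would be the sentinel,
          whereas every point reached is at most the acceptable \<open>2 * A / m\<close>.\<close>
        have ex: "2 * real (s_of i) > y i"
        proof (rule ccontr)
          assume "\<not> 2 * real (s_of i) > y i"
          then have "X = (3 * real A + 1) / real m" using ev(7) by (simp add: class_key_def)
          moreover have "X \<le> 2 * real A / real m" by (rule low[OF acceptable_upper[OF inst]])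
          ultimately have "3 * real A + 1 \<le> 2 * real A" using m_pos by (simp add: field_simps)
          then show False by simp
        qed
        show ?thesis
        proof (cases "2 * real (s_of i) > X")
          case True
          have X: "X = next_jump (s_of i) (P_of i) (y i)" using ev(7) ex by (simp add: class_key_def)
          have "mul_of i X < mul_of i (y i)"
            using batches_next_jump[OF ex exp_pos[OF i y(1)[OF i] ex]] True unfolding X by blast
          moreover define b where "b = max 1 (nat \<lceil>2 * real (P_of i) / hi\<rceil>)"
          have "b \<le> mul_of i X"
          proof -
            \<comment> \<open>\<open>X \<le> hi\<close> comes from the failed check, since
              \<open>hi\<close> is acceptable.\<close>
            have "2 * real (P_of i) / hi \<le> 2 * real (P_of i) / X"
              using low[OF hi] exp_pos[OF i AX True] by (intro divide_left_mono) auto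
            then have "nat \<lceil>2 * real (P_of i) / hi\<rceil> \<le> nat \<lceil>2 * real (P_of i) / X\<rceil>"
              by (intro nat_mono ceiling_mono)
            then show ?thesis using True by (simp add: batches_def b_def)
          qed
          ultimately show ?thesis using True ex unfolding jumps_left_def b_def[symmetric] by auto
        qed (use ex in \<open>simp add: jumps_left_def\<close>)
      qed
      show "\<forall>l\<in>{..<c}. jumps_left hi l (y' l) \<le> jumps_left hi l (y l)"
        using step by (auto simp: y'_def)
      show "\<exists>l\<in>{..<c}. jumps_left hi l (y' l) < jumps_left hi l (y l)"
        using step i by (auto simp: y'_def intro!: bexI[of _ i])
    qed simp
    show ?thesis
    proof (rule wp_mono[OF wp_update_path[OF v3(1) i v3(2) k3 tr v3(5)[symmetric] key3s] order_refl])
      fix s4 assume s4: "tree_ok s4 \<and> (\<forall>a. a \<notin> tree_arrays \<longrightarrow> s4 a = s3 a)"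
      have fr4: "s4 a = s a" if "a \<notin> sweep_arrays" for a
        using s4 fr3[OF that] that by (simp add: sweep_arrays_def)
      have eq: "s4 a = s3 a" if "a \<in> {v_xn, v_xd, v_M, v_L, a_cnt, a_mul, a_kn, a_kd}" for a
        using s4 that by (auto simp: tree_arrays_def)
      have k4: "key s4 = key s3" by (simp add: key_def fun_eq_iff eq)
      have "loads s4" using ld fr4
        by (simp add: loads_def header_def sweep_arrays_def bisect_arrays_def search_arrays_def tree_arrays_def)
      moreover have "xn \<le> V ^ 3" "xd \<le> V ^ 3" using ev(4,5) V_pow[of 2 3] by auto
      moreover have "s4 v_M 0 = (\<Sum>l<c. cnt_of l (y' l))" "s4 v_L 0 = (\<Sum>l<c. P_of l + mul_of l (y' l) * s_of l)"
        using s3 M' L' by (simp_all add: eq s1_def)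
      moreover have "real A / real m \<le> y' l \<and> y' l \<le> X \<and> X \<le> key s4 l \<and> evaluated s4 l (y' l)" if l: "l < c" for l
      proof (intro conjI)
        show "real A / real m \<le> y' l" by (rule y'A[OF l])
        show "y' l \<le> X" using y(2)[OF l] YX by (simp add: y'_def)
        show "evaluated s4 l (y' l)" using ev3[OF l] by (simp add: evaluated_def eq)
        show "X \<le> key s4 l"
        proof (cases "l = i")
          case True
          have "X \<le> class_key i X" by (rule class_key_ge[OF i AX low])
          then show ?thesis using key_class_key[OF ev3[OF i]] True by (simp add: k4 y'_def)
        qed (use Xmin[OF l] key3[OF l] in \<open>simp add: k4\<close>)
      qed
      ultimately have "sweeping y' s4"
        using s4 ev(3) AX low v3(3,4) unfolding sweeping_def Let_def by (simp add: eq ev(6)[symmetric])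
      with less fr4 show "\<exists>y'. sweeping y' s4 \<and>
         (\<Sum>i<c. jumps_left hi i (y' i)) < (\<Sum>i<c. jumps_left hi i (y i)) \<and>
         (\<forall>a. a \<notin> sweep_arrays \<longrightarrow> s4 a = s a)" by blast
    qed
  qed
  have "wp B pop (max_cost ?p + (max_cost eval_class + t_path * (halvings (2 * c) + 1))) (\<lambda>s'. \<exists>y'. sweeping y' s' \<and>
     (\<Sum>i<c. jumps_left hi i (y' i)) < (\<Sum>i<c. jumps_left hi i (y i)) \<and>
     (\<forall>a. a \<notin> sweep_arrays \<longrightarrow> s' a = s a)) s"
    unfolding pop_def
  proof (rule wp_seqI[OF 1])
    fix s2 assume "s2 = s1"
    then show "wp B (eval_class ;; update_path) (max_cost eval_class + t_path * (halvings (2 * c) + 1))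
     (\<lambda>s'. \<exists>y'. sweeping y' s' \<and>
     (\<Sum>i<c. jumps_left hi i (y' i)) < (\<Sum>i<c. jumps_left hi i (y i)) \<and>
     (\<forall>a. a \<notin> sweep_arrays \<longrightarrow> s' a = s a)) s2"
      using wp_seqI[OF ev_class main] by simp
  qed
  then show ?thesis
  proof (rule wp_mono)
    define a where "a = max_cost ?p"
    define b where "b = max_cost eval_class"
    have "a + (b + t_path * (halvings (2 * c) + 1)) \<le> (a + b + t_path) * (halvings (2 * c) + 1)"
      by (simp add: algebra_simps)
    then show "max_cost ?p + (max_cost eval_class + t_path * (halvings (2 * c) + 1)) \<le> t_pop * (halvings (2 * c) + 1)"
      unfolding t_pop_def a_def b_def .
  qed
qed

definition t_sweep :: nat where
  "t_sweep = t_build + max_cost check + 4 * (1 + cost (e_Not (Var v_found)) + t_pop + max_cost check) +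
     (1 + cost (e_Not (Var v_found)))"

text \<open>By \<open>batches_interval\<close> the batches of a class can drop at most three times
  before \<open>hi\<close>, and it turns cheap at most once. So there are at most
  \<open>4 * c\<close> pops, each of logarithmic cost.\<close>

lemma wp_sweep:
  assumes ld: "loads s" and bis: "bisected G l" "m \<le> G" "G \<le> 2 * m"
    and x: "s v_xn 0 = A * (G + l)" "s v_xd 0 = m * G"
    and ev: "\<forall>i<c. evaluated s i (real (A * (G + l)) / real (m * G))"
    and sums: "s v_M 0 = exp_sum I (real (A * (G + l)) / real (m * G))"
      "s v_L 0 = load_sum I (real (A * (G + l)) / real (m * G))"
  shows "wp B sweep (t_sweep * ((c + 1) * (halvings (2 * c) + 1)))
    (\<lambda>s'. s' v_td 0 > 0 \<and> s' v_tn 0 \<le> V ^ 5 \<and> s' v_td 0 \<le> V ^ 3 \<and>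
       optimal (real (s' v_tn 0) / real (s' v_td 0)) \<and> (\<forall>a. a \<notin> sweep_arrays \<longrightarrow> s' a = s a)) s"
proof -
  let ?Q = "\<lambda>s'. s' v_td 0 > 0 \<and> s' v_tn 0 \<le> V ^ 5 \<and> s' v_td 0 \<le> V ^ 3 \<and>
       optimal (real (s' v_tn 0) / real (s' v_td 0)) \<and> (\<forall>a. a \<notin> sweep_arrays \<longrightarrow> s' a = s a)"
  define lo where "lo = real (A * (G + l)) / real (m * G)"
  define hi where "hi = real (A * (G + l + 1)) / real (m * G)"
  have G: "G \<ge> 1" "l + 1 \<le> G" using bis by (auto simp: bisected_def)
  have acc: "acceptable I hi" and low: "\<And>T. acceptable I T \<Longrightarrow> lo \<le> T"
    using bis(1) by (auto simp: bisected_def hi_def lo_def)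
  have lohi: "lo \<le> hi" by (rule low[OF acc])
  have Alo: "real A / real m \<le> lo" unfolding lo_def by (rule bisected_ge[OF bis(1)])
  have jl: "jumps_left hi i lo \<le> 4" if i: "i < c" for i
  proof -
    have "mul_of i lo \<le> max 1 (nat \<lceil>2 * real (P_of i) / hi\<rceil>) + 3"
      by (rule batches_interval[OF inst i bis(2), where l = "real l"])
        (auto simp: lo_def hi_def algebra_simps)
    then show ?thesis by (simp only: jumps_left_def split: if_split) linarith
  qed
  have k: "keys_ok s" using ev by (simp add: keys_ok_def evaluated_def)
  have sc: "s v_c 0 = c" using ld by (simp add: loads_def header_def)
  define P where "P = (\<lambda>y s'. checked y s' \<and> (\<forall>a. a \<notin> sweep_arrays \<longrightarrow> s' a = s a))"
  let ?\<mu> = "\<lambda>y. \<Sum>i<c. jumps_left hi i (y i)"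
  let ?h = "halvings (2 * c) + 1"
  let ?e = "e_Not (Var v_found)"
  have 1: "wp B build_tree (t_build * (c + 1)) (\<lambda>s'. sweeping (\<lambda>_. lo) s' \<and> (\<forall>a. a \<notin> sweep_arrays \<longrightarrow> s' a = s a)) s"
  proof (rule wp_mono[OF wp_build_tree[OF sc k] order_refl])
    fix s1 assume s1: "tree_ok s1 \<and> (\<forall>a. a \<notin> tree_arrays \<longrightarrow> s1 a = s a)"
    have fr: "s1 a = s a" if "a \<notin> sweep_arrays" for a using s1 that by (simp add: sweep_arrays_def)
    have eq: "s1 a = s a" if "a \<in> {v_xn, v_xd, v_M, v_L, a_cnt, a_mul, a_kn, a_kd}" for a
      using s1 that by (auto simp: tree_arrays_def)
    have "loads s1" using ld fr
      by (simp add: loads_def header_def sweep_arrays_def bisect_arrays_def search_arrays_def tree_arrays_def)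
    moreover have ev1: "evaluated s1 i lo" if "i < c" for i
      using ev that by (simp add: evaluated_def eq lo_def)
    moreover have "lo \<le> key s1 i" if "i < c" for i
      using class_key_ge[OF that Alo low] key_class_key[OF ev1[OF that]] by simp
    moreover have "A * (G + l) \<le> V ^ 3" "m * G \<le> V ^ 3"
    proof -
      have VV: "8 * V \<le> V ^ 2" unfolding power2_eq_square using V(5) by (intro mult_le_mono1) auto
      show "A * (G + l) \<le> V ^ 3" by (rule mult_V[of _ 1 _ 2]) (use G bis V VV in auto)
      show "m * G \<le> V ^ 3" by (rule mult_V[of _ 1 _ 2]) (use G bis V VV in auto)
    qed
    moreover have "s1 v_M 0 = exp_sum I lo" "s1 v_L 0 = load_sum I lo" using sums by (simp_all add: eq lo_def)
    moreover have "s1 v_xn 0 = A * (G + l)" "s1 v_xd 0 = m * G" using x by (simp_all add: eq)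
    moreover have "m * G > 0" using m_pos G by simp
    ultimately have "sweeping (\<lambda>_. lo) s1"
      using s1 Alo low unfolding sweeping_def Let_def exp_sum_def load_sum_def
      by (simp add: lo_def[symmetric] del: of_nat_mult of_nat_add)
    with fr show "sweeping (\<lambda>_. lo) s1 \<and> (\<forall>a. a \<notin> sweep_arrays \<longrightarrow> s1 a = s a)" by blast
  qed
  have chk: "wp B check (max_cost check) (P y) s1"
    if "sweeping y s1" "\<forall>a. a \<notin> sweep_arrays \<longrightarrow> s1 a = s a" for y s1
    by (rule wp_mono[OF wp_check[OF that(1)] order_refl])
      (use that(2) in \<open>simp add: P_def sweep_arrays_def bisect_arrays_def search_arrays_def\<close>)
  have step: "wp B (pop ;; check) (t_pop * ?h + max_cost check) (\<lambda>s''. \<exists>y'. P y' s'' \<and> ?\<mu> y' < ?\<mu> y) s'"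
    if P: "P y s'" and e: "eval ?e s' \<noteq> 0" for y s'
  proof (rule wp_seqI)
    have "checked y s'" "s' v_found 0 = 0" using P e by (auto simp: P_def)
    then show "wp B pop (t_pop * ?h) (\<lambda>s1. \<exists>y'. sweeping y' s1 \<and> ?\<mu> y' < ?\<mu> y \<and>
       (\<forall>a. a \<notin> sweep_arrays \<longrightarrow> s1 a = s' a)) s'"
      by (rule wp_pop[OF _ _ acc])
    fix s1 assume "\<exists>y'. sweeping y' s1 \<and> ?\<mu> y' < ?\<mu> y \<and> (\<forall>a. a \<notin> sweep_arrays \<longrightarrow> s1 a = s' a)"
    then obtain y' where y': "sweeping y' s1" "?\<mu> y' < ?\<mu> y" "\<forall>a. a \<notin> sweep_arrays \<longrightarrow> s1 a = s' a" by blast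
    have "\<forall>a. a \<notin> sweep_arrays \<longrightarrow> s1 a = s a" using y'(3) P by (simp add: P_def)
    from chk[OF y'(1) this] show "wp B check (max_cost check) (\<lambda>s''. \<exists>y'. P y' s'' \<and> ?\<mu> y' < ?\<mu> y) s1"
      by (rule wp_mono) (use y'(2) in auto)
  qed
  have 2: "wp B (While ?e (pop ;; check)) ((4 * c) * (1 + cost ?e + (t_pop * ?h + max_cost check)) + (1 + cost ?e)) ?Q s1"
    if P1: "P (\<lambda>_. lo) s1" for s1
  proof (rule wp_while[where I = P and \<mu> = ?\<mu> and g = "\<lambda>_. lo", OF step P1])
    have "?\<mu> (\<lambda>_. lo) \<le> (\<Sum>i<c. 4)" by (rule sum_mono) (use jl in simp)
    then show "?\<mu> (\<lambda>_. lo) \<le> 4 * c" by simp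
    fix y s' assume "P y s'" "eval ?e s' = 0"
    then show "?Q s'" by (auto simp: P_def checked_def)
  qed
  have "wp B sweep (t_build * (c + 1) + (max_cost check +
      ((4 * c) * (1 + cost ?e + (t_pop * ?h + max_cost check)) + (1 + cost ?e)))) ?Q s"
    unfolding sweep_def
  proof (rule wp_seqI[OF 1])
    fix s1 assume s1: "sweeping (\<lambda>_. lo) s1 \<and> (\<forall>a. a \<notin> sweep_arrays \<longrightarrow> s1 a = s a)"
    show "wp B (check ;; While ?e (pop ;; check)) (max_cost check +
      ((4 * c) * (1 + cost ?e + (t_pop * ?h + max_cost check)) + (1 + cost ?e))) ?Q s1"
      by (rule wp_seqI[OF chk 2]) (use s1 in auto)
  qed
  then show ?thesis
  proof (rule wp_mono)
    define a where "a = max_cost check"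
    define b where "b = 1 + cost ?e"
    define h where "h = halvings (2 * c)"
    have "t_build * (c + 1) + (a + ((4 * c) * (b + (t_pop * (h + 1) + a)) + b))
      \<le> (t_build + a + 4 * (b + t_pop + a) + b) * ((c + 1) * (h + 1))"
      by (simp add: algebra_simps)
    then show "t_build * (c + 1) + (max_cost check +
      ((4 * c) * (1 + cost ?e + (t_pop * ?h + max_cost check)) + (1 + cost ?e)))
      \<le> t_sweep * ((c + 1) * (halvings (2 * c) + 1))"
      unfolding t_sweep_def a_def b_def h_def .
  qed
qed

end

section \<open>Reading and ordering the jobs\<close>

abbreviation "v_p \<equiv> 57 :: nat"
abbreviation "a_ord \<equiv> 58 :: nat"
abbreviation "v_k \<equiv> 59 :: nat"
abbreviation "v_d \<equiv> 60 :: nat"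
abbreviation "v_H \<equiv> 61 :: nat"
abbreviation "v_e \<equiv> 62 :: nat"

definition "class_at x = Read 0 (Add (Add (Const 3) (Var v_c)) (Mul (Const 2) x))"
definition "time_at x = Read 0 (Add (Add (Const 4) (Var v_c)) (Mul (Const 2) x))"

text \<open>A bucket sort by class: every job is pushed onto the linked list of its class in
  constant time, which avoids the logarithmic factor of sorting by comparisons.\<close>

definition "job_body =
  v_i ::= class_at (Var v_j) ;;
  Write a_P (Var v_i) (Add (Read a_P (Var v_i)) (time_at (Var v_j))) ;;
  Write a_next (Var v_j) (Read a_head (Var v_i)) ;;
  Write a_head (Var v_i) (Add (Var v_j) (Const 1)) ;;
  v_N ::= Add (Var v_N) (time_at (Var v_j)) ;;
  v_j ::= Add (Var v_j) (Const 1)"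

definition "setup_body =
  v_N ::= Add (Var v_N) e_setup ;;
  Cond (Less (Var v_smax) e_setup) (v_smax ::= e_setup) Skip ;;
  v_i ::= Add (Var v_i) (Const 1)"

definition "read_header =
  v_m ::= Read 0 (Const 0) ;; v_c ::= Read 0 (Const 1) ;; v_n ::= Read 0 (Const 2)"

definition "read_end = v_A ::= Mul (Var v_m) (Var v_smax) ;; Cond (Less (Var v_A) (Var v_N)) (v_A ::= Var v_N) Skip"

definition prepare :: com where
  "prepare = read_header ;; While (Less (Var v_j) (Var v_n)) job_body ;; v_i ::= Const 0 ;;
    While (Less (Var v_i) (Var v_c)) setup_body ;; read_end"

text \<open>A link is a job number plus one, and 0 ends the list.\<close>

primrec chain :: "(nat \<Rightarrow> nat) \<Rightarrow> nat \<Rightarrow> nat list \<Rightarrow> bool" where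
  "chain nx p [] \<longleftrightarrow> p = 0"
| "chain nx p (x # xs) \<longleftrightarrow> p = Suc x \<and> chain nx (nx x) xs"

lemma chain_upd: "j \<notin> set xs \<Longrightarrow> chain (nx(j := v)) p xs = chain nx p xs"
  by (induction xs arbitrary: p) auto

text \<open>Each round handles one job or leaves one class, so a single loop of at most
  \<open>n + c\<close> rounds suffices. A class that fails \<open>b\<close> is left without visiting
  its jobs, and no list head is read after the last class.\<close>

definition walk_step :: "expr \<Rightarrow> com" where
  "walk_step b = Cond (e_And b (Var v_p))
     (Write a_ord (Var v_k) (Sub (Var v_p) (Const 1)) ;; v_k ::= Add (Var v_k) (Const 1) ;;
      v_p ::= Read a_next (Sub (Var v_p) (Const 1)))
     (v_i ::= Add (Var v_i) (Const 1) ;;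
      Cond (Less (Var v_i) (Var v_c)) (v_p ::= Read a_head (Var v_i)) Skip)"

definition walk :: "expr \<Rightarrow> com" where
  "walk b = (v_i ::= Const 0 ;; v_p ::= Read a_head (Const 0)) ;; While (Less (Var v_i) (Var v_c)) (walk_step b)"

definition "e_expensive = Less (Var v_H) (Mul e_setup (Var v_d))"

definition arrange :: com where
  "arrange = (v_d ::= Mul (Const 2) (Var v_td) ;; v_H ::= Var v_tn ;; v_k ::= Const 0) ;;
    walk e_expensive ;; v_e ::= Var v_k ;; walk (e_Not e_expensive)"

section \<open>The lists of jobs by class\<close>

context ram
begin

text \<open>Reversed, because new jobs are pushed at the front.\<close>

definition job_list :: "nat \<Rightarrow> nat \<Rightarrow> nat list" where
  "job_list k i = rev (filter (\<lambda>j. job_class I j = i) [0..<k])"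

lemma job_list_Suc: "job_list (Suc k) i = (if job_class I k = i then k # job_list k i else job_list k i)"
  by (simp add: job_list_def)

lemma set_job_list: "set (job_list k i) = {j. j < k \<and> job_class I j = i}"
  by (auto simp: job_list_def)

lemma distinct_job_list: "distinct (job_list k i)"
  by (simp add: job_list_def)

lemma job_class_less: "j < n \<Longrightarrow> job_class I j < c"
proof -
  assume "j < n"
  then have "job_class I j \<in> job_class I ` {0..<n}" by auto
  also have "\<dots> = {0..<c}" using inst by (simp add: valid_instance_def)
  finally show ?thesis by simp
qed

lemma sum_length_job_list: "k \<le> n \<Longrightarrow> (\<Sum>i<c. length (job_list k i)) = k"
proof (induction k)
  case (Suc k)
  have "(\<Sum>i<c. length (job_list (Suc k) i)) = (\<Sum>i<c. length (job_list k i) + (if i = job_class I k then 1 else 0))"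
    by (rule sum.cong) (auto simp: job_list_Suc)
  then show ?case using Suc job_class_less[of k] by (simp add: sum.distrib)
qed (simp add: job_list_def)

definition partial_load :: "nat \<Rightarrow> nat \<Rightarrow> nat" where
  "partial_load k i = (\<Sum>j | j < k \<and> job_class I j = i. proc_time I j)"

lemma partial_load_Suc:
  "partial_load (Suc k) i = partial_load k i + (if job_class I k = i then proc_time I k else 0)"
proof -
  have "{j. j < Suc k \<and> job_class I j = i} =
    (if job_class I k = i then insert k {j. j < k \<and> job_class I j = i} else {j. j < k \<and> job_class I j = i})"
    by (auto simp: less_Suc_eq)
  then show ?thesis by (simp add: partial_load_def)
qed

lemma partial_load_n: "partial_load n i = P_of i"
  by (simp add: partial_load_def class_load_def jobs_of_def)

lemma partial_load_le: "k \<le> n \<Longrightarrow> partial_load k i \<le> P_of i"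
  unfolding partial_load_n[symmetric] unfolding partial_load_def by (rule sum_mono2) auto

lemma sum_partial_load: "k \<le> n \<Longrightarrow> (\<Sum>i<c. partial_load k i) = (\<Sum>j<k. proc_time I j)"
proof (induction k)
  case (Suc k)
  have "(\<Sum>i<c. partial_load (Suc k) i) = (\<Sum>i<c. partial_load k i + (if i = job_class I k then proc_time I k else 0))"
    by (rule sum.cong) (auto simp: partial_load_Suc)
  then show ?case using Suc job_class_less[of k] by (simp add: sum.distrib)
qed (simp add: partial_load_def)

lemma total_load_split: "total_load I = (\<Sum>j<n. proc_time I j) + (\<Sum>i<c. s_of i)"
  using sum_partial_load[of n] by (simp add: total_load_def sum.distrib partial_load_n)

lemma time_le: "k \<le> n \<Longrightarrow> l \<le> c \<Longrightarrow> (\<Sum>j<k. proc_time I j) + (\<Sum>i<l. s_of i) \<le> V"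
proof -
  assume "k \<le> n" "l \<le> c"
  then have "(\<Sum>j<k. proc_time I j) \<le> (\<Sum>j<n. proc_time I j)" "(\<Sum>i<l. s_of i) \<le> (\<Sum>i<c. s_of i)"
    by (auto intro!: sum_mono2)
  then have "(\<Sum>j<k. proc_time I j) + (\<Sum>i<l. s_of i) \<le> total_load I" by (simp add: total_load_split)
  also have "\<dots> \<le> V" using V(4) by (simp add: base_load_def)
  finally show ?thesis .
qed

definition listed :: "memory \<Rightarrow> bool" where
  "listed s \<longleftrightarrow> (\<forall>i<c. chain (s a_next) (s a_head i) (job_list n i))"

definition t_prepare :: nat where
  "t_prepare = max_cost read_header + (1 + cost (Less (Var v_j) (Var v_n)) + max_cost job_body) +
     (1 + cost (Less (Var v_j) (Var v_n))) + max_cost (v_i ::= Const 0) +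
     (1 + cost (Less (Var v_i) (Var v_c)) + max_cost setup_body) + (1 + cost (Less (Var v_i) (Var v_c))) + max_cost read_end"

definition prefix_max :: "nat \<Rightarrow> nat" where
  "prefix_max k = Max (insert 0 (s_of ` {..<k}))"

lemma prefix_max_Suc: "prefix_max (Suc k) = max (prefix_max k) (s_of k)"
proof -
  have "insert 0 (s_of ` {..<Suc k}) = insert (s_of k) (insert 0 (s_of ` {..<k}))" by (auto simp: less_Suc_eq)
  then show ?thesis by (simp add: prefix_max_def max.commute)
qed

lemma max_setup_A: "m * max_setup I \<le> A" "max_setup I \<le> A"
proof -
  show 1: "m * max_setup I \<le> A" by (simp add: base_load_def)
  have "max_setup I \<le> m * max_setup I" using m_pos by simp
  with 1 show "max_setup I \<le> A" by linarith
qed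

lemma wp_prepare:
  assumes s: "s = init_memory (encode_instance I)"
  shows "wp B prepare (t_prepare * (n + c + 1)) (\<lambda>s'. loads s' \<and> listed s' \<and> s' 1 = s 1 \<and>
     (\<forall>a. a \<notin> {v_m, v_c, v_n, v_i, v_j, v_N, v_smax, v_A, a_P, a_head, a_next} \<longrightarrow> s' a = s a)) s"
proof -
  define W where "W = {v_m, v_c, v_n, v_i, v_j, v_N, v_smax, v_A, a_P, a_head, a_next}"
  have z: "s a k = 0" if "a \<noteq> 0" for a k using that s by (simp add: init_memory_def)
  have B: "1 < B" "0 < B" "m < B" "n < B" "c < B" "V < B"
    using less_B_pow[of 1 0] less_B_pow[of m 1] less_B_pow[of n 1] less_B_pow[of c 1] less_B_pow[of V 1] V by auto
  define H where "H = (\<lambda>s'. header s' \<and> (\<forall>a. a \<notin> W \<longrightarrow> s' a = s a))"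
  define P where "P = (\<lambda>k s'. H s' \<and> s' v_j 0 = k \<and> k \<le> n \<and> (\<forall>i<c. s' a_P i = partial_load k i) \<and>
     s' v_N 0 = (\<Sum>j<k. proc_time I j) \<and> s' v_smax 0 = 0 \<and>
     (\<forall>i<c. chain (s' a_next) (s' a_head i) (job_list k i)))"
  define P' where "P' = (\<lambda>k s'. H s' \<and> s' v_i 0 = k \<and> k \<le> c \<and> (\<forall>i<c. s' a_P i = P_of i) \<and>
     s' v_N 0 = (\<Sum>j<n. proc_time I j) + (\<Sum>i<k. s_of i) \<and> s' v_smax 0 = prefix_max k \<and> listed s')"
  let ?e = "Less (Var v_j) (Var v_n)"
  let ?e' = "Less (Var v_i) (Var v_c)"
  have 1: "wp B read_header (max_cost read_header) (P 0) s"
  proof (rule wp_vc)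
    have "s 0 0 = m" "s 0 (Suc 0) = c" "s 0 2 = n" "s 0 = init_memory (encode_instance I) 0"
      using input_machines input_classes input_jobs s by simp_all
    then show "vc B read_header (P 0) s"
      using B by (simp add: read_header_def P_def H_def header_def W_def partial_load_def job_list_def z)
  qed
  have step: "wp B job_body (max_cost job_body) (\<lambda>s''. \<exists>k'. P k' s'' \<and> n - k' < n - k) s'"
    if P: "P k s'" and e: "eval ?e s' \<noteq> 0" for k s'
  proof (rule wp_vc)
    define i where "i = job_class I k"
    define p where "p = proc_time I k"
    have hd: "s' 0 = init_memory (encode_instance I) 0" "s' v_m 0 = m" "s' v_c 0 = c" "s' v_n 0 = n"
      using P by (simp_all add: P_def H_def header_def)
    have k: "s' v_j 0 = k" "k < n" using P e hd by (auto simp: P_def split: if_splits)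
    have i: "i < c" using job_class_less[OF k(2)] by (simp add: i_def)
    have cls: "s' 0 (3 + c + 2 * k) = i" "s' 0 (4 + c + 2 * k) = p"
      using input_job[OF k(2)] hd by (simp_all add: i_def p_def)
    have aP: "s' a_P i = partial_load k i" "s' v_N 0 = (\<Sum>j<k. proc_time I j)" using P i by (simp_all add: P_def)
    have "partial_load (Suc k) i \<le> V"
      using partial_load_le[of "Suc k" i] load_le_V[OF i] k by simp
    then have b1: "partial_load k i + p < B" using B by (simp add: partial_load_Suc i_def p_def)
    have "(\<Sum>j<Suc k. proc_time I j) \<le> V" using time_le[of "Suc k" 0] k by simp
    then have b2: "(\<Sum>j<k. proc_time I j) + p < B" using B by (simp add: p_def)
    have ch: "chain (s' a_next) (s' a_head i) (job_list k i)" using P i by (simp add: P_def)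
    have b3: "s' a_head i < B"
    proof (cases "job_list k i")
      case (Cons x xs)
      then have "x < k" using set_job_list[of k i] by auto
      then show ?thesis using ch Cons k B by simp
    qed (use ch B in simp)
    have b4: "i < B" "k < B" "Suc k < B" using i k B by auto
    define s2 where "s2 = (s'(v_i := (s' v_i)(0 := i), a_P := (s' a_P)(i := partial_load k i + p),
      a_next := (s' a_next)(k := s' a_head i), a_head := (s' a_head)(i := Suc k),
      v_N := (s' v_N)(0 := (\<Sum>j<k. proc_time I j) + p), v_j := (s' v_j)(0 := Suc k)))"
    have "P (Suc k) s2"
      unfolding P_def
    proof (intro conjI allI impI)
      show "H s2" using P by (simp add: P_def H_def header_def s2_def W_def)
      show "s2 v_j 0 = Suc k" "Suc k \<le> n" using k by (simp_all add: s2_def)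
      show "s2 a_P l = partial_load (Suc k) l" if "l < c" for l
        using P that by (simp add: P_def s2_def partial_load_Suc i_def p_def)
      show "s2 v_N 0 = (\<Sum>j<Suc k. proc_time I j)" by (simp add: s2_def p_def)
      show "s2 v_smax 0 = 0" using P by (simp add: P_def s2_def)
      show "chain (s2 a_next) (s2 a_head l) (job_list (Suc k) l)" if l: "l < c" for l
      proof -
        \<comment> \<open>Job \<open>k\<close> is new, so writing its link does not disturb any list
          built so far.\<close>
        have "k \<notin> set (job_list k l)" by (simp add: set_job_list)
        moreover have "chain (s' a_next) (s' a_head l) (job_list k l)" using P l by (simp add: P_def)
        ultimately show ?thesis
          by (simp add: s2_def job_list_Suc i_def[symmetric] chain_upd)
      qed
    qed
    then have "\<exists>k'. P k' s2 \<and> n - k' < n - k" using k by (intro exI[of _ "Suc k"]) simp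
    then show "vc B job_body (\<lambda>s''. \<exists>k'. P k' s'' \<and> n - k' < n - k) s'"
      using k hd cls aP b1 b2 b3 b4 unfolding job_body_def class_at_def time_at_def
      by (simp add: s2_def)
  qed
  have 2: "wp B (While ?e job_body) (n * (1 + cost ?e + max_cost job_body) + (1 + cost ?e)) (P n) s1"
    if P1: "P 0 s1" for s1
  proof (rule wp_while[where I = P and \<mu> = "\<lambda>k. n - k" and g = 0, OF step P1])
    show "n - 0 \<le> n" by (rule diff_le_self)
    fix k s' assume P: "P k s'" and e: "eval ?e s' = 0"
    then have "k = n" by (auto simp: P_def H_def header_def split: if_splits)
    then show "P n s'" using P by simp
  qed
  have 3: "wp B (v_i ::= Const 0) (max_cost (v_i ::= Const 0)) (P' 0) s1" if P1: "P n s1" for s1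
    by (rule wp_vc) (use P1 B in \<open>simp add: P_def P'_def H_def header_def W_def partial_load_n listed_def prefix_max_def\<close>)
  have step': "wp B setup_body (max_cost setup_body) (\<lambda>s''. \<exists>k'. P' k' s'' \<and> c - k' < c - k) s'"
    if P: "P' k s'" and e: "eval ?e' s' \<noteq> 0" for k s'
  proof (rule wp_vc)
    have hd: "s' 0 = init_memory (encode_instance I) 0" "s' v_m 0 = m" "s' v_c 0 = c" "s' v_n 0 = n"
      using P by (simp_all add: P'_def H_def header_def)
    have k: "s' v_i 0 = k" "k < c" using P e hd by (auto simp: P'_def split: if_splits)
    have sk: "s' 0 (3 + k) = s_of k" using input_setup[OF k(2)] hd by simp
    define N where "N = (\<Sum>j<n. proc_time I j) + (\<Sum>i<k. s_of i)"
    have N: "N + s_of k < B" using time_le[of n "Suc k"] k B by (simp add: N_def)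
    have old: "s' v_N 0 = N" "s' v_smax 0 = prefix_max k" using P by (simp_all add: P'_def N_def)
    have sB: "s_of k < B" "Suc k < B" using setup_le_V[OF k(2)] k B by auto
    define s2 where "s2 = s'(v_N := (s' v_N)(0 := N + s_of k), v_smax := (s' v_smax)(0 := prefix_max (Suc k)),
      v_i := (s' v_i)(0 := Suc k))"
    have "P' (Suc k) s2"
      using P k by (simp add: P'_def s2_def H_def header_def W_def listed_def N_def)
    then have Q: "\<exists>k'. P' k' s2 \<and> c - k' < c - k" using k by (intro exI[of _ "Suc k"]) simp
    show "vc B setup_body (\<lambda>s''. \<exists>k'. P' k' s'' \<and> c - k' < c - k) s'"
    proof (cases "prefix_max k < s_of k")
      case True
      then have "prefix_max (Suc k) = s_of k" by (simp add: prefix_max_Suc)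
      then show ?thesis
        using Q k hd sk old N sB B True unfolding setup_body_def by (simp add: s2_def)
    next
      case False
      then have m: "prefix_max (Suc k) = prefix_max k" by (simp add: prefix_max_Suc)
      have "s2 = s'(v_N := (s' v_N)(0 := N + s_of k), v_i := (s' v_i)(0 := Suc k))"
        using old(2) by (auto simp: s2_def m fun_eq_iff)
      then show ?thesis
        using Q k hd sk old N sB B False unfolding setup_body_def by simp
    qed
  qed
  have 4: "wp B (While ?e' setup_body) (c * (1 + cost ?e' + max_cost setup_body) + (1 + cost ?e')) (P' c) s1"
    if P1: "P' 0 s1" for s1
  proof (rule wp_while[where I = P' and \<mu> = "\<lambda>k. c - k" and g = 0, OF step' P1])
    show "c - 0 \<le> c" by (rule diff_le_self)
    fix k s' assume P: "P' k s'" and e: "eval ?e' s' = 0"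
    then have "k = c" by (auto simp: P'_def H_def header_def split: if_splits)
    then show "P' c s'" using P by simp
  qed
  let ?Q = "\<lambda>s'. loads s' \<and> listed s' \<and> s' 1 = s 1 \<and> (\<forall>a. a \<notin> W \<longrightarrow> s' a = s a)"
  have 5: "wp B read_end (max_cost read_end) ?Q s1" if P1: "P' c s1" for s1
  proof (rule wp_vc)
    have hd: "s1 v_m 0 = m" using P1 by (simp add: P'_def H_def header_def)
    have N: "s1 v_N 0 = total_load I" "s1 v_smax 0 = max_setup I"
      using P1 by (simp_all add: P'_def total_load_split prefix_max_def max_setup_def)
    have bnd: "m * max_setup I < B" "total_load I < B"
      using max_setup_A(1) V(4) B by (auto simp: base_load_def)
    show "vc B read_end ?Q s1"
      using hd N bnd P1 B unfolding read_end_def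
      by (auto simp: loads_def base_load_def P'_def H_def header_def W_def listed_def)
  qed
  have "wp B prepare (max_cost read_header + ((n * (1 + cost ?e + max_cost job_body) + (1 + cost ?e)) +
      (max_cost (v_i ::= Const 0) + ((c * (1 + cost ?e' + max_cost setup_body) + (1 + cost ?e')) + max_cost read_end)))) ?Q s"
    unfolding prepare_def
    by (rule wp_seqI[OF 1], rule wp_seqI[OF 2], assumption, rule wp_seqI[OF 3], assumption,
        rule wp_seqI[OF 4], assumption, rule 5)
  then show ?thesis
  proof (rule wp_mono)
    define a where "a = max_cost read_header"
    define b where "b = 1 + cost ?e"
    define b' where "b' = 1 + cost ?e'"
    define x where "x = max_cost (v_i ::= Const 0)"
    have "a + ((n * (b + max_cost job_body) + b) + (x + ((c * (b' + max_cost setup_body) + b') + max_cost read_end)))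
      \<le> (a + (b + max_cost job_body) + b + x + (b' + max_cost setup_body) + b' + max_cost read_end) * (n + c + 1)"
      by (simp add: algebra_simps)
    then show "max_cost read_header + ((n * (1 + cost ?e + max_cost job_body) + (1 + cost ?e)) +
      (max_cost (v_i ::= Const 0) + ((c * (1 + cost ?e' + max_cost setup_body) + (1 + cost ?e')) + max_cost read_end)))
      \<le> t_prepare * (n + c + 1)"
      unfolding t_prepare_def a_def b_def b'_def x_def .
  qed (simp add: W_def)
qed

definition listing :: "memory \<Rightarrow> nat list \<Rightarrow> bool" where
  "listing s xs \<longleftrightarrow> s v_k 0 = length xs \<and> (\<forall>t<length xs. s a_ord t = xs ! t)"

definition walk_arrays :: "nat set" where
  "walk_arrays = {v_i, v_p, v_k, a_ord}"

definition t_walk :: "expr \<Rightarrow> nat" where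
  "t_walk b = max_cost (v_i ::= Const 0 ;; v_p ::= Read a_head (Const 0)) +
     (1 + cost (Less (Var v_i) (Var v_c)) + max_cost (walk_step b)) + (1 + cost (Less (Var v_i) (Var v_c)))"

text \<open>The ghost \<open>(i, dn, rest)\<close> splits the list of the current class into the
  jobs already listed and those still linked from \<open>v_p\<close>; the measure counts remaining
  classes and jobs. \<open>pre\<close> lets the second walk append to the result of the
  first.\<close>

lemma wp_walk:
  assumes ld: "header s" "listed s" and lst: "listing s pre" "length pre \<le> n"
    and b: "\<And>i s'. i < c \<Longrightarrow> s' v_i 0 = i \<Longrightarrow> \<forall>a. a \<notin> walk_arrays \<longrightarrow> s' a = s a \<Longrightarrow> eval b s' \<noteq> 0 \<longleftrightarrow> g i"
  shows "wp B (walk b) (t_walk b * (n + c + 1))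
    (\<lambda>s'. listing s' (pre @ concat (map (job_list n) (filter g [0..<c]))) \<and>
      (\<forall>a. a \<notin> walk_arrays \<longrightarrow> s' a = s a)) s"
proof -
  have hd: "s v_c 0 = c" using ld by (simp add: header_def)
  have BV: "V ^ 2 < B" using less_B_pow[of "V ^ 2" 2] by simp
  have VV: "8 * V \<le> V ^ 2" unfolding power2_eq_square using V(5) by (intro mult_le_mono1) auto
  have B: "0 < B" "1 < B" "2 * n + 1 < B" "c < B" using BV VV V by linarith+
  define cc where "cc = (\<lambda>i. concat (map (job_list n) (filter g [0..<i])))"
  have cc_Suc: "cc (Suc i) = cc i @ (if g i then job_list n i else [])" for i by (simp add: cc_def)
  have len_cc: "length (cc i) \<le> (\<Sum>l<i. length (job_list n l))" for i
    by (induction i) (auto simp: cc_Suc, simp add: cc_def)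
  have len_all: "(\<Sum>l<i. length (job_list n l)) \<le> n" if "i \<le> c" for i
  proof -
    have "(\<Sum>l<i. length (job_list n l)) \<le> (\<Sum>l<c. length (job_list n l))" by (rule sum_mono2) (use that in auto)
    then show ?thesis by (simp add: sum_length_job_list)
  qed
  define P where "P = (\<lambda>(i, dn, rest) s'. s' v_i 0 = i \<and> i \<le> c \<and> listing s' (pre @ cc i @ dn) \<and>
     (if i < c then job_list n i = dn @ rest \<and> chain (s' a_next) (s' v_p 0) rest \<and> (\<not> g i \<longrightarrow> dn = [])
      else dn = [] \<and> rest = []) \<and>
     (\<forall>a. a \<notin> walk_arrays \<longrightarrow> s' a = s a))"
  define \<mu> where "\<mu> = (\<lambda>(i, dn::nat list, rest::nat list). (c - i) + length rest + (\<Sum>l\<in>{Suc i..<c}. length (job_list n l)))"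
  let ?e = "Less (Var v_i) (Var v_c)"
  have head: "s a_head i \<le> n" if "i < c" for i
  proof -
    have ch: "chain (s a_next) (s a_head i) (job_list n i)" using ld(2) that by (simp add: listed_def)
    show ?thesis
    proof (cases "job_list n i")
      case (Cons x xs)
      then have "x < n" using set_job_list[of n i] by auto
      then show ?thesis using ch Cons by simp
    qed (use ch in simp)
  qed
  have 1: "wp B (v_i ::= Const 0 ;; v_p ::= Read a_head (Const 0)) (max_cost (v_i ::= Const 0 ;; v_p ::= Read a_head (Const 0)))
     (P (0, [], job_list n 0)) s"
  proof (rule wp_vc)
    have "s a_head 0 < B" using head[OF c_pos] B(3) by linarith
    then show "vc B (v_i ::= Const 0 ;; v_p ::= Read a_head (Const 0)) (P (0, [], job_list n 0)) s"
      using B c_pos ld(2) lst(1) by (simp add: P_def cc_def walk_arrays_def listing_def listed_def)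
  qed
  have step: "wp B (walk_step b) (max_cost (walk_step b)) (\<lambda>s''. \<exists>x'. P x' s'' \<and> \<mu> x' < \<mu> x) s'"
    if P: "P x s'" and e: "eval ?e s' \<noteq> 0" for x s'
  proof (rule wp_vc)
    obtain i dn rest where x: "x = (i, dn, rest)" by (cases x)
    have fr: "\<forall>a. a \<notin> walk_arrays \<longrightarrow> s' a = s a" using P by (simp add: P_def x)
    then have hd': "s' v_c 0 = c" "s' a_next = s a_next" "s' a_head = s a_head" using hd by (simp_all add: walk_arrays_def)
    have i: "s' v_i 0 = i" "i < c" using P e hd' by (auto simp: P_def x split: if_splits)
    have inv: "listing s' (pre @ cc i @ dn)" "job_list n i = dn @ rest" "chain (s a_next) (s' v_p 0) rest" "\<not> g i \<longrightarrow> dn = []"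
      using P i hd' by (simp_all add: P_def x)
    have g: "eval b s' \<noteq> 0 \<longleftrightarrow> g i" by (rule b[OF i(2,1) fr])
    have lk: "s' v_k 0 = length (pre @ cc i @ dn)" using inv by (simp add: listing_def)
    have len: "length (pre @ cc i @ dn) \<le> 2 * n"
    proof -
      have "length (cc i) + length (job_list n i) \<le> (\<Sum>l<Suc i. length (job_list n l))" using len_cc[of i] by simp
      also have "\<dots> \<le> n" using len_all[of "Suc i"] i by simp
      finally show ?thesis using lst(2) inv(2) by simp
    qed
    show "vc B (walk_step b) (\<lambda>s''. \<exists>x'. P x' s'' \<and> \<mu> x' < \<mu> x) s'"
    proof (cases "g i \<and> s' v_p 0 \<noteq> 0")
      case True
      then obtain j rest' where r: "rest = j # rest'" using inv(3) by (cases rest) auto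
      then have p: "s' v_p 0 = Suc j" "chain (s a_next) (s a_next j) rest'" using inv(3) by simp_all
      have j: "j < n" using set_job_list[of n i] inv(2) r by auto
      have nb: "s a_next j < B"
      proof (cases rest')
        case (Cons y ys)
        then have "y < n" using set_job_list[of n i] inv(2) r by auto
        then show ?thesis using p(2) Cons B by simp
      qed (use p(2) B in simp)
      define L where "L = length (pre @ cc i @ dn)"
      define s2 where "s2 = s'(a_ord := (s' a_ord)(L := j), v_k := (s' v_k)(0 := Suc L), v_p := (s' v_p)(0 := s a_next j))"
      have "listing s2 (pre @ cc i @ dn @ [j])"
        unfolding listing_def
      proof (intro conjI allI impI)
        show "s2 v_k 0 = length (pre @ cc i @ dn @ [j])" by (simp add: s2_def L_def)
        fix t assume t: "t < length (pre @ cc i @ dn @ [j])"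
        have "(pre @ cc i @ dn @ [j]) ! t = ((pre @ cc i @ dn) @ [j]) ! t" by simp
        also have "\<dots> = (if t < L then (pre @ cc i @ dn) ! t else j)"
          using t by (simp only: nth_append L_def[symmetric]) (auto simp: L_def less_Suc_eq)
        finally show "s2 a_ord t = (pre @ cc i @ dn @ [j]) ! t"
          using inv(1) t by (auto simp: s2_def listing_def L_def less_Suc_eq)
      qed
      then have "P (i, dn @ [j], rest') s2"
        using P i inv r p True hd' fr by (simp add: P_def x s2_def walk_arrays_def)
      moreover have "\<mu> (i, dn @ [j], rest') < \<mu> x" by (simp add: x \<mu>_def r)
      ultimately have Q: "\<exists>x'. P x' s2 \<and> \<mu> x' < \<mu> x" by blast
      have "L < B" "Suc L < B" "j < B" using len B j unfolding L_def by linarith+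
      then show ?thesis
        using Q True g p lk[folded L_def] hd' nb B unfolding walk_step_def
        by (simp add: s2_def)
    next
      case False
      have dn: "dn = (if g i then job_list n i else [])"
        using False inv(2-4) by (cases rest) auto
      define p' where "p' = (if Suc i < c then s a_head (Suc i) else s' v_p 0)"
      define s2 where "s2 = s'(v_i := (s' v_i)(0 := Suc i), v_p := (s' v_p)(0 := p'))"
      define rest' where "rest' = (if Suc i < c then job_list n (Suc i) else [])"
      have "listing s2 (pre @ cc (Suc i) @ [])"
        using inv(1) by (simp add: listing_def s2_def cc_Suc dn)
      then have "P (Suc i, [], rest') s2"
        using i fr ld(2) hd' by (simp add: P_def s2_def walk_arrays_def rest'_def p'_def listed_def)
      moreover have "\<mu> (Suc i, [], rest') < \<mu> x"
      proof (cases "Suc i < c")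
        case True
        then have "(\<Sum>l\<in>{Suc i..<c}. length (job_list n l)) = length (job_list n (Suc i)) + (\<Sum>l\<in>{Suc (Suc i)..<c}. length (job_list n l))"
          by (simp add: sum.atLeast_Suc_lessThan)
        then show ?thesis using i True by (simp add: x \<mu>_def rest'_def)
      qed (use i in \<open>simp add: x \<mu>_def rest'_def\<close>)
      ultimately have Q: "\<exists>x'. P x' s2 \<and> \<mu> x' < \<mu> x" by blast
      have ne: "eval b s' * s' v_p 0 = 0" using False g by auto
      have iB: "Suc i < B" using i B by simp
      show ?thesis
      proof (cases "Suc i < c")
        case True
        have "s a_head (Suc i) < B" using head[OF True] B(3) by linarith
        then show ?thesis
          using Q True ne i hd' iB B unfolding walk_step_def
          by (simp add: s2_def p'_def)
      next
        case nc: False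
        have "s2 = s'(v_i := (s' v_i)(0 := Suc i))" using nc by (auto simp: s2_def p'_def fun_eq_iff)
        then show ?thesis
          using Q nc ne i hd' iB B unfolding walk_step_def by simp
      qed
    qed
  qed
  have 2: "wp B (While ?e (walk_step b)) ((n + c) * (1 + cost ?e + max_cost (walk_step b)) + (1 + cost ?e))
    (\<lambda>s'. listing s' (pre @ cc c) \<and> (\<forall>a. a \<notin> walk_arrays \<longrightarrow> s' a = s a)) s1"
    if P1: "P (0, [], job_list n 0) s1" for s1
  proof (rule wp_while[where I = P and \<mu> = \<mu> and g = "(0, [], job_list n 0)", OF step P1])
    have "(\<Sum>l<c. length (job_list n l)) = length (job_list n 0) + (\<Sum>l\<in>{Suc 0..<c}. length (job_list n l))"
      using c_pos by (simp add: lessThan_atLeast0 sum.atLeast_Suc_lessThan)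
    then show "\<mu> (0, [], job_list n 0) \<le> n + c" by (simp add: \<mu>_def sum_length_job_list)
    fix x s' assume P: "P x s'" and e: "eval ?e s' = 0"
    obtain i dn rest where x: "x = (i, dn, rest)" by (cases x)
    have "s' v_c 0 = c" using P hd by (simp add: P_def x walk_arrays_def)
    then have "i = c" using P e by (auto simp: P_def x split: if_splits)
    then show "listing s' (pre @ cc c) \<and> (\<forall>a. a \<notin> walk_arrays \<longrightarrow> s' a = s a)"
      using P by (auto simp: P_def x)
  qed
  have "wp B (walk b) (max_cost (v_i ::= Const 0 ;; v_p ::= Read a_head (Const 0)) +
      ((n + c) * (1 + cost ?e + max_cost (walk_step b)) + (1 + cost ?e)))
    (\<lambda>s'. listing s' (pre @ cc c) \<and> (\<forall>a. a \<notin> walk_arrays \<longrightarrow> s' a = s a)) s"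
    unfolding walk_def by (rule wp_seqI[OF 1 2])
  then show ?thesis
  proof (rule wp_mono)
    define a where "a = max_cost (v_i ::= Const 0 ;; v_p ::= Read a_head (Const 0))"
    define b' where "b' = 1 + cost ?e"
    have "a + ((n + c) * (b' + max_cost (walk_step b)) + b') \<le> (a + (b' + max_cost (walk_step b)) + b') * (n + c + 1)"
      by (simp add: algebra_simps)
    then show "max_cost (v_i ::= Const 0 ;; v_p ::= Read a_head (Const 0)) +
      ((n + c) * (1 + cost ?e + max_cost (walk_step b)) + (1 + cost ?e)) \<le> t_walk b * (n + c + 1)"
      unfolding t_walk_def a_def b'_def .
  qed (simp add: cc_def)
qed

section \<open>The order of the jobs for the placement\<close>

definition jobs_in :: "(nat \<Rightarrow> bool) \<Rightarrow> nat list" where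
  "jobs_in g = concat (map (job_list n) (filter g [0..<c]))"

definition costly :: "nat \<Rightarrow> nat \<Rightarrow> nat \<Rightarrow> bool" where
  "costly H d i \<longleftrightarrow> H < s_of i * d"

definition order :: "nat \<Rightarrow> nat \<Rightarrow> nat list" where
  "order H d = jobs_in (costly H d) @ jobs_in (\<lambda>i. \<not> costly H d i)"

lemma set_jobs_in: "set (jobs_in g) = {j. j < n \<and> g (job_class I j)}"
  using job_class_less by (auto simp: jobs_in_def set_job_list)

lemma distinct_concat_jobs: "distinct is \<Longrightarrow> distinct (concat (map (job_list n) is))"
  by (induction "is") (auto simp: distinct_job_list set_job_list)

lemma sorted_concat_jobs: "sorted is \<Longrightarrow> sorted (map (job_class I) (concat (map (job_list n) is)))"
proof (induction "is")
  case (Cons i "is")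
  have "map (job_class I) (job_list n i) = map (\<lambda>_. i) (job_list n i)"
    by (rule map_cong) (auto simp: set_job_list)
  then show ?case using Cons by (auto simp: sorted_append set_job_list map_replicate_const)
qed simp

lemma distinct_order: "distinct (order H d)"
  by (auto simp: order_def set_jobs_in) (auto simp: jobs_in_def intro!: distinct_concat_jobs)

lemma set_order: "set (order H d) = {..<n}"
  by (auto simp: order_def set_jobs_in)

lemma length_order: "length (order H d) = n"
  using distinct_card[OF distinct_order[of H d]] by (simp add: set_order)

lemma sorted_jobs_in: "sorted (map (job_class I) (jobs_in g))"
  unfolding jobs_in_def by (rule sorted_concat_jobs) (simp add: sorted_wrt_filter)

text \<open>With \<open>d = 2 * td\<close> and \<open>H = tn\<close>, the quotient
  \<open>H / d\<close> is exactly \<open>T / 2\<close>. The acceptance conditions at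
  \<open>T = tn / td\<close> become the hypotheses of the placement after clearing
  denominators.\<close>

lemma placement_order:
  assumes td: "td > 0" and acc: "acceptable I (real tn / real td)"
  shows "placement I (2 * td) tn (length (jobs_in (costly tn (2 * td)))) (nth (order tn (2 * td)))
    (\<lambda>i. mul_of i (real tn / real td))"
proof
  define T where "T = real tn / real td"
  let ?g = "costly tn (2 * td)"
  let ?E = "jobs_in ?g" and ?C = "jobs_in (\<lambda>i. \<not> ?g i)"
  have len: "length ?E + length ?C = n" using length_order[of tn "2 * td"] by (simp add: order_def)
  have s: "real (s_of i) \<le> T" if "i < c" for i using acc that by (simp add: acceptable_def T_def)
  have g: "?g i \<longleftrightarrow> 2 * real (s_of i) > T" for i
  proof -
    have "2 * real (s_of i) > T \<longleftrightarrow> real tn < real (s_of i * (2 * td))"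
      using td by (simp add: T_def field_simps)
    then show ?thesis by (simp only: of_nat_less_iff costly_def)
  qed
  show "valid_instance I" by (rule inst)
  show "2 * td > 0" using td by simp
  show "s_of i * (2 * td) \<le> 2 * tn" if "i < c" for i
  proof -
    have "real (s_of i * (2 * td)) \<le> real (2 * tn)" using s[OF that] td by (simp add: T_def field_simps)
    then show ?thesis by (simp only: of_nat_le_iff)
  qed
  show "bij_betw (nth (order tn (2 * td))) {..<n} {..<n}"
    by (rule bij_betw_nth) (simp_all add: distinct_order length_order set_order)
  show "length ?E \<le> n" using len by simp
  have in_E: "order tn (2 * td) ! t = ?E ! t \<and> ?E ! t \<in> set ?E" if "t < length ?E" for t
    using that by (simp add: order_def nth_append)
  have in_C: "order tn (2 * td) ! t = ?C ! (t - length ?E) \<and> ?C ! (t - length ?E) \<in> set ?C"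
    if "length ?E \<le> t" "t < n" for t
    using that len by (simp add: order_def nth_append)
  show "tn < s_of (job_class I (order tn (2 * td) ! t)) * (2 * td)" if "t < length ?E" for t
    using in_E[OF that] by (simp add: set_jobs_in costly_def)
  show "s_of (job_class I (order tn (2 * td) ! t)) * (2 * td) \<le> tn" if "length ?E \<le> t" "t < n" for t
    using in_C[OF that] by (simp add: set_jobs_in costly_def)
  show "job_class I (order tn (2 * td) ! t) \<le> job_class I (order tn (2 * td) ! t')"
    if "t \<le> t'" "t' < length ?E" for t t'
    using sorted_nth_mono[OF sorted_jobs_in[of ?g] that(1)] in_E[of t] in_E[of t'] that by simp
  show "job_class I (order tn (2 * td) ! t) \<le> job_class I (order tn (2 * td) ! t')"
    if "length ?E \<le> t" "t \<le> t'" "t' < n" for t t'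
    using sorted_nth_mono[OF sorted_jobs_in[of "\<lambda>i. \<not> ?g i"], of "t - length ?E" "t' - length ?E"]
      in_C[of t] in_C[of t'] that len by simp
  show "1 \<le> mul_of i (real tn / real td)" for i by (rule batches_ge1)
  show "P_of i * (2 * td) \<le> mul_of i (real tn / real td) * tn" if "i < c" "tn < s_of i * (2 * td)" for i
  proof -
    have ex: "2 * real (s_of i) > T" using that(2) g by (simp add: costly_def)
    with s[OF that(1)] have T: "T > 0" by linarith
    have "2 * real (P_of i) / T \<le> real (mul_of i T)"
    proof -
      have "2 * real (P_of i) / T \<le> real (nat \<lceil>2 * real (P_of i) / T\<rceil>)" by linarith
      also have "\<dots> \<le> real (mul_of i T)" using ex by (simp add: batches_def)
      finally show ?thesis .
    qed
    then have "2 * real (P_of i) \<le> real (mul_of i T) * T" using T by (simp add: field_simps)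
    then have "real (P_of i * (2 * td)) \<le> real (mul_of i T * tn)"
      using td by (simp add: T_def[symmetric]) (simp add: T_def field_simps)
    then show ?thesis by (simp only: of_nat_le_iff T_def)
  qed
  have "(\<Sum>i<c. if tn < s_of i * (2 * td) then mul_of i T else 0) = exp_sum I T"
    unfolding exp_sum_def by (rule sum.cong) (use g in \<open>auto simp: exp_machines_def costly_def\<close>)
  moreover have "exp_sum I T \<le> m" using acc by (simp add: acceptable_def T_def exp_sum_def)
  ultimately show "(\<Sum>i<c. if tn < s_of i * (2 * td) then mul_of i (real tn / real td) else 0) \<le> m"
    unfolding T_def by simp
  have "real (load_sum I T) \<le> real m * T" using acc by (simp add: acceptable_def T_def load_sum_def)
  then have "real (load_sum I T * (2 * td)) \<le> real (m * (2 * tn))" using td by (simp add: T_def field_simps)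
  then have "load_sum I T * (2 * td) \<le> m * (2 * tn)" by (simp only: of_nat_le_iff)
  moreover have "(\<Sum>i<c. P_of i * (2 * td) + mul_of i T * (s_of i * (2 * td))) = load_sum I T * (2 * td)"
    unfolding load_sum_def sum_distrib_right by (rule sum.cong) (simp_all add: algebra_simps)
  ultimately show "(\<Sum>i<c. P_of i * (2 * td) + mul_of i (real tn / real td) * (s_of i * (2 * td))) \<le> m * (2 * tn)"
    by (simp add: T_def)
qed

definition arrange_arrays :: "nat set" where
  "arrange_arrays = walk_arrays \<union> {v_d, v_H, v_e}"

definition t_arrange :: nat where
  "t_arrange = max_cost (v_d ::= Mul (Const 2) (Var v_td) ;; v_H ::= Var v_tn ;; v_k ::= Const 0) +
     t_walk e_expensive + max_cost (v_e ::= Var v_k) + t_walk (e_Not e_expensive)"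

lemma wp_arrange:
  assumes ld: "loads s" "listed s" and x: "s v_tn 0 = tn" "s v_td 0 = td" and bnd: "tn \<le> V ^ 5" "td \<le> V ^ 3"
  shows "wp B arrange (t_arrange * (n + c + 1)) (\<lambda>s'. listing s' (order tn (2 * td)) \<and>
     s' v_d 0 = 2 * td \<and> s' v_H 0 = tn \<and> s' v_e 0 = length (jobs_in (costly tn (2 * td))) \<and>
     (\<forall>a. a \<notin> arrange_arrays \<longrightarrow> s' a = s a)) s"
proof -
  let ?g = "costly tn (2 * td)"
  let ?E = "jobs_in ?g" and ?C = "jobs_in (\<lambda>i. \<not> ?g i)"
  have len: "length ?E + length ?C = n" using length_order[of tn "2 * td"] by (simp add: order_def)
  have VV: "2 * V ^ 3 \<le> V ^ 4"
  proof -
    have "2 * V ^ 3 \<le> V * V ^ 3" using V(5) by (intro mult_le_mono1) simp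
    then show ?thesis by (simp add: numeral_eq_Suc)
  qed
  have B: "tn < B" "2 * td < B" "0 < B" "n < B"
    using less_B_pow[OF bnd(1)] less_B_pow[of "2 * td" 4] less_B_pow[of 1 0] less_B_pow[of n 1] VV bnd(2) V by auto
  have hd: "header s" using ld by (simp add: loads_def)
  define R where "R = (\<lambda>s'. s' v_d 0 = 2 * td \<and> s' v_H 0 = tn \<and> (\<forall>a. a \<notin> arrange_arrays \<longrightarrow> s' a = s a))"
  have R: "header s'" "listed s'" if "R s'" for s'
    using hd ld that by (auto simp: R_def header_def listed_def arrange_arrays_def walk_arrays_def)
  have ev: "eval e_expensive s2 \<noteq> 0 \<longleftrightarrow> ?g i"
    if "R s1" "i < c" "s2 v_i 0 = i" "\<forall>a. a \<notin> walk_arrays \<longrightarrow> s2 a = s1 a" for s1 s2 i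
  proof -
    have "s2 v_H 0 = tn" "s2 v_d 0 = 2 * td" "s2 0 = s1 0" using that by (simp_all add: R_def walk_arrays_def)
    moreover have "s1 0 (3 + i) = s_of i" using R(1)[OF that(1)] input_setup[OF that(2)] by (simp add: header_def)
    ultimately show ?thesis using that(3) by (simp add: e_expensive_def costly_def)
  qed
  have keep: "R s2" if "R s1" "\<forall>a. a \<notin> walk_arrays \<longrightarrow> s2 a = s1 a" for s1 s2
    using that by (simp add: R_def arrange_arrays_def walk_arrays_def)
  let ?p = "v_d ::= Mul (Const 2) (Var v_td) ;; v_H ::= Var v_tn ;; v_k ::= Const 0"
  have 1: "wp B ?p (max_cost ?p) (\<lambda>s1. R s1 \<and> listing s1 []) s"
    by (rule wp_vc) (use B x in \<open>simp add: R_def listing_def arrange_arrays_def walk_arrays_def\<close>)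
  have 2: "wp B (walk e_expensive) (t_walk e_expensive * (n + c + 1)) (\<lambda>s2. R s2 \<and> listing s2 ?E) s1"
    if s1: "R s1 \<and> listing s1 []" for s1
  proof (rule wp_mono[OF wp_walk[where pre = "[]" and g = ?g and b = e_expensive and s = s1] order_refl])
    show "header s1" "listed s1" using R s1 by auto
    show "eval e_expensive s' \<noteq> 0 \<longleftrightarrow> ?g i"
      if "i < c" "s' v_i 0 = i" "\<forall>a. a \<notin> walk_arrays \<longrightarrow> s' a = s1 a" for i s'
      using ev[of s1 i s'] s1 that by simp
  qed (use s1 keep in \<open>auto simp: jobs_in_def\<close>)
  have 3: "wp B (v_e ::= Var v_k) (max_cost (v_e ::= Var v_k)) (\<lambda>s3. R s3 \<and> listing s3 ?E \<and> s3 v_e 0 = length ?E) s2"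
    if s2: "R s2 \<and> listing s2 ?E" for s2
    by (rule wp_vc) (use s2 B len in \<open>simp add: R_def listing_def arrange_arrays_def walk_arrays_def\<close>)
  have 4: "wp B (walk (e_Not e_expensive)) (t_walk (e_Not e_expensive) * (n + c + 1))
     (\<lambda>s'. listing s' (order tn (2 * td)) \<and>
     s' v_d 0 = 2 * td \<and> s' v_H 0 = tn \<and> s' v_e 0 = length (jobs_in (costly tn (2 * td))) \<and>
     (\<forall>a. a \<notin> arrange_arrays \<longrightarrow> s' a = s a)) s3"
    if s3: "R s3 \<and> listing s3 ?E \<and> s3 v_e 0 = length ?E" for s3
  proof (rule wp_mono[OF wp_walk[where pre = ?E and g = "\<lambda>i. \<not> ?g i" and b = "e_Not e_expensive" and s = s3] order_refl])
    show "header s3" "listed s3" using R s3 by auto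
    show "listing s3 ?E" "length ?E \<le> n" using s3 len by auto
    show "eval (e_Not e_expensive) s' \<noteq> 0 \<longleftrightarrow> \<not> ?g i"
      if "i < c" "s' v_i 0 = i" "\<forall>a. a \<notin> walk_arrays \<longrightarrow> s' a = s3 a" for i s'
      using ev[of s3 i s'] s3 that by (auto simp: e_expensive_def)
    fix s4 assume s4: "listing s4 (?E @ concat (map (job_list n) (filter (\<lambda>i. \<not> ?g i) [0..<c]))) \<and>
      (\<forall>a. a \<notin> walk_arrays \<longrightarrow> s4 a = s3 a)"
    then have "R s4" using keep s3 by blast
    moreover have "s4 v_e 0 = length ?E" using s3 s4 by (simp add: walk_arrays_def)
    moreover have "listing s4 (order tn (2 * td))" using s4 by (simp add: order_def jobs_in_def)
    ultimately show "listing s4 (order tn (2 * td)) \<and>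
     s4 v_d 0 = 2 * td \<and> s4 v_H 0 = tn \<and> s4 v_e 0 = length (jobs_in (costly tn (2 * td))) \<and>
     (\<forall>a. a \<notin> arrange_arrays \<longrightarrow> s4 a = s a)" by (simp add: R_def)
  qed
  have "wp B arrange (max_cost ?p + (t_walk e_expensive * (n + c + 1) +
      (max_cost (v_e ::= Var v_k) + t_walk (e_Not e_expensive) * (n + c + 1))))
    (\<lambda>s'. listing s' (order tn (2 * td)) \<and>
     s' v_d 0 = 2 * td \<and> s' v_H 0 = tn \<and> s' v_e 0 = length (jobs_in (costly tn (2 * td))) \<and>
     (\<forall>a. a \<notin> arrange_arrays \<longrightarrow> s' a = s a)) s"
    unfolding arrange_def
    by (rule wp_seqI[OF 1], rule wp_seqI[OF 2], assumption, rule wp_seqI[OF 3], assumption, rule 4)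
  then show ?thesis
  proof (rule wp_mono)
    define a where "a = max_cost ?p"
    define b where "b = max_cost (v_e ::= Var v_k)"
    have "a + (t_walk e_expensive * (n + c + 1) + (b + t_walk (e_Not e_expensive) * (n + c + 1)))
      \<le> (a + t_walk e_expensive + b + t_walk (e_Not e_expensive)) * (n + c + 1)"
      by (simp add: algebra_simps)
    then show "max_cost ?p + (t_walk e_expensive * (n + c + 1) +
      (max_cost (v_e ::= Var v_k) + t_walk (e_Not e_expensive) * (n + c + 1))) \<le> t_arrange * (n + c + 1)"
      unfolding t_arrange_def a_def b_def .
  qed
qed

end

section \<open>Writing the schedule\<close>

abbreviation "v_f \<equiv> 70 :: nat"
abbreviation "v_mode \<equiv> 71 :: nat"
abbreviation "v_z \<equiv> 72 :: nat"
abbreviation "a_pos \<equiv> 73 :: nat"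
abbreviation "a_rem \<equiv> 74 :: nat"
abbreviation "v_hp \<equiv> 75 :: nat"
abbreviation "v_op \<equiv> 76 :: nat"
abbreviation "v_cnt \<equiv> 77 :: nat"
abbreviation "v_t \<equiv> 78 :: nat"
abbreviation "v_job \<equiv> 79 :: nat"
abbreviation "v_r \<equiv> 80 :: nat"
abbreviation "v_w \<equiv> 81 :: nat"
abbreviation "v_s \<equiv> 82 :: nat"
abbreviation "v_q \<equiv> 83 :: nat"
abbreviation "a_fin \<equiv> 84 :: nat"

definition load_current :: com where
  "load_current =
    v_t ::= Read a_pos (Var v_z) ;; v_job ::= Read a_ord (Var v_t) ;; v_i ::= class_at (Var v_job) ;;
    v_r ::= Read a_rem (Var v_z) ;; v_s ::= Mul e_setup (Var v_d) ;;
    Cond (Less (Var v_H) (Var v_s)) (v_w ::= Var v_H) (v_w ::= Sub (Mul (Const 3) (Var v_H)) (Var v_s))"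

abbreviation "out k x \<equiv> Write 1 (Add (Var v_op) (Const k)) x"

text \<open>Nine words: the multiplicity \<open>q\<close>, the item count 2, a setup, and a piece
  that fills the machine.\<close>

definition "write_full =
  v_q ::= Div (Sub (Var v_r) (Const 1)) (Var v_w) ;;
  out 0 (Var v_q) ;; out 1 (Const 2) ;; out 2 (Const 0) ;; out 3 (Var v_i) ;; out 4 (Const 0) ;;
  out 5 (Const 1) ;; out 6 (Var v_job) ;; out 7 (Var v_s) ;; out 8 (Var v_w) ;;
  v_op ::= Add (Var v_op) (Const 9) ;; v_cnt ::= Add (Var v_cnt) (Const 1) ;;
  Write a_rem (Var v_z) (Sub (Var v_r) (Mul (Var v_q) (Var v_w)))"

text \<open>Five words: multiplicity 1, item count 1, and the setup. \<open>v_hp\<close> keeps the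
  address of this header, so that \<open>count_item\<close> can raise the item count when something
  is appended later.\<close>

definition "write_new =
  out 0 (Const 1) ;; out 1 (Const 1) ;; out 2 (Const 0) ;; out 3 (Var v_i) ;; out 4 (Const 0) ;;
  v_hp ::= Var v_op ;; v_op ::= Add (Var v_op) (Const 5) ;; v_cnt ::= Add (Var v_cnt) (Const 1) ;;
  v_f ::= Var v_s ;; v_mode ::= Const 1"

definition "open_machine =
  Cond (Less (Read a_pos (Const 0)) (Read a_fin (Const 0))) (v_z ::= Const 0) (v_z ::= Const 1) ;;
  load_current ;; Cond (Less (Var v_w) (Var v_r)) write_full Skip ;; write_new"

definition "count_item = Write 1 (Add (Var v_hp) (Const 1)) (Add (Read 1 (Add (Var v_hp) (Const 1))) (Const 1))"

definition "write_piece x =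
  out 0 (Const 1) ;; out 1 (Var v_job) ;; out 2 (Var v_f) ;; out 3 x ;; v_op ::= Add (Var v_op) (Const 4) ;; count_item"

definition "e_room = Sub (Add (Var v_s) (Var v_w)) (Var v_f)"

text \<open>The mode is preset to 2 and corrected to 1 if the next job belongs to the same class.
  Equality of classes is tested by two comparisons, because expressions only offer
  \<open>Less\<close>.\<close>

definition "advance =
  v_f ::= Add (Var v_f) (Var v_r) ;; v_t ::= Add (Var v_t) (Const 1) ;; Write a_pos (Var v_z) (Var v_t) ;;
  v_mode ::= Const 2 ;;
  Cond (Less (Var v_t) (Read a_fin (Var v_z)))
    (v_job ::= Read a_ord (Var v_t) ;; Write a_rem (Var v_z) (Mul (time_at (Var v_job)) (Var v_d)) ;;
     Cond (e_And (e_Le (class_at (Var v_job)) (Var v_i)) (e_Le (Var v_i) (class_at (Var v_job))))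
       (v_mode ::= Const 1) Skip)
    Skip"

definition "place_job =
  load_current ;;
  Cond (Less (Add (Var v_s) (Var v_w)) (Add (Var v_f) (Var v_r)))
    (write_piece e_room ;; Write a_rem (Var v_z) (Sub (Var v_r) e_room) ;; v_mode ::= Const 0)
    (write_piece (Var v_r) ;; advance)"

definition "write_setup =
  out 0 (Const 0) ;; out 1 (Var v_i) ;; out 2 (Var v_f) ;; v_op ::= Add (Var v_op) (Const 3) ;; count_item ;;
  v_f ::= Add (Var v_f) (Var v_s) ;; v_mode ::= Const 1"

definition "try_setup =
  v_z ::= Const 1 ;;
  Cond (Less (Read a_pos (Const 1)) (Read a_fin (Const 1)))
    (load_current ;;
     Cond (Less (Mul (Const 3) (Var v_H)) (Add (Var v_f) (Var v_s))) (v_mode ::= Const 0) write_setup)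
    (v_mode ::= Const 0)"

definition "place_step =
  Cond (Var v_mode) (Cond (Less (Const 1) (Var v_mode)) try_setup place_job) open_machine"

text \<open>The sum acts as a disjunction: it is 0 exactly when the placement is in mode 0 and both
  streams are exhausted.\<close>

definition "e_busy = Add (Var v_mode)
  (Add (Less (Read a_pos (Const 0)) (Read a_fin (Const 0))) (Less (Read a_pos (Const 1)) (Read a_fin (Const 1))))"

text \<open>Configurations start at word 2. The two words before them are written last, when the
  number of configurations is known.\<close>

definition "place_init =
  Write a_fin (Const 0) (Var v_e) ;; Write a_fin (Const 1) (Var v_n) ;; Write a_pos (Const 1) (Var v_e) ;;
  v_op ::= Const 2 ;;
  Write a_rem (Const 0) (Mul (time_at (Read a_ord (Const 0))) (Var v_d)) ;;
  Cond (Less (Var v_e) (Var v_n)) (Write a_rem (Const 1) (Mul (time_at (Read a_ord (Var v_e))) (Var v_d))) Skip"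

definition "place_all = place_init ;; While e_busy place_step ;; Write 1 (Const 0) (Var v_d) ;; Write 1 (Const 1) (Var v_cnt)"

section \<open>Layout of the output and its relation to the abstract state\<close>

definition holds_at :: "(nat \<Rightarrow> nat) \<Rightarrow> nat \<Rightarrow> nat list \<Rightarrow> bool" where
  "holds_at f b xs \<longleftrightarrow> (\<forall>k<length xs. f (b + k) = xs ! k)"

lemma holds_at_Nil [simp]: "holds_at f b []"
  by (simp add: holds_at_def)

lemma holds_at_Cons [simp]: "holds_at f b (x # xs) \<longleftrightarrow> f b = x \<and> holds_at f (Suc b) xs"
  by (auto simp: holds_at_def less_Suc_eq_0_disj)

lemma holds_at_append [simp]: "holds_at f b (xs @ ys) \<longleftrightarrow> holds_at f b xs \<and> holds_at f (b + length xs) ys"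
  by (induction xs arbitrary: b) auto

lemma holds_at_upd [simp]:
  assumes "i < b \<or> b + length xs \<le> i"
  shows "holds_at (f(i := v)) b xs = holds_at f b xs"
proof -
  have "(f(i := v)) (b + k) = f (b + k)" if "k < length xs" for k
    using assms that by fastforce
  then show ?thesis by (simp add: holds_at_def)
qed

definition enc :: "nat schedule \<Rightarrow> nat list" where
  "enc R = concat (map encode_config R)"

lemma enc_simps [simp]: "enc [] = []" "enc ((cfg, k) # R) = k # length cfg # concat (map encode_item cfg) @ enc R"
    "enc (R @ R') = enc R @ enc R'"
  by (simp_all add: enc_def encode_config_def)

text \<open>\<open>v_hp\<close> is the start of the last configuration, the only one that can still
  change.\<close>

definition written_out :: "memory \<Rightarrow> nat schedule \<Rightarrow> bool" where
  "written_out s R \<longleftrightarrow> holds_at (s 1) 2 (enc R) \<and> s v_op 0 = 2 + length (enc R) \<and> s v_cnt 0 = length R \<and>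
     (R \<noteq> [] \<longrightarrow> s v_hp 0 = 2 + length (enc (butlast R)))"

locale emitter = ram I V B + pl: placement I d H e ord bt
  for I V B d H e ord bt +
  assumes dH: "d \<le> V ^ 4" "H \<le> V ^ 5"
begin

definition ready :: "memory \<Rightarrow> bool" where
  "ready s \<longleftrightarrow> header s \<and> s v_d 0 = d \<and> s v_H 0 = H \<and> s a_fin 0 = e \<and> s a_fin 1 = n \<and> (\<forall>t<n. s a_ord t = ord t)"

definition rel :: "placement_state \<Rightarrow> memory \<Rightarrow> bool" where
  "rel st s \<longleftrightarrow> ready s \<and> s v_f 0 = fill st \<and> s v_mode 0 = mode st \<and> s v_z 0 = str st \<and>
     s a_pos 0 = pos st 0 \<and> s a_pos 1 = pos st 1 \<and> s a_rem 0 = rem st 0 \<and> s a_rem 1 = rem st 1 \<and>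
     written_out s (sched st)"

lemma sg_le_V: "i < c \<Longrightarrow> pl.sg i \<le> V ^ 5"
  unfolding pl.sg_def by (rule mult_V[of _ 1 _ 4]) (use setup_le_V dH in auto)

lemma H3_le_V: "3 * H \<le> V ^ 6"
  by (rule order_trans[OF mult_le_mono mult_V[of V 1 "V ^ 5" 5]]) (use V dH in auto)

lemma proc_time_le_V: "j < n \<Longrightarrow> proc_time I j \<le> V"
proof -
  assume j: "j < n"
  have "proc_time I j \<le> (\<Sum>l<n. proc_time I l)" by (rule member_le_sum) (use j in auto)
  with time_le[of n 0] show ?thesis by simp
qed

lemma sz_le_V: "t < n \<Longrightarrow> pl.sz t \<le> V ^ 5"
  unfolding pl.sz_def by (rule mult_V[of _ 1 _ 4]) (use proc_time_le_V pl.ord_less dH in auto)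

lemma wd_le_V: "pl.wd i \<le> V ^ 6"
  using H3_le_V by (auto simp: pl.wd_def)

lemma in_B: "x \<le> V ^ 5 \<Longrightarrow> x < B" "x \<le> V ^ 6 \<Longrightarrow> x < B"
  using less_B_pow[of x 5] less_B_pow[of x 6] by auto

text \<open>Phrased as a rule for \<open>vc\<close> with the resulting memory written out, so that
  it can be used inside the symbolic execution of all three kinds of steps.\<close>

lemma vc_load_current:
  assumes rd: "ready s" and z: "s v_z 0 = z" "s a_pos z = t" "s a_rem z = r" and t: "t < n" and r: "r \<le> pl.sz t"
    and Q: "Q (s(v_t := (s v_t)(0 := t), v_job := (s v_job)(0 := ord t), v_i := (s v_i)(0 := pl.cl t),
      v_r := (s v_r)(0 := r), v_s := (s v_s)(0 := pl.sg (pl.cl t)), v_w := (s v_w)(0 := pl.wd (pl.cl t))))"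
  shows "vc B load_current Q s"
proof -
  define i where "i = pl.cl t"
  have i: "i < c" using pl.cl_less[OF t] by (simp add: i_def)
  have j: "ord t < n" by (rule pl.ord_less[OF t])
  have s0: "s 0 = init_memory (encode_instance I) 0" "s v_c 0 = c" "s v_d 0 = d" "s v_H 0 = H" "s a_ord t = ord t"
    using rd t by (simp_all add: ready_def header_def)
  have rdm: "s 0 (3 + c + 2 * ord t) = i" "s 0 (3 + i) = s_of i"
    using input_job[OF j] input_setup[OF i] s0 by (simp_all add: i_def pl.cl_def)
  have sgd: "s_of i * d = pl.sg i" by (simp add: pl.sg_def)
  have b: "0 < B" "t < B" "ord t < B" "i < B" "r < B" "pl.sg i < B" "pl.wd i < B" "H < B"
    using less_B_pow[of V 1] in_B(1)[OF order_trans[OF r sz_le_V[OF t]]] in_B(1)[OF sg_le_V[OF i]] in_B(2)[OF wd_le_V[of i]]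
      in_B(1)[OF dH(2)] t j i V by auto
  show ?thesis
  proof (cases "H < pl.sg i")
    case True
    then show ?thesis
      using Q z s0 rdm sgd b True unfolding load_current_def class_at_def i_def[symmetric]
      by (simp add: pl.wd_def)
  next
    case False
    then show ?thesis
      using Q z s0 rdm sgd b False unfolding load_current_def class_at_def i_def[symmetric]
      by (simp add: pl.wd_def)
  qed
qed

section \<open>Simulation of the placement steps\<close>

lemma rel_current:
  assumes s: "pl.shape st" and r: "rel st s" and z: "z \<le> 1" "pos st z < pl.fin z"
  shows "s a_pos z = pos st z" "s a_rem z = rem st z" "pos st z < n" "rem st z \<le> pl.sz (pos st z)"
proof -
  have "z = 0 \<or> z = 1" using z(1) by auto
  then show "s a_pos z = pos st z" "s a_rem z = rem st z" using r by (auto simp: rel_def)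
  show "pos st z < n" by (rule pl.stream_of(1)[OF s z])
  show "rem st z \<le> pl.sz (pos st z)" using pl.placed_pos[OF s z] by linarith
qed

text \<open>14 is the most that one step appends: nine words for the full machines and five for the
  new machine.\<close>

lemma vc_open:
  assumes s: "pl.good st" and m0: "mode st = 0" and nf: "\<not> pl.finished st" and r: "rel st s"
    and op: "s v_op 0 + 14 < B"
  shows "vc B open_machine (rel (pl.step st)) s"
proof -
  have sh: "pl.shape st" using s by (simp add: pl.good_def)
  define z where "z = (if pos st 0 < e then 0 else 1::nat)"
  define t where "t = pos st z"
  define i where "i = pl.cl t"
  define q where "q = (rem st z - 1) div pl.wd i"
  define o0 where "o0 = s v_op 0"
  have z: "z \<le> 1" "pos st z < pl.fin z"
    using nf m0 by (auto simp: z_def pl.finished_def pl.fin_def)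
  note cur = rel_current[OF sh r z]
  have i: "i < c" using pl.cl_less cur(3) by (simp add: i_def t_def)
  have j: "ord t < n" using pl.ord_less cur(3) by (simp add: t_def)
  have rd: "ready s" using r by (simp add: rel_def)
  have wo: "holds_at (s 1) 2 (enc (sched st))" "o0 = 2 + length (enc (sched st))" "s v_cnt 0 = length (sched st)"
    using r by (simp_all add: rel_def written_out_def o0_def)
  have opB: "length (enc (sched st)) + 16 < B" using op wo by (simp add: o0_def)
  have lenR: "length R \<le> length (enc R)" for R :: "nat schedule"
    by (induction R) (auto simp: enc_def encode_config_def)
  have cntB: "s v_cnt 0 + 2 < B" using op wo lenR[of "sched st"] by (simp add: o0_def)
  have b: "z < B" "ord t < B" "i < B" "rem st z < B" "pl.sg i < B" "pl.wd i < B" "2 < B"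
    using less_B_pow[of V 1] in_B(1)[OF order_trans[OF cur(4) sz_le_V[OF cur(3)]]] in_B(1)[OF sg_le_V[OF i]]
      in_B(2)[OF wd_le_V[of i]] j i V z by auto
  have qB: "q < B" "rem st z - q * pl.wd i < B"
  proof -
    have "q \<le> rem st z - 1" unfolding q_def by (rule div_le_dividend)
    then show "q < B" using b by linarith
    show "rem st z - q * pl.wd i < B" using b by linarith
  qed
  define s1 where "s1 = s(v_z := (s v_z)(0 := z))"
  have s1: "ready s1" "s1 v_z 0 = z" "s1 a_pos z = t" "s1 a_rem z = rem st z" "t < n" "rem st z \<le> pl.sz t"
    using rd cur by (simp_all add: s1_def ready_def header_def t_def)
  define s2 where "s2 = s1(v_t := (s1 v_t)(0 := t), v_job := (s1 v_job)(0 := ord t), v_i := (s1 v_i)(0 := i),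
      v_r := (s1 v_r)(0 := rem st z), v_s := (s1 v_s)(0 := pl.sg i), v_w := (s1 v_w)(0 := pl.wd i))"
  have s2: "s2 v_z 0 = z" "s2 v_job 0 = ord t" "s2 v_i 0 = i" "s2 v_r 0 = rem st z" "s2 v_s 0 = pl.sg i" "s2 v_w 0 = pl.wd i"
    "s2 v_op 0 = o0" "s2 v_cnt 0 = length (sched st)" "s2 1 = s 1" "s2 a_pos = s a_pos" "s2 a_rem = s a_rem"
    using wo by (simp_all add: s2_def s1_def o0_def)
  have rd2: "ready s2" using rd by (simp add: s2_def s1_def ready_def header_def)
  have st': "pl.step st = st\<lparr>sched := sched st @ (if pl.wd i < rem st z then [([Setup i 0, Piece (ord t) (pl.sg i) (pl.wd i)], q)] else [])
          @ [([Setup i 0], 1)], fill := pl.sg i, mode := 1, str := z,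
        rem := (rem st)(z := rem st z - (if pl.wd i < rem st z then q else 0) * pl.wd i)\<rparr>"
    using m0 by (simp add: pl.step_def Let_def z_def t_def i_def q_def)
  have relpos: "s a_pos 0 = pos st 0" "s a_pos (Suc 0) = pos st (Suc 0)" "s a_rem 0 = rem st 0" "s a_rem (Suc 0) = rem st (Suc 0)"
    using r by (simp_all add: rel_def)
  have qd: "(rem st z - Suc 0) div pl.wd i = q" by (simp add: q_def)
  have main: "vc B (Cond (Less (Var v_w) (Var v_r)) write_full Skip ;; write_new) (rel (pl.step st)) s2"
  proof (cases "pl.wd i < rem st z")
    case True
    show ?thesis
      using True s2 b qB opB cntB wo unfolding write_full_def write_new_def
      apply simp
      unfolding rel_def st'
      using True z rd2 relpos qd
      by (cases "z = 0") (simp_all add: written_out_def butlast_append ready_def header_def le_Suc_eq)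
  next
    case False
    show ?thesis
      using False s2 b qB opB cntB wo unfolding write_new_def
      apply simp
      unfolding rel_def st'
      using False z rd2 relpos
      by (cases "z = 0") (simp_all add: written_out_def ready_def header_def le_Suc_eq)
  qed
  have "vc B load_current (vc B (Cond (Less (Var v_w) (Var v_r)) write_full Skip ;; write_new) (rel (pl.step st))) s1"
    by (rule vc_load_current[OF s1]) (fact main[unfolded s2_def i_def])
  moreover have "(s a_pos 0 < s a_fin 0) = (pos st 0 < e)"
    using r by (simp add: rel_def ready_def)
  moreover have "0 < B" "1 < B" using b(7) by auto
  ultimately show ?thesis
    unfolding open_machine_def s1_def z_def by (cases "pos st 0 < e") simp_all
qed

text \<open>With \<open>L\<close> words of configurations before it, the open configuration has its
  header at \<open>2 + L\<close> and its items from \<open>4 + L\<close> on; the next free word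
  follows after its \<open>K\<close> item words.\<close>

lemma rel_last:
  assumes r: "rel st s" and R: "sched st = Q @ [(cfg, 1)]"
  defines "L \<equiv> length (enc Q)" and "K \<equiv> length (concat (map encode_item cfg))"
  shows "holds_at (s 1) 2 (enc Q)" "s 1 (2 + L) = 1" "s 1 (3 + L) = length cfg"
    "holds_at (s 1) (4 + L) (concat (map encode_item cfg))"
    "s v_op 0 = 4 + L + K" "s v_hp 0 = 2 + L" "s v_cnt 0 = Suc (length Q)" "length cfg \<le> K"
proof -
  have "length cfg \<le> length (concat (map encode_item cfg))"
  proof (induction cfg)
    case (Cons it cfg)
    then show ?case by (cases it) auto
  qed simp
  then show "length cfg \<le> K" by (simp add: K_def)
  have "written_out s (Q @ [(cfg, 1)])" using r R by (simp add: rel_def)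
  then show "holds_at (s 1) 2 (enc Q)" "s 1 (2 + L) = 1" "s 1 (3 + L) = length cfg"
    "holds_at (s 1) (4 + L) (concat (map encode_item cfg))"
    "s v_op 0 = 4 + L + K" "s v_hp 0 = 2 + L" "s v_cnt 0 = Suc (length Q)"
    by (simp_all add: written_out_def L_def K_def del: add_2_eq_Suc add_2_eq_Suc' length_concat)
qed

lemma written_out_snoc:
  assumes "holds_at f 2 (enc Q)" "f (2 + length (enc Q)) = 1" "f (3 + length (enc Q)) = Suc (length cfg)"
    "holds_at f (4 + length (enc Q)) (concat (map encode_item cfg))"
    "holds_at f (4 + length (enc Q) + length (concat (map encode_item cfg))) (encode_item it)"
    and "s 1 = f" "s v_op 0 = 4 + length (enc Q) + length (concat (map encode_item cfg)) + length (encode_item it)"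
    "s v_hp 0 = 2 + length (enc Q)" "s v_cnt 0 = Suc (length Q)"
  shows "written_out s (Q @ [(cfg @ [it], 1)])"
  using assms by (simp add: written_out_def del: add_2_eq_Suc add_2_eq_Suc' length_concat)

lemma vc_place:
  assumes s: "pl.good st" and m1: "mode st = 1" and r: "rel st s" and op: "s v_op 0 + 14 < B"
  shows "vc B place_job (rel (pl.step st)) s"
proof -
  have sh: "pl.shape st" using s by (simp add: pl.good_def)
  define z where "z = str st"
  define t where "t = pos st z"
  define i where "i = pl.cl t"
  define f where "f = fill st"
  define x where "x = rem st z"
  from sh m1 obtain Q cfg where R: "sched st = Q @ [(cfg, 1)]" "t < pl.fin z" "f \<le> pl.sg i + pl.wd i"
    by (auto simp: pl.shape_def Let_def z_def t_def i_def f_def)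
  have z: "z \<le> 1" "pos st z < pl.fin z" using sh R by (simp_all add: pl.shape_def z_def t_def)
  then have z01: "z = 0 \<or> z = 1" by auto
  note cur = rel_current[OF sh r z]
  have i: "i < c" using pl.cl_less cur(3) by (simp add: i_def t_def)
  have j: "ord t < n" using pl.ord_less cur(3) by (simp add: t_def)
  have rd: "ready s" using r by (simp add: rel_def)
  define L where "L = length (enc Q)"
  define K where "K = length (concat (map encode_item cfg))"
  note w = rel_last[OF r R(1), folded L_def K_def]
  have sv: "s v_z 0 = z" "s v_f 0 = f" using r by (simp_all add: rel_def z_def f_def)
  have cap: "pl.sg i + pl.wd i \<le> 3 * H" by (rule pl.cap_le[OF i])
  have capB: "pl.sg i + pl.wd i < B" using cap H3_le_V in_B(2)[of "3 * H"] by linarith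
  have fin: "s a_fin z = pl.fin z" using rd z01 by (auto simp: ready_def pl.fin_def)
  have b: "z < B" "ord t < B" "i < B" "x < B" "f < B" "2 < B" "Suc t < B"
    using less_B_pow[of V 1] in_B(1)[OF order_trans[OF cur(4) sz_le_V[OF cur(3)]]] capB R(3) j i V z cur(3)
    by (auto simp: t_def x_def)
  have opB: "4 + L + K + 14 < B" "Suc (length cfg) < B" using op w by auto
  define s2 where "s2 = s(v_t := (s v_t)(0 := t), v_job := (s v_job)(0 := ord t), v_i := (s v_i)(0 := i),
      v_r := (s v_r)(0 := x), v_s := (s v_s)(0 := pl.sg i), v_w := (s v_w)(0 := pl.wd i))"
  have s2: "s2 v_z 0 = z" "s2 v_job 0 = ord t" "s2 v_i 0 = i" "s2 v_r 0 = x" "s2 v_s 0 = pl.sg i" "s2 v_w 0 = pl.wd i"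
    "s2 v_op 0 = 4 + L + K" "s2 v_hp 0 = 2 + L" "s2 v_cnt 0 = Suc (length Q)" "s2 1 = s 1" "s2 v_f 0 = f" "s2 v_t 0 = t"
    "s2 a_pos = s a_pos" "s2 a_rem = s a_rem" "s2 a_fin = s a_fin"
    using w sv by (simp_all add: s2_def)
  have rd2: "ready s2" using rd by (simp add: s2_def ready_def header_def)
  have relpos: "s a_pos 0 = pos st 0" "s a_pos 1 = pos st 1" "s a_rem 0 = rem st 0" "s a_rem 1 = rem st 1"
    using r by (simp_all add: rel_def)
  have cnt: "s 1 (3 + L) = length cfg" by (rule w(3))
  have out: "written_out s' (Q @ [(cfg @ [Piece (ord t) f y], 1)])"
    if "s' 1 = (s 1)(4 + L + K := 1, 5 + L + K := ord t, 6 + L + K := f, 7 + L + K := y, 3 + L := Suc (length cfg))"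
      "s' v_op 0 = 8 + L + K" "s' v_hp 0 = 2 + L" "s' v_cnt 0 = Suc (length Q)" for s' y
    by (rule written_out_snoc[where f = "s' 1"])
      (use w(1-4) that in \<open>simp_all add: L_def[symmetric] K_def[symmetric] del: add_2_eq_Suc add_2_eq_Suc' length_concat\<close>)
  have piece: "vc B (write_piece ex) Q' s2"
    if "eval ex (s2(1 := (s 1)(4 + L + K := 1, 5 + L + K := ord t, 6 + L + K := f))) = y" "y < B"
      "Q' (s2(1 := (s 1)(4 + L + K := 1, 5 + L + K := ord t, 6 + L + K := f, 7 + L + K := y, 3 + L := Suc (length cfg)),
          v_op := (s2 v_op)(0 := 8 + L + K)))" for ex y Q'
    using that s2 b opB cnt unfolding write_piece_def count_item_def
    by (simp add: add.commute add.left_commute fun_upd_twist del: add_2_eq_Suc add_2_eq_Suc')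
  define F where "F = (\<lambda>y. (s 1)(4 + L + K := 1, 5 + L + K := ord t, 6 + L + K := f, 7 + L + K := y, 3 + L := Suc (length cfg)))"
  define s3 where "s3 = (\<lambda>y. s2(1 := F y, v_op := (s2 v_op)(0 := 8 + L + K)))"
  have piece': "vc B (write_piece ex) Q' s2"
    if "\<And>G. eval ex (s2(1 := G)) = y" "y < B" "Q' (s3 y)" for ex y Q'
    by (rule piece[where y = y]) (use that in \<open>simp_all add: s3_def F_def\<close>)
  have s3: "s3 y v_z 0 = z" "s3 y v_job 0 = ord t" "s3 y v_i 0 = i" "s3 y v_r 0 = x" "s3 y v_s 0 = pl.sg i" "s3 y v_w 0 = pl.wd i"
    "s3 y v_op 0 = 8 + L + K" "s3 y v_hp 0 = 2 + L" "s3 y v_cnt 0 = Suc (length Q)" "s3 y 1 = F y" "s3 y v_f 0 = f" "s3 y v_t 0 = t"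
    "s3 y a_pos = s a_pos" "s3 y a_rem = s a_rem" "s3 y a_fin = s a_fin" "s3 y v_z = s v_z" for y
    using s2 by (simp_all add: s3_def) (simp add: s2_def)
  have rd3: "ready (s3 y)" for y using rd2 by (simp add: s3_def ready_def header_def)
  have out3: "written_out s' (Q @ [(cfg @ [Piece (ord t) f y], 1)])"
    if "s' 1 = F y" "s' v_op = s3 y v_op" "s' v_hp = s3 y v_hp" "s' v_cnt = s3 y v_cnt" for s' y
    by (rule out) (use that s3 in \<open>simp_all add: F_def\<close>)
  have main: "vc B (Cond (Less (Add (Var v_s) (Var v_w)) (Add (Var v_f) (Var v_r)))
    (write_piece e_room ;; Write a_rem (Var v_z) (Sub (Var v_r) e_room) ;; v_mode ::= Const 0)
    (write_piece (Var v_r) ;; advance)) (rel (pl.step st)) s2"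
  proof (cases "f + x \<le> pl.sg i + pl.wd i")
    case False
    define y where "y = pl.sg i + pl.wd i - f"
    have yB: "y < B" "x - y < B" "0 < B" using capB b by (auto simp: y_def)
    have st': "pl.step st = st\<lparr>sched := Q @ [(cfg @ [Piece (ord t) f y], 1)], rem := (rem st)(z := x - y), mode := 0\<rparr>"
      using m1 False by (simp add: pl.step_def Let_def R(1) z_def t_def i_def f_def x_def y_def)
    define s4 where "s4 = (s3 y)(a_rem := (s a_rem)(z := x - y), v_mode := (s3 y v_mode)(0 := 0))"
    have "rel (pl.step st) s4"
      unfolding rel_def st'
    proof (intro conjI)
      show "ready s4" using rd3[of y] by (simp add: s4_def ready_def header_def)
      show "written_out s4 (sched (st\<lparr>sched := Q @ [(cfg @ [Piece (ord t) f y], 1)], rem := (rem st)(z := x - y), mode := 0\<rparr>))"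
        using out3[of s4 y] s3[of y] by (simp add: s4_def)
    qed (use s3[of y] sv r z01 relpos in \<open>auto simp: s4_def f_def z_def rel_def\<close>)
    then have "vc B (Write a_rem (Var v_z) (Sub (Var v_r) e_room) ;; v_mode ::= Const 0) (rel (pl.step st)) (s3 y)"
      using s3[of y] yB b by (simp add: e_room_def s4_def y_def[symmetric])
    then have "vc B (write_piece e_room) (vc B (Write a_rem (Var v_z) (Sub (Var v_r) e_room) ;; v_mode ::= Const 0) (rel (pl.step st))) s2"
      by (rule piece'[where y = y, rotated 2]) (use yB s2 in \<open>simp_all add: e_room_def y_def\<close>)
    then show ?thesis using False s2 by simp
  next
    case True
    define same where "same \<longleftrightarrow> t + 1 < pl.fin z \<and> pl.cl (t + 1) = i"
    define x' where "x' = (if t + 1 < pl.fin z then pl.sz (t + 1) else x)"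
    have st': "pl.step st = st\<lparr>sched := Q @ [(cfg @ [Piece (ord t) f x], 1)], fill := f + x, pos := (pos st)(z := t + 1),
       mode := (if same then 1 else 2), rem := (rem st)(z := x')\<rparr>"
      using m1 True by (simp add: pl.step_def Let_def R(1) z_def t_def i_def f_def x_def same_def x'_def)
    have fB: "f + x < B" using True capB by linarith
    define j' where "j' = (if t + 1 < pl.fin z then ord (t + 1) else ord t)"
    define s4 where "s4 = (s3 x)(v_f := (s3 x v_f)(0 := f + x), v_t := (s3 x v_t)(0 := Suc t), a_pos := (s a_pos)(z := Suc t),
       v_mode := (s3 x v_mode)(0 := if same then 1 else 2), v_job := (s3 x v_job)(0 := j'), a_rem := (s a_rem)(z := x'))"
    have "rel (pl.step st) s4"
      unfolding rel_def st'
    proof (intro conjI)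
      show "ready s4" using rd3[of x] by (simp add: s4_def ready_def header_def)
      show "written_out s4 (sched (st\<lparr>sched := Q @ [(cfg @ [Piece (ord t) f x], 1)], fill := f + x, pos := (pos st)(z := t + 1),
       mode := (if same then 1 else 2), rem := (rem st)(z := x')\<rparr>))"
        using out3[of s4 x] s3[of x] by (simp add: s4_def)
    qed (use s3[of x] sv r z01 relpos in \<open>auto simp: s4_def f_def z_def rel_def\<close>)
    note Q4 = this
    have "vc B advance (rel (pl.step st)) (s3 x)"
    proof (cases "t + 1 < pl.fin z")
      case nx: True
      then have tn: "t + 1 < n" using z01 pl.e by (auto simp: pl.fin_def)
      have j'n: "ord (Suc t) < n" "ord (Suc t) < B" using pl.ord_less[OF tn] V less_B_pow[of V 1] by auto
      have cl: "pl.cl (Suc t) < c" using pl.cl_less[OF tn] by simp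
      have s0: "s3 x 0 = init_memory (encode_instance I) 0" "s3 x v_c 0 = c" "s3 x v_d 0 = d" "s3 x a_ord (Suc t) = ord (Suc t)"
        using rd3[of x] tn by (simp_all add: ready_def header_def)
      have inp: "init_memory (encode_instance I) 0 (3 + c + 2 * ord (Suc t)) = pl.cl (Suc t)"
        "init_memory (encode_instance I) 0 (4 + c + 2 * ord (Suc t)) * d = pl.sz (Suc t)"
        using input_job[OF j'n(1)] by (simp_all add: pl.cl_def pl.sz_def)
      have szB: "pl.sz (Suc t) < B" using in_B(1)[OF sz_le_V[OF tn]] by simp
      have fin3: "s3 x a_fin z = pl.fin z" using fin s3 by simp
      have eqs: "x' = pl.sz (Suc t)" "j' = ord (Suc t)" using nx by (simp_all add: x'_def j'_def)
      show ?thesis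
      proof (cases "pl.cl (Suc t) = i")
        case True
        then have "same" using nx by (simp add: same_def)
        then have s4': "s4 = (s3 x)(v_f := (s3 x v_f)(0 := f + x), v_t := (s3 x v_t)(0 := Suc t), a_pos := (s a_pos)(z := Suc t),
           v_job := (s3 x v_job)(0 := ord (Suc t)), a_rem := (s a_rem)(z := pl.sz (Suc t)), v_mode := (s3 x v_mode)(0 := 1))"
          by (auto simp: s4_def eqs fun_eq_iff)
        show ?thesis
          using Q4 s3[of x] b fB nx fin3 s0 inp szB j'n True unfolding s4' advance_def class_at_def time_at_def
          by simp
      next
        case diff: False
        then have "\<not> same" by (simp add: same_def)
        then have s4': "s4 = (s3 x)(v_f := (s3 x v_f)(0 := f + x), v_t := (s3 x v_t)(0 := Suc t), a_pos := (s a_pos)(z := Suc t),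
           v_mode := (s3 x v_mode)(0 := 2), v_job := (s3 x v_job)(0 := ord (Suc t)), a_rem := (s a_rem)(z := pl.sz (Suc t)))"
          by (auto simp: s4_def eqs fun_eq_iff)
        have "(pl.cl (Suc t) < i \<or> i < pl.cl (Suc t))" using diff by auto
        then show ?thesis
          using Q4 s3[of x] b fB nx fin3 s0 inp szB j'n unfolding s4' advance_def class_at_def time_at_def
          by auto
      qed
    next
      case nx: False
      have fin3: "s3 x a_fin z = pl.fin z" using fin s3 by simp
      have eqs: "x' = x" "j' = ord t" "\<not> same" using nx by (simp_all add: x'_def j'_def same_def)
      have "s3 x a_rem z = x" using cur(2) s3 by (simp add: x_def)
      then have s4': "s4 = (s3 x)(v_f := (s3 x v_f)(0 := f + x), v_t := (s3 x v_t)(0 := Suc t), a_pos := (s a_pos)(z := Suc t),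
           v_mode := (s3 x v_mode)(0 := 2))"
        using s3[of x] by (auto simp: s4_def eqs fun_eq_iff)
      show ?thesis
        using Q4 s3[of x] b fB nx fin3 unfolding s4' advance_def by simp
    qed
    then have "vc B (write_piece (Var v_r)) (vc B advance (rel (pl.step st))) s2"
      by (rule piece'[where y = x, rotated 2]) (use b s2 in simp_all)
    then show ?thesis using True s2 by simp
  qed
  have s1: "ready s" "s v_z 0 = z" "s a_pos z = t" "s a_rem z = x" "t < n" "x \<le> pl.sz t"
    using rd cur sv by (simp_all add: t_def x_def)
  have "vc B load_current (vc B (Cond (Less (Add (Var v_s) (Var v_w)) (Add (Var v_f) (Var v_r)))
    (write_piece e_room ;; Write a_rem (Var v_z) (Sub (Var v_r) e_room) ;; v_mode ::= Const 0)
    (write_piece (Var v_r) ;; advance)) (rel (pl.step st))) s"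
    by (rule vc_load_current[OF s1]) (fact main[unfolded s2_def i_def])
  then show ?thesis unfolding place_job_def by simp
qed

lemma vc_setup:
  assumes s: "pl.good st" and m2: "mode st = 2" and r: "rel st s" and op: "s v_op 0 + 14 < B"
  shows "vc B try_setup (rel (pl.step st)) s"
proof -
  have sh: "pl.shape st" using s by (simp add: pl.good_def)
  define t where "t = pos st 1"
  define i where "i = pl.cl t"
  define f where "f = fill st"
  define x where "x = rem st 1"
  from sh m2 obtain Q cfg where R: "sched st = Q @ [(cfg, 1)]"
    by (auto simp: pl.shape_def Let_def)
  have rd: "ready s" using r by (simp add: rel_def)
  have sv: "s v_f 0 = f" "s a_pos 1 = t" "s a_fin 1 = n" using r rd by (simp_all add: rel_def ready_def f_def t_def)
  have B: "0 < B" "1 < B" "2 < B" using less_B_pow[of V 1] V by auto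
  define s1 where "s1 = s(v_z := (s v_z)(0 := 1))"
  have rd1: "ready s1" using rd by (simp add: s1_def ready_def header_def)
  have stop: "rel (st\<lparr>mode := 0, str := 1\<rparr>) s'"
    if "s' v_mode 0 = 0" "s' v_z 0 = 1" "\<forall>a. a \<notin> {v_z, v_mode, v_t, v_job, v_i, v_r, v_s, v_w} \<longrightarrow> s' a = s a" for s'
    using r that by (simp add: rel_def ready_def header_def written_out_def)
  show ?thesis
  proof (cases "t < n")
    case False
    then have "pl.step st = st\<lparr>mode := 0, str := 1\<rparr>" using m2 by (simp add: pl.step_def Let_def t_def)
    moreover have "rel (st\<lparr>mode := 0, str := 1\<rparr>) (s1(v_mode := (s1 v_mode)(0 := 0)))"
      by (rule stop) (simp_all add: s1_def)
    ultimately show ?thesis using sv B False unfolding try_setup_def by (simp add: s1_def)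
  next
    case True
    have z: "(1::nat) \<le> 1" "pos st 1 < pl.fin 1" using True by (simp_all add: pl.fin_def t_def)
    note cur = rel_current[OF sh r z]
    have i: "i < c" using pl.cl_less True by (simp add: i_def)
    define L where "L = length (enc Q)"
    define K where "K = length (concat (map encode_item cfg))"
    note w = rel_last[OF r R, folded L_def K_def]
    have opB: "4 + L + K + 14 < B" "Suc (length cfg) < B" using op w by auto
    define s2 where "s2 = s1(v_t := (s1 v_t)(0 := t), v_job := (s1 v_job)(0 := ord t), v_i := (s1 v_i)(0 := i),
      v_r := (s1 v_r)(0 := x), v_s := (s1 v_s)(0 := pl.sg i), v_w := (s1 v_w)(0 := pl.wd i))"
    have s2: "s2 v_i 0 = i" "s2 v_s 0 = pl.sg i" "s2 v_op 0 = 4 + L + K" "s2 v_hp 0 = 2 + L" "s2 v_cnt 0 = Suc (length Q)"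
      "s2 1 = s 1" "s2 v_f 0 = f" "s2 v_H 0 = H"
      using w sv rd by (simp_all add: s2_def s1_def ready_def)
    have cnt: "s 1 (3 + L) = length cfg" by (rule w(3))
    have main: "vc B (Cond (Less (Mul (Const 3) (Var v_H)) (Add (Var v_f) (Var v_s))) (v_mode ::= Const 0) write_setup)
      (rel (pl.step st)) s2"
    proof (cases "f + pl.sg i \<le> 3 * H")
      case False
      then have "pl.step st = st\<lparr>mode := 0, str := 1\<rparr>" using m2 by (simp add: pl.step_def Let_def t_def i_def f_def)
      moreover have "rel (st\<lparr>mode := 0, str := 1\<rparr>) (s2(v_mode := (s2 v_mode)(0 := 0)))"
        by (rule stop) (simp_all add: s2_def s1_def)
      ultimately show ?thesis using s2 B False by simp
    next
      case fits: True
      then have st': "pl.step st = st\<lparr>sched := Q @ [(cfg @ [Setup i f], 1)], fill := f + pl.sg i, mode := 1, str := 1\<rparr>"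
        using m2 True by (simp add: pl.step_def Let_def R t_def i_def f_def)
      define F where "F = (s 1)(4 + L + K := 0, 5 + L + K := i, 6 + L + K := f, 3 + L := Suc (length cfg))"
      define s4 where "s4 = s2(1 := F, v_op := (s2 v_op)(0 := 7 + L + K), v_f := (s2 v_f)(0 := f + pl.sg i),
        v_mode := (s2 v_mode)(0 := 1))"
      have wo: "written_out s4 (Q @ [(cfg @ [Setup i f], 1)])"
        by (rule written_out_snoc[where f = F])
          (use w(1-4) s2 in \<open>simp_all add: s4_def F_def L_def[symmetric] K_def[symmetric] del: add_2_eq_Suc add_2_eq_Suc' length_concat\<close>)
      have "rel (pl.step st) s4"
        unfolding rel_def st' using wo r rd
        by (simp add: s4_def s2_def s1_def ready_def header_def rel_def)
      moreover have "f + pl.sg i < B" "f < B" using fits H3_le_V in_B(2)[of "3 * H"] by linarith+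
      moreover have "i < B" using i V less_B_pow[of V 1] by auto
      ultimately show ?thesis
        using s2 B fits opB cnt unfolding write_setup_def count_item_def
        by (simp add: s4_def F_def add.commute add.left_commute fun_upd_twist del: add_2_eq_Suc add_2_eq_Suc')
    qed
    have pre: "ready s1" "s1 v_z 0 = 1" "s1 a_pos 1 = t" "s1 a_rem 1 = x" "t < n" "x \<le> pl.sz t"
      using rd1 cur True by (simp_all add: s1_def t_def x_def)
    have "vc B load_current (vc B (Cond (Less (Mul (Const 3) (Var v_H)) (Add (Var v_f) (Var v_s))) (v_mode ::= Const 0) write_setup)
      (rel (pl.step st))) s1"
      by (rule vc_load_current[OF pre]) (fact main[unfolded s2_def i_def])
    then show ?thesis using sv B True unfolding try_setup_def by (simp add: s1_def)
  qed
qed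

lemma vc_step:
  assumes s: "pl.good st" and nf: "\<not> pl.finished st" and r: "rel st s" and op: "s v_op 0 + 14 < B"
  shows "vc B place_step (rel (pl.step st)) s"
proof -
  have "mode st \<le> 2" using s by (simp add: pl.good_def pl.shape_def)
  then consider "mode st = 0" | "mode st = 1" | "mode st = 2" by linarith
  moreover have "s v_mode 0 = mode st" using r by (simp add: rel_def)
  ultimately show ?thesis
    using vc_open[OF s _ nf r op] vc_place[OF s _ r op] vc_setup[OF s _ r op]
    unfolding place_step_def by cases simp_all
qed

section \<open>Length of the output and running time of the placement\<close>

definition t_place :: nat where
  "t_place = max_cost place_init + 4 * (1 + cost e_busy + max_cost place_step) +
     (1 + cost e_busy + max_cost place_step) + (1 + cost e_busy) +
     max_cost (Write 1 (Const 0) (Var v_d) ;; Write 1 (Const 1) (Var v_cnt))"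

lemma length_enc_step:
  assumes s: "pl.good st"
  shows "length (enc (sched (pl.step st))) \<le> length (enc (sched st)) + 14"
proof -
  have sh: "pl.shape st" using s by (simp add: pl.good_def)
  show ?thesis
  proof (cases "mode st = 0")
    case False
    with sh obtain Q cfg where R: "sched st = Q @ [(cfg, 1)]" by (auto simp: pl.shape_def)
    show ?thesis using False by (auto simp: pl.step_def Let_def R)
  qed (auto simp: pl.step_def Let_def)
qed

text \<open>The zero cells from \<open>z\<close> supply the initial mode, fill level, stream and
  counters, so \<open>place_init\<close> sets only what differs from 0.\<close>

lemma wp_place_all:
  assumes hd: "header s" and x: "s v_d 0 = d" "s v_H 0 = H" "s v_e 0 = e" "\<forall>t<n. s a_ord t = ord t"
    and z: "\<forall>a k. a = 1 \<or> 70 \<le> a \<longrightarrow> s a k = 0"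
  shows "wp B place_all (t_place * (n + 1))
    (\<lambda>s'. \<exists>st. pl.good st \<and> pl.finished st \<and> holds_output s' (encode_schedule d (sched st))) s"
proof -
  have n: "n \<ge> 1" using inst by (simp add: valid_instance_def)
  have VV: "64 * V \<le> V ^ 3"
  proof -
    have "8 * 8 * V \<le> V * V * V" using V(5) by (intro mult_le_mono) auto
    then show ?thesis by (simp add: power3_eq_cube)
  qed
  have B: "2 < B" "0 < B" "1 < B" "e < B" "n < B" "d < B" "30 + 56 * n < B"
    using less_B_pow[of V 1] less_B_pow[of d 4] less_B_pow[of "30 + 56 * n" 3] VV V dH pl.e by auto
  define st0 where "st0 = \<lparr>sched = [], fill = 0, mode = 0, str = 0, pos = (\<lambda>z. if z = 0 then 0 else e),
     rem = (\<lambda>z. if z = 0 then pl.sz 0 else if e < n then pl.sz e else 0)\<rparr>"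
  have g0: "pl.good st0" "pl.potential st0 \<le> 4 * n + 1"
    by (rule pl.good_init; simp add: st0_def)+
  \<comment> \<open>The output position plus 14 words per unit of potential never grows, so output
    addresses stay linear in \<open>n\<close> and below \<open>B\<close>.\<close>
  define J where "J = (\<lambda>st s'. pl.good st \<and> rel st s' \<and> s' v_op 0 + 14 * pl.potential st \<le> 2 + 14 * (4 * n + 1))"
  have 1: "wp B place_init (max_cost place_init) (J st0) s"
  proof (rule wp_vc)
    have s0: "s 0 = init_memory (encode_instance I) 0" "s v_c 0 = c" "s v_n 0 = n" using hd by (simp_all add: header_def)
    have o0: "s a_ord 0 = ord 0" "init_memory (encode_instance I) 0 (4 + c + 2 * ord 0) * d = pl.sz 0" "pl.sz 0 < B"
      using x n input_job[OF pl.ord_less[of 0]] in_B(1)[OF sz_le_V[of 0]] by (auto simp: pl.sz_def)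
    have oe: "s a_ord e = ord e" "init_memory (encode_instance I) 0 (4 + c + 2 * ord e) * d = pl.sz e" "pl.sz e < B" if "e < n"
      using x that input_job[OF pl.ord_less[of e]] in_B(1)[OF sz_le_V[of e]] by (auto simp: pl.sz_def)
    define s1 where "s1 = s(a_fin := (s a_fin)(0 := e, 1 := n), a_pos := (s a_pos)(1 := e), v_op := (s v_op)(0 := 2),
      a_rem := (s a_rem)(0 := pl.sz 0, 1 := if e < n then pl.sz e else 0))"
    have "rel st0 s1"
      using hd x z by (simp add: rel_def ready_def header_def st0_def s1_def written_out_def)
    then have Q: "J st0 s1" using g0 by (simp add: J_def s1_def)
    show "vc B place_init (J st0) s"
    proof (cases "e < n")
      case True
      then show ?thesis
        using Q B s0 o0 oe x unfolding place_init_def time_at_def s1_def by simp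
    next
      case False
      have "s1 = s(a_fin := (s a_fin)(0 := e, 1 := n), a_pos := (s a_pos)(1 := e), v_op := (s v_op)(0 := 2),
        a_rem := (s a_rem)(0 := pl.sz 0))"
        using False z by (auto simp: s1_def fun_eq_iff)
      then show ?thesis
        using Q B s0 o0 x False unfolding place_init_def time_at_def by simp
    qed
  qed
  have busy: "eval e_busy s' \<noteq> 0 \<longleftrightarrow> \<not> pl.finished st" if "rel st s'" for st s'
    using that by (simp add: e_busy_def pl.finished_def rel_def ready_def)
  have step: "wp B place_step (max_cost place_step) (\<lambda>s''. \<exists>st'. J st' s'' \<and> pl.potential st' < pl.potential st) s'"
    if P: "J st s'" and e: "eval e_busy s' \<noteq> 0" for st s'
  proof -
    have P': "pl.good st" "rel st s'" "s' v_op 0 + 14 * pl.potential st \<le> 2 + 14 * (4 * n + 1)"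
      using P by (simp_all add: J_def)
    have nf: "\<not> pl.finished st" using busy[OF P'(2)] e by simp
    note g = pl.good_step[OF P'(1) nf]
    have "s' v_op 0 \<le> 2 + 14 * (4 * n + 1)" using P'(3) by (rule add_leD1)
    then have op: "s' v_op 0 + 14 < B" using B(7) by simp
    show ?thesis
    proof (rule wp_mono[OF wp_vc[OF vc_step[OF P'(1) nf P'(2) op]] order_refl])
      fix s2 assume r: "rel (pl.step st) s2"
      have "s2 v_op 0 \<le> s' v_op 0 + 14"
        using r P'(2) length_enc_step[OF P'(1)] by (simp add: rel_def written_out_def)
      then have "J (pl.step st) s2" using r g P'(3) by (simp add: J_def)
      with g(2) show "\<exists>st'. J st' s2 \<and> pl.potential st' < pl.potential st" by blast
    qed
  qed
  have 2: "wp B (While e_busy place_step) ((4 * n + 1) * (1 + cost e_busy + max_cost place_step) + (1 + cost e_busy))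
    (\<lambda>s'. \<exists>st. J st s' \<and> pl.finished st) s1" if "J st0 s1" for s1
  proof (rule wp_while[where I = J and \<mu> = pl.potential and g = st0, OF step that g0(2)])
    fix st s' assume "J st s'" "eval e_busy s' = 0"
    then show "\<exists>st. J st s' \<and> pl.finished st" using busy[of st s'] by (auto simp: J_def)
  qed
  let ?p = "Write 1 (Const 0) (Var v_d) ;; Write 1 (Const 1) (Var v_cnt)"
  have 3: "wp B ?p (max_cost ?p)
    (\<lambda>s'. \<exists>st. pl.good st \<and> pl.finished st \<and> holds_output s' (encode_schedule d (sched st))) s2"
    if s2: "\<exists>st. J st s2 \<and> pl.finished st" for s2
  proof (rule wp_vc)
    obtain st where st: "pl.good st" "rel st s2" "pl.finished st" "s2 v_op 0 \<le> 2 + 14 * (4 * n + 1)"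
      using s2 by (auto simp: J_def)
    have lenR: "length R \<le> length (enc R)" for R :: "nat schedule"
      by (induction R) (auto simp: enc_def encode_config_def)
    have w: "holds_at (s2 1) 2 (enc (sched st))" "s2 v_cnt 0 = length (sched st)" "s2 v_d 0 = d"
      "length (sched st) \<le> s2 v_op 0"
      using st(2) lenR[of "sched st"] by (simp_all add: rel_def written_out_def ready_def)
    have cB: "length (sched st) < B" using w(4) st(4) B(7) by simp
    define s3 where "s3 = s2(1 := (s2 1)(0 := d, 1 := length (sched st)))"
    have "holds_at (s3 1) 0 (encode_schedule d (sched st))"
      using w(1) by (simp add: s3_def encode_schedule_def enc_def[symmetric] numeral_2_eq_2)
    then have "holds_output s3 (encode_schedule d (sched st))"
      by (simp add: holds_output_def holds_at_def)
    then have "\<exists>st. pl.good st \<and> pl.finished st \<and> holds_output s3 (encode_schedule d (sched st))"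
      using st by blast
    then show "vc B ?p (\<lambda>s'. \<exists>st. pl.good st \<and> pl.finished st \<and> holds_output s' (encode_schedule d (sched st))) s2"
      using w(2,3) B cB by (simp add: s3_def)
  qed
  have "wp B place_all (max_cost place_init + (((4 * n + 1) * (1 + cost e_busy + max_cost place_step) + (1 + cost e_busy)) + max_cost ?p))
    (\<lambda>s'. \<exists>st. pl.good st \<and> pl.finished st \<and> holds_output s' (encode_schedule d (sched st))) s"
    unfolding place_all_def by (rule wp_seqI[OF 1], rule wp_seqI[OF 2], assumption, rule 3)
  then show ?thesis
  proof (rule wp_mono)
    define a where "a = max_cost place_init"
    define b where "b = 1 + cost e_busy"
    define x where "x = max_cost ?p"
    have "a + (((4 * n + 1) * (b + max_cost place_step) + b) + x)
      \<le> (a + 4 * (b + max_cost place_step) + (b + max_cost place_step) + b + x) * (n + 1)"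
      by (simp add: algebra_simps)
    then show "max_cost place_init + (((4 * n + 1) * (1 + cost e_busy + max_cost place_step) + (1 + cost e_busy)) + max_cost ?p)
      \<le> t_place * (n + 1)"
      unfolding t_place_def a_def b_def x_def .
  qed
qed

end

section \<open>The algorithm\<close>

definition schedule_program :: com where
  "schedule_program = prepare ;; bisect ;; sweep ;; arrange ;; place_all"

text \<open>With \<open>W\<close> the word base, the total load and \<open>m\<close> times the
  largest setup are at most \<open>W ^ 2\<close>. The cube is taken so that \<open>W \<ge> 2\<close>
  gives \<open>8 \<le> V\<close>, and 24 is \<open>3 * 8\<close>.\<close>

lemma ram_word_base:
  assumes "valid_instance I"
  shows "ram I (word_base (encode_instance I) ^ 3) (word_base (encode_instance I) ^ 24)"
proof
  define W where "W = word_base (encode_instance I)"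
  let ?n = "num_jobs I" and ?c = "num_classes I" and ?m = "machines I"
  have W: "W \<ge> 2" "length (encode_instance I) \<le> W" by (simp_all add: W_def word_base_def)
  have mem: "x \<le> W" if "x \<in> set (encode_instance I)" for x
  proof -
    have "x \<le> Max (insert 0 (set (encode_instance I)))" by (rule Max_ge) (use that in auto)
    then show ?thesis by (simp add: W_def word_base_def)
  qed
  have len: "?c + ?n \<le> W"
  proof -
    have "length (encode_instance I) = 3 + ?c + 2 * ?n"
      by (simp add: encode_instance_def num_classes_def num_jobs_def length_concat_pairs del: length_concat)
    with W(2) show ?thesis by linarith
  qed
  have m: "?m \<le> W" by (rule mem) (simp add: encode_instance_def)
  have s: "setup_time I i \<le> W" if "i < ?c" for i
    by (rule mem) (use that in \<open>auto simp: encode_instance_def setup_time_def num_classes_def\<close>)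
  have t: "proc_time I j \<le> W" if "j < ?n" for j
  proof (rule mem)
    obtain a b where ab: "jobs I ! j = (a, b)" by (cases "jobs I ! j")
    then have "(a, b) \<in> set (jobs I)" using that nth_mem[of j "jobs I"] by (simp add: num_jobs_def)
    then have "b \<in> set (concat (map (\<lambda>(i, t). [i, t]) (jobs I)))"
      by (auto intro!: bexI[of _ "(a, b)"])
    then show "proc_time I j \<in> set (encode_instance I)"
      by (simp add: encode_instance_def proc_time_def ab)
  qed
  have P: "(\<Sum>i<?c. class_load I i) = (\<Sum>j<?n. proc_time I j)"
  proof -
    have "(\<Sum>i<?c. \<Sum>j | j \<in> {..<?n} \<and> job_class I j = i. proc_time I j) = (\<Sum>j<?n. proc_time I j)"
      by (rule sum.group) (use assms in \<open>auto simp: valid_instance_def lessThan_atLeast0\<close>)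
    then show ?thesis by (simp add: class_load_def jobs_of_def)
  qed
  have "total_load I \<le> W * W"
  proof -
    have "total_load I = (\<Sum>i<?c. setup_time I i) + (\<Sum>j<?n. proc_time I j)"
      by (simp add: total_load_def sum.distrib P)
    also have "\<dots> \<le> (\<Sum>i<?c. W) + (\<Sum>j<?n. W)" by (intro add_mono sum_mono) (use s t in auto)
    also have "\<dots> = (?c + ?n) * W" by (simp add: algebra_simps)
    also have "\<dots> \<le> W * W" by (intro mult_le_mono1 len)
    finally show ?thesis .
  qed
  moreover have "?m * max_setup I \<le> W * W"
  proof (intro mult_le_mono m)
    show "max_setup I \<le> W" unfolding max_setup_def by (rule Max.boundedI) (use s in auto)
  qed
  ultimately have A: "base_load I \<le> W ^ 2" by (simp add: base_load_def power2_eq_square)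
  have pow: "W \<le> W ^ 3" "W ^ 2 \<le> W ^ 3"
    using W(1) power_increasing[of 1 3 W] power_increasing[of 2 3 W] by auto
  show "valid_instance I" by fact
  show "?m \<le> word_base (encode_instance I) ^ 3" "?n \<le> word_base (encode_instance I) ^ 3"
    "?c \<le> word_base (encode_instance I) ^ 3" "base_load I \<le> word_base (encode_instance I) ^ 3"
    using m len A pow unfolding W_def[symmetric] by linarith+
  show "8 \<le> word_base (encode_instance I) ^ 3"
    using power_mono[OF W(1), of 3] by (simp add: W_def)
  show "(word_base (encode_instance I) ^ 3) ^ 8 \<le> word_base (encode_instance I) ^ 24"
    by (simp add: power_mult[symmetric])
qed

section \<open>Correctness and running time of the whole program\<close>

context ram
begin

text \<open>The \<open>t_\<close> factors are fixed by the text of the program and do not depend on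
  the instance, so they can be collected in one constant for all instances.\<close>

definition "run_time = ram.t_prepare * (n + c + 1) + (t_bisect * ((c + 1) * (halvings m + 1)) +
  (t_sweep * ((c + 1) * (halvings (2 * c) + 1)) + (t_arrange * (n + c + 1) + emitter.t_place * (n + 1))))"

lemma wp_schedule_program:
  "wp B schedule_program run_time
    (\<lambda>s'. \<exists>S. represents s' S \<and> feasible I S \<and> makespan I S \<le> 3 / 2 * OPT_split I)
    (init_memory (encode_instance I))"
proof -
  define s where "s = init_memory (encode_instance I)"
  let ?Q = "\<lambda>s'. \<exists>S. represents s' S \<and> feasible I S \<and> makespan I S \<le> 3 / 2 * OPT_split I"
  have zero: "s a k = 0" if "a \<noteq> 0" for a k using that by (simp add: s_def init_memory_def)
  \<comment> \<open>Bisection and sweep write only to \<open>sweep_arrays\<close>, so the input, the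
    loads, the lists, and the still empty arrays of the last phase survive.\<close>
  have keep: "loads s2 \<and> listed s2 \<and> (\<forall>a. a = 1 \<or> 70 \<le> a \<longrightarrow> s2 a = s a)"
    if "loads s1 \<and> listed s1 \<and> (\<forall>a. a = 1 \<or> 70 \<le> a \<longrightarrow> s1 a = s a)" "\<forall>a. a \<notin> X \<longrightarrow> s2 a = s1 a"
      "X \<subseteq> sweep_arrays" for s1 s2 X
  proof -
    have "s2 a = s1 a" if "a \<notin> sweep_arrays" for a using that \<open>X \<subseteq> sweep_arrays\<close> \<open>\<forall>a. a \<notin> X \<longrightarrow> s2 a = s1 a\<close> by blast
    then show ?thesis
      using that(1) by (auto simp: loads_def header_def listed_def sweep_arrays_def bisect_arrays_def search_arrays_def tree_arrays_def)
  qed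
  define R1 where "R1 = (\<lambda>s1. loads s1 \<and> listed s1 \<and> (\<forall>a. a = 1 \<or> 70 \<le> a \<longrightarrow> s1 a = s a))"
  define R2 where "R2 = (\<lambda>s2. R1 s2 \<and> (\<exists>G l. bisected G l \<and> m \<le> G \<and> G \<le> 2 * m \<and> s2 v_xn 0 = A * (G + l) \<and> s2 v_xd 0 = m * G \<and>
       (\<forall>i<c. evaluated s2 i (real (A * (G + l)) / real (m * G))) \<and>
       s2 v_M 0 = exp_sum I (real (A * (G + l)) / real (m * G)) \<and>
       s2 v_L 0 = load_sum I (real (A * (G + l)) / real (m * G))))"
  define R3 where "R3 = (\<lambda>s3. R1 s3 \<and> s3 v_td 0 > 0 \<and> s3 v_tn 0 \<le> V ^ 5 \<and> s3 v_td 0 \<le> V ^ 3 \<and>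
       optimal (real (s3 v_tn 0) / real (s3 v_td 0)))"
  define R4 where "R4 = (\<lambda>s4. \<exists>tn td. td > 0 \<and> tn \<le> V ^ 5 \<and> td \<le> V ^ 3 \<and> optimal (real tn / real td) \<and>
       header s4 \<and> listing s4 (order tn (2 * td)) \<and> s4 v_d 0 = 2 * td \<and> s4 v_H 0 = tn \<and>
       s4 v_e 0 = length (jobs_in (costly tn (2 * td))) \<and> (\<forall>a. a = 1 \<or> 70 \<le> a \<longrightarrow> s4 a = s a))"
  have 1: "wp B prepare (ram.t_prepare * (n + c + 1)) R1 s"
    by (rule wp_mono[OF wp_prepare[OF s_def] order_refl]) (auto simp: R1_def)
  have 2: "wp B bisect (t_bisect * ((c + 1) * (halvings m + 1))) R2 s1" if "R1 s1" for s1
  proof (rule wp_mono[OF wp_bisect order_refl])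
    show "loads s1" using that by (simp add: R1_def)
    fix s2 assume s2: "\<exists>G l. bisected G l \<and> m \<le> G \<and> G \<le> 2 * m \<and> s2 v_xn 0 = A * (G + l) \<and> s2 v_xd 0 = m * G \<and>
       (\<forall>i<c. evaluated s2 i (real (A * (G + l)) / real (m * G))) \<and>
       s2 v_M 0 = exp_sum I (real (A * (G + l)) / real (m * G)) \<and>
       s2 v_L 0 = load_sum I (real (A * (G + l)) / real (m * G)) \<and>
       (\<forall>a. a \<notin> bisect_arrays \<longrightarrow> s2 a = s1 a)"
    then have "R1 s2" unfolding R1_def
      by (intro keep[where X = bisect_arrays, OF that[unfolded R1_def]]) (blast, auto simp: sweep_arrays_def)
    with s2 show "R2 s2" unfolding R2_def by blast
  qed
  have 3: "wp B sweep (t_sweep * ((c + 1) * (halvings (2 * c) + 1))) R3 s2" if R: "R2 s2" for s2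
  proof -
    from R obtain G l where G: "bisected G l" "m \<le> G" "G \<le> 2 * m" "s2 v_xn 0 = A * (G + l)" "s2 v_xd 0 = m * G"
       "\<forall>i<c. evaluated s2 i (real (A * (G + l)) / real (m * G))"
       "s2 v_M 0 = exp_sum I (real (A * (G + l)) / real (m * G))"
       "s2 v_L 0 = load_sum I (real (A * (G + l)) / real (m * G))" and R1: "R1 s2"
      unfolding R2_def by blast
    have "loads s2" using R1 by (simp add: R1_def)
    from wp_sweep[OF this G] show ?thesis
    proof (rule wp_mono[OF _ order_refl])
      fix s3 assume s3: "s3 v_td 0 > 0 \<and> s3 v_tn 0 \<le> V ^ 5 \<and> s3 v_td 0 \<le> V ^ 3 \<and>
       optimal (real (s3 v_tn 0) / real (s3 v_td 0)) \<and> (\<forall>a. a \<notin> sweep_arrays \<longrightarrow> s3 a = s2 a)"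
      then have "R1 s3" unfolding R1_def by (intro keep[where X = sweep_arrays, OF R1[unfolded R1_def]]) auto
      with s3 show "R3 s3" unfolding R3_def by blast
    qed
  qed
  have 4: "wp B arrange (t_arrange * (n + c + 1)) R4 s3" if R: "R3 s3" for s3
  proof -
    have R1: "loads s3" "listed s3" "\<forall>a. a = 1 \<or> 70 \<le> a \<longrightarrow> s3 a = s a"
      and b: "s3 v_tn 0 \<le> V ^ 5" "s3 v_td 0 \<le> V ^ 3" "s3 v_td 0 > 0" "optimal (real (s3 v_tn 0) / real (s3 v_td 0))"
      using R by (simp_all add: R3_def R1_def)
    from wp_arrange[OF R1(1,2) refl refl b(1,2)] show ?thesis
    proof (rule wp_mono[OF _ order_refl])
      fix s4 assume s4: "listing s4 (order (s3 v_tn 0) (2 * s3 v_td 0)) \<and>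
        s4 v_d 0 = 2 * s3 v_td 0 \<and> s4 v_H 0 = s3 v_tn 0 \<and>
        s4 v_e 0 = length (jobs_in (costly (s3 v_tn 0) (2 * s3 v_td 0))) \<and>
        (\<forall>a. a \<notin> arrange_arrays \<longrightarrow> s4 a = s3 a)"
      have "header s4" using s4 R1(1) by (simp add: loads_def header_def arrange_arrays_def walk_arrays_def)
      moreover have "\<forall>a. a = 1 \<or> 70 \<le> a \<longrightarrow> s4 a = s a"
        using s4 R1(3) by (auto simp: arrange_arrays_def walk_arrays_def)
      ultimately show "R4 s4" using s4 b unfolding R4_def by blast
    qed
  qed
  have 5: "wp B place_all (emitter.t_place * (n + 1)) ?Q s4" if R: "R4 s4" for s4
  proof -
    from R obtain tn td where td: "td > 0" and bnd: "tn \<le> V ^ 5" "td \<le> V ^ 3" and opt: "optimal (real tn / real td)"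
      and hd: "header s4" and lst: "listing s4 (order tn (2 * td))" and v: "s4 v_d 0 = 2 * td" "s4 v_H 0 = tn"
       "s4 v_e 0 = length (jobs_in (costly tn (2 * td)))" and z: "\<forall>a. a = 1 \<or> 70 \<le> a \<longrightarrow> s4 a = s a"
      unfolding R4_def by blast
    have acc: "acceptable I (real tn / real td)" and low: "\<And>T. acceptable I T \<Longrightarrow> real tn / real td \<le> T"
      using opt by (auto simp: optimal_def)
    interpret pl: placement I "2 * td" tn "length (jobs_in (costly tn (2 * td)))" "nth (order tn (2 * td))"
      "\<lambda>i. mul_of i (real tn / real td)"
      by (rule placement_order[OF td acc])
    have d4: "2 * td \<le> V ^ 4"
    proof -
      have "2 * td \<le> V * V ^ 3" using V(5) bnd(2) by (intro mult_le_mono) auto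
      then show ?thesis by (simp add: numeral_eq_Suc)
    qed
    interpret em: emitter I V B "2 * td" tn "length (jobs_in (costly tn (2 * td)))" "nth (order tn (2 * td))"
      "\<lambda>i. mul_of i (real tn / real td)"
      by unfold_locales (use d4 bnd in auto)
    have o: "\<forall>t<n. s4 a_ord t = order tn (2 * td) ! t"
      using lst by (simp add: listing_def length_order)
    have z4: "\<forall>a k. a = 1 \<or> 70 \<le> a \<longrightarrow> s4 a k = 0" using z zero by auto
    from em.wp_place_all[OF hd v o z4] show ?thesis
    proof (rule wp_mono[OF _ order_refl])
      fix s5 assume "\<exists>st. pl.good st \<and> pl.finished st \<and> holds_output s5 (encode_schedule (2 * td) (sched st))"
      then obtain st where st: "pl.good st" "pl.finished st" "holds_output s5 (encode_schedule (2 * td) (sched st))" by blast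
      define S where "S = pl.real_sched (sched st)"
      have feas: "feasible I S" unfolding S_def by (rule pl.finished_feasible(1)[OF st(1,2)])
      have "makespan I S \<le> 3 * (real tn / real (2 * td))" unfolding S_def by (rule pl.finished_feasible(2)[OF st(1,2)])
      then have "makespan I S \<le> 3 / 2 * (real tn / real td)" by simp
      then have "makespan I S \<le> 3 / 2 * OPT_split I"
        by (rule makespan_le_OPT_split[OF inst feas]) (use low in auto)
      moreover have "represents s5 S"
        unfolding represents_def S_def pl.real_sched_def using st(3) td
        by (intro exI[of _ "2 * td"] exI[of _ "sched st"]) simp
      ultimately show "?Q s5" using feas by blast
    qed
  qed
  have "wp B schedule_program run_time ?Q s"
    unfolding schedule_program_def run_time_def
    by (rule wp_seqI[OF 1], rule wp_seqI[OF 2], assumption, rule wp_seqI[OF 3], assumption,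
        rule wp_seqI[OF 4], assumption, rule 5)
  then show ?thesis by (simp add: s_def)
qed

text \<open>Classes are nonempty, so \<open>c \<le> n\<close>, and \<open>c + m \<ge> 2\<close>
  makes the logarithm at least 1. Hence the additive constants are absorbed, and both
  \<open>halvings m + 1\<close> and \<open>halvings (2 * c) + 1\<close> are bounded by multiples of
  \<open>log 2 (c + m)\<close>.\<close>

lemma run_time_le:
  "real run_time \<le> real (3 * ram.t_prepare + 4 * t_bisect + 6 * t_sweep + 3 * t_arrange + 2 * emitter.t_place) *
     (real n + real c * log 2 (real c + real m))"
proof -
  define l where "l = log 2 (real c + real m)"
  have cm: "real c \<ge> 1" "real m \<ge> 1" using c_pos m_pos by simp_all
  have "log 2 2 \<le> l" unfolding l_def using cm by (subst log_le_cancel_iff) auto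
  then have l: "l \<ge> 1" by simp
  have cn: "c \<le> n"
  proof -
    have "card {0..<c} \<le> card {0..<n}"
      using card_image_le[of "{0..<n}" "job_class I"] inst by (simp add: valid_instance_def)
    then show ?thesis by simp
  qed
  have n: "n \<ge> 1" using cn c_pos by simp
  have "real (halvings m) \<le> log 2 (real m)" using halvings_le_log m_pos by simp
  also have "\<dots> \<le> l" unfolding l_def using cm by (subst log_le_cancel_iff) auto
  finally have hm: "real (halvings m + 1) \<le> 2 * l" using l by simp
  have "real (halvings (2 * c)) \<le> log 2 (real (2 * c))" using halvings_le_log[of "2 * c"] c_pos by simp
  also have "\<dots> = 1 + log 2 (real c)" using cm by (simp add: log_mult)
  also have "log 2 (real c) \<le> l" unfolding l_def using cm by (subst log_le_cancel_iff) auto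
  finally have hc: "real (halvings (2 * c) + 1) \<le> 3 * l" using l by simp
  have c2: "real (c + 1) \<le> 2 * real c" using cm by simp
  have b1: "real (n + c + 1) \<le> 3 * real n" "real (n + 1) \<le> 2 * real n" using cn n by simp_all
  have b2: "real ((c + 1) * (halvings m + 1)) \<le> 4 * (real c * l)"
  proof -
    have "real (c + 1) * real (halvings m + 1) \<le> (2 * real c) * (2 * l)"
      by (rule mult_mono[OF c2 hm]) simp_all
    then show ?thesis unfolding of_nat_mult by simp
  qed
  have b3: "real ((c + 1) * (halvings (2 * c) + 1)) \<le> 6 * (real c * l)"
  proof -
    have "real (c + 1) * real (halvings (2 * c) + 1) \<le> (2 * real c) * (3 * l)"
      by (rule mult_mono[OF c2 hc]) simp_all
    then show ?thesis unfolding of_nat_mult by simp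
  qed
  define X where "X = real n + real c * l"
  have cl0: "0 \<le> real c * l" using l by simp
  have X: "real (n + c + 1) \<le> 3 * X" "real (n + 1) \<le> 2 * X" "real ((c + 1) * (halvings m + 1)) \<le> 4 * X"
    "real ((c + 1) * (halvings (2 * c) + 1)) \<le> 6 * X"
  proof -
    have nX: "real n \<le> X" "real c * l \<le> X" using cl0 by (simp_all add: X_def)
    show "real (n + c + 1) \<le> 3 * X" by (rule order_trans[OF b1(1)]) (use nX in simp)
    show "real (n + 1) \<le> 2 * X" by (rule order_trans[OF b1(2)]) (use nX in simp)
    show "real ((c + 1) * (halvings m + 1)) \<le> 4 * X" by (rule order_trans[OF b2]) (use nX in simp)
    show "real ((c + 1) * (halvings (2 * c) + 1)) \<le> 6 * X" by (rule order_trans[OF b3]) (use nX in simp)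
  qed
  have mul: "real (a * b) \<le> real (k * a) * X" if "real b \<le> real k * X" for a b k
    using mult_left_mono[OF that, of "real a"] by (simp add: algebra_simps)
  have "real run_time \<le> real (3 * ram.t_prepare) * X + (real (4 * t_bisect) * X +
      (real (6 * t_sweep) * X + (real (3 * t_arrange) * X + real (2 * emitter.t_place) * X)))"
    unfolding run_time_def of_nat_add[where ?'a = real]
    by (intro add_mono mul; use X in simp)
  then show ?thesis unfolding X_def l_def by (simp add: algebra_simps)
qed

end

theorem theorem3p5:
  shows "\<exists>(prog :: com) (k :: nat) (K :: real).
    \<forall>I. valid_instance I \<longrightarrow>
      (\<exists>time mem S.
         exec (word_base (encode_instance I) ^ k) prog (init_memory (encode_instance I)) time mem \<and>
         real time \<le> K * (real (num_jobs I) +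
           real (num_classes I) * log 2 (real (num_classes I) + real (machines I))) \<and>
         represents mem S \<and>
         feasible I S \<and>
         makespan I S \<le> 3 / 2 * OPT_split I)"
proof -
  define K where "K = real (3 * ram.t_prepare + 4 * ram.t_bisect + 6 * ram.t_sweep + 3 * ram.t_arrange + 2 * emitter.t_place)"
  have "\<exists>time mem S. exec (word_base (encode_instance I) ^ 24) schedule_program (init_memory (encode_instance I)) time mem \<and>
         real time \<le> K * (real (num_jobs I) +
           real (num_classes I) * log 2 (real (num_classes I) + real (machines I))) \<and>
         represents mem S \<and> feasible I S \<and> makespan I S \<le> 3 / 2 * OPT_split I"
    if inst: "valid_instance I" for I
  proof -
    interpret ram I "word_base (encode_instance I) ^ 3" "word_base (encode_instance I) ^ 24"
      by (rule ram_word_base[OF inst])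
    from wp_schedule_program obtain time mem where
      "exec (word_base (encode_instance I) ^ 24) schedule_program (init_memory (encode_instance I)) time mem"
      "time \<le> run_time" "\<exists>S. represents mem S \<and> feasible I S \<and> makespan I S \<le> 3 / 2 * OPT_split I"
      unfolding wp_def by blast
    moreover from this(2) have "real time \<le> real run_time" by simp
    then have "real time \<le> K * (real (num_jobs I) +
           real (num_classes I) * log 2 (real (num_classes I) + real (machines I)))"
      using run_time_le unfolding K_def by linarith
    ultimately show ?thesis by blast
  qed
  then show ?thesis by blast
qed

end
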